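(* Let $\Lambda=\mathbf{k}Q/I$ be a gentle algebra and let $w=w_n\cdots w_1$ be a string or a band. Define a homotopy string or band $\pi(w)$ as follows. (1) $\pi(w)=\mathrm{dir}(b)\,w'\,\mathrm{inv}(a)$ if there are $a$ and $b$ with $\bar a,b\in Q_1$ such that $bwa$ is defined as a string, where $w'=w$. (2) $\pi(w)=w'\,\mathrm{inv}(a)$ if there is an $a$ with $\bar a\in Q_1$ such that $wa$ is defined as a string but no $b\in Q_1$ with $bw$ defined as a string, where $w'=w_j\cdots w_1$ is obtained by removing a maximal direct substring $w_n\cdots w_{j+1}$ of $w$. (3) $\pi(w)=\mathrm{dir}(b)\,w'$ if there is $b\in Q_1$ with $bw$ defined as a string but no $a$ with $\bar a\in Q_1$ such that $wa$ is defined as a string, where $w'=w_n\cdots w_i$ is obtained by removing a maximal inverse substring $w_{i-1}\cdots w_1$ of $w$. (4) $\pi(w)=w'$ if there is neither an $a$ with $\bar a\in Q_1$ such that $wa$ is defined as a string nor a $b\in Q_1$ such that $bw$ is defined as a string, where $w'=w_j\cdots w_i$ is obtained by removing a maximal direct substring $w_n\cdots w_{j+1}$ and a maximal inverse substring $w_{i-1}\cdots w_1$. (5) $\pi(w)=w$ if $w$ is a band. Then the string complex $P^\bullet_{\pi(w)}$ (respectively the band complex $B^\bullet_{\pi(w)}$ when $w$ is a band) is a projective resolution of the string module $M(w)$ (respectively the band module $B(w)$).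
   Context: Gentle algebra: $\mathbf{k}$ is algebraically closed, $\Lambda=\mathbf{k}Q/I$ is finite-dimensional, $Q$ a finite quiver, $I$ admissible, such that (1) at each vertex at most two arrows start and at most two end; (2) for each arrow $a$ there is at most one arrow $b$ with $e(a)=s(b)$, $ba\notin I$ and at most one arrow $c$ with $e(c)=s(a)$, $ac\notin I$; (3) the same with $\in I$ in place of $\notin I$; (4) $I$ is generated by paths of length two. Modules are left modules, paths are read right to left, $P(x)=\Lambda e_x$. Strings, bands: arrows $a$ have formal inverses $\bar a$ ($\bar{\bar a}=a$). A walk is a sequence $w=w_l\cdots w_1$ of arrows (direct letters) and inverse arrows (inverse letters) with $s(w_{i+1})=e(w_i)$ and no subsequence $a\bar a$ or $\bar aa$; $\bar w=\bar w_1\cdots\bar w_l$. A string is a walk with no subwalk $u$ with $u\in I$ or $\bar u\in I$, or a trivial string $1_x$. $M(w)$ has basis $z_0,\dots,z_l$ ($z_0$ at $s(w_1)$, $z_i$ at $e(w_i)$); an arrow $w_i$ maps $z_{i-1}\mapsto z_i$, for $w_i=\bar a$ the arrow $a$ maps $z_i\mapsto z_{i-1}$, all other actions are zero. A band is a string $b=b_n\cdots b_1$ with $e(b_n)=s(b_1)$, $b_1\neq\bar b_n$, $b_1b_n$ a string, $b$ not a proper power; the (quasi-simple) band module $B(b)=B(b,\mu)$ is the cyclic analogue of $M(b)$, with basis indexed by $\mathbb{Z}/n$ and a scalar $\mu\in\mathbf{k}^*$ on one direct letter. Scalars are suppressed from the notation. Homotopy strings: a homotopy string is a walk (relations allowed),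 or a trivial one at a vertex, partitioned into homotopy letters $\sigma_n\cdots\sigma_1$: maximal subwalks $p$ such that $p$ is a path not in $I$ (direct) or $\bar p$ is (inverse). It may be infinite to the left (right) if it is eventually a direct (inverse) antipath there, where an antipath is a direct or inverse walk all of whose homotopy letters have length $1$. For $b\in Q_1$, $\mathrm{dir}(b)=\cdots\sigma_2\sigma_1$ is the maximal direct antipath starting with $\sigma_1=b$; for $a$ with $\bar a\in Q_1$, $\mathrm{inv}(a)=\sigma_{-1}\sigma_{-2}\cdots$ is the maximal inverse antipath ending with $\sigma_{-1}=a$ (both possibly infinite). If all letters are removed, $w'$ is the trivial walk at the remaining vertex. Complexes: $P^\bullet_\sigma$ has one summand $P(x)$ for each endpoint position of a homotopy letter; a direct homotopy letter $p$ gives the component $P(e(p))\to P(s(p))$ (right multiplication by $p$) of the differential, an inverse letter $p$ the component $P(s(p))\to P(e(p))$ given by $\bar p$; for a trivial homotopy string it is the stalk complex $P(x)$. For a band, $B^\bullet_\sigma=B^\bullet_{\sigma,\lambda}$ is the cyclic analogue with one component multiplied by a scalar $\lambda\in\mathbf{k}^*$. The complexes here are placed so that their maximal nonzero degree is $0$. *)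

theory Defs
  imports
    "HOL-Algebra.QuotRing"
    "HOL-Algebra.Module"
    "HOL-Computational_Algebra.Polynomial"
    "HOL-Library.Extended_Nat"
    "Graph_Theory.Arc_Walk"
begin

section \<open>Modules over a noncommutative ring\<close>

text \<open>
  The library locale \<open>module\<close> assumes a commutative ring, so only its record type is reused;
  the record fields \<open>mult\<close> and \<open>one\<close> of a module carry no meaning.
\<close>

locale left_module = R?: ring R + M?: abelian_group M for R (structure) and M (structure) +
  assumes smult_closed:
      "\<lbrakk>a \<in> carrier R; x \<in> carrier M\<rbrakk> \<Longrightarrow> a \<odot>\<^bsub>M\<^esub> x \<in> carrier M"
    and smult_l_distr:
      "\<lbrakk>a \<in> carrier R; b \<in> carrier R; x \<in> carrier M\<rbrakk> \<Longrightarrow>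
        (a \<oplus>\<^bsub>R\<^esub> b) \<odot>\<^bsub>M\<^esub> x = a \<odot>\<^bsub>M\<^esub> x \<oplus>\<^bsub>M\<^esub> b \<odot>\<^bsub>M\<^esub> x"
    and smult_r_distr:
      "\<lbrakk>a \<in> carrier R; x \<in> carrier M; y \<in> carrier M\<rbrakk> \<Longrightarrow>
        a \<odot>\<^bsub>M\<^esub> (x \<oplus>\<^bsub>M\<^esub> y) = a \<odot>\<^bsub>M\<^esub> x \<oplus>\<^bsub>M\<^esub> a \<odot>\<^bsub>M\<^esub> y"
    and smult_assoc1:
      "\<lbrakk>a \<in> carrier R; b \<in> carrier R; x \<in> carrier M\<rbrakk> \<Longrightarrow>
        (a \<otimes>\<^bsub>R\<^esub> b) \<odot>\<^bsub>M\<^esub> x = a \<odot>\<^bsub>M\<^esub> (b \<odot>\<^bsub>M\<^esub> x)"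
    and smult_one:
      "x \<in> carrier M \<Longrightarrow> \<one>\<^bsub>R\<^esub> \<odot>\<^bsub>M\<^esub> x = x"

definition lmod_hom ::
    "('r, 'x) ring_scheme \<Rightarrow> ('r, 'm, 'y) module_scheme \<Rightarrow> ('r, 'n, 'z) module_scheme \<Rightarrow> ('m \<Rightarrow> 'n) set" where
  "lmod_hom R M N = {f \<in> carrier M \<rightarrow> carrier N.
     (\<forall>x\<in>carrier M. \<forall>y\<in>carrier M. f (x \<oplus>\<^bsub>M\<^esub> y) = f x \<oplus>\<^bsub>N\<^esub> f y) \<and>
     (\<forall>r\<in>carrier R. \<forall>x\<in>carrier M. f (r \<odot>\<^bsub>M\<^esub> x) = r \<odot>\<^bsub>N\<^esub> f x)}"

definition left_ideal_sum :: "('r, 'x) ring_scheme \<Rightarrow> ('i \<Rightarrow> 'r set) \<Rightarrow> ('r, 'i \<Rightarrow> 'r) module" where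
  \<comment> \<open>the external direct sum of the left ideals \<open>A i\<close>\<close>
  "left_ideal_sum R A =
    \<lparr> carrier = {f. (\<forall>i. f i \<in> A i) \<and> finite {i. f i \<noteq> \<zero>\<^bsub>R\<^esub>}},
      monoid.mult = undefined, one = undefined,
      zero = (\<lambda>i. \<zero>\<^bsub>R\<^esub>), add = (\<lambda>f g i. f i \<oplus>\<^bsub>R\<^esub> g i),
      module.smult = (\<lambda>r f i. r \<otimes>\<^bsub>R\<^esub> f i) \<rparr>"

definition free_lmod :: "('r, 'x) ring_scheme \<Rightarrow> 'i set \<Rightarrow> ('r, 'i \<Rightarrow> 'r) module" where
  "free_lmod R B = left_ideal_sum R (\<lambda>i. if i \<in> B then carrier R else {\<zero>\<^bsub>R\<^esub>})"

text \<open>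
  Projective = direct summand of a free module. Taking the basis inside the type of the elements
  of \<open>P\<close> is no restriction, since a projective module is a summand of the free module on its own
  carrier.
\<close>

definition projective_lmod :: "('r, 'x) ring_scheme \<Rightarrow> ('r, 'm, 'y) module_scheme \<Rightarrow> bool" where
  "projective_lmod R P \<longleftrightarrow> left_module R P \<and>
    (\<exists>B :: 'm set. \<exists>f \<in> lmod_hom R P (free_lmod R B). \<exists>g \<in> lmod_hom R (free_lmod R B) P.
       \<forall>x\<in>carrier P. g (f x) = x)"

text \<open>Complexes are graded cohomologically: \<open>d i : C i \<rightarrow> C (i + 1)\<close>.\<close>

definition projective_resolution ::
    "('r, 'x) ring_scheme \<Rightarrow> (int \<Rightarrow> ('r, 'm, 'y) module_scheme) \<Rightarrow> (int \<Rightarrow> 'm \<Rightarrow> 'm)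
      \<Rightarrow> ('r, 'n, 'z) module_scheme \<Rightarrow> bool" where
  "projective_resolution R C d M \<longleftrightarrow>
     left_module R M \<and>
     (\<forall>i. projective_lmod R (C i)) \<and>
     (\<forall>i. d i \<in> lmod_hom R (C i) (C (i + 1))) \<and>
     (\<forall>i>0. carrier (C i) = {\<zero>\<^bsub>C i\<^esub>}) \<and>
     (\<forall>i<0. {x \<in> carrier (C i). d i x = \<zero>\<^bsub>C (i + 1)\<^esub>} = d (i - 1) ` carrier (C (i - 1))) \<and>
     (\<exists>\<epsilon> \<in> lmod_hom R (C 0) M. \<epsilon> ` carrier (C 0) = carrier M \<and>
        {x \<in> carrier (C 0). \<epsilon> x = \<zero>\<^bsub>M\<^esub>} = d (-1) ` carrier (C (-1)))"


section \<open>Gentle algebras\<close>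

text \<open>
  A quiver is a \<open>pre_digraph\<close>, the arrow \<open>a\<close> running from \<open>s(a) = tail Q a\<close> to
  \<open>e(a) = head Q a\<close>. Lists are in order of traversal: the path \<open>a\<^sub>l \<dots> a\<^sub>1\<close> starting at \<open>x\<close> is
  \<open>(x, [a\<^sub>1, \<dots>, a\<^sub>l])\<close>, and \<open>(x, [])\<close> is the idempotent \<open>e\<^sub>x\<close>. The algebra product \<open>q p\<close> is
  ``first \<open>p\<close>, then \<open>q\<close>''.
\<close>

type_synonym ('v, 'a) qpath = "'v \<times> 'a list"

definition qpaths :: "('v, 'a) pre_digraph \<Rightarrow> ('v, 'a) qpath set" where
  "qpaths Q = {(x, as). \<exists>y. pre_digraph.awalk Q x as y}"

definition path_elem :: "'k::zero \<Rightarrow> ('v, 'a) qpath \<Rightarrow> ('v, 'a) qpath \<Rightarrow> 'k" where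
  "path_elem c p = (\<lambda>q. if q = p then c else 0)"

definition path_algebra :: "('v, 'a) pre_digraph \<Rightarrow> (('v, 'a) qpath \<Rightarrow> 'k::field) ring" where
  "path_algebra Q =
    \<lparr> carrier = {f. finite {p. f p \<noteq> 0} \<and> {p. f p \<noteq> 0} \<subseteq> qpaths Q},
      monoid.mult = (\<lambda>f g (x, as). \<Sum>i\<le>length as.
                f (pre_digraph.awlast Q x (take i as), drop i as) * g (x, take i as)),
      one = (\<lambda>(x, as). if x \<in> verts Q \<and> as = [] then 1 else 0),
      zero = (\<lambda>p. 0),
      add = (\<lambda>f g p. f p + g p) \<rparr>"

definition arrow_ideal_power :: "('v, 'a) pre_digraph \<Rightarrow> nat \<Rightarrow> (('v, 'a) qpath \<Rightarrow> 'k::field) set" where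
  \<comment> \<open>the \<open>m\<close>-th power of the arrow ideal is generated by the paths of length \<open>m\<close>\<close>
  "arrow_ideal_power Q m =
     Idl\<^bsub>path_algebra Q\<^esub> (path_elem 1 ` {p \<in> qpaths Q. length (snd p) = m})"

definition admissible_ideal :: "('v, 'a) pre_digraph \<Rightarrow> (('v, 'a) qpath \<Rightarrow> 'k::field) set \<Rightarrow> bool" where
  "admissible_ideal Q I \<longleftrightarrow> ideal I (path_algebra Q) \<and>
     (\<exists>m\<ge>2. arrow_ideal_power Q m \<subseteq> I) \<and> I \<subseteq> arrow_ideal_power Q 2"

definition bound_quiver_algebra ::
    "('v, 'a) pre_digraph \<Rightarrow> (('v, 'a) qpath \<Rightarrow> 'k::field) set \<Rightarrow> (('v, 'a) qpath \<Rightarrow> 'k) set ring" where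
  "bound_quiver_algebra Q I = path_algebra Q Quot I"

definition path_class ::
    "('v, 'a) pre_digraph \<Rightarrow> (('v, 'a) qpath \<Rightarrow> 'k::field) set \<Rightarrow> 'k \<Rightarrow> ('v, 'a) qpath \<Rightarrow> (('v, 'a) qpath \<Rightarrow> 'k) set" where
  \<comment> \<open>the element \<open>c \<cdot> p\<close> of \<open>kQ / I\<close>\<close>
  "path_class Q I c p = I +>\<^bsub>path_algebra Q\<^esub> path_elem c p"

definition proj_at ::
    "('v, 'a) pre_digraph \<Rightarrow> (('v, 'a) qpath \<Rightarrow> 'k::field) set \<Rightarrow> 'v \<Rightarrow> (('v, 'a) qpath \<Rightarrow> 'k) set set" where
  \<comment> \<open>the indecomposable projective \<open>P(x) = \<Lambda> e\<^sub>x\<close>, as a left ideal\<close>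
  "proj_at Q I x = (\<lambda>u. u \<otimes>\<^bsub>bound_quiver_algebra Q I\<^esub> path_class Q I 1 (x, [])) `
                     carrier (bound_quiver_algebra Q I)"

definition finite_dimensional_quotient ::
    "('v, 'a) pre_digraph \<Rightarrow> (('v, 'a) qpath \<Rightarrow> 'k::field) set \<Rightarrow> bool" where
  "finite_dimensional_quotient Q I \<longleftrightarrow>
     (\<exists>B. finite B \<and> B \<subseteq> carrier (path_algebra Q) \<and>
        (\<forall>f \<in> carrier (path_algebra Q). \<exists>c. (\<lambda>p. f p - (\<Sum>b\<in>B. c b * b p)) \<in> I))"

definition path_in :: "('v, 'a) pre_digraph \<Rightarrow> (('v, 'a) qpath \<Rightarrow> 'k::field) set \<Rightarrow> 'a list \<Rightarrow> bool" where
  \<comment> \<open>for nonempty paths\<close>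
  "path_in Q I as \<longleftrightarrow> path_elem 1 (tail Q (hd as), as) \<in> I"

locale gentle_algebra = fin_digraph Q
  for Q :: "('v, 'a) pre_digraph" and I :: "(('v, 'a) qpath \<Rightarrow> 'k::alg_closed_field) set" +
  assumes admissible: "admissible_ideal Q I"
    and finite_dimensional: "finite_dimensional_quotient Q I"
    and two_arrows: "x \<in> verts Q \<Longrightarrow>
          card {a \<in> arcs Q. tail Q a = x} \<le> 2 \<and> card {a \<in> arcs Q. head Q a = x} \<le> 2"
    and nonzero_continuation: "a \<in> arcs Q \<Longrightarrow>
          card {b \<in> arcs Q. head Q a = tail Q b \<and> \<not> path_in Q I [a, b]} \<le> 1 \<and>
          card {c \<in> arcs Q. head Q c = tail Q a \<and> \<not> path_in Q I [c, a]} \<le> 1"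
    and zero_continuation: "a \<in> arcs Q \<Longrightarrow>
          card {b \<in> arcs Q. head Q a = tail Q b \<and> path_in Q I [a, b]} \<le> 1 \<and>
          card {c \<in> arcs Q. head Q c = tail Q a \<and> path_in Q I [c, a]} \<le> 1"
    and quadratic_monomial: "\<exists>S \<subseteq> {p \<in> qpaths Q. length (snd p) = 2}.
          I = Idl\<^bsub>path_algebra Q\<^esub> (path_elem 1 ` S)"


section \<open>Strings, bands and their modules\<close>

datatype 'a letter = is_Dir: Dir (arr: 'a) | is_Inv: Inv (arr: 'a)

fun bar :: "'a letter \<Rightarrow> 'a letter" where
  "bar (Dir a) = Inv a"
| "bar (Inv a) = Dir a"

fun src :: "('v, 'a) pre_digraph \<Rightarrow> 'a letter \<Rightarrow> 'v" where
  "src Q (Dir a) = tail Q a"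
| "src Q (Inv a) = head Q a"

fun tgt :: "('v, 'a) pre_digraph \<Rightarrow> 'a letter \<Rightarrow> 'v" where
  "tgt Q (Dir a) = head Q a"
| "tgt Q (Inv a) = tail Q a"

text \<open>
  A finite walk \<open>w = w\<^sub>l \<dots> w\<^sub>1\<close> is \<open>(x, [w\<^sub>1, \<dots>, w\<^sub>l])\<close> with \<open>x\<close> its start; the left end of \<open>w\<close>
  is thus the end of the list. \<open>wvtx Q w i\<close> is the vertex of the basis element \<open>z\<^sub>i\<close>.
\<close>

type_synonym ('v, 'a) fwalk = "'v \<times> 'a letter list"

fun wvtx :: "('v, 'a) pre_digraph \<Rightarrow> ('v, 'a) fwalk \<Rightarrow> nat \<Rightarrow> 'v" where
  "wvtx Q (x, ws) 0 = x"
| "wvtx Q (x, ws) (Suc i) = tgt Q (ws ! i)"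

fun is_walk :: "('v, 'a) pre_digraph \<Rightarrow> ('v, 'a) fwalk \<Rightarrow> bool" where
  "is_walk Q (x, ws) \<longleftrightarrow> x \<in> verts Q \<and> arr ` set ws \<subseteq> arcs Q \<and>
     (\<forall>i<length ws. src Q (ws ! i) = wvtx Q (x, ws) i) \<and>
     (\<forall>i. Suc i < length ws \<longrightarrow> ws ! Suc i \<noteq> bar (ws ! i))"

fun is_string :: "('v, 'a) pre_digraph \<Rightarrow> (('v, 'a) qpath \<Rightarrow> 'k::field) set \<Rightarrow> ('v, 'a) fwalk \<Rightarrow> bool" where
  "is_string Q I (x, ws) \<longleftrightarrow> is_walk Q (x, ws) \<and>
     (\<forall>us as vs. as \<noteq> [] \<and> (ws = us @ map Dir as @ vs \<or> ws = us @ map Inv (rev as) @ vs)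
        \<longrightarrow> \<not> path_in Q I as)"

fun is_band :: "('v, 'a) pre_digraph \<Rightarrow> (('v, 'a) qpath \<Rightarrow> 'k::field) set \<Rightarrow> ('v, 'a) fwalk \<Rightarrow> bool" where
  "is_band Q I (x, ws) \<longleftrightarrow> is_string Q I (x, ws) \<and> ws \<noteq> [] \<and>
     wvtx Q (x, ws) (length ws) = x \<and>
     hd ws \<noteq> bar (last ws) \<and> is_string Q I (src Q (last ws), [last ws, hd ws]) \<and>
     (\<nexists>us m. m \<ge> 2 \<and> ws = concat (replicate m us))"

text \<open>
  A finite set \<open>N\<close> of basis elements, the \<open>i\<close>-th one at the vertex \<open>vt i\<close>, and matrices
  \<open>m a i j\<close> (the coefficient of the \<open>i\<close>-th in the image of the \<open>j\<close>-th basis element under \<open>a\<close>)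
  describe a representation of \<open>Q\<close>; \<open>rep_module\<close> is the corresponding left \<open>kQ/I\<close>-module. The
  action of a class is that of any representative; it is well defined when \<open>I\<close> acts by zero.
\<close>

definition arrow_action :: "'i set \<Rightarrow> ('a \<Rightarrow> 'i \<Rightarrow> 'i \<Rightarrow> 'k::field) \<Rightarrow> 'a \<Rightarrow> ('i \<Rightarrow> 'k) \<Rightarrow> 'i \<Rightarrow> 'k" where
  "arrow_action N m a v = (\<lambda>i. if i \<in> N then \<Sum>j\<in>N. m a i j * v j else 0)"

definition path_action ::
    "'i set \<Rightarrow> ('i \<Rightarrow> 'v) \<Rightarrow> ('a \<Rightarrow> 'i \<Rightarrow> 'i \<Rightarrow> 'k::field) \<Rightarrow> ('v, 'a) qpath \<Rightarrow> ('i \<Rightarrow> 'k) \<Rightarrow> 'i \<Rightarrow> 'k" where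
  "path_action N vt m p v =
     fold (arrow_action N m) (snd p) (\<lambda>i. if i \<in> N \<and> vt i = fst p then v i else 0)"

definition kQ_action ::
    "'i set \<Rightarrow> ('i \<Rightarrow> 'v) \<Rightarrow> ('a \<Rightarrow> 'i \<Rightarrow> 'i \<Rightarrow> 'k::field) \<Rightarrow> (('v, 'a) qpath \<Rightarrow> 'k) \<Rightarrow> ('i \<Rightarrow> 'k) \<Rightarrow> 'i \<Rightarrow> 'k" where
  "kQ_action N vt m f v = (\<lambda>i. \<Sum>p | f p \<noteq> 0. f p * path_action N vt m p v i)"

definition rep_module ::
    "'i set \<Rightarrow> ('i \<Rightarrow> 'v) \<Rightarrow> ('a \<Rightarrow> 'i \<Rightarrow> 'i \<Rightarrow> 'k::field) \<Rightarrow> ((('v, 'a) qpath \<Rightarrow> 'k) set, 'i \<Rightarrow> 'k) module" where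
  "rep_module N vt m =
    \<lparr> carrier = {v. \<forall>i. i \<notin> N \<longrightarrow> v i = 0},
      monoid.mult = undefined, one = undefined,
      zero = (\<lambda>i. 0), add = (\<lambda>u v i. u i + v i),
      module.smult = (\<lambda>X v. THE u. \<forall>f\<in>X. kQ_action N vt m f v = u) \<rparr>"

fun string_module :: "('v, 'a) pre_digraph \<Rightarrow> ('v, 'a) fwalk \<Rightarrow> ((('v, 'a) qpath \<Rightarrow> 'k::field) set, nat \<Rightarrow> 'k) module" where
  "string_module Q (x, ws) = rep_module {0..length ws} (wvtx Q (x, ws))
     (\<lambda>a i j. if \<exists>k<length ws. ws ! k = Dir a \<and> j = k \<and> i = Suc k \<or>
                               ws ! k = Inv a \<and> j = Suc k \<and> i = k
              then 1 else 0)"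

text \<open>
  The basis of \<open>B(w, \<mu>)\<close> is indexed by \<open>0, \<dots>, n - 1\<close>, modulo \<open>n\<close>; the scalar \<open>\<mu>\<close> is put on the
  letter \<open>ws ! r\<close>, which is to be direct. Several letters may connect the same two
  indices when \<open>n = 2\<close>, hence the sum.
\<close>

fun band_module ::
    "('v, 'a) pre_digraph \<Rightarrow> ('v, 'a) fwalk \<Rightarrow> nat \<Rightarrow> 'k::field \<Rightarrow> ((('v, 'a) qpath \<Rightarrow> 'k) set, nat \<Rightarrow> 'k) module" where
  "band_module Q (x, ws) r \<mu> = rep_module {0..<length ws} (wvtx Q (x, ws))
     (\<lambda>a i j. \<Sum>k<length ws.
        (if ws ! k = Dir a \<and> j = k \<and> i = Suc k mod length ws then (if k = r then \<mu> else 1) else 0) +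
        (if ws ! k = Inv a \<and> j = Suc k mod length ws \<and> i = k then 1 else 0))"


section \<open>Homotopy strings and their complexes\<close>

text \<open>
  Possibly infinite walks: \<open>positions\<close> is an interval of integers, \<open>vtx\<close> gives the vertex at a
  position, and \<open>lett k\<close> is the letter leading from position \<open>k\<close> to \<open>k + 1\<close> (relevant if both
  are positions). Positions increase from right to left in the notation
  \<open>\<dots> w\<^sub>2 w\<^sub>1\<close>; ``infinite to the left'' means unbounded above.
\<close>

record ('v, 'a) hwalk =
  positions :: "int set"
  vtx :: "int \<Rightarrow> 'v"
  lett :: "int \<Rightarrow> 'a letter"

definition is_hwalk :: "('v, 'a) pre_digraph \<Rightarrow> ('v, 'a) hwalk \<Rightarrow> bool" where
  "is_hwalk Q \<sigma> \<longleftrightarrow> positions \<sigma> \<noteq> {} \<and>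
     (\<forall>i\<in>positions \<sigma>. \<forall>j\<in>positions \<sigma>. {i..j} \<subseteq> positions \<sigma>) \<and>
     (\<forall>i\<in>positions \<sigma>. vtx \<sigma> i \<in> verts Q) \<and>
     (\<forall>i. {i, i + 1} \<subseteq> positions \<sigma> \<longrightarrow> arr (lett \<sigma> i) \<in> arcs Q \<and>
        src Q (lett \<sigma> i) = vtx \<sigma> i \<and> tgt Q (lett \<sigma> i) = vtx \<sigma> (i + 1)) \<and>
     (\<forall>i. {i, i + 1, i + 2} \<subseteq> positions \<sigma> \<longrightarrow> lett \<sigma> (i + 1) \<noteq> bar (lett \<sigma> i))"

definition seg_path :: "('v, 'a) hwalk \<Rightarrow> int \<Rightarrow> int \<Rightarrow> ('v, 'a) qpath" where
  \<comment> \<open>for a direct subwalk \<open>p\<close> between positions \<open>i < j\<close> the path \<open>p\<close>, for an inverse one \<open>bar p\<close>\<close>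
  "seg_path \<sigma> i j =
    (let as = map (\<lambda>k. arr (lett \<sigma> k)) [i..j - 1]
     in if is_Dir (lett \<sigma> i) then (vtx \<sigma> i, as) else (vtx \<sigma> j, rev as))"

definition nonzero_segment :: "(('v, 'a) qpath \<Rightarrow> 'k::field) set \<Rightarrow> ('v, 'a) hwalk \<Rightarrow> int \<Rightarrow> int \<Rightarrow> bool" where
  "nonzero_segment I \<sigma> i j \<longleftrightarrow> i < j \<and> {i..j} \<subseteq> positions \<sigma> \<and>
     ((\<forall>k\<in>{i..<j}. is_Dir (lett \<sigma> k)) \<or> (\<forall>k\<in>{i..<j}. is_Inv (lett \<sigma> k))) \<and>
     path_elem 1 (seg_path \<sigma> i j) \<notin> I"

definition homotopy_letter :: "(('v, 'a) qpath \<Rightarrow> 'k::field) set \<Rightarrow> ('v, 'a) hwalk \<Rightarrow> int \<Rightarrow> int \<Rightarrow> bool" where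
  "homotopy_letter I \<sigma> i j \<longleftrightarrow> nonzero_segment I \<sigma> i j \<and>
     (\<forall>i' j'. i' \<le> i \<and> j \<le> j' \<and> nonzero_segment I \<sigma> i' j' \<longrightarrow> i' = i \<and> j' = j)"

definition homotopy_string :: "('v, 'a) pre_digraph \<Rightarrow> (('v, 'a) qpath \<Rightarrow> 'k::field) set \<Rightarrow> ('v, 'a) hwalk \<Rightarrow> bool" where
  "homotopy_string Q I \<sigma> \<longleftrightarrow> is_hwalk Q \<sigma> \<and>
     (\<not> bdd_above (positions \<sigma>) \<longrightarrow>
        (\<exists>m. \<forall>k\<ge>m. is_Dir (lett \<sigma> k) \<and> homotopy_letter I \<sigma> k (k + 1))) \<and>
     (\<not> bdd_below (positions \<sigma>) \<longrightarrow>
        (\<exists>m. \<forall>k\<le>m. is_Inv (lett \<sigma> k) \<and> homotopy_letter I \<sigma> k (k + 1)))"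

text \<open>
  A finite or infinite sequence of arrows \<open>(N, f)\<close> stands for the direct walk
  \<open>\<dots> f 1, f 0\<close> with \<open>N\<close> letters.
\<close>

type_synonym 'a arrow_seq = "enat \<times> (nat \<Rightarrow> 'a)"

fun direct_walk :: "('v, 'a) pre_digraph \<Rightarrow> 'a arrow_seq \<Rightarrow> ('v, 'a) hwalk" where
  "direct_walk Q (N, f) =
    \<lparr> positions = {k. 0 \<le> k \<and> enat (nat k) \<le> N},
      vtx = (\<lambda>k. if k \<le> 0 then tail Q (f 0) else head Q (f (nat (k - 1)))),
      lett = (\<lambda>k. Dir (f (nat k))) \<rparr>"

definition direct_antipath :: "('v, 'a) pre_digraph \<Rightarrow> (('v, 'a) qpath \<Rightarrow> 'k::field) set \<Rightarrow> 'a arrow_seq \<Rightarrow> bool" where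
  "direct_antipath Q I \<tau> \<longleftrightarrow> is_hwalk Q (direct_walk Q \<tau>) \<and>
     (\<forall>i j. homotopy_letter I (direct_walk Q \<tau>) i j \<longrightarrow> j = i + 1)"

text \<open>
  \<open>max_antipath Q I b \<tau>\<close> says \<open>\<tau> = dir(b)\<close>. Since \<open>inv(a)\<close> is the formal inverse of
  \<open>dir(bar a)\<close>, it is given by the arrow sequence
  of the latter.
\<close>

fun max_antipath :: "('v, 'a) pre_digraph \<Rightarrow> (('v, 'a) qpath \<Rightarrow> 'k::field) set \<Rightarrow> 'a \<Rightarrow> 'a arrow_seq \<Rightarrow> bool" where
  "max_antipath Q I b (N, f) \<longleftrightarrow> N \<ge> 1 \<and> f 0 = b \<and> direct_antipath Q I (N, f) \<and>
     (\<nexists>N' f'. N' > N \<and> (\<forall>i. enat i < N \<longrightarrow> f' i = f i) \<and> direct_antipath Q I (N', f'))"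

definition no_letters :: "'a arrow_seq" where
  "no_letters = (0, undefined)"

text \<open>
  \<open>glue Q (N, f) w (M, g)\<close> is the concatenation of the direct walk \<open>\<dots> f 1, f 0\<close>, the walk \<open>w\<close>
  (at the positions \<open>0, \<dots>, l\<close>) and the inverse walk \<open>bar (g 0), bar (g 1), \<dots>\<close>.
\<close>

fun glue :: "('v, 'a) pre_digraph \<Rightarrow> 'a arrow_seq \<Rightarrow> ('v, 'a) fwalk \<Rightarrow> 'a arrow_seq \<Rightarrow> ('v, 'a) hwalk" where
  "glue Q (N, f) (x, ws) (M, g) =
    (let l = int (length ws) in
     \<lparr> positions = {k. (k > l \<longrightarrow> enat (nat (k - l)) \<le> N) \<and> (k < 0 \<longrightarrow> enat (nat (- k)) \<le> M)},
       vtx = (\<lambda>k. if k < 0 then head Q (g (nat (- k - 1)))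
                  else if k \<le> l then wvtx Q (x, ws) (nat k)
                  else head Q (f (nat (k - l - 1)))),
       lett = (\<lambda>k. if k < 0 then Inv (g (nat (- k - 1)))
                   else if k < l then ws ! nat k
                   else Dir (f (nat (k - l)))) \<rparr>)"

fun remove_left_direct :: "('v, 'a) fwalk \<Rightarrow> ('v, 'a) fwalk" where
  "remove_left_direct (x, ws) = (x, rev (dropWhile is_Dir (rev ws)))"

fun remove_right_inverse :: "('v, 'a) pre_digraph \<Rightarrow> ('v, 'a) fwalk \<Rightarrow> ('v, 'a) fwalk" where
  "remove_right_inverse Q (x, ws) =
     (wvtx Q (x, ws) (length (takeWhile is_Inv ws)), dropWhile is_Inv ws)"

text \<open>
  For \<open>b \<in> Q\<^sub>1\<close> and \<open>a = bar c\<close> with \<open>c \<in> Q\<^sub>1\<close>: \<open>bw\<close>, \<open>wa\<close>, \<open>bwa\<close> is defined as a string.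
\<close>

fun left_ext :: "('v, 'a) pre_digraph \<Rightarrow> (('v, 'a) qpath \<Rightarrow> 'k::field) set \<Rightarrow> 'a \<Rightarrow> ('v, 'a) fwalk \<Rightarrow> bool" where
  "left_ext Q I b (x, ws) \<longleftrightarrow> is_string Q I (x, ws @ [Dir b])"

fun right_ext :: "('v, 'a) pre_digraph \<Rightarrow> (('v, 'a) qpath \<Rightarrow> 'k::field) set \<Rightarrow> ('v, 'a) fwalk \<Rightarrow> 'a \<Rightarrow> bool" where
  "right_ext Q I (x, ws) c \<longleftrightarrow> tgt Q (Inv c) = x \<and> is_string Q I (src Q (Inv c), Inv c # ws)"

fun both_ext :: "('v, 'a) pre_digraph \<Rightarrow> (('v, 'a) qpath \<Rightarrow> 'k::field) set \<Rightarrow> 'a \<Rightarrow> ('v, 'a) fwalk \<Rightarrow> 'a \<Rightarrow> bool" where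
  "both_ext Q I b (x, ws) c \<longleftrightarrow>
     tgt Q (Inv c) = x \<and> is_string Q I (src Q (Inv c), Inv c # ws @ [Dir b])"

text \<open>
  The relation ``\<open>\<sigma>\<close> is \<open>\<pi>(w)\<close>'' for a string \<open>w\<close>. For \<open>w = 1\<^sub>x\<close> the arrows \<open>a\<close>, \<open>b\<close> in the first
  rule can be interchanged, which replaces \<open>\<sigma>\<close> by its formal inverse. If exactly one arrow
  \<open>b\<close> starts at \<open>x\<close>, then both \<open>b 1\<^sub>x\<close> and \<open>1\<^sub>x (bar b)\<close> are strings, but not \<open>b 1\<^sub>x (bar b)\<close>, so
  none of the first four rules applies. With the usual convention of assigning the
  arrow to one of the two sides of \<open>1\<^sub>x\<close>, one obtains the second or the third case; the last
  two rules admit either choice.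
\<close>

inductive is_pi :: "('v, 'a) pre_digraph \<Rightarrow> (('v, 'a) qpath \<Rightarrow> 'k::field) set \<Rightarrow> ('v, 'a) fwalk \<Rightarrow> ('v, 'a) hwalk \<Rightarrow> bool"
  for Q I where
  both: "\<lbrakk>both_ext Q I b w c; max_antipath Q I b \<tau>; max_antipath Q I c \<rho>\<rbrakk>
     \<Longrightarrow> is_pi Q I w (glue Q \<tau> w \<rho>)"
| right: "\<lbrakk>right_ext Q I w c; \<nexists>b. left_ext Q I b w; max_antipath Q I c \<rho>\<rbrakk>
     \<Longrightarrow> is_pi Q I w (glue Q no_letters (remove_left_direct w) \<rho>)"
| left: "\<lbrakk>left_ext Q I b w; \<nexists>c. right_ext Q I w c; max_antipath Q I b \<tau>\<rbrakk>
     \<Longrightarrow> is_pi Q I w (glue Q \<tau> (remove_right_inverse Q w) no_letters)"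
| neither: "\<lbrakk>\<nexists>c. right_ext Q I w c; \<nexists>b. left_ext Q I b w\<rbrakk>
     \<Longrightarrow> is_pi Q I w (glue Q no_letters (remove_right_inverse Q (remove_left_direct w)) no_letters)"
| trivial_right: "\<lbrakk>right_ext Q I (x, []) c; \<nexists>b. both_ext Q I b (x, []) c; max_antipath Q I c \<rho>\<rbrakk>
     \<Longrightarrow> is_pi Q I (x, []) (glue Q no_letters (x, []) \<rho>)"
| trivial_left: "\<lbrakk>left_ext Q I b (x, []); \<nexists>c. both_ext Q I b (x, []) c; max_antipath Q I b \<tau>\<rbrakk>
     \<Longrightarrow> is_pi Q I (x, []) (glue Q \<tau> (x, []) no_letters)"

text \<open>
  String and band complexes are treated together: a band of length \<open>n\<close> is unrolled to an
  \<open>n\<close>-periodic walk, and positions are taken modulo \<open>n\<close>. Strings have \<open>n = 0\<close>;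
  recall \<open>k mod 0 = k\<close>. For a homotopy letter between positions \<open>i < j\<close>, the path contributing to
  the differential is multiplied by the scalar \<open>c i\<close>.
\<close>

definition endpoints :: "(('v, 'a) qpath \<Rightarrow> 'k::field) set \<Rightarrow> ('v, 'a) hwalk \<Rightarrow> int set" where
  "endpoints I \<sigma> =
     (if \<exists>k. positions \<sigma> = {k} then positions \<sigma>
      else {k. \<exists>j. homotopy_letter I \<sigma> k j \<or> homotopy_letter I \<sigma> j k})"

definition is_grading :: "(('v, 'a) qpath \<Rightarrow> 'k::field) set \<Rightarrow> int \<Rightarrow> ('v, 'a) hwalk \<Rightarrow> (int \<Rightarrow> int) \<Rightarrow> bool" where
  "is_grading I n \<sigma> \<delta> \<longleftrightarrow>
     (\<forall>i j. homotopy_letter I \<sigma> i j \<longrightarrow> (if is_Dir (lett \<sigma> i) then \<delta> i = \<delta> j + 1 else \<delta> j = \<delta> i + 1)) \<and>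
     (\<forall>k\<in>endpoints I \<sigma>. \<delta> (k mod n) = \<delta> k) \<and>
     (\<forall>k\<in>endpoints I \<sigma>. \<delta> k \<le> 0) \<and> (\<exists>k\<in>endpoints I \<sigma>. \<delta> k = 0)"

definition position_degree :: "(('v, 'a) qpath \<Rightarrow> 'k::field) set \<Rightarrow> int \<Rightarrow> ('v, 'a) hwalk \<Rightarrow> int \<Rightarrow> int" where
  \<comment> \<open>a grading is unique on the endpoints, if it exists\<close>
  "position_degree I n \<sigma> = (SOME \<delta>. is_grading I n \<sigma> \<delta>)"

definition complex_term ::
    "('v, 'a) pre_digraph \<Rightarrow> (('v, 'a) qpath \<Rightarrow> 'k::field) set \<Rightarrow> int \<Rightarrow> ('v, 'a) hwalk \<Rightarrow> int
      \<Rightarrow> ((('v, 'a) qpath \<Rightarrow> 'k) set, int \<Rightarrow> (('v, 'a) qpath \<Rightarrow> 'k) set) module" where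
  "complex_term Q I n \<sigma> d = left_ideal_sum (bound_quiver_algebra Q I)
     (\<lambda>k. if k \<in> endpoints I \<sigma> \<and> k mod n = k \<and> position_degree I n \<sigma> k = d
          then proj_at Q I (vtx \<sigma> k) else {\<zero>\<^bsub>bound_quiver_algebra Q I\<^esub>})"

definition comp_source :: "('v, 'a) hwalk \<Rightarrow> int \<times> int \<Rightarrow> int" where
  "comp_source \<sigma> = (\<lambda>(i, j). if is_Dir (lett \<sigma> i) then j else i)"

definition comp_target :: "('v, 'a) hwalk \<Rightarrow> int \<times> int \<Rightarrow> int" where
  "comp_target \<sigma> = (\<lambda>(i, j). if is_Dir (lett \<sigma> i) then i else j)"

definition complex_diff ::
    "('v, 'a) pre_digraph \<Rightarrow> (('v, 'a) qpath \<Rightarrow> 'k::field) set \<Rightarrow> int \<Rightarrow> (int \<Rightarrow> 'k) \<Rightarrow> ('v, 'a) hwalk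
      \<Rightarrow> int \<Rightarrow> (int \<Rightarrow> (('v, 'a) qpath \<Rightarrow> 'k) set) \<Rightarrow> int \<Rightarrow> (('v, 'a) qpath \<Rightarrow> 'k) set" where
  \<comment> \<open>The formula is the same in every degree \<open>d\<close>. Of the \<open>n\<close>-translates of a homotopy letter of a
    band, the one starting in \<open>0, \<dots>, n - 1\<close> is used.\<close>
  "complex_diff Q I n c \<sigma> d u = (\<lambda>t.
     \<Oplus>\<^bsub>bound_quiver_algebra Q I\<^esub> h \<in> {(i, j). homotopy_letter I \<sigma> i j \<and> i mod n = i \<and>
                                        comp_target \<sigma> (i, j) mod n = t}.
       u (comp_source \<sigma> h mod n) \<otimes>\<^bsub>bound_quiver_algebra Q I\<^esub>
         path_class Q I (c (fst h)) (seg_path \<sigma> (fst h) (snd h)))"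

abbreviation "string_complex Q I \<sigma> \<equiv> complex_term Q I 0 \<sigma>"
abbreviation "string_complex_diff Q I \<sigma> \<equiv> complex_diff Q I 0 (\<lambda>_. 1) \<sigma>"

fun unroll :: "('v, 'a) pre_digraph \<Rightarrow> ('v, 'a) fwalk \<Rightarrow> ('v, 'a) hwalk" where
  "unroll Q (x, ws) =
    (let n = int (length ws) in
     \<lparr> positions = UNIV,
       vtx = (\<lambda>k. wvtx Q (x, ws) (nat (k mod n))),
       lett = (\<lambda>k. ws ! nat (k mod n)) \<rparr>)"

text \<open>
  In the band complex the scalar is put on the component of the homotopy letter starting at
  position \<open>q\<close>.
\<close>

definition band_component :: "('v, 'a) pre_digraph \<Rightarrow> (('v, 'a) qpath \<Rightarrow> 'k::field) set \<Rightarrow> ('v, 'a) fwalk \<Rightarrow> int \<Rightarrow> bool" where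
  "band_component Q I w q \<longleftrightarrow>
     q \<in> {0..<int (length (snd w))} \<and> (\<exists>j. homotopy_letter I (unroll Q w) q j)"

abbreviation "band_complex Q I w \<equiv> complex_term Q I (int (length (snd w))) (unroll Q w)"
abbreviation "band_complex_diff Q I w q \<nu> \<equiv>
  complex_diff Q I (int (length (snd w))) (\<lambda>i. if i = q then \<nu> else 1) (unroll Q w)"

end

theory Submission
  imports Defs "HOL-Library.Sublist"
begin

text \<open>
  A path is called nonzero if no two consecutive arrows of it form a zero relation. As \<open>I\<close> is
  generated by paths of length two, the classes of the nonzero paths are a basis of \<open>\<Lambda>\<close> (lemma
  \<open>I_iff\<close>). Hence an element of a term of the complex is a finite family of scalars, with one
  coordinate for each pair \<open>(t, p)\<close> of an endpoint \<open>t\<close> of a homotopy letter and a nonzero path \<open>p\<close>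
  starting at the vertex of \<open>t\<close>. A homotopy letter from \<open>s\<close> to \<open>t\<close> given by the path \<open>h\<close> makes the
  differential carry the coordinate \<open>(s, p)\<close> to the coordinate ``first \<open>h\<close>, then \<open>p\<close>'' at \<open>t\<close>. Two
  letters with the same target begin with different arrows, so nothing is ever added up: up to
  scalars, the differential is a partial matching of coordinates, and exactness is a statement
  about paths. The locale \<open>path_resolution\<close> contains this criterion.

  The endpoints of degree \<open>0\<close> are the tops, the positions at which no arrow of the walk ends. At
  any other endpoint \<open>s\<close>, for every nonzero path \<open>p\<close> from \<open>s\<close> exactly one of two things happens:
  \<open>p\<close> starts with a homotopy letter that has its target at \<open>s\<close>, or some homotopy letter with
  source \<open>s\<close> can be prolonged by \<open>p\<close> to a nonzero path (lemma \<open>exact_at_source\<close>). This is where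
  the algebra has to be gentle: of two arrows ending at a vertex exactly one has a zero relation
  with a given arrow starting there, and an arrow has a zero relation with at most one arrow
  following it. At the outer ends of the walk the alternative holds because the antipaths \<open>dir(b)\<close>
  and \<open>inv(a)\<close> are maximal. It is exactness in negative degrees.

  In degree \<open>0\<close>, the generator at a top \<open>t\<close> is sent to a multiple \<open>\<eta> t\<close> of the basis element
  \<open>z\<^sub>t\<close>. Paths along the walk move it to other basis elements. All other paths kill it, and they
  begin with a homotopy letter with target \<open>t\<close> (lemma \<open>killed_prefix\<close>); the removal of outer
  letters in the definition of \<open>\<pi>(w)\<close> serves this purpose. A basis element is reached from a
  single top, along a path that does not begin with a homotopy letter, or it sits at a deep
  position, where arrows end from both sides. In the second case it is reached from two tops,
  along two homotopy letters with a common source, and the image of the generator at the source is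
  annihilated if the scalars \<open>\<eta>\<close> satisfy a recursion along the walk (lemma \<open>deep_fibre\<close>). For a
  string the recursion can be solved step by step. Around a band the solution has to close up,
  which forces the scalar of the band complex to be \<open>(\<plusminus>\<mu>)\<close> or its inverse (lemma
  \<open>band_resolution\<close>).

  Strings and bands are both instances of the locale \<open>walk_resolution\<close>, with period \<open>0\<close> and \<open>n\<close>.
\<close>

section \<open>The algebra in terms of its nonzero paths\<close>

context gentle_algebra
begin

abbreviation kQ :: "(('v, 'a) qpath \<Rightarrow> 'k) ring" where "kQ \<equiv> path_algebra Q"
abbreviation \<Lambda> :: "(('v, 'a) qpath \<Rightarrow> 'k) set ring" where "\<Lambda> \<equiv> bound_quiver_algebra Q I"

definition path_end :: "'v \<Rightarrow> 'a list \<Rightarrow> 'v" where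
  "path_end x as = (if as = [] then x else head Q (last as))"

definition rel :: "'a \<Rightarrow> 'a \<Rightarrow> bool" where
  "rel a b \<longleftrightarrow> path_in Q I [a, b]"

definition nonzero_list :: "'a list \<Rightarrow> bool" where
  "nonzero_list as \<longleftrightarrow> set as \<subseteq> arcs Q \<and> successively (\<lambda>a b. head Q a = tail Q b \<and> \<not> rel a b) as"

definition nonzero_paths :: "('v, 'a) qpath set" where
  "nonzero_paths = {(x, as). x \<in> verts Q \<and> nonzero_list as \<and> (as \<noteq> [] \<longrightarrow> tail Q (hd as) = x)}"

lemma awlast_eq: "awlast x as = path_end x as"
  by (simp add: path_end_def awalk_verts_conv)

lemma path_end_simps [simp]:
  "path_end x [] = x" "path_end x (as @ [a]) = head Q a"
  "path_end x (as @ bs) = path_end (path_end x as) bs" "path_end x (a # as) = path_end (head Q a) as"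
  by (auto simp: path_end_def)

lemma qpaths_Nil: "(x, []) \<in> qpaths Q \<longleftrightarrow> x \<in> verts Q"
  by (auto simp: qpaths_def awalk_Nil_iff)

lemma qpaths_Cons: "(x, a # as) \<in> qpaths Q \<longleftrightarrow> a \<in> arcs Q \<and> x = tail Q a \<and> (head Q a, as) \<in> qpaths Q"
  by (auto simp: qpaths_def awalk_Cons_iff)

lemma qpaths_append:
  "(x, as @ bs) \<in> qpaths Q \<longleftrightarrow> (x, as) \<in> qpaths Q \<and> (path_end x as, bs) \<in> qpaths Q"
proof (induction as arbitrary: x)
  case Nil
  then show ?case by (cases bs) (auto simp: qpaths_Nil qpaths_Cons)
qed (auto simp: qpaths_Cons)

lemma nonzero_paths_Nil [simp]: "(x, []) \<in> nonzero_paths \<longleftrightarrow> x \<in> verts Q"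
  by (auto simp: nonzero_paths_def nonzero_list_def)

lemma nonzero_paths_vert: "(x, as) \<in> nonzero_paths \<Longrightarrow> x \<in> verts Q"
  by (auto simp: nonzero_paths_def)

lemma nonzero_list_append:
  "nonzero_list (as @ bs) \<longleftrightarrow> nonzero_list as \<and> nonzero_list bs \<and>
     (as \<noteq> [] \<and> bs \<noteq> [] \<longrightarrow> head Q (last as) = tail Q (hd bs) \<and> \<not> rel (last as) (hd bs))"
  by (auto simp: nonzero_list_def successively_append_iff)

lemma nonzero_list_Cons:
  "nonzero_list (a # bs) \<longleftrightarrow> a \<in> arcs Q \<and> nonzero_list bs \<and>
     (bs \<noteq> [] \<longrightarrow> head Q a = tail Q (hd bs) \<and> \<not> rel a (hd bs))"
  by (cases bs) (auto simp: nonzero_list_def)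

lemma nonzero_paths_append:
  "(x, as @ bs) \<in> nonzero_paths \<longleftrightarrow>
     (x, as) \<in> nonzero_paths \<and> (path_end x as, bs) \<in> nonzero_paths \<and>
     (as \<noteq> [] \<and> bs \<noteq> [] \<longrightarrow> \<not> rel (last as) (hd bs))"
proof (cases "as = [] \<or> bs = []")
  case True
  have "path_end x as \<in> verts Q" if "(x, as) \<in> nonzero_paths"
    using that by (cases "as = []") (auto simp: nonzero_paths_def nonzero_list_def path_end_def subset_iff)
  with True show ?thesis
    by (auto dest: nonzero_paths_vert)
next
  case False
  then show ?thesis
    by (auto simp: nonzero_paths_def nonzero_list_append path_end_def)
       (metis head_in_verts last_in_set nonzero_list_def subset_iff)
qed

lemma nonzero_paths_subset: "nonzero_paths \<subseteq> qpaths Q"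
proof -
  have "(x, as) \<in> qpaths Q" if "(x, as) \<in> nonzero_paths" for x as
    using that
  proof (induction as arbitrary: x)
    case (Cons a as)
    then show ?case
      using nonzero_paths_append[of x "[a]" as]
      by (auto simp: qpaths_Cons nonzero_paths_def nonzero_list_def)
  qed (auto simp: qpaths_Nil)
  then show ?thesis by auto
qed

lemma zero_path_split:
  assumes "(x, as) \<in> qpaths Q" "(x, as) \<notin> nonzero_paths"
  obtains us a b vs where "as = us @ [a, b] @ vs" "rel a b"
proof -
  have "\<exists>us a b vs. as = us @ [a, b] @ vs \<and> rel a b"
    using assms
  proof (induction as arbitrary: x)
    case (Cons a as)
    show ?case
    proof (cases "(head Q a, as) \<in> nonzero_paths")
      case True
      with Cons.prems nonzero_paths_append[of x "[a]" as] obtain b bs where "as = b # bs" "rel a b"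
        by (cases as) (auto simp: qpaths_Cons nonzero_paths_def nonzero_list_def)
      then have "a # as = [] @ [a, b] @ bs" by simp
      with \<open>rel a b\<close> show ?thesis by blast
    next
      case False
      with Cons obtain us c d vs where "as = us @ [c, d] @ vs" "rel c d"
        by (fastforce simp: qpaths_Cons)
      then have "a # as = (a # us) @ [c, d] @ vs" by simp
      with \<open>rel c d\<close> show ?thesis by blast
    qed
  qed (auto simp: qpaths_Nil)
  then show thesis using that by blast
qed

subsection \<open>The ideal\<close>

lemma ideal_I: "ideal I kQ"
  using admissible by (simp add: admissible_ideal_def)

lemma ring_kQ: "ring kQ"
  using ideal_I by (simp add: ideal_def)

lemma kQ_carrier: "f \<in> carrier kQ \<longleftrightarrow> finite {p. f p \<noteq> 0} \<and> {p. f p \<noteq> 0} \<subseteq> qpaths Q"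
  by (simp add: path_algebra_def)

lemma kQ_simps: "f \<oplus>\<^bsub>kQ\<^esub> g = (\<lambda>p. f p + g p)" "\<zero>\<^bsub>kQ\<^esub> = (\<lambda>p. 0)"
  "\<one>\<^bsub>kQ\<^esub> = (\<lambda>(x, as). if x \<in> verts Q \<and> as = [] then 1 else 0)"
  by (simp_all add: path_algebra_def)

lemma kQ_mult: "(f \<otimes>\<^bsub>kQ\<^esub> g) (x, as) = (\<Sum>i\<le>length as. f (path_end x (take i as), drop i as) * g (x, take i as))"
  by (simp add: path_algebra_def awlast_eq)

lemma path_elem_carrier: "p \<in> qpaths Q \<Longrightarrow> path_elem c p \<in> carrier kQ"
  by (auto simp: kQ_carrier path_elem_def)

lemma mult_path_elem:
  "(f \<otimes>\<^bsub>kQ\<^esub> path_elem c (x, as)) (y, cs) =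
     (if y = x \<and> prefix as cs then f (path_end x as, drop (length as) cs) * c else 0)"
proof -
  have *: "path_elem c (x, as) (y, take i cs) = (if y = x \<and> prefix as cs \<and> i = length as then c else 0)"
    if "i \<le> length cs" for i
    using that take_is_prefix[of i cs] by (auto simp: path_elem_def) (auto simp: prefix_def)
  have "(f \<otimes>\<^bsub>kQ\<^esub> path_elem c (x, as)) (y, cs) =
    (\<Sum>i\<le>length cs. if i = length as then (if y = x \<and> prefix as cs then f (path_end y (take i cs), drop i cs) * c else 0) else 0)"
    unfolding kQ_mult by (rule sum.cong) (auto simp: *)
  also have "\<dots> = (if y = x \<and> prefix as cs then f (path_end x as, drop (length as) cs) * c else 0)"
    by (auto simp: prefix_def)
  finally show ?thesis .
qed

lemma path_elem_mult:
  assumes "y = path_end x as"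
  shows "path_elem c (y, bs) \<otimes>\<^bsub>kQ\<^esub> path_elem d (x, as) = path_elem (c * d) (x, as @ bs)"
proof (rule ext)
  fix q :: "('v, 'a) qpath"
  obtain z cs where q: "q = (z, cs)" by (cases q)
  show "(path_elem c (y, bs) \<otimes>\<^bsub>kQ\<^esub> path_elem d (x, as)) q = path_elem (c * d) (x, as @ bs) q"
    unfolding q mult_path_elem using assms by (auto simp: path_elem_def prefix_def)
qed

lemma take_drop_nonzero_paths:
  assumes "(x, as) \<in> nonzero_paths"
  shows "(x, take i as) \<in> nonzero_paths" "(path_end x (take i as), drop i as) \<in> nonzero_paths"
  using nonzero_paths_append[of x "take i as" "drop i as"] assms by auto

text \<open>
  A coefficient of a product at a nonzero path only involves coefficients at initial and final
  parts of this path, and these are nonzero paths, too.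
\<close>

lemma ideal_vanishing: "ideal {f \<in> carrier kQ. \<forall>p\<in>nonzero_paths. f p = 0} kQ" (is "ideal ?J kQ")
proof -
  interpret K: ring kQ by (rule ring_kQ)
  show ?thesis
  proof (rule idealI[OF ring_kQ])
    have *: "(\<ominus>\<^bsub>kQ\<^esub> f) p = - f p" if "f \<in> carrier kQ" for f p
    proof -
      have "(\<ominus>\<^bsub>kQ\<^esub> f \<oplus>\<^bsub>kQ\<^esub> f) p = 0"
        using K.l_neg[OF that] by (simp add: kQ_simps)
      then show ?thesis by (simp add: kQ_simps eq_neg_iff_add_eq_0)
    qed
    show "subgroup ?J (add_monoid kQ)"
    proof (rule K.add.subgroupI)
      show "?J \<noteq> {}" using K.zero_closed by (auto simp: kQ_simps)
      show "\<ominus>\<^bsub>kQ\<^esub> f \<in> ?J" if "f \<in> ?J" for f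
        using that * by auto
      show "f \<oplus>\<^bsub>kQ\<^esub> g \<in> ?J" if "f \<in> ?J" "g \<in> ?J" for f g
        using that K.a_closed[of f g] by (auto simp: kQ_simps)
    qed auto
    have **: "(f \<otimes>\<^bsub>kQ\<^esub> g) p = 0" if "f \<in> ?J \<or> g \<in> ?J" "p \<in> nonzero_paths" for f g p
      using that take_drop_nonzero_paths
      by (cases p) (force simp: kQ_mult intro!: sum.neutral)
    show "x \<otimes>\<^bsub>kQ\<^esub> a \<in> ?J" "a \<otimes>\<^bsub>kQ\<^esub> x \<in> ?J" if "a \<in> ?J" "x \<in> carrier kQ" for a x
      using that **[of x a] **[of a x] K.m_closed[of x a] K.m_closed[of a x] by auto
  qed
qed

lemma sum_path_elems_in:
  assumes "ideal J kQ" "finite P" "\<And>p. p \<in> P \<Longrightarrow> path_elem (f p) p \<in> J"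
  shows "(\<lambda>q. if q \<in> P then f q else 0) \<in> J"
  using assms(2,3)
proof (induction P)
  case empty
  then show ?case
    using additive_subgroup.zero_closed[OF ideal.axioms(1)[OF assms(1)]] by (simp add: kQ_simps)
next
  case (insert p P)
  have "(\<lambda>q. if q \<in> insert p P then f q else 0) = path_elem (f p) p \<oplus>\<^bsub>kQ\<^esub> (\<lambda>q. if q \<in> P then f q else 0)"
    using insert.hyps by (auto simp: kQ_simps path_elem_def)
  then show ?case
    using insert additive_subgroup.a_closed[OF ideal.axioms(1)[OF assms(1)]] by auto
qed

lemma zero_path_in_I:
  assumes "p \<in> qpaths Q" "p \<notin> nonzero_paths"
  shows "path_elem c p \<in> I"
proof -
  obtain x as where p: "p = (x, as)" by (cases p)
  then obtain us a b vs where as: "as = us @ [a, b] @ vs" and ab: "rel a b"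
    using zero_path_split assms by blast
  let ?y = "path_end x us"
  have q: "(x, us) \<in> qpaths Q" "(?y, [a, b]) \<in> qpaths Q" "(head Q b, vs) \<in> qpaths Q"
    using assms(1) unfolding p as by (auto simp: qpaths_append qpaths_Cons qpaths_Nil)
  then have "?y = tail Q a" by (simp add: qpaths_Cons)
  with ab have "path_elem 1 (?y, [a, b]) \<in> I" by (simp add: rel_def path_in_def)
  then have "path_elem c (head Q b, vs) \<otimes>\<^bsub>kQ\<^esub> (path_elem 1 (?y, [a, b]) \<otimes>\<^bsub>kQ\<^esub> path_elem 1 (x, us)) \<in> I"
    using ideal.I_l_closed[OF ideal_I] ideal.I_r_closed[OF ideal_I] path_elem_carrier q by simp
  then show ?thesis by (simp add: path_elem_mult p as)
qed

text \<open>
  Since \<open>I\<close> is generated by paths of length two, membership in \<open>I\<close> can be read off from the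
  coefficients at the paths without a zero relation. This makes everything below a matter of
  combinatorics of paths.
\<close>

lemma I_iff: "f \<in> I \<longleftrightarrow> f \<in> carrier kQ \<and> (\<forall>p\<in>nonzero_paths. f p = 0)"
proof
  obtain S where S: "S \<subseteq> {p \<in> qpaths Q. length (snd p) = 2}"
    and I: "I = Idl\<^bsub>kQ\<^esub> (path_elem 1 ` S)"
    using quadratic_monomial by blast
  have "path_elem 1 ` S \<subseteq> {f \<in> carrier kQ. \<forall>p\<in>nonzero_paths. f p = 0}"
  proof (rule image_subsetI, rule CollectI, intro conjI ballI)
    fix s assume "s \<in> S"
    then show "path_elem 1 s \<in> carrier kQ" using S by (intro path_elem_carrier) auto
  next
    fix s p assume "s \<in> S" and p: "p \<in> nonzero_paths"
    then obtain x as where xas: "s = (x, as)" and s: "(x, as) \<in> S" by (cases s) auto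
    from s S obtain a b where ab: "as = [a, b]" by (auto simp: length_Suc_conv numeral_2_eq_2)
    have x: "x = tail Q a" using s S ab by (auto simp: qpaths_Cons)
    have "path_elem 1 (x, as) \<in> I"
      unfolding I by (rule subsetD[OF ring.genideal_self[OF ring_kQ]])
        (use s S path_elem_carrier in auto)
    then have "rel a b" by (simp add: rel_def path_in_def ab x)
    then have "(x, as) \<notin> nonzero_paths" by (simp add: ab nonzero_paths_def nonzero_list_def)
    with p show "path_elem 1 s p = 0" by (auto simp: path_elem_def xas)
  qed
  then have "Idl\<^bsub>kQ\<^esub> (path_elem 1 ` S) \<subseteq> {f \<in> carrier kQ. \<forall>p\<in>nonzero_paths. f p = 0}"
    by (rule ring.genideal_minimal[OF ring_kQ ideal_vanishing])
  then have "I \<subseteq> {f \<in> carrier kQ. \<forall>p\<in>nonzero_paths. f p = 0}"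
    by (rule subset_trans[OF equalityD1[OF I]])
  then show "f \<in> I \<Longrightarrow> f \<in> carrier kQ \<and> (\<forall>p\<in>nonzero_paths. f p = 0)"
    by (drule_tac subsetD) simp_all
next
  assume f: "f \<in> carrier kQ \<and> (\<forall>p\<in>nonzero_paths. f p = 0)"
  have "(\<lambda>q. if q \<in> {p. f p \<noteq> 0} then f q else 0) \<in> I"
    by (rule sum_path_elems_in[OF ideal_I]) (use f in \<open>auto simp: kQ_carrier intro!: zero_path_in_I\<close>)
  moreover have "(\<lambda>q. if q \<in> {p. f p \<noteq> 0} then f q else 0) = f" by auto
  ultimately show "f \<in> I" by simp
qed

lemma path_elem_in_I_iff: "p \<in> qpaths Q \<Longrightarrow> path_elem 1 p \<in> I \<longleftrightarrow> p \<notin> nonzero_paths"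
  unfolding I_iff using path_elem_carrier[of p 1] by (auto simp: path_elem_def)

lemma path_in_iff:
  assumes "as \<noteq> []" "(tail Q (hd as), as) \<in> qpaths Q"
  shows "path_in Q I as \<longleftrightarrow> \<not> nonzero_list as"
  using path_elem_in_I_iff[OF assms(2)] assms
  by (cases as) (auto simp: path_in_def nonzero_paths_def qpaths_Cons nonzero_list_def)

definition length_bound :: nat where
  "length_bound = (SOME m. arrow_ideal_power Q m \<subseteq> I)"

text \<open>
  By admissibility, \<open>I\<close> contains all paths from some length on, and the initial parts of a nonzero
  path are not in \<open>I\<close>.
\<close>

lemma nonzero_path_length: "(x, as) \<in> nonzero_paths \<Longrightarrow> length as < length_bound"
proof (rule ccontr)
  assume p: "(x, as) \<in> nonzero_paths" and l: "\<not> length as < length_bound"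
  obtain m where "arrow_ideal_power Q m \<subseteq> I"
    using admissible by (auto simp: admissible_ideal_def)
  then have sub: "arrow_ideal_power Q length_bound \<subseteq> I"
    unfolding length_bound_def by (rule someI)
  let ?p = "(x, take length_bound as)"
  have nz: "?p \<in> nonzero_paths" using p by (rule take_drop_nonzero_paths)
  then have q: "?p \<in> qpaths Q" using nonzero_paths_subset by auto
  have "path_elem (1::'k) ?p \<in> arrow_ideal_power Q length_bound"
    unfolding arrow_ideal_power_def
    by (rule subsetD[OF ring.genideal_self[OF ring_kQ]]) (use q l in \<open>auto intro: path_elem_carrier\<close>)
  with sub path_elem_in_I_iff[OF q] nz show False by auto
qed

lemma finite_nonzero_paths: "finite nonzero_paths"
proof (rule finite_subset)
  show "nonzero_paths \<subseteq> verts Q \<times> {as. set as \<subseteq> arcs Q \<and> length as \<le> length_bound}"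
    using nonzero_path_length by (fastforce simp: nonzero_paths_def nonzero_list_def)
  show "finite (verts Q \<times> {as. set as \<subseteq> arcs Q \<and> length as \<le> length_bound})"
    by (intro finite_cartesian_product finite_lists_length_le) simp_all
qed

subsection \<open>Coefficients\<close>

abbreviation cls :: "(('v, 'a) qpath \<Rightarrow> 'k) \<Rightarrow> (('v, 'a) qpath \<Rightarrow> 'k) set" where
  "cls f \<equiv> I +>\<^bsub>kQ\<^esub> f"

text \<open>
  An element of \<open>\<Lambda>\<close> is determined by its coefficients at the nonzero paths, which can be read off
  from any representative.
\<close>

definition coeff :: "(('v, 'a) qpath \<Rightarrow> 'k) set \<Rightarrow> ('v, 'a) qpath \<Rightarrow> 'k" where
  "coeff X p = (if p \<in> nonzero_paths then (SOME f. f \<in> X) p else 0)"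

lemma ring_\<Lambda>: "ring \<Lambda>"
  unfolding bound_quiver_algebra_def by (rule ideal.quotient_is_ring[OF ideal_I])

lemma \<Lambda>_simps:
  "carrier \<Lambda> = cls ` carrier kQ" "\<zero>\<^bsub>\<Lambda>\<^esub> = I" "\<one>\<^bsub>\<Lambda>\<^esub> = cls \<one>\<^bsub>kQ\<^esub>" "X \<oplus>\<^bsub>\<Lambda>\<^esub> Y = X <+>\<^bsub>kQ\<^esub> Y"
  "X \<otimes>\<^bsub>\<Lambda>\<^esub> Y = rcoset_mult kQ I X Y"
  by (auto simp: bound_quiver_algebra_def FactRing_def A_RCOSETS_def')

lemma cls_carrier: "f \<in> carrier kQ \<Longrightarrow> cls f \<in> carrier \<Lambda>"
  by (simp add: \<Lambda>_simps)

lemma cls_eq_iff: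
  assumes "f \<in> carrier kQ" "g \<in> carrier kQ"
  shows "g \<in> cls f \<longleftrightarrow> (\<forall>p\<in>nonzero_paths. g p = f p)"
proof -
  interpret K: ring kQ by (rule ring_kQ)
  interpret i: ideal I kQ by (rule ideal_I)
  have m: "g \<ominus>\<^bsub>kQ\<^esub> f \<in> carrier kQ" using assms by simp
  have "(g \<ominus>\<^bsub>kQ\<^esub> f) \<oplus>\<^bsub>kQ\<^esub> f = g"
    using assms by (simp add: K.minus_eq K.a_assoc K.l_neg)
  then have *: "(g \<ominus>\<^bsub>kQ\<^esub> f) p + f p = g p" for p
    unfolding kQ_simps by (rule fun_cong)
  have "g \<in> cls f \<longleftrightarrow> g \<ominus>\<^bsub>kQ\<^esub> f \<in> I"
    by (rule i.a_rcos_module_minus[OF ring_kQ assms])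
  also have "\<dots> \<longleftrightarrow> (\<forall>p\<in>nonzero_paths. g p = f p)"
    using m *[symmetric] by (auto simp: I_iff)
  finally show ?thesis .
qed

lemma abelian_subgroup_I: "abelian_subgroup I kQ"
  by (rule abelian_subgroupI3[OF ideal.axioms(1)[OF ideal_I] ring.is_abelian_group[OF ring_kQ]])

lemma cls_subset: "f \<in> carrier kQ \<Longrightarrow> g \<in> cls f \<Longrightarrow> g \<in> carrier kQ"
  by (rule abelian_subgroup.a_elemrcos_carrier[OF abelian_subgroup_I])

lemma cls_self: "f \<in> carrier kQ \<Longrightarrow> f \<in> cls f"
  by (simp add: cls_eq_iff)

lemma coeff_rep:
  assumes "X \<in> carrier \<Lambda>" "f \<in> X"
  shows "f \<in> carrier kQ" "p \<in> nonzero_paths \<Longrightarrow> f p = coeff X p"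
proof -
  obtain g where g: "g \<in> carrier kQ" "X = cls g" using assms(1) by (auto simp: \<Lambda>_simps)
  then show "f \<in> carrier kQ" using assms(2) cls_subset by simp
  assume "p \<in> nonzero_paths"
  have "(SOME f. f \<in> X) \<in> X" using someI[of "\<lambda>f. f \<in> X", OF assms(2)] .
  then have "(SOME f. f \<in> X) p = g p" "f p = g p"
    using \<open>p \<in> nonzero_paths\<close> assms(2) cls_eq_iff[OF g(1)] cls_subset[OF g(1)] unfolding g(2) by blast+
  then show "f p = coeff X p"
    using \<open>p \<in> nonzero_paths\<close> by (simp add: coeff_def)
qed

lemma coeff_cls: "f \<in> carrier kQ \<Longrightarrow> coeff (cls f) p = (if p \<in> nonzero_paths then f p else 0)"
  using coeff_rep(2)[OF cls_carrier cls_self] by (auto simp: coeff_def)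

lemma coeff_outside [simp]: "p \<notin> nonzero_paths \<Longrightarrow> coeff X p = 0"
  by (simp add: coeff_def)

lemma coeff_subset:
  assumes "X \<in> carrier \<Lambda>" "Y \<in> carrier \<Lambda>" "\<And>p. p \<in> nonzero_paths \<Longrightarrow> coeff X p = coeff Y p"
  shows "X \<subseteq> Y"
proof
  fix h assume h: "h \<in> X"
  obtain g where g: "g \<in> carrier kQ" "Y = cls g"
    using assms(2) by (auto simp: \<Lambda>_simps)
  have "h p = g p" if "p \<in> nonzero_paths" for p
    using coeff_rep(2)[OF assms(1) h that] coeff_rep(2)[OF assms(2) _ that] cls_self[OF g(1)] assms(3)[OF that] g
    by simp
  then show "h \<in> Y"
    using cls_eq_iff[OF g(1) coeff_rep(1)[OF assms(1) h]] g by simp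
qed

lemma coeff_inject:
  assumes "X \<in> carrier \<Lambda>" "Y \<in> carrier \<Lambda>" "\<And>p. p \<in> nonzero_paths \<Longrightarrow> coeff X p = coeff Y p"
  shows "X = Y"
  using coeff_subset[of X Y] coeff_subset[of Y X] assms by force

lemma coeff_cls_nonzero:
  assumes "{p. g p \<noteq> 0} \<subseteq> nonzero_paths"
  shows "cls g \<in> carrier \<Lambda>" "coeff (cls g) = g"
proof -
  have "g \<in> carrier kQ"
    using assms finite_nonzero_paths finite_subset nonzero_paths_subset by (auto simp: kQ_carrier)
  then show "cls g \<in> carrier \<Lambda>" "coeff (cls g) = g"
    using assms by (auto simp: cls_carrier coeff_cls fun_eq_iff)
qed

lemma coeff_zero [simp]: "coeff \<zero>\<^bsub>\<Lambda>\<^esub> p = 0"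
proof -
  have "\<zero>\<^bsub>\<Lambda>\<^esub> = cls \<zero>\<^bsub>kQ\<^esub>"
    using additive_subgroup.a_subset[OF ideal.axioms(1)[OF ideal_I]]
      abelian_group.a_coset_add_zero[OF ring.is_abelian_group[OF ring_kQ]]
    by (auto simp: \<Lambda>_simps)
  then show ?thesis
    using coeff_cls[of "\<zero>\<^bsub>kQ\<^esub>" p] ring.ring_simprules(2)[OF ring_kQ] by (simp add: kQ_simps)
qed

lemma coeff_add:
  assumes "X \<in> carrier \<Lambda>" "Y \<in> carrier \<Lambda>"
  shows "coeff (X \<oplus>\<^bsub>\<Lambda>\<^esub> Y) p = coeff X p + coeff Y p"
proof -
  obtain f g where fg: "f \<in> carrier kQ" "X = cls f" "g \<in> carrier kQ" "Y = cls g"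
    using assms by (auto simp: \<Lambda>_simps)
  have "X \<oplus>\<^bsub>\<Lambda>\<^esub> Y = cls (f \<oplus>\<^bsub>kQ\<^esub> g)"
    using abelian_subgroup.a_rcos_sum[OF abelian_subgroup_I fg(1,3)] fg by (simp add: \<Lambda>_simps)
  then show ?thesis
    using fg ring.ring_simprules(1)[OF ring_kQ, of f g] by (simp add: coeff_cls kQ_simps)
qed

lemma coeff_mult:
  assumes "X \<in> carrier \<Lambda>" "Y \<in> carrier \<Lambda>" "(x, as) \<in> nonzero_paths"
  shows "coeff (X \<otimes>\<^bsub>\<Lambda>\<^esub> Y) (x, as) =
    (\<Sum>i\<le>length as. coeff X (path_end x (take i as), drop i as) * coeff Y (x, take i as))"
proof -
  obtain f g where fg: "f \<in> carrier kQ" "X = cls f" "g \<in> carrier kQ" "Y = cls g"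
    using assms by (auto simp: \<Lambda>_simps)
  have "X \<otimes>\<^bsub>\<Lambda>\<^esub> Y = cls (f \<otimes>\<^bsub>kQ\<^esub> g)"
    using ideal.rcoset_mult_add[OF ideal_I, of f g] fg by (simp add: \<Lambda>_simps)
  then show ?thesis
    using fg assms(3) take_drop_nonzero_paths[OF assms(3)] ring.ring_simprules(5)[OF ring_kQ, of f g]
    by (simp add: coeff_cls kQ_mult)
qed

lemma coeff_one: "coeff \<one>\<^bsub>\<Lambda>\<^esub> (x, as) = (if x \<in> verts Q \<and> as = [] then 1 else 0)"
  using coeff_cls[of "\<one>\<^bsub>kQ\<^esub>" "(x, as)"] ring.ring_simprules(6)[OF ring_kQ]
  by (auto simp: \<Lambda>_simps kQ_simps)

lemma path_class_carrier: "p \<in> qpaths Q \<Longrightarrow> path_class Q I c p \<in> carrier \<Lambda>"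
  by (simp add: path_class_def cls_carrier path_elem_carrier)

text \<open>
  Right multiplication by a path prolongs the paths at their beginning and thus shifts
  coefficients.
\<close>

lemma coeff_mult_path_class:
  assumes "X \<in> carrier \<Lambda>" "(x, as) \<in> qpaths Q" "(y, cs) \<in> nonzero_paths"
  shows "coeff (X \<otimes>\<^bsub>\<Lambda>\<^esub> path_class Q I c (x, as)) (y, cs) =
    (if y = x \<and> prefix as cs then coeff X (path_end x as, drop (length as) cs) * c else 0)"
proof -
  obtain f where f: "f \<in> carrier kQ" "X = cls f"
    using assms by (auto simp: \<Lambda>_simps)
  let ?p = "path_elem c (x, as)"
  have p: "?p \<in> carrier kQ" by (rule path_elem_carrier[OF assms(2)])
  have "X \<otimes>\<^bsub>\<Lambda>\<^esub> path_class Q I c (x, as) = cls (f \<otimes>\<^bsub>kQ\<^esub> ?p)"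
    using ideal.rcoset_mult_add[OF ideal_I, of f ?p] f p by (simp add: \<Lambda>_simps path_class_def)
  then have "coeff (X \<otimes>\<^bsub>\<Lambda>\<^esub> path_class Q I c (x, as)) (y, cs) = (f \<otimes>\<^bsub>kQ\<^esub> ?p) (y, cs)"
    using f assms(3) p ring.ring_simprules(5)[OF ring_kQ, of f ?p] by (simp add: coeff_cls)
  moreover have "(path_end x as, drop (length as) cs) \<in> nonzero_paths" if "y = x" "prefix as cs"
    using that assms(3) nonzero_paths_append[of x as "drop (length as) cs"] by (auto simp: prefix_def)
  ultimately show ?thesis
    using f by (simp add: mult_path_elem coeff_cls)
qed

lemma coeff_finsum:
  assumes "finite H" "\<And>h. h \<in> H \<Longrightarrow> X h \<in> carrier \<Lambda>"
  shows "(\<Oplus>\<^bsub>\<Lambda>\<^esub>h\<in>H. X h) \<in> carrier \<Lambda>" "coeff (\<Oplus>\<^bsub>\<Lambda>\<^esub>h\<in>H. X h) p = (\<Sum>h\<in>H. coeff (X h) p)"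
proof -
  interpret R: ring \<Lambda> by (rule ring_\<Lambda>)
  show "(\<Oplus>\<^bsub>\<Lambda>\<^esub>h\<in>H. X h) \<in> carrier \<Lambda>" using assms by (intro R.finsum_closed) auto
  show "coeff (\<Oplus>\<^bsub>\<Lambda>\<^esub>h\<in>H. X h) p = (\<Sum>h\<in>H. coeff (X h) p)"
    using assms
  proof (induction H)
    case (insert h H)
    then have "(\<Oplus>\<^bsub>\<Lambda>\<^esub>h\<in>insert h H. X h) = X h \<oplus>\<^bsub>\<Lambda>\<^esub> (\<Oplus>\<^bsub>\<Lambda>\<^esub>h\<in>H. X h)"
      by (intro R.finsum_insert) auto
    moreover have "(\<Oplus>\<^bsub>\<Lambda>\<^esub>h\<in>H. X h) \<in> carrier \<Lambda>" using insert by (intro R.finsum_closed) auto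
    ultimately show ?case using insert by (simp add: coeff_add)
  qed simp
qed

lemma mem_proj_at_iff:
  assumes "x \<in> verts Q"
  shows "X \<in> proj_at Q I x \<longleftrightarrow> X \<in> carrier \<Lambda> \<and> (\<forall>p. coeff X p \<noteq> 0 \<longrightarrow> fst p = x)"
proof -
  interpret R: ring \<Lambda> by (rule ring_\<Lambda>)
  let ?e = "path_class Q I 1 (x, [])"
  have e: "?e \<in> carrier \<Lambda>" using assms by (simp add: path_class_carrier qpaths_Nil)
  have c: "coeff (X \<otimes>\<^bsub>\<Lambda>\<^esub> ?e) p = (if fst p = x then coeff X p else 0)" if "X \<in> carrier \<Lambda>" for X p
    using coeff_mult_path_class[OF that, of x "[]" "fst p" "snd p" 1] assms
    by (cases "p \<in> nonzero_paths") (auto simp: qpaths_Nil)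
  show ?thesis
  proof
    assume "X \<in> proj_at Q I x"
    then show "X \<in> carrier \<Lambda> \<and> (\<forall>p. coeff X p \<noteq> 0 \<longrightarrow> fst p = x)"
      using c e by (auto simp: proj_at_def split: if_splits)
  next
    assume X: "X \<in> carrier \<Lambda> \<and> (\<forall>p. coeff X p \<noteq> 0 \<longrightarrow> fst p = x)"
    have "X \<otimes>\<^bsub>\<Lambda>\<^esub> ?e = X"
      by (rule coeff_inject) (use X c e in auto)
    then show "X \<in> proj_at Q I x"
      unfolding proj_at_def using X by (metis imageI)
  qed
qed

end

section \<open>Modules given by matrices\<close>

text \<open>
  The matrices of a representation satisfying the zero relations. The action of \<open>\<Lambda>\<close> on
  \<open>rep_module\<close> is defined by a choice-free but indirect description; the aim here is to express it
  by coefficients.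
\<close>

locale bound_representation = gentle_algebra Q I
  for Q :: "('v, 'a) pre_digraph" and I :: "(('v, 'a) qpath \<Rightarrow> 'k::alg_closed_field) set" +
  fixes N :: "'i set" and vt :: "'i \<Rightarrow> 'v" and m :: "'a \<Rightarrow> 'i \<Rightarrow> 'i \<Rightarrow> 'k"
  assumes finite_N: "finite N"
    and vt_verts: "i \<in> N \<Longrightarrow> vt i \<in> verts Q"
    and matrix_support: "\<lbrakk>a \<in> arcs Q; i \<in> N; j \<in> N; m a i j \<noteq> 0\<rbrakk> \<Longrightarrow> vt j = tail Q a \<and> vt i = head Q a"
    and relations_act_zero: "\<lbrakk>a \<in> arcs Q; b \<in> arcs Q; rel a b\<rbrakk> \<Longrightarrow>
          arrow_action N m b (arrow_action N m a v) = (\<lambda>i. 0)"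
begin

abbreviation act_path :: "('v, 'a) qpath \<Rightarrow> ('i \<Rightarrow> 'k) \<Rightarrow> 'i \<Rightarrow> 'k" where
  "act_path \<equiv> path_action N vt m"

abbreviation M :: "((('v, 'a) qpath \<Rightarrow> 'k) set, 'i \<Rightarrow> 'k) module" where
  "M \<equiv> rep_module N vt m"

lemma arrow_action_linear:
  "arrow_action N m a (\<lambda>i. u i + v i) = (\<lambda>i. arrow_action N m a u i + arrow_action N m a v i)"
  "arrow_action N m a (\<lambda>i. c * v i) = (\<lambda>i. c * arrow_action N m a v i)"
  by (auto simp: arrow_action_def fun_eq_iff sum.distrib sum_distrib_left algebra_simps)

lemma arrow_action_zero: "arrow_action N m a (\<lambda>i. 0) = (\<lambda>i. 0)"
  by (auto simp: arrow_action_def)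

lemma fold_linear:
  "fold (arrow_action N m) as (\<lambda>i. u i + v i) =
     (\<lambda>i. fold (arrow_action N m) as u i + fold (arrow_action N m) as v i)"
  "fold (arrow_action N m) as (\<lambda>i. c * v i) = (\<lambda>i. c * fold (arrow_action N m) as v i)"
  by (induction as arbitrary: u v) (simp_all add: arrow_action_linear)

lemma fold_zero: "fold (arrow_action N m) as (\<lambda>i. 0) = (\<lambda>i. 0)"
  by (induction as) (simp_all add: arrow_action_zero)

lemma act_path_add: "act_path p (\<lambda>i. u i + v i) i = act_path p u i + act_path p v i"
proof -
  have "(\<lambda>i. if i \<in> N \<and> vt i = fst p then u i + v i else 0) =
    (\<lambda>i. (if i \<in> N \<and> vt i = fst p then u i else 0) + (if i \<in> N \<and> vt i = fst p then v i else 0))"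
    by auto
  then show ?thesis by (simp add: path_action_def fold_linear)
qed

lemma act_path_scale: "act_path p (\<lambda>i. c * v i) i = c * act_path p v i"
proof -
  have "(\<lambda>i. if i \<in> N \<and> vt i = fst p then c * v i else 0) =
    (\<lambda>i. c * (if i \<in> N \<and> vt i = fst p then v i else 0))"
    by auto
  then show ?thesis by (simp add: path_action_def fold_linear)
qed

lemma act_path_zero: "act_path p (\<lambda>i. 0) = (\<lambda>i. 0)"
  by (simp add: path_action_def fold_zero cong: if_cong)

lemma act_path_sum:
  assumes "finite P"
  shows "act_path q (\<lambda>i. \<Sum>p\<in>P. c p * g p i) i = (\<Sum>p\<in>P. c p * act_path q (g p) i)"
  using assms by (induction P) (simp_all add: act_path_add act_path_scale act_path_zero)

lemma act_path_support:
  assumes "(x, as) \<in> qpaths Q" "act_path (x, as) v i \<noteq> 0"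
  shows "i \<in> N" "vt i = path_end x as"
proof -
  have *: "i \<in> N \<and> vt i = path_end x as"
  proof (cases as rule: rev_cases)
    case Nil
    with assms(2) show ?thesis by (auto simp: path_action_def split: if_splits)
  next
    case (snoc bs a)
    then have "a \<in> arcs Q" using assms(1) by (simp add: qpaths_append qpaths_Cons)
    have "arrow_action N m a (act_path (x, bs) v) i \<noteq> 0"
      using assms(2) snoc by (simp add: path_action_def)
    then obtain j where "i \<in> N" "j \<in> N" "m a i j \<noteq> 0"
      by (auto simp: arrow_action_def split: if_splits elim!: sum.not_neutral_contains_not_neutral)
    with matrix_support[OF \<open>a \<in> arcs Q\<close>] snoc show ?thesis by simp
  qed
  then show "i \<in> N" "vt i = path_end x as" by auto
qed

lemma act_path_conv:
  "act_path (x, as) v = fold (arrow_action N m) as (\<lambda>i. if i \<in> N \<and> vt i = x then v i else 0)"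
  by (simp add: path_action_def)

lemma act_path_fold: "act_path (x, as @ bs) v = fold (arrow_action N m) bs (act_path (x, as) v)"
  by (simp add: act_path_conv)

lemma act_path_append:
  assumes "(x, as) \<in> qpaths Q"
  shows "act_path (path_end x as, bs) (act_path (x, as) v) = act_path (x, as @ bs) v"
proof -
  have "(\<lambda>i. if i \<in> N \<and> vt i = path_end x as then act_path (x, as) v i else 0) = act_path (x, as) v"
    using act_path_support[OF assms] by fastforce
  then show ?thesis by (simp only: act_path_conv[of "path_end x as"] act_path_fold)
qed

lemma act_path_mismatch:
  assumes "(x, as) \<in> qpaths Q" "y \<noteq> path_end x as"
  shows "act_path (y, bs) (act_path (x, as) v) = (\<lambda>i. 0)"
proof -
  have "(\<lambda>i. if i \<in> N \<and> vt i = y then act_path (x, as) v i else 0) = (\<lambda>i. 0)"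
    using act_path_support[OF assms(1)] assms(2) by fastforce
  then have "fold (arrow_action N m) bs (\<lambda>i. if i \<in> N \<and> vt i = y then act_path (x, as) v i else 0) = (\<lambda>i. 0)"
    by (simp only: fold_zero)
  then show ?thesis by (simp only: act_path_conv[of y])
qed

lemma act_zero_path:
  assumes "p \<in> qpaths Q" "p \<notin> nonzero_paths"
  shows "act_path p v = (\<lambda>i. 0)"
proof -
  obtain x as where p: "p = (x, as)" by (cases p)
  then obtain us a b vs where as: "as = us @ [a, b] @ vs" and "rel a b"
    using zero_path_split assms by blast
  moreover have "a \<in> arcs Q" "b \<in> arcs Q"
    using assms(1) p as by (auto simp: qpaths_append qpaths_Cons)
  ultimately have "arrow_action N m b (arrow_action N m a u) = (\<lambda>i. 0)" for u
    using relations_act_zero by blast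
  then show ?thesis by (simp add: p as path_action_def fold_zero)
qed

text \<open>
  Paths that are not nonzero act by zero, so any representative of \<open>X\<close> gives the same sum over the
  nonzero paths.
\<close>

definition act :: "(('v, 'a) qpath \<Rightarrow> 'k) set \<Rightarrow> ('i \<Rightarrow> 'k) \<Rightarrow> 'i \<Rightarrow> 'k" where
  "act X v = (\<lambda>i. \<Sum>p\<in>nonzero_paths. coeff X p * act_path p v i)"

lemma M_simps:
  "carrier M = {v. \<forall>i. i \<notin> N \<longrightarrow> v i = 0}" "\<zero>\<^bsub>M\<^esub> = (\<lambda>i. 0)" "u \<oplus>\<^bsub>M\<^esub> v = (\<lambda>i. u i + v i)"
  by (simp_all add: rep_module_def)

lemma kQ_action_eq:
  assumes "X \<in> carrier \<Lambda>" "f \<in> X"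
  shows "kQ_action N vt m f v = act X v"
proof
  fix i
  have f: "finite {p. f p \<noteq> 0}" "{p. f p \<noteq> 0} \<subseteq> qpaths Q"
    using coeff_rep(1)[OF assms] by (auto simp: kQ_carrier)
  have "kQ_action N vt m f v i = (\<Sum>p\<in>{p. f p \<noteq> 0} \<union> nonzero_paths. f p * act_path p v i)"
    unfolding kQ_action_def using f finite_nonzero_paths by (intro sum.mono_neutral_left) auto
  also have "\<dots> = (\<Sum>p\<in>nonzero_paths. f p * act_path p v i)"
    using f finite_nonzero_paths act_zero_path nonzero_paths_subset
    by (intro sum.mono_neutral_right) auto
  also have "\<dots> = act X v i"
    unfolding act_def using coeff_rep(2)[OF assms] by (intro sum.cong) auto
  finally show "kQ_action N vt m f v i = act X v i" .
qed

lemma smult_eq: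
  assumes "X \<in> carrier \<Lambda>"
  shows "X \<odot>\<^bsub>M\<^esub> v = act X v"
proof -
  obtain f where "f \<in> X" using assms cls_self by (auto simp: \<Lambda>_simps)
  then show ?thesis
    using kQ_action_eq[OF assms] by (auto simp: rep_module_def intro!: the_equality)
qed

lemma act_closed: "act X v \<in> carrier M"
  using act_path_support(1) nonzero_paths_subset
  by (fastforce simp: M_simps act_def intro!: sum.neutral)

text \<open>
  Both sides run over the factorizations of nonzero paths into two parts: a pair of nonzero paths
  that do not compose, or compose to a path in \<open>I\<close>, acts by zero.
\<close>

lemma act_mult:
  assumes "X \<in> carrier \<Lambda>" "Y \<in> carrier \<Lambda>"
  shows "act (X \<otimes>\<^bsub>\<Lambda>\<^esub> Y) v = act X (act Y v)"
proof
  fix i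
  let ?N = nonzero_paths
  let ?F = "\<lambda>q p. coeff X q * (coeff Y p * act_path q (act_path p v) i)"
  let ?S = "{(q, p) \<in> ?N \<times> ?N. fst q = path_end (fst p) (snd p) \<and> (fst p, snd p @ snd q) \<in> ?N}"
  have z: "act_path q (act_path p v) i = 0" if "q \<in> ?N" "p \<in> ?N" "(q, p) \<notin> ?S" for p q
  proof -
    obtain x as y bs where pq: "p = (x, as)" "q = (y, bs)" by (cases p, cases q)
    have qp: "(x, as) \<in> qpaths Q" "(y, bs) \<in> qpaths Q" using nonzero_paths_subset that pq by auto
    show ?thesis
    proof (cases "y = path_end x as")
      case True
      then have "(x, as @ bs) \<in> qpaths Q" "(x, as @ bs) \<notin> ?N"
        using that pq qp by (auto simp: qpaths_append)
      then show ?thesis using act_zero_path act_path_append[OF qp(1)] True pq by simp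
    next
      case False
      then show ?thesis using act_path_mismatch[OF qp(1)] pq by simp
    qed
  qed
  have "act X (act Y v) i = (\<Sum>q\<in>?N. coeff X q * (\<Sum>p\<in>?N. coeff Y p * act_path q (act_path p v) i))"
    by (simp add: act_def act_path_sum[OF finite_nonzero_paths])
  also have "\<dots> = (\<Sum>(q, p)\<in>?N \<times> ?N. ?F q p)"
    by (simp add: sum_distrib_left sum.cartesian_product)
  also have "\<dots> = (\<Sum>(q, p)\<in>?S. ?F q p)"
  proof (rule sum.mono_neutral_right)
    show "\<forall>s\<in>?N \<times> ?N - ?S. (case s of (q, p) \<Rightarrow> ?F q p) = 0"
    proof
      fix s assume s: "s \<in> ?N \<times> ?N - ?S"
      then show "(case s of (q, p) \<Rightarrow> ?F q p) = 0"
        using z[of "fst s" "snd s"] by (cases s) simp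
    qed
  qed (use finite_nonzero_paths in auto)
  \<comment> \<open>a composable pair corresponds to a nonzero path together with the place where it is cut\<close>
  also have "\<dots> = (\<Sum>(p, k)\<in>(SIGMA p:?N. {..length (snd p)}).
      coeff X (path_end (fst p) (take k (snd p)), drop k (snd p)) * (coeff Y (fst p, take k (snd p)) * act_path p v i))"
  proof (rule sum.reindex_bij_witness[where
        i = "\<lambda>(p, k). ((path_end (fst p) (take k (snd p)), drop k (snd p)), (fst p, take k (snd p)))" and
        j = "\<lambda>(q, p). ((fst p, snd p @ snd q), length (snd p))"])
    fix b assume "b \<in> (SIGMA p:?N. {..length (snd p)})"
    then show "(case case b of (p, k) \<Rightarrow> ((path_end (fst p) (take k (snd p)), drop k (snd p)), fst p, take k (snd p)) of
             (q, p) \<Rightarrow> ((fst p, snd p @ snd q), length (snd p))) = b"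
      "(case b of (p, k) \<Rightarrow> ((path_end (fst p) (take k (snd p)), drop k (snd p)), fst p, take k (snd p))) \<in> ?S"
      using take_drop_nonzero_paths[of "fst (fst b)" "snd (fst b)" "snd b"] by (auto split: prod.splits)
  next
    fix s assume s: "s \<in> ?S"
    then show "(case case s of (q, p) \<Rightarrow> ((fst p, snd p @ snd q), length (snd p)) of
              (p, k) \<Rightarrow> ((path_end (fst p) (take k (snd p)), drop k (snd p)), fst p, take k (snd p))) = s"
      "(case s of (q, p) \<Rightarrow> ((fst p, snd p @ snd q), length (snd p))) \<in> (SIGMA p:?N. {..length (snd p)})"
      by (auto split: prod.splits)
    obtain y bs x as where [simp]: "s = ((y, bs), (x, as))" by (metis prod.exhaust)
    have "(x, as) \<in> qpaths Q" "y = path_end x as" using s nonzero_paths_subset by auto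
    then show "(case case s of (q, p) \<Rightarrow> ((fst p, snd p @ snd q), length (snd p)) of (p, k) \<Rightarrow>
          coeff X (path_end (fst p) (take k (snd p)), drop k (snd p)) * (coeff Y (fst p, take k (snd p)) * act_path p v i)) =
         (case s of (q, p) \<Rightarrow> ?F q p)"
      using act_path_append[of x as bs v] by simp
  qed
  also have "\<dots> = (\<Sum>p\<in>?N. \<Sum>k\<le>length (snd p).
      coeff X (path_end (fst p) (take k (snd p)), drop k (snd p)) * (coeff Y (fst p, take k (snd p)) * act_path p v i))"
    by (rule sum.Sigma[symmetric]) (use finite_nonzero_paths in auto)
  also have "\<dots> = act (X \<otimes>\<^bsub>\<Lambda>\<^esub> Y) v i"
    unfolding act_def
  proof (rule sum.cong)
    fix p assume "p \<in> ?N"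
    then show "(\<Sum>k\<le>length (snd p). coeff X (path_end (fst p) (take k (snd p)), drop k (snd p)) *
        (coeff Y (fst p, take k (snd p)) * act_path p v i)) = coeff (X \<otimes>\<^bsub>\<Lambda>\<^esub> Y) p * act_path p v i"
      using coeff_mult[OF assms, of "fst p" "snd p"] by (simp add: sum_distrib_right mult.assoc)
  qed simp
  finally show "act (X \<otimes>\<^bsub>\<Lambda>\<^esub> Y) v i = act X (act Y v) i" ..
qed

lemma act_one:
  assumes "v \<in> carrier M"
  shows "act \<one>\<^bsub>\<Lambda>\<^esub> v = v"
proof
  fix i
  have "act \<one>\<^bsub>\<Lambda>\<^esub> v i = (\<Sum>p\<in>(\<lambda>x. (x, [])) ` verts Q. coeff \<one>\<^bsub>\<Lambda>\<^esub> p * act_path p v i)"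
    unfolding act_def by (rule sum.mono_neutral_right) (auto simp: finite_nonzero_paths coeff_one)
  also have "\<dots> = (\<Sum>x\<in>verts Q. if i \<in> N \<and> vt i = x then v i else 0)"
    by (subst sum.reindex) (auto simp: inj_on_def coeff_one path_action_def)
  also have "\<dots> = v i"
    using assms vt_verts by (cases "i \<in> N") (auto simp: M_simps)
  finally show "act \<one>\<^bsub>\<Lambda>\<^esub> v i = v i" .
qed

lemma left_module_M: "left_module \<Lambda> M"
proof -
  interpret R: ring \<Lambda> by (rule ring_\<Lambda>)
  interpret A: abelian_group M
  proof (rule abelian_groupI)
    show "\<exists>y\<in>carrier M. y \<oplus>\<^bsub>M\<^esub> x = \<zero>\<^bsub>M\<^esub>" if "x \<in> carrier M" for x
      by (rule bexI[of _ "\<lambda>i. - x i"]) (use that in \<open>auto simp: M_simps\<close>)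
  qed (auto simp: M_simps algebra_simps)
  show ?thesis
  proof unfold_locales
    show "a \<odot>\<^bsub>M\<^esub> x \<in> carrier M" if "a \<in> carrier \<Lambda>" for a x
      using that act_closed by (simp add: smult_eq)
    show "(a \<oplus>\<^bsub>\<Lambda>\<^esub> b) \<odot>\<^bsub>M\<^esub> x = a \<odot>\<^bsub>M\<^esub> x \<oplus>\<^bsub>M\<^esub> b \<odot>\<^bsub>M\<^esub> x"
      if "a \<in> carrier \<Lambda>" "b \<in> carrier \<Lambda>" for a b x
      using that by (simp add: smult_eq) (simp add: act_def coeff_add M_simps algebra_simps sum.distrib)
    show "a \<odot>\<^bsub>M\<^esub> (x \<oplus>\<^bsub>M\<^esub> y) = a \<odot>\<^bsub>M\<^esub> x \<oplus>\<^bsub>M\<^esub> a \<odot>\<^bsub>M\<^esub> y" if "a \<in> carrier \<Lambda>" for a x y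
      using that by (simp add: smult_eq) (simp add: act_def act_path_add M_simps algebra_simps sum.distrib)
    show "a \<otimes>\<^bsub>\<Lambda>\<^esub> b \<odot>\<^bsub>M\<^esub> x = a \<odot>\<^bsub>M\<^esub> (b \<odot>\<^bsub>M\<^esub> x)" if "a \<in> carrier \<Lambda>" "b \<in> carrier \<Lambda>" for a b x
      using that by (simp add: smult_eq act_mult)
    show "\<one>\<^bsub>\<Lambda>\<^esub> \<odot>\<^bsub>M\<^esub> x = x" if "x \<in> carrier M" for x
      using that by (simp add: smult_eq act_one)
  qed
qed

end

section \<open>Direct sums of left ideals generated by idempotents\<close>

lemma left_module_left_ideal_sum:
  assumes "ring R" and A: "\<And>i. A i \<subseteq> carrier R" "\<And>i. \<zero>\<^bsub>R\<^esub> \<in> A i"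
    "\<And>i x y. x \<in> A i \<Longrightarrow> y \<in> A i \<Longrightarrow> x \<oplus>\<^bsub>R\<^esub> y \<in> A i"
    "\<And>i r x. r \<in> carrier R \<Longrightarrow> x \<in> A i \<Longrightarrow> r \<otimes>\<^bsub>R\<^esub> x \<in> A i"
  shows "left_module R (left_ideal_sum R A)"
proof -
  interpret R: ring R by fact
  let ?M = "left_ideal_sum R A"
  have car: "f i \<in> carrier R" if "f \<in> carrier ?M" for f i
    using that A(1)[of i] by (auto simp: left_ideal_sum_def)
  have fin: "finite {i. f i \<noteq> \<zero>\<^bsub>R\<^esub>}" if "f \<in> carrier ?M" for f
    using that by (simp add: left_ideal_sum_def)
  have memI: "f \<in> carrier ?M" if "\<And>i. f i \<in> A i" "finite {i. f i \<noteq> \<zero>\<^bsub>R\<^esub>}" for f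
    using that by (simp add: left_ideal_sum_def)
  have mem: "f i \<in> A i" if "f \<in> carrier ?M" for f i
    using that by (simp add: left_ideal_sum_def)
  have smult: "(\<lambda>i. r \<otimes>\<^bsub>R\<^esub> f i) \<in> carrier ?M" if "f \<in> carrier ?M" "r \<in> carrier R" for f r
  proof (rule memI)
    show "r \<otimes>\<^bsub>R\<^esub> f i \<in> A i" for i by (rule A(4)[OF that(2) mem[OF that(1)]])
    show "finite {i. r \<otimes>\<^bsub>R\<^esub> f i \<noteq> \<zero>\<^bsub>R\<^esub>}"
      by (rule finite_subset[OF _ fin[OF that(1)]]) (use that(2) in auto)
  qed
  have add: "(\<lambda>i. f i \<oplus>\<^bsub>R\<^esub> g i) \<in> carrier ?M" if "f \<in> carrier ?M" "g \<in> carrier ?M" for f g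
  proof (rule memI)
    show "f i \<oplus>\<^bsub>R\<^esub> g i \<in> A i" for i by (rule A(3)[OF mem[OF that(1)] mem[OF that(2)]])
    show "finite {i. f i \<oplus>\<^bsub>R\<^esub> g i \<noteq> \<zero>\<^bsub>R\<^esub>}"
      by (rule finite_subset[OF _ finite_UnI[OF fin[OF that(1)] fin[OF that(2)]]]) auto
  qed
  have zero: "(\<lambda>i. \<zero>\<^bsub>R\<^esub>) \<in> carrier ?M"
    by (rule memI) (use A(2) in auto)
  have simps: "f \<oplus>\<^bsub>?M\<^esub> g = (\<lambda>i. f i \<oplus>\<^bsub>R\<^esub> g i)" "\<zero>\<^bsub>?M\<^esub> = (\<lambda>i. \<zero>\<^bsub>R\<^esub>)"
    "r \<odot>\<^bsub>?M\<^esub> f = (\<lambda>i. r \<otimes>\<^bsub>R\<^esub> f i)" for f g r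
    by (simp_all add: left_ideal_sum_def)
  interpret M: abelian_group ?M
  proof (rule abelian_groupI)
    fix x assume x: "x \<in> carrier ?M"
    have "(\<lambda>i. \<ominus>\<^bsub>R\<^esub> \<one>\<^bsub>R\<^esub> \<otimes>\<^bsub>R\<^esub> x i) \<in> carrier ?M"
      by (rule smult[OF x]) simp
    moreover have "(\<lambda>i. \<ominus>\<^bsub>R\<^esub> \<one>\<^bsub>R\<^esub> \<otimes>\<^bsub>R\<^esub> x i) \<oplus>\<^bsub>?M\<^esub> x = \<zero>\<^bsub>?M\<^esub>"
      using car[OF x] by (simp add: simps R.l_minus R.l_neg)
    ultimately show "\<exists>y\<in>carrier ?M. y \<oplus>\<^bsub>?M\<^esub> x = \<zero>\<^bsub>?M\<^esub>" by blast
  next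
    fix x y z assume x: "x \<in> carrier ?M" and y: "y \<in> carrier ?M"
    show "x \<oplus>\<^bsub>?M\<^esub> y \<in> carrier ?M" using add[OF x y] by (simp add: simps)
    show "x \<oplus>\<^bsub>?M\<^esub> y = y \<oplus>\<^bsub>?M\<^esub> x" using car[OF x] car[OF y] by (simp add: simps R.a_comm)
    show "\<zero>\<^bsub>?M\<^esub> \<oplus>\<^bsub>?M\<^esub> x = x" using car[OF x] by (simp add: simps)
    show "x \<oplus>\<^bsub>?M\<^esub> y \<oplus>\<^bsub>?M\<^esub> z = x \<oplus>\<^bsub>?M\<^esub> (y \<oplus>\<^bsub>?M\<^esub> z)" if "z \<in> carrier ?M"
      using car[OF x] car[OF y] car[OF that] by (simp add: simps R.a_assoc)
  qed (use zero in \<open>simp add: simps\<close>)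
  show ?thesis
  proof unfold_locales
    fix a b x y assume a: "a \<in> carrier R" and x: "x \<in> carrier ?M"
    show "a \<odot>\<^bsub>?M\<^esub> x \<in> carrier ?M" using smult[OF x a] by (simp add: simps)
    show "(a \<oplus>\<^bsub>R\<^esub> b) \<odot>\<^bsub>?M\<^esub> x = a \<odot>\<^bsub>?M\<^esub> x \<oplus>\<^bsub>?M\<^esub> b \<odot>\<^bsub>?M\<^esub> x" if "b \<in> carrier R"
      using car[OF x] a that by (simp add: simps R.l_distr)
    show "a \<odot>\<^bsub>?M\<^esub> (x \<oplus>\<^bsub>?M\<^esub> y) = a \<odot>\<^bsub>?M\<^esub> x \<oplus>\<^bsub>?M\<^esub> a \<odot>\<^bsub>?M\<^esub> y" if "y \<in> carrier ?M"
      using car[OF x] car[OF that] a by (simp add: simps R.r_distr)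
    show "a \<otimes>\<^bsub>R\<^esub> b \<odot>\<^bsub>?M\<^esub> x = a \<odot>\<^bsub>?M\<^esub> (b \<odot>\<^bsub>?M\<^esub> x)" if "b \<in> carrier R"
      using car[OF x] a that by (simp add: simps R.m_assoc)
  next
    fix x assume "x \<in> carrier ?M"
    then show "\<one>\<^bsub>R\<^esub> \<odot>\<^bsub>?M\<^esub> x = x" using car by (simp add: simps)
  qed
qed

text \<open>
  A left ideal generated by an idempotent is a retract of the regular module, hence a direct sum
  of such ideals is a retract of a free module. The basis is labelled by the elements of the
  direct sum that are supported on one nonzero summand.
\<close>

lemma projective_left_ideal_sum:
  fixes R :: "('r, 'x) ring_scheme" and A :: "'i \<Rightarrow> 'r set"
  assumes "ring R" and e: "\<And>i. e i \<in> carrier R" "\<And>i. e i \<otimes>\<^bsub>R\<^esub> e i = e i"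
    and A: "\<And>i. A i = (\<lambda>x. x \<otimes>\<^bsub>R\<^esub> e i) ` carrier R"
  shows "projective_lmod R (left_ideal_sum R A)"
proof -
  interpret R: ring R by fact
  let ?M = "left_ideal_sum R A"
  have A_closed: "A i \<subseteq> carrier R" "\<zero>\<^bsub>R\<^esub> \<in> A i" "x \<in> A i \<Longrightarrow> y \<in> A i \<Longrightarrow> x \<oplus>\<^bsub>R\<^esub> y \<in> A i"
    "r \<in> carrier R \<Longrightarrow> x \<in> A i \<Longrightarrow> r \<otimes>\<^bsub>R\<^esub> x \<in> A i" for i x y r
  proof -
    show "A i \<subseteq> carrier R" using e by (auto simp: A)
    show "\<zero>\<^bsub>R\<^esub> \<in> A i" unfolding A by (rule image_eqI[of _ _ "\<zero>\<^bsub>R\<^esub>"]) (use e in auto)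
    show "x \<oplus>\<^bsub>R\<^esub> y \<in> A i" if xy: "x \<in> A i" "y \<in> A i"
    proof -
      obtain x' y' where "x' \<in> carrier R" "x = x' \<otimes>\<^bsub>R\<^esub> e i" "y' \<in> carrier R" "y = y' \<otimes>\<^bsub>R\<^esub> e i"
        using xy by (auto simp: A)
      then show ?thesis using e(1)[of i] by (auto simp: A R.l_distr intro: image_eqI[of _ _ "x' \<oplus>\<^bsub>R\<^esub> y'"])
    qed
    show "r \<otimes>\<^bsub>R\<^esub> x \<in> A i" if rx: "r \<in> carrier R" "x \<in> A i"
    proof -
      obtain x' where "x' \<in> carrier R" "x = x' \<otimes>\<^bsub>R\<^esub> e i" using rx by (auto simp: A)
      then show ?thesis using rx(1) e(1)[of i] by (auto simp: A R.m_assoc intro: image_eqI[of _ _ "r \<otimes>\<^bsub>R\<^esub> x'"])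
    qed
  qed
  have fixed: "x \<otimes>\<^bsub>R\<^esub> e i = x" if x: "x \<in> A i" for x i
  proof -
    obtain y where "y \<in> carrier R" "x = y \<otimes>\<^bsub>R\<^esub> e i" using x by (auto simp: A)
    then show ?thesis using e[of i] by (simp add: R.m_assoc)
  qed
  define K where "K = {i. A i \<noteq> {\<zero>\<^bsub>R\<^esub>}}"
  define b where "b k = (\<lambda>j. if j = k then \<one>\<^bsub>R\<^esub> else \<zero>\<^bsub>R\<^esub>)" for k :: 'i
  have inj: "inj_on b K"
  proof (rule inj_onI, rule ccontr)
    fix i j assume ij: "i \<in> K" "b i = b j" "i \<noteq> j"
    then have "\<one>\<^bsub>R\<^esub> = \<zero>\<^bsub>R\<^esub>" by (metis b_def)
    then have "carrier R = {\<zero>\<^bsub>R\<^esub>}" by (rule R.one_zeroD)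
    then have "A i = {\<zero>\<^bsub>R\<^esub>}" using A_closed(1,2)[of i] by auto
    with ij show False by (simp add: K_def)
  qed
  define f where "f u = (\<lambda>x. if x \<in> b ` K then u (inv_into K b x) else \<zero>\<^bsub>R\<^esub>)" for u
  define g where "g v = (\<lambda>k. if k \<in> K then v (b k) \<otimes>\<^bsub>R\<^esub> e k else \<zero>\<^bsub>R\<^esub>)" for v
  let ?F = "free_lmod R (b ` K)"
  have Fc: "carrier ?F = {v. (\<forall>x. v x \<in> (if x \<in> b ` K then carrier R else {\<zero>\<^bsub>R\<^esub>})) \<and> finite {x. v x \<noteq> \<zero>\<^bsub>R\<^esub>}}"
    by (simp add: free_lmod_def left_ideal_sum_def)
  have Fc_carrier: "v x \<in> carrier R" if "v \<in> carrier ?F" for v x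
  proof -
    have "v x \<in> (if x \<in> b ` K then carrier R else {\<zero>\<^bsub>R\<^esub>})" using that unfolding Fc by blast
    then show ?thesis by (cases "x \<in> b ` K") simp_all
  qed
  have Mc: "carrier ?M = {u. (\<forall>k. u k \<in> A k) \<and> finite {k. u k \<noteq> \<zero>\<^bsub>R\<^esub>}}"
    by (simp add: left_ideal_sum_def)
  have ops: "u \<oplus>\<^bsub>?M\<^esub> v = (\<lambda>i. u i \<oplus>\<^bsub>R\<^esub> v i)" "r \<odot>\<^bsub>?M\<^esub> u = (\<lambda>i. r \<otimes>\<^bsub>R\<^esub> u i)"
    "u' \<oplus>\<^bsub>?F\<^esub> v' = (\<lambda>i. u' i \<oplus>\<^bsub>R\<^esub> v' i)" "r \<odot>\<^bsub>?F\<^esub> u' = (\<lambda>i. r \<otimes>\<^bsub>R\<^esub> u' i)" for u v r u' v'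
    by (simp_all add: left_ideal_sum_def free_lmod_def)
  have f: "f \<in> lmod_hom R ?M ?F"
    unfolding lmod_hom_def
  proof (intro CollectI conjI ballI Pi_I)
    fix u assume u: "u \<in> carrier ?M"
    have "{x. f u x \<noteq> \<zero>\<^bsub>R\<^esub>} \<subseteq> b ` {k. u k \<noteq> \<zero>\<^bsub>R\<^esub>}"
      using inj by (auto simp: f_def split: if_splits)
    then have "finite {x. f u x \<noteq> \<zero>\<^bsub>R\<^esub>}" using u by (auto simp: Mc intro: finite_subset)
    moreover have "u k \<in> carrier R" for k using u A_closed(1)[of k] by (auto simp: Mc)
    ultimately show "f u \<in> carrier ?F" by (auto simp: Fc f_def)
  qed (auto simp: ops f_def)
  have g: "g \<in> lmod_hom R ?F ?M"
    unfolding lmod_hom_def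
  proof (intro CollectI conjI ballI Pi_I)
    fix v assume v: "v \<in> carrier ?F"
    have vc: "v x \<in> carrier R" for x by (rule Fc_carrier[OF v])
    have "{k. g v k \<noteq> \<zero>\<^bsub>R\<^esub>} \<subseteq> b -` {x. v x \<noteq> \<zero>\<^bsub>R\<^esub>} \<inter> K"
      using e by (auto simp: g_def split: if_splits)
    moreover have "finite (b -` {x. v x \<noteq> \<zero>\<^bsub>R\<^esub>} \<inter> K)"
      using v inj by (intro finite_vimage_IntI) (auto simp: Fc)
    ultimately have "finite {k. g v k \<noteq> \<zero>\<^bsub>R\<^esub>}" by (rule finite_subset)
    moreover have "g v k \<in> A k" for k
      using vc A_closed(2) by (auto simp: g_def A)
    ultimately show "g v \<in> carrier ?M" by (simp add: Mc)
    show "g (r \<odot>\<^bsub>?F\<^esub> v) = r \<odot>\<^bsub>?M\<^esub> g v" if "r \<in> carrier R" for r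
      using vc that e by (auto simp: ops g_def R.m_assoc)
    show "g (v \<oplus>\<^bsub>?F\<^esub> w) = g v \<oplus>\<^bsub>?M\<^esub> g w" if "w \<in> carrier ?F" for w
    proof -
      have "w x \<in> carrier R" for x by (rule Fc_carrier[OF that])
      then show ?thesis using vc e by (auto simp: ops g_def R.l_distr)
    qed
  qed
  have gf: "g (f u) = u" if u: "u \<in> carrier ?M" for u
  proof
    fix k
    have uk: "u k \<in> A k" using u by (simp add: Mc)
    show "g (f u) k = u k"
    proof (cases "k \<in> K")
      case True
      then show ?thesis using inj fixed[OF uk] by (simp add: g_def f_def)
    next
      case False
      then show ?thesis using uk by (simp add: g_def K_def)
    qed
  qed
  have "left_module R ?M"
    by (rule left_module_left_ideal_sum[where A = A, OF assms(1)])
      (fact A_closed(1), fact A_closed(2), erule (1) A_closed(3), erule (1) A_closed(4))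
  then show ?thesis
    unfolding projective_lmod_def
    by (intro conjI exI[of _ "b ` K"] bexI[OF _ f] bexI[OF _ g] ballI gf)
qed

section \<open>Complexes whose differential is right multiplication by paths\<close>

text \<open>
  A combinatorial criterion for a projective resolution of \<open>M\<close>. The generators \<open>t \<in> T\<close> have degree
  \<open>deg t\<close> and generate a copy of \<open>P(vx t)\<close>. Each \<open>h \<in> H\<close> contributes to the differential the right
  multiplication by the path \<open>pth h\<close>, from the summand \<open>src h\<close> to the summand \<open>tgt h\<close>; the path
  runs from the vertex of the target to that of the source. A generator \<open>t\<close> of degree \<open>0\<close> is sent
  to \<open>gen t\<close>, and the path \<open>as\<close> moves \<open>gen t\<close> to \<open>\<theta> t as\<close> times the basis element \<open>\<zeta> t as\<close>.

  Call \<open>(t, as)\<close> reached if \<open>as\<close> begins with some \<open>pth h\<close> for which \<open>tgt h = t\<close>. The assumption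
  \<open>exact_negative\<close> says that a coordinate is reached if and only if the differential maps it to
  zero. By \<open>fibre_cases\<close> and \<open>fibre_pair\<close>, the coordinates contributing to a basis element of \<open>M\<close>
  are either a single one that is not reached, or the two that are reached from one coordinate
  \<open>(src h, [])\<close>, with cancelling scalars. By \<open>killed\<close>, coordinates mapped to zero in \<open>M\<close> are
  reached.
\<close>

locale path_resolution = bound_representation Q I N vt m
  for Q :: "('v, 'a) pre_digraph" and I :: "(('v, 'a) qpath \<Rightarrow> 'k::alg_closed_field) set"
    and N :: "'i set" and vt :: "'i \<Rightarrow> 'v" and m :: "'a \<Rightarrow> 'i \<Rightarrow> 'i \<Rightarrow> 'k" +
  fixes T :: "'p set" and vx :: "'p \<Rightarrow> 'v" and deg :: "'p \<Rightarrow> int"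
    and H :: "'h set" and src tgt :: "'h \<Rightarrow> 'p" and pth :: "'h \<Rightarrow> 'a list" and c :: "'h \<Rightarrow> 'k"
    and gen :: "'p \<Rightarrow> 'i \<Rightarrow> 'k" and \<zeta> :: "'p \<Rightarrow> 'a list \<Rightarrow> 'i" and \<theta> :: "'p \<Rightarrow> 'a list \<Rightarrow> 'k"
  assumes vx_verts: "t \<in> T \<Longrightarrow> vx t \<in> verts Q"
    and deg_nonpos: "t \<in> T \<Longrightarrow> deg t \<le> 0"
    and ends_T: "h \<in> H \<Longrightarrow> src h \<in> T" "h \<in> H \<Longrightarrow> tgt h \<in> T"
    and deg_tgt: "h \<in> H \<Longrightarrow> deg (tgt h) = deg (src h) + 1"
    and pth_nonzero: "h \<in> H \<Longrightarrow> (vx (tgt h), pth h) \<in> nonzero_paths"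
    and pth_nonempty: "h \<in> H \<Longrightarrow> pth h \<noteq> []"
    and pth_end: "h \<in> H \<Longrightarrow> path_end (vx (tgt h)) (pth h) = vx (src h)"
    and scalar_nonzero: "h \<in> H \<Longrightarrow> c h \<noteq> 0"
    and finite_tgt: "finite {h \<in> H. tgt h = t}"
    and finite_src: "finite {h \<in> H. src h = s}"
    and hd_distinct: "\<lbrakk>h \<in> H; h' \<in> H; tgt h = tgt h'; hd (pth h) = hd (pth h')\<rbrakk> \<Longrightarrow> h = h'"
    and last_distinct: "\<lbrakk>h \<in> H; h' \<in> H; src h = src h'; last (pth h) = last (pth h')\<rbrakk> \<Longrightarrow> h = h'"
    and act_gen: "\<lbrakk>t \<in> T; deg t = 0; (vx t, as) \<in> nonzero_paths\<rbrakk> \<Longrightarrow>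
          path_action N vt m (vx t, as) (gen t) = (\<lambda>i. if i = \<zeta> t as then \<theta> t as else 0)"
    and exact_negative: "\<lbrakk>s \<in> T; deg s < 0; (vx s, as) \<in> nonzero_paths\<rbrakk> \<Longrightarrow>
          (\<exists>h\<in>H. tgt h = s \<and> prefix (pth h) as) \<longleftrightarrow>
          \<not> (\<exists>h\<in>H. src h = s \<and> (vx (tgt h), pth h @ as) \<in> nonzero_paths)"
    and unique_src: "\<lbrakk>h \<in> H; h' \<in> H; src h = src h'; deg (src h) < -1\<rbrakk> \<Longrightarrow> h = h'"
    and fibre_cases: "i \<in> N \<Longrightarrow>
          (\<exists>t as. t \<in> T \<and> deg t = 0 \<and> \<not> (\<exists>h\<in>H. tgt h = t \<and> prefix (pth h) as) \<and>
             {(t, as). t \<in> T \<and> deg t = 0 \<and> (vx t, as) \<in> nonzero_paths \<and> \<zeta> t as = i \<and> \<theta> t as \<noteq> 0} = {(t, as)}) \<or>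
          (\<exists>h\<in>H. \<exists>h'\<in>H. h \<noteq> h' \<and> src h = src h' \<and>
             {(t, as). t \<in> T \<and> deg t = 0 \<and> (vx t, as) \<in> nonzero_paths \<and> \<zeta> t as = i \<and> \<theta> t as \<noteq> 0} =
               {(tgt h, pth h), (tgt h', pth h')} \<and>
             c h * \<theta> (tgt h) (pth h) + c h' * \<theta> (tgt h') (pth h') = 0)"
    and fibre_pair: "\<lbrakk>h \<in> H; h' \<in> H; h \<noteq> h'; src h = src h'\<rbrakk> \<Longrightarrow> \<exists>i\<in>N.
             {(t, as). t \<in> T \<and> deg t = 0 \<and> (vx t, as) \<in> nonzero_paths \<and> \<zeta> t as = i \<and> \<theta> t as \<noteq> 0} =
               {(tgt h, pth h), (tgt h', pth h')} \<and>
             c h * \<theta> (tgt h) (pth h) + c h' * \<theta> (tgt h') (pth h') = 0"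
    and killed: "\<lbrakk>t \<in> T; deg t = 0; (vx t, as) \<in> nonzero_paths; \<theta> t as = 0\<rbrakk> \<Longrightarrow>
          \<exists>h\<in>H. tgt h = t \<and> prefix (pth h) as"
begin

definition fibre :: "'i \<Rightarrow> ('p \<times> 'a list) set" where
  "fibre i = {(t, as). t \<in> T \<and> deg t = 0 \<and> (vx t, as) \<in> nonzero_paths \<and> \<zeta> t as = i \<and> \<theta> t as \<noteq> 0}"

definition term_at :: "int \<Rightarrow> ((('v, 'a) qpath \<Rightarrow> 'k) set, 'p \<Rightarrow> (('v, 'a) qpath \<Rightarrow> 'k) set) module" where
  "term_at d = left_ideal_sum \<Lambda> (\<lambda>t. if t \<in> T \<and> deg t = d then proj_at Q I (vx t) else {\<zero>\<^bsub>\<Lambda>\<^esub>})"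

definition D :: "('p \<Rightarrow> (('v, 'a) qpath \<Rightarrow> 'k) set) \<Rightarrow> 'p \<Rightarrow> (('v, 'a) qpath \<Rightarrow> 'k) set" where
  "D u t = (\<Oplus>\<^bsub>\<Lambda>\<^esub>h\<in>{h \<in> H. tgt h = t}. u (src h) \<otimes>\<^bsub>\<Lambda>\<^esub> path_class Q I (c h) (vx (tgt h), pth h))"

definition co :: "('p \<Rightarrow> (('v, 'a) qpath \<Rightarrow> 'k) set) \<Rightarrow> 'p \<Rightarrow> 'a list \<Rightarrow> 'k" where
  "co u t as = coeff (u t) (vx t, as)"

sublocale \<Lambda>: ring \<Lambda> by (rule ring_\<Lambda>)

subsection \<open>The terms\<close>

lemma term_at_simps:
  "u \<oplus>\<^bsub>term_at d\<^esub> v = (\<lambda>i. u i \<oplus>\<^bsub>\<Lambda>\<^esub> v i)" "\<zero>\<^bsub>term_at d\<^esub> = (\<lambda>i. \<zero>\<^bsub>\<Lambda>\<^esub>)"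
  "X \<odot>\<^bsub>term_at d\<^esub> u = (\<lambda>i. X \<otimes>\<^bsub>\<Lambda>\<^esub> u i)"
  by (simp_all add: term_at_def left_ideal_sum_def)

lemma mem_term_at:
  "u \<in> carrier (term_at d) \<longleftrightarrow> finite {t. u t \<noteq> \<zero>\<^bsub>\<Lambda>\<^esub>} \<and> (\<forall>t. u t \<in> carrier \<Lambda>) \<and>
     (\<forall>t. u t \<noteq> \<zero>\<^bsub>\<Lambda>\<^esub> \<longrightarrow> t \<in> T \<and> deg t = d) \<and> (\<forall>t p. coeff (u t) p \<noteq> 0 \<longrightarrow> fst p = vx t)"
  (is "?l \<longleftrightarrow> ?r")
proof
  assume l: ?l
  have "u t \<in> (if t \<in> T \<and> deg t = d then proj_at Q I (vx t) else {\<zero>\<^bsub>\<Lambda>\<^esub>})" for t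
    using l by (simp add: term_at_def left_ideal_sum_def)
  then have "if t \<in> T \<and> deg t = d then u t \<in> carrier \<Lambda> \<and> (\<forall>p. coeff (u t) p \<noteq> 0 \<longrightarrow> fst p = vx t)
     else u t = \<zero>\<^bsub>\<Lambda>\<^esub>" for t
    using mem_proj_at_iff[OF vx_verts, of t "u t"] by (metis singletonD)
  moreover have "finite {t. u t \<noteq> \<zero>\<^bsub>\<Lambda>\<^esub>}"
    using l by (simp add: term_at_def left_ideal_sum_def)
  ultimately show ?r
    by (metis \<Lambda>.zero_closed coeff_zero)
next
  assume r: ?r
  have "u t \<in> (if t \<in> T \<and> deg t = d then proj_at Q I (vx t) else {\<zero>\<^bsub>\<Lambda>\<^esub>})" for t
    using r mem_proj_at_iff[OF vx_verts, of t "u t"] by (cases "t \<in> T \<and> deg t = d") auto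
  then show ?l using r by (simp add: term_at_def left_ideal_sum_def)
qed

lemma term_at_carrier: "u \<in> carrier (term_at d) \<Longrightarrow> u t \<in> carrier \<Lambda>"
  by (simp add: mem_term_at)

lemma coeff_vertex: "u \<in> carrier (term_at d) \<Longrightarrow> fst p \<noteq> vx t \<Longrightarrow> coeff (u t) p = 0"
  unfolding mem_term_at by blast

lemma term_at_eqI:
  assumes "u \<in> carrier (term_at d)" "v \<in> carrier (term_at d)"
    "\<And>t as. t \<in> T \<Longrightarrow> deg t = d \<Longrightarrow> (vx t, as) \<in> nonzero_paths \<Longrightarrow> co u t as = co v t as"
  shows "u = v"
proof
  fix t
  show "u t = v t"
  proof (cases "t \<in> T \<and> deg t = d")
    case True
    show ?thesis
    proof (rule coeff_inject)
      fix p :: "('v, 'a) qpath" assume p: "p \<in> nonzero_paths"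
      obtain x as where xas: "p = (x, as)" by (cases p)
      show "coeff (u t) p = coeff (v t) p"
      proof (cases "x = vx t")
        case True
        with assms(3)[of t as] \<open>t \<in> T \<and> deg t = d\<close> p xas show ?thesis by (simp add: co_def)
      next
        case False
        then have "coeff (u t) p = 0" "coeff (v t) p = 0"
          using coeff_vertex[OF assms(1)] coeff_vertex[OF assms(2)] xas by auto
        then show ?thesis by simp
      qed
    qed (use assms term_at_carrier in auto)
  next
    case False
    then have "u t = \<zero>\<^bsub>\<Lambda>\<^esub>" "v t = \<zero>\<^bsub>\<Lambda>\<^esub>" using assms(1,2) unfolding mem_term_at by blast+
    then show ?thesis by simp
  qed
qed

lemma co_zero: "u t = \<zero>\<^bsub>\<Lambda>\<^esub> \<Longrightarrow> co u t as = 0"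
  by (simp add: co_def)

text \<open>
  Inverse to taking coordinates; this is how preimages under the differential and the augmentation
  are written down.
\<close>

definition mk :: "int \<Rightarrow> ('p \<Rightarrow> 'a list \<Rightarrow> 'k) \<Rightarrow> 'p \<Rightarrow> (('v, 'a) qpath \<Rightarrow> 'k) set" where
  "mk d g = (\<lambda>t. if t \<in> T \<and> deg t = d \<and> (\<exists>as. (vx t, as) \<in> nonzero_paths \<and> g t as \<noteq> 0)
     then cls (\<lambda>p. if p \<in> nonzero_paths \<and> fst p = vx t then g t (snd p) else 0) else \<zero>\<^bsub>\<Lambda>\<^esub>)"

lemma mk:
  assumes "finite {t \<in> T. deg t = d \<and> (\<exists>as. (vx t, as) \<in> nonzero_paths \<and> g t as \<noteq> 0)}"
  shows "mk d g \<in> carrier (term_at d)"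
    "\<lbrakk>t \<in> T; deg t = d; (vx t, as) \<in> nonzero_paths\<rbrakk> \<Longrightarrow> co (mk d g) t as = g t as"
proof -
  let ?f = "\<lambda>t p. if p \<in> nonzero_paths \<and> fst p = vx t then g t (snd p) else 0"
  have f: "cls (?f t) \<in> carrier \<Lambda>" "coeff (cls (?f t)) = ?f t" for t
  proof -
    have "{p. ?f t p \<noteq> 0} \<subseteq> nonzero_paths" by auto
    then show "cls (?f t) \<in> carrier \<Lambda>" "coeff (cls (?f t)) = ?f t"
      by (fact coeff_cls_nonzero)+
  qed
  have "finite {t. mk d g t \<noteq> \<zero>\<^bsub>\<Lambda>\<^esub>}"
    by (rule finite_subset[OF _ assms]) (auto simp: mk_def split: if_splits)
  moreover have "mk d g t \<in> carrier \<Lambda>" for t using f by (simp add: mk_def)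
  moreover have "coeff (mk d g t) p \<noteq> 0 \<Longrightarrow> fst p = vx t" for t p
    using f by (auto simp: mk_def split: if_splits)
  moreover have "mk d g t \<noteq> \<zero>\<^bsub>\<Lambda>\<^esub> \<Longrightarrow> t \<in> T \<and> deg t = d" for t
    by (auto simp: mk_def split: if_splits)
  ultimately show "mk d g \<in> carrier (term_at d)"
    unfolding mem_term_at by blast
  show "co (mk d g) t as = g t as" if "t \<in> T" "deg t = d" "(vx t, as) \<in> nonzero_paths"
    using that f by (auto simp: mk_def co_def)
qed

lemma projective_term_at: "projective_lmod \<Lambda> (term_at d)"
proof -
  let ?e = "\<lambda>t. if t \<in> T \<and> deg t = d then path_class Q I 1 (vx t, []) else \<zero>\<^bsub>\<Lambda>\<^esub>"
  have e: "path_class Q I 1 (vx t, []) \<in> carrier \<Lambda>" if "t \<in> T" for t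
    using that vx_verts by (simp add: path_class_carrier qpaths_Nil)
  have idem: "path_class Q I 1 (vx t, []) \<otimes>\<^bsub>\<Lambda>\<^esub> path_class Q I 1 (vx t, []) = path_class Q I 1 (vx t, [])"
    if t: "t \<in> T" for t
  proof (rule coeff_inject)
    fix p :: "('v, 'a) qpath" assume p: "p \<in> nonzero_paths"
    have "coeff (path_class Q I 1 (vx t, [])) p = path_elem 1 (vx t, []) p"
      using p t vx_verts by (simp add: path_class_def coeff_cls path_elem_carrier qpaths_Nil)
    then have "coeff (path_class Q I 1 (vx t, [])) p = (if p = (vx t, []) then 1 else 0)"
      by (simp add: path_elem_def)
    then show "coeff (path_class Q I 1 (vx t, []) \<otimes>\<^bsub>\<Lambda>\<^esub> path_class Q I 1 (vx t, [])) p =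
      coeff (path_class Q I 1 (vx t, [])) p"
      using coeff_mult_path_class[OF e[OF t], of "vx t" "[]" "fst p" "snd p" 1] t p vx_verts[OF t]
      by (cases p) (auto simp: qpaths_Nil)
  qed (use e[OF t] in auto)
  show "projective_lmod \<Lambda> (term_at d)"
    unfolding term_at_def
  proof (rule projective_left_ideal_sum[OF ring_\<Lambda>, where e = ?e])
    fix t
    show "?e t \<in> carrier \<Lambda>" using e by simp
    show "?e t \<otimes>\<^bsub>\<Lambda>\<^esub> ?e t = ?e t" using idem by simp
    show "(if t \<in> T \<and> deg t = d then proj_at Q I (vx t) else {\<zero>\<^bsub>\<Lambda>\<^esub>}) = (\<lambda>X. X \<otimes>\<^bsub>\<Lambda>\<^esub> ?e t) ` carrier \<Lambda>"
      using \<Lambda>.zero_closed by (auto simp: proj_at_def image_iff)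
  qed
qed

subsection \<open>The differential in coordinates\<close>

lemma pth_qpath: "h \<in> H \<Longrightarrow> (vx (tgt h), pth h) \<in> qpaths Q"
  using pth_nonzero nonzero_paths_subset by blast

lemma D_term_closed: "h \<in> H \<Longrightarrow> X \<in> carrier \<Lambda> \<Longrightarrow> X \<otimes>\<^bsub>\<Lambda>\<^esub> path_class Q I (c h) (vx (tgt h), pth h) \<in> carrier \<Lambda>"
  using pth_qpath path_class_carrier by simp

lemma D_carrier:
  assumes "\<And>t. u t \<in> carrier \<Lambda>"
  shows "D u t \<in> carrier \<Lambda>"
  unfolding D_def by (rule coeff_finsum(1)[OF finite_tgt]) (use assms D_term_closed in auto)

lemma coeff_D:
  assumes "\<And>t. u t \<in> carrier \<Lambda>" "p \<in> nonzero_paths"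
  shows "coeff (D u t) p = (\<Sum>h\<in>{h \<in> H. tgt h = t}.
     if fst p = vx t \<and> prefix (pth h) (snd p) then c h * coeff (u (src h)) (vx (src h), drop (length (pth h)) (snd p)) else 0)"
  unfolding D_def
proof (subst coeff_finsum(2)[OF finite_tgt])
  show "u (src h) \<otimes>\<^bsub>\<Lambda>\<^esub> path_class Q I (c h) (vx (tgt h), pth h) \<in> carrier \<Lambda>" if "h \<in> {h \<in> H. tgt h = t}" for h
    using that assms D_term_closed by auto
  show "(\<Sum>h\<in>{h \<in> H. tgt h = t}. coeff (u (src h) \<otimes>\<^bsub>\<Lambda>\<^esub> path_class Q I (c h) (vx (tgt h), pth h)) p) =
    (\<Sum>h\<in>{h \<in> H. tgt h = t}. if fst p = vx t \<and> prefix (pth h) (snd p)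
       then c h * coeff (u (src h)) (vx (src h), drop (length (pth h)) (snd p)) else 0)"
  proof (rule sum.cong)
    fix h assume "h \<in> {h \<in> H. tgt h = t}"
    then have h: "h \<in> H" and t: "t = tgt h" by auto
    show "coeff (u (src h) \<otimes>\<^bsub>\<Lambda>\<^esub> path_class Q I (c h) (vx (tgt h), pth h)) p =
      (if fst p = vx t \<and> prefix (pth h) (snd p)
       then c h * coeff (u (src h)) (vx (src h), drop (length (pth h)) (snd p)) else 0)"
      unfolding t
      using coeff_mult_path_class[OF assms(1) pth_qpath[OF h], of "fst p" "snd p" "src h" "c h"] assms(2)
      by (simp add: pth_end[OF h])
  qed simp
qed

text \<open>
  Paths issuing from the same position along different homotopy letters begin with different
  arrows. Hence at most one term contributes to each coordinate of the differential.
\<close>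

lemma prefix_unique:
  assumes "h \<in> H" "h' \<in> H" "tgt h = tgt h'" "prefix (pth h) as" "prefix (pth h') as"
  shows "h = h'"
proof -
  have "hd (pth h) = hd as" if "h \<in> H" "prefix (pth h) as" for h
    using that pth_nonempty[of h] by (auto simp: prefix_def)
  then show ?thesis using hd_distinct assms by simp
qed

lemma co_D:
  assumes "\<And>t. u t \<in> carrier \<Lambda>" "h \<in> H" "(vx (tgt h), pth h @ as) \<in> nonzero_paths"
  shows "co (D u) (tgt h) (pth h @ as) = c h * co u (src h) as"
proof -
  have "co (D u) (tgt h) (pth h @ as) = (\<Sum>h'\<in>{h' \<in> H. tgt h' = tgt h}. if h' = h then c h * co u (src h) as else 0)"
    unfolding co_def coeff_D[OF assms(1,3)]
    by (rule sum.cong) (use prefix_unique[OF _ assms(2)] in auto)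
  also have "\<dots> = c h * co u (src h) as"
    using assms(2) finite_tgt by simp
  finally show ?thesis .
qed

lemma co_D_zero:
  assumes "\<And>t. u t \<in> carrier \<Lambda>" "\<not> (\<exists>h\<in>H. tgt h = t \<and> prefix (pth h) as)" "(vx t, as) \<in> nonzero_paths"
  shows "co (D u) t as = 0"
  unfolding co_def coeff_D[OF assms(1,3)] by (rule sum.neutral) (use assms(2) in auto)

lemma D_closed:
  assumes "u \<in> carrier (term_at d)"
  shows "D u \<in> carrier (term_at (d + 1))"
proof -
  have u: "u t \<in> carrier \<Lambda>" for t using assms by (rule term_at_carrier)
  have *: "\<exists>h\<in>H. tgt h = t \<and> u (src h) \<noteq> \<zero>\<^bsub>\<Lambda>\<^esub>" if ne: "D u t \<noteq> \<zero>\<^bsub>\<Lambda>\<^esub>" for t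
  proof (rule ccontr)
    assume n: "\<not> ?thesis"
    have "D u t = \<zero>\<^bsub>\<Lambda>\<^esub>"
    proof (rule coeff_inject)
      fix p :: "('v, 'a) qpath" assume "p \<in> nonzero_paths"
      then show "coeff (D u t) p = coeff \<zero>\<^bsub>\<Lambda>\<^esub> p"
        using n by (auto simp: coeff_D[OF u] intro!: sum.neutral)
    qed (use D_carrier[OF u] in auto)
    with ne show False by simp
  qed
  have "{t. D u t \<noteq> \<zero>\<^bsub>\<Lambda>\<^esub>} \<subseteq> tgt ` (\<Union>s\<in>{s. u s \<noteq> \<zero>\<^bsub>\<Lambda>\<^esub>}. {h \<in> H. src h = s})"
    using * by force
  moreover have "finite (tgt ` (\<Union>s\<in>{s. u s \<noteq> \<zero>\<^bsub>\<Lambda>\<^esub>}. {h \<in> H. src h = s}))"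
    using assms finite_src by (intro finite_imageI finite_UN_I) (auto simp: mem_term_at)
  ultimately have "finite {t. D u t \<noteq> \<zero>\<^bsub>\<Lambda>\<^esub>}" by (rule finite_subset)
  moreover have "t \<in> T \<and> deg t = d + 1" if nz: "D u t \<noteq> \<zero>\<^bsub>\<Lambda>\<^esub>" for t
  proof -
    obtain h where "h \<in> H" "tgt h = t" "u (src h) \<noteq> \<zero>\<^bsub>\<Lambda>\<^esub>" using *[OF nz] by blast
    then show ?thesis using assms deg_tgt ends_T by (auto simp: mem_term_at)
  qed
  moreover have "fst p = vx t" if "coeff (D u t) p \<noteq> 0" for t p
  proof -
    have "p \<in> nonzero_paths" using that by (meson coeff_outside)
    then show ?thesis
      using that by (auto simp: coeff_D[OF u] elim!: sum.not_neutral_contains_not_neutral split: if_splits)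
  qed
  ultimately show ?thesis
    using D_carrier[OF u] by (simp add: mem_term_at)
qed

lemma D_hom: "D \<in> lmod_hom \<Lambda> (term_at d) (term_at (d + 1))"
  unfolding lmod_hom_def
proof (intro CollectI conjI ballI Pi_I)
  fix u assume u: "u \<in> carrier (term_at d)"
  then show "D u \<in> carrier (term_at (d + 1))" by (rule D_closed)
  have uc: "u t \<in> carrier \<Lambda>" for t using u by (rule term_at_carrier)
  let ?P = "\<lambda>h. path_class Q I (c h) (vx (tgt h), pth h)"
  have P: "?P h \<in> carrier \<Lambda>" if "h \<in> H" for h using that pth_qpath path_class_carrier by simp
  show "D (X \<odot>\<^bsub>term_at d\<^esub> u) = X \<odot>\<^bsub>term_at (d + 1)\<^esub> D u" if X: "X \<in> carrier \<Lambda>" for X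
  proof
    fix t
    have "X \<otimes>\<^bsub>\<Lambda>\<^esub> D u t = (\<Oplus>\<^bsub>\<Lambda>\<^esub>h\<in>{h \<in> H. tgt h = t}. X \<otimes>\<^bsub>\<Lambda>\<^esub> (u (src h) \<otimes>\<^bsub>\<Lambda>\<^esub> ?P h))"
      unfolding D_def by (rule \<Lambda>.finsum_rdistr[OF finite_tgt X]) (use uc P in auto)
    also have "\<dots> = (\<Oplus>\<^bsub>\<Lambda>\<^esub>h\<in>{h \<in> H. tgt h = t}. X \<otimes>\<^bsub>\<Lambda>\<^esub> u (src h) \<otimes>\<^bsub>\<Lambda>\<^esub> ?P h)"
      by (rule \<Lambda>.finsum_cong') (use uc P X in \<open>auto simp: \<Lambda>.m_assoc\<close>)
    finally show "D (X \<odot>\<^bsub>term_at d\<^esub> u) t = (X \<odot>\<^bsub>term_at (d + 1)\<^esub> D u) t"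
      by (simp add: term_at_simps D_def)
  qed
  show "D (u \<oplus>\<^bsub>term_at d\<^esub> v) = D u \<oplus>\<^bsub>term_at (d + 1)\<^esub> D v" if v: "v \<in> carrier (term_at d)" for v
  proof
    fix t
    have vc: "v t \<in> carrier \<Lambda>" for t using v by (rule term_at_carrier)
    have "D u t \<oplus>\<^bsub>\<Lambda>\<^esub> D v t = (\<Oplus>\<^bsub>\<Lambda>\<^esub>h\<in>{h \<in> H. tgt h = t}. u (src h) \<otimes>\<^bsub>\<Lambda>\<^esub> ?P h \<oplus>\<^bsub>\<Lambda>\<^esub> v (src h) \<otimes>\<^bsub>\<Lambda>\<^esub> ?P h)"
      unfolding D_def by (rule \<Lambda>.finsum_addf[symmetric]) (use uc vc P in auto)
    also have "\<dots> = (\<Oplus>\<^bsub>\<Lambda>\<^esub>h\<in>{h \<in> H. tgt h = t}. (u (src h) \<oplus>\<^bsub>\<Lambda>\<^esub> v (src h)) \<otimes>\<^bsub>\<Lambda>\<^esub> ?P h)"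
      by (rule \<Lambda>.finsum_cong') (use uc vc P in \<open>auto simp: \<Lambda>.l_distr\<close>)
    finally show "D (u \<oplus>\<^bsub>term_at d\<^esub> v) t = (D u \<oplus>\<^bsub>term_at (d + 1)\<^esub> D v) t"
      by (simp add: term_at_simps D_def)
  qed
qed

subsection \<open>Exactness\<close>

text \<open>
  As the differential matches coordinates, an element with vanishing coordinates outside the
  reached ones has a preimage. The only obstruction is that the same coordinate of the preimage
  may be prescribed twice, by two letters with a common source.
\<close>

lemma preimage_exists:
  assumes u: "u \<in> carrier (term_at d)" and "d \<le> 0"
    and outside: "\<And>t as. \<lbrakk>t \<in> T; deg t = d; (vx t, as) \<in> nonzero_paths;
        \<not> (\<exists>h\<in>H. tgt h = t \<and> prefix (pth h) as)\<rbrakk> \<Longrightarrow> co u t as = 0"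
    and consistent: "\<And>h h' as. \<lbrakk>h \<in> H; h' \<in> H; src h = src h'; deg (tgt h) = d;
        (vx (tgt h), pth h @ as) \<in> nonzero_paths; (vx (tgt h'), pth h' @ as) \<in> nonzero_paths\<rbrakk> \<Longrightarrow>
        co u (tgt h) (pth h @ as) / c h = co u (tgt h') (pth h' @ as) / c h'"
  shows "\<exists>v\<in>carrier (term_at (d - 1)). D v = u"
proof -
  define P where "P s as h \<longleftrightarrow> h \<in> H \<and> src h = s \<and> (vx (tgt h), pth h @ as) \<in> nonzero_paths" for s as h
  define g where "g s as = (if \<exists>h. P s as h then let h = (SOME h. P s as h) in co u (tgt h) (pth h @ as) / c h else 0)"
    for s as
  have g: "g (src h) as = co u (tgt h) (pth h @ as) / c h"
    if h: "h \<in> H" "(vx (tgt h), pth h @ as) \<in> nonzero_paths" "deg (tgt h) = d" for h as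
  proof -
    have P: "P (src h) as h" using h by (simp add: P_def)
    define h' where "h' = (SOME h'. P (src h) as h')"
    have P': "P (src h) as h'" unfolding h'_def using P by (rule someI)
    have ex: "\<exists>h'. P (src h) as h'" using P by blast
    have "g (src h) as = co u (tgt h') (pth h' @ as) / c h'"
      using ex unfolding g_def h'_def by (simp only: if_True Let_def)
    moreover have "co u (tgt h) (pth h @ as) / c h = co u (tgt h') (pth h' @ as) / c h'"
      by (rule consistent[OF h(1) _ _ h(3,2)]) (use P' in \<open>auto simp: P_def\<close>)
    ultimately show ?thesis by simp
  qed
  let ?v = "mk (d - 1) g"
  have fin: "finite {s \<in> T. deg s = d - 1 \<and> (\<exists>as. (vx s, as) \<in> nonzero_paths \<and> g s as \<noteq> 0)}"
  proof (rule finite_subset)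
    show "{s \<in> T. deg s = d - 1 \<and> (\<exists>as. (vx s, as) \<in> nonzero_paths \<and> g s as \<noteq> 0)} \<subseteq>
      src ` (\<Union>t\<in>{t. u t \<noteq> \<zero>\<^bsub>\<Lambda>\<^esub>}. {h \<in> H. tgt h = t})"
    proof
      fix s assume "s \<in> {s \<in> T. deg s = d - 1 \<and> (\<exists>as. (vx s, as) \<in> nonzero_paths \<and> g s as \<noteq> 0)}"
      then obtain as where "g s as \<noteq> 0" by blast
      define h where "h = (SOME h. P s as h)"
      have ex: "\<exists>h. P s as h" using \<open>g s as \<noteq> 0\<close> by (metis g_def)
      then have "P s as h" unfolding h_def by (rule someI_ex)
      moreover have "g s as = co u (tgt h) (pth h @ as) / c h"
        using ex unfolding g_def h_def by (simp only: if_True Let_def)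
      then have "u (tgt h) \<noteq> \<zero>\<^bsub>\<Lambda>\<^esub>" using \<open>g s as \<noteq> 0\<close> co_zero by auto
      ultimately show "s \<in> src ` (\<Union>t\<in>{t. u t \<noteq> \<zero>\<^bsub>\<Lambda>\<^esub>}. {h \<in> H. tgt h = t})"
        by (auto simp: P_def)
    qed
    show "finite (src ` (\<Union>t\<in>{t. u t \<noteq> \<zero>\<^bsub>\<Lambda>\<^esub>}. {h \<in> H. tgt h = t}))"
      using u finite_tgt by (intro finite_imageI finite_UN_I) (auto simp: mem_term_at)
  qed
  have v: "?v \<in> carrier (term_at (d - 1))" by (rule mk(1)[OF fin])
  have "D ?v = u"
  proof (rule term_at_eqI)
    show "D ?v \<in> carrier (term_at d)" using D_closed[OF v] by simp
    show "u \<in> carrier (term_at d)" by fact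
    fix t as assume t: "t \<in> T" "deg t = d" "(vx t, as) \<in> nonzero_paths"
    show "co (D ?v) t as = co u t as"
    proof (cases "\<exists>h\<in>H. tgt h = t \<and> prefix (pth h) as")
      case True
      then obtain h bs where h: "h \<in> H" "tgt h = t" "as = pth h @ bs" by (auto simp: prefix_def)
      have "(vx (src h), bs) \<in> nonzero_paths"
        using t(3) h pth_end[OF h(1)] nonzero_paths_append[of "vx t" "pth h" bs] by simp
      moreover have "deg (src h) = d - 1" using deg_tgt[OF h(1)] h t by simp
      ultimately have "co ?v (src h) bs = g (src h) bs"
        by (intro mk(2)[OF fin]) (use ends_T h in auto)
      then have "co (D ?v) (tgt h) (pth h @ bs) = c h * g (src h) bs"
        by (subst co_D[OF term_at_carrier[OF v] h(1)]) (use h t in auto)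
      also have "\<dots> = co u (tgt h) (pth h @ bs)"
        by (subst g[OF h(1)]) (use h t scalar_nonzero in auto)
      finally show ?thesis by (simp only: h)
    next
      case False
      have "co (D ?v) t as = 0" by (rule co_D_zero[OF term_at_carrier[OF v] False t(3)])
      then show ?thesis using outside[OF t False] by simp
    qed
  qed
  with v show ?thesis by blast
qed

text \<open>
  A coordinate in negative degree that is not mapped to zero is not reached.
\<close>

lemma D_D:
  assumes u: "u \<in> carrier (term_at d)" and "d < -1"
  shows "D (D u) = \<zero>\<^bsub>term_at (d + 2)\<^esub>"
proof (rule term_at_eqI)
  have Du: "D u \<in> carrier (term_at (d + 1))" by (rule D_closed[OF u])
  show "D (D u) \<in> carrier (term_at (d + 2))" using D_closed[OF Du] by (simp add: add.commute)
  show "\<zero>\<^bsub>term_at (d + 2)\<^esub> \<in> carrier (term_at (d + 2))" by (auto simp: mem_term_at term_at_simps)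
  fix t as assume t: "t \<in> T" "deg t = d + 2" "(vx t, as) \<in> nonzero_paths"
  have "co (D (D u)) t as = 0"
  proof (cases "\<exists>h\<in>H. tgt h = t \<and> prefix (pth h) as")
    case True
    then obtain h bs where h: "h \<in> H" "tgt h = t" "as = pth h @ bs" by (auto simp: prefix_def)
    have b: "(vx (src h), bs) \<in> nonzero_paths"
      using t(3) h pth_end[OF h(1)] nonzero_paths_append[of "vx t" "pth h" bs] by simp
    have "deg (src h) < 0" using deg_tgt[OF h(1)] h t \<open>d < -1\<close> by simp
    then have "\<not> (\<exists>h'\<in>H. tgt h' = src h \<and> prefix (pth h') bs)"
      using exact_negative[OF ends_T(1)[OF h(1)] _ b] h t by blast
    then have "co (D u) (src h) bs = 0"
      by (intro co_D_zero[OF term_at_carrier[OF u] _ b])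
    then have "co (D (D u)) (tgt h) (pth h @ bs) = 0"
      by (subst co_D[OF term_at_carrier[OF Du] h(1)]) (use h t in auto)
    then show ?thesis by (simp only: h)
  next
    case False
    then show ?thesis by (rule co_D_zero[OF term_at_carrier[OF Du] _ t(3)])
  qed
  then show "co (D (D u)) t as = co \<zero>\<^bsub>term_at (d + 2)\<^esub> t as"
    by (simp add: co_def term_at_simps)
qed

lemma exact_at_negative:
  assumes "d < 0"
  shows "{u \<in> carrier (term_at d). D u = \<zero>\<^bsub>term_at (d + 1)\<^esub>} = D ` carrier (term_at (d - 1))"
proof (intro equalityI subsetI)
  fix u assume "u \<in> {u \<in> carrier (term_at d). D u = \<zero>\<^bsub>term_at (d + 1)\<^esub>}"
  then have u: "u \<in> carrier (term_at d)" and Du: "D u = (\<lambda>t. \<zero>\<^bsub>\<Lambda>\<^esub>)" by (auto simp: term_at_simps)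
  have "\<exists>v\<in>carrier (term_at (d - 1)). D v = u"
  proof (rule preimage_exists[OF u])
    show "d \<le> 0" using assms by simp
    fix t as assume t: "t \<in> T" "deg t = d" "(vx t, as) \<in> nonzero_paths"
      "\<not> (\<exists>h\<in>H. tgt h = t \<and> prefix (pth h) as)"
    then obtain h where h: "h \<in> H" "src h = t" "(vx (tgt h), pth h @ as) \<in> nonzero_paths"
      using exact_negative[OF t(1) _ t(3)] assms by auto
    have "c h * co u (src h) as = 0"
      using co_D[of u, OF term_at_carrier[OF u] h(1,3)] Du co_zero[of "D u"] by simp
    then show "co u t as = 0" using h scalar_nonzero by simp
  next
    fix h h' as assume "h \<in> H" "h' \<in> H" "src h = src h'" "deg (tgt h) = d"
    then have "h = h'" using unique_src deg_tgt[of h] assms by auto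
    then show "co u (tgt h) (pth h @ as) / c h = co u (tgt h') (pth h' @ as) / c h'" by simp
  qed
  then show "u \<in> D ` carrier (term_at (d - 1))" by blast
next
  fix u assume "u \<in> D ` carrier (term_at (d - 1))"
  then obtain v where v: "v \<in> carrier (term_at (d - 1))" "u = D v" by blast
  then show "u \<in> {u \<in> carrier (term_at d). D u = \<zero>\<^bsub>term_at (d + 1)\<^esub>}"
    using D_closed[OF v(1)] D_D[OF v(1)] assms by (simp add: add.commute)
qed

subsection \<open>The augmentation\<close>

definition \<epsilon> :: "('p \<Rightarrow> (('v, 'a) qpath \<Rightarrow> 'k) set) \<Rightarrow> 'i \<Rightarrow> 'k" where
  "\<epsilon> u = (\<lambda>i. \<Sum>t | u t \<noteq> \<zero>\<^bsub>\<Lambda>\<^esub>. act (u t) (gen t) i)"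

lemma fibre_finite: "i \<in> N \<Longrightarrow> finite (fibre i)"
  by (drule fibre_cases, unfold fibre_def[symmetric], elim disjE exE bexE conjE) simp_all

lemma act_zero: "act \<zero>\<^bsub>\<Lambda>\<^esub> v i = 0"
  by (simp add: act_def)

lemma act_add:
  assumes "X \<in> carrier \<Lambda>" "Y \<in> carrier \<Lambda>"
  shows "act (X \<oplus>\<^bsub>\<Lambda>\<^esub> Y) v i = act X v i + act Y v i"
  using assms by (simp add: act_def coeff_add algebra_simps sum.distrib)

lemma \<epsilon>_superset:
  assumes "finite S" "{t. u t \<noteq> \<zero>\<^bsub>\<Lambda>\<^esub>} \<subseteq> S"
  shows "\<epsilon> u i = (\<Sum>t\<in>S. act (u t) (gen t) i)"
  unfolding \<epsilon>_def by (rule sum.mono_neutral_left[OF assms]) (auto simp: act_zero)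

lemma act_gen_eq:
  assumes "t \<in> T" "deg t = 0" "\<And>p. coeff X p \<noteq> 0 \<Longrightarrow> fst p = vx t"
  shows "act X (gen t) i =
    (\<Sum>as | (vx t, as) \<in> nonzero_paths. coeff X (vx t, as) * (if i = \<zeta> t as then \<theta> t as else 0))"
proof -
  have "act X (gen t) i = (\<Sum>p\<in>(\<lambda>as. (vx t, as)) ` {as. (vx t, as) \<in> nonzero_paths}. coeff X p * act_path p (gen t) i)"
    unfolding act_def using finite_nonzero_paths
  proof (rule sum.mono_neutral_right)
    show "\<forall>p\<in>nonzero_paths - (\<lambda>as. (vx t, as)) ` {as. (vx t, as) \<in> nonzero_paths}. coeff X p * act_path p (gen t) i = 0"
      using assms(3) by force
  qed auto
  also have "\<dots> = (\<Sum>as | (vx t, as) \<in> nonzero_paths. coeff X (vx t, as) * act_path (vx t, as) (gen t) i)"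
    by (subst sum.reindex) (auto simp: inj_on_def)
  also have "\<dots> = (\<Sum>as | (vx t, as) \<in> nonzero_paths. coeff X (vx t, as) * (if i = \<zeta> t as then \<theta> t as else 0))"
    by (rule sum.cong) (use assms act_gen in auto)
  finally show ?thesis .
qed

lemma finite_paths_from: "finite {as. (x, as) \<in> nonzero_paths}"
  by (rule finite_subset[OF _ finite_imageI[OF finite_nonzero_paths, of snd]]) force

text \<open>
  In coordinates, the augmentation collects at each basis element the coordinates of its fibre.
\<close>

lemma \<epsilon>_eq:
  assumes u: "u \<in> carrier (term_at 0)" and i: "i \<in> N"
  shows "\<epsilon> u i = (\<Sum>(t, as)\<in>fibre i. co u t as * \<theta> t as)"
proof -
  let ?S = "{t. u t \<noteq> \<zero>\<^bsub>\<Lambda>\<^esub>} \<union> fst ` fibre i"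
  let ?P = "SIGMA t:?S. {as. (vx t, as) \<in> nonzero_paths}"
  have S: "finite ?S" using u fibre_finite[OF i] by (auto simp: mem_term_at)
  have "\<epsilon> u i = (\<Sum>t\<in>?S. act (u t) (gen t) i)" by (rule \<epsilon>_superset[OF S]) auto
  also have "\<dots> = (\<Sum>t\<in>?S. \<Sum>as | (vx t, as) \<in> nonzero_paths. co u t as * (if i = \<zeta> t as then \<theta> t as else 0))"
    unfolding co_def
  proof (rule sum.cong)
    fix t assume "t \<in> ?S"
    then have "t \<in> T" "deg t = 0" using u by (auto simp: mem_term_at fibre_def)
    then show "act (u t) (gen t) i = (\<Sum>as | (vx t, as) \<in> nonzero_paths.
        coeff (u t) (vx t, as) * (if i = \<zeta> t as then \<theta> t as else 0))"
      by (rule act_gen_eq) (use coeff_vertex[OF u] in metis)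
  qed simp
  also have "\<dots> = (\<Sum>(t, as)\<in>?P. co u t as * (if i = \<zeta> t as then \<theta> t as else 0))"
    by (rule sum.Sigma) (use S finite_paths_from in auto)
  also have "\<dots> = (\<Sum>(t, as)\<in>fibre i. co u t as * (if i = \<zeta> t as then \<theta> t as else 0))"
  proof (rule sum.mono_neutral_right)
    show "finite ?P" using S finite_paths_from by auto
    show "fibre i \<subseteq> ?P" by (force simp: fibre_def)
    show "\<forall>p\<in>?P - fibre i. (case p of (t, as) \<Rightarrow> co u t as * (if i = \<zeta> t as then \<theta> t as else 0)) = 0"
    proof
      fix p assume p: "p \<in> ?P - fibre i"
      obtain t as where [simp]: "p = (t, as)" by (cases p)
      have "t \<in> T" "deg t = 0" "(vx t, as) \<in> nonzero_paths" using p u by (auto simp: mem_term_at fibre_def)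
      then have "\<zeta> t as \<noteq> i \<or> \<theta> t as = 0" using p by (auto simp: fibre_def)
      then show "(case p of (t, as) \<Rightarrow> co u t as * (if i = \<zeta> t as then \<theta> t as else 0)) = 0" by auto
    qed
  qed
  also have "\<dots> = (\<Sum>(t, as)\<in>fibre i. co u t as * \<theta> t as)"
    by (rule sum.cong) (auto simp: fibre_def)
  finally show ?thesis .
qed

lemma \<epsilon>_closed: "\<epsilon> u \<in> carrier M"
  using act_closed by (auto simp: M_simps \<epsilon>_def)

lemma \<epsilon>_hom: "\<epsilon> \<in> lmod_hom \<Lambda> (term_at 0) M"
  unfolding lmod_hom_def
proof (intro CollectI conjI ballI Pi_I)
  fix u assume u: "u \<in> carrier (term_at 0)"
  then have uf: "finite {t. u t \<noteq> \<zero>\<^bsub>\<Lambda>\<^esub>}" and uc: "u t \<in> carrier \<Lambda>" for t by (auto simp: mem_term_at)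
  show "\<epsilon> u \<in> carrier M" by (rule \<epsilon>_closed)
  show "\<epsilon> (u \<oplus>\<^bsub>term_at 0\<^esub> v) = \<epsilon> u \<oplus>\<^bsub>M\<^esub> \<epsilon> v" if v: "v \<in> carrier (term_at 0)" for v
  proof
    fix i
    let ?S = "{t. u t \<noteq> \<zero>\<^bsub>\<Lambda>\<^esub>} \<union> {t. v t \<noteq> \<zero>\<^bsub>\<Lambda>\<^esub>}"
    have S: "finite ?S" using uf v by (auto simp: mem_term_at)
    have vc: "v t \<in> carrier \<Lambda>" for t using v by (auto simp: mem_term_at)
    have "\<epsilon> (u \<oplus>\<^bsub>term_at 0\<^esub> v) i = (\<Sum>t\<in>?S. act (u t \<oplus>\<^bsub>\<Lambda>\<^esub> v t) (gen t) i)"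
      unfolding term_at_simps by (rule \<epsilon>_superset[OF S]) fastforce
    also have "\<dots> = (\<Sum>t\<in>?S. act (u t) (gen t) i) + (\<Sum>t\<in>?S. act (v t) (gen t) i)"
      unfolding sum.distrib[symmetric] using uc vc by (simp add: act_add)
    also have "\<dots> = \<epsilon> u i + \<epsilon> v i"
      using \<epsilon>_superset[OF S, of u] \<epsilon>_superset[OF S, of v] by simp
    finally show "\<epsilon> (u \<oplus>\<^bsub>term_at 0\<^esub> v) i = (\<epsilon> u \<oplus>\<^bsub>M\<^esub> \<epsilon> v) i" by (simp add: M_simps)
  qed
  show "\<epsilon> (X \<odot>\<^bsub>term_at 0\<^esub> u) = X \<odot>\<^bsub>M\<^esub> \<epsilon> u" if X: "X \<in> carrier \<Lambda>" for X
  proof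
    fix i
    let ?S = "{t. u t \<noteq> \<zero>\<^bsub>\<Lambda>\<^esub>}"
    have "\<epsilon> (X \<odot>\<^bsub>term_at 0\<^esub> u) i = (\<Sum>t\<in>?S. act (X \<otimes>\<^bsub>\<Lambda>\<^esub> u t) (gen t) i)"
      unfolding term_at_simps
      by (rule \<epsilon>_superset[OF uf], rule subsetI, rule CollectI, rule notI) (simp add: X)
    also have "\<dots> = (\<Sum>t\<in>?S. act X (act (u t) (gen t)) i)"
      using act_mult[OF X uc] by simp
    also have "\<dots> = (\<Sum>p\<in>nonzero_paths. coeff X p * (\<Sum>t\<in>?S. act_path p (act (u t) (gen t)) i))"
      unfolding act_def[of X] by (subst sum.swap) (simp add: sum_distrib_left)
    also have "\<dots> = (\<Sum>p\<in>nonzero_paths. coeff X p * act_path p (\<epsilon> u) i)"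
      using act_path_sum[OF uf, where c = "\<lambda>t. 1" and g = "\<lambda>t. act (u t) (gen t)"] by (simp add: \<epsilon>_def)
    also have "\<dots> = (X \<odot>\<^bsub>M\<^esub> \<epsilon> u) i" by (simp add: smult_eq[OF X] act_def)
    finally show "\<epsilon> (X \<odot>\<^bsub>term_at 0\<^esub> u) i = (X \<odot>\<^bsub>M\<^esub> \<epsilon> u) i" .
  qed
qed

lemma \<epsilon>_surj:
  assumes w: "w \<in> carrier M"
  shows "\<exists>u\<in>carrier (term_at 0). \<epsilon> u = w"
proof -
  have "fibre i \<noteq> {}" if "i \<in> N" for i
    using fibre_cases[OF that] unfolding fibre_def[symmetric] by (elim disjE exE bexE conjE) auto
  then have "\<forall>i\<in>N. \<exists>p. p \<in> fibre i" by fast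
  then have "\<exists>r. \<forall>i\<in>N. r i \<in> fibre i" by (rule bchoice)
  then obtain r where r: "\<And>i. i \<in> N \<Longrightarrow> r i \<in> fibre i" by auto
  define g where "g t as = (if \<zeta> t as \<in> N \<and> (t, as) = r (\<zeta> t as) then w (\<zeta> t as) / \<theta> t as else 0)" for t as
  have fin: "finite {t \<in> T. deg t = 0 \<and> (\<exists>as. (vx t, as) \<in> nonzero_paths \<and> g t as \<noteq> 0)}"
  proof (rule finite_subset)
    show "{t \<in> T. deg t = 0 \<and> (\<exists>as. (vx t, as) \<in> nonzero_paths \<and> g t as \<noteq> 0)} \<subseteq> fst ` r ` N"
    proof (rule subsetI, elim CollectE conjE exE)
      fix t as assume "g t as \<noteq> 0"
      then have "\<zeta> t as \<in> N" "(t, as) = r (\<zeta> t as)" by (auto simp: g_def split: if_splits)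
      then show "t \<in> fst ` r ` N" by (metis fst_conv image_eqI)
    qed
    show "finite (fst ` r ` N)" using finite_N by simp
  qed
  let ?u = "mk 0 g"
  have u: "?u \<in> carrier (term_at 0)" by (rule mk(1)[OF fin])
  have "\<epsilon> ?u i = w i" for i
  proof (cases "i \<in> N")
    case True
    have "\<epsilon> ?u i = (\<Sum>(t, as)\<in>fibre i. g t as * \<theta> t as)"
      unfolding \<epsilon>_eq[OF u True] by (rule sum.cong) (use mk(2)[OF fin] in \<open>auto simp: fibre_def\<close>)
    also have "\<dots> = (\<Sum>p\<in>fibre i. if p = r i then w i else 0)"
    proof (rule sum.cong)
      fix p assume p: "p \<in> fibre i"
      obtain t as where [simp]: "p = (t, as)" by (cases p)
      show "(case p of (t, as) \<Rightarrow> g t as * \<theta> t as) = (if p = r i then w i else 0)"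
        using p True by (simp add: g_def fibre_def)
    qed simp
    also have "\<dots> = w i" using r[OF True] fibre_finite[OF True] by simp
    finally show ?thesis .
  next
    case False
    then show ?thesis using w \<epsilon>_closed[of ?u] by (simp add: M_simps)
  qed
  with u show ?thesis by blast
qed

text \<open>
  Two letters with the same source end with different arrows, at most one of which can be followed
  by a given arrow without a zero relation. Hence two letters can only be prolonged simultaneously
  by the empty path.
\<close>

lemma src_arrow_unique:
  assumes "h \<in> H" "h' \<in> H" "src h = src h'" "as \<noteq> []"
    "(vx (tgt h), pth h @ as) \<in> nonzero_paths" "(vx (tgt h'), pth h' @ as) \<in> nonzero_paths"
  shows "h = h'"
proof -
  let ?C = "{b \<in> arcs Q. head Q b = tail Q (hd as) \<and> \<not> path_in Q I [b, hd as]}"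
  have mem: "last (pth h) \<in> ?C \<and> hd as \<in> arcs Q"
    if "h \<in> H" "(vx (tgt h), pth h @ as) \<in> nonzero_paths" for h
  proof -
    have "nonzero_list (pth h @ as)" using that by (auto simp: nonzero_paths_def)
    moreover have "last (pth h) \<in> set (pth h)" "hd as \<in> set as" using that pth_nonempty assms(4) by auto
    ultimately show ?thesis
      using that pth_nonempty[OF that(1)] assms(4) by (auto simp: nonzero_list_append rel_def) (auto simp: nonzero_list_def)
  qed
  then have "card ?C \<le> Suc 0" using nonzero_continuation[of "hd as"] mem[OF assms(1,5)] by auto
  moreover have "finite ?C" by simp
  ultimately have "last (pth h) = last (pth h')"
    using mem[OF assms(1,5)] mem[OF assms(2,6)] card_le_Suc0_iff_eq[of ?C] by blast
  then show ?thesis using last_distinct assms by blast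
qed

lemma pair_distinct:
  assumes "h \<in> H" "h' \<in> H" "h \<noteq> h'"
  shows "(tgt h, pth h) \<noteq> (tgt h', pth h')"
  using assms hd_distinct[of h h'] by auto

lemma \<epsilon>_pair:
  assumes "u \<in> carrier (term_at 0)" "i \<in> N" "h \<in> H" "h' \<in> H" "h \<noteq> h'"
    "fibre i = {(tgt h, pth h), (tgt h', pth h')}"
  shows "\<epsilon> u i = co u (tgt h) (pth h) * \<theta> (tgt h) (pth h) + co u (tgt h') (pth h') * \<theta> (tgt h') (pth h')"
  unfolding \<epsilon>_eq[OF assms(1,2)] assms(6) using pair_distinct[OF assms(3-5)] by auto

text \<open>
  The kernel of the augmentation is described by one linear equation for each basis element of
  \<open>M\<close>. It says that a single coordinate vanishes, or that two coordinates come from a common one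
  under the differential.
\<close>

lemma exact_at_zero: "{u \<in> carrier (term_at 0). \<epsilon> u = \<zero>\<^bsub>M\<^esub>} = D ` carrier (term_at (-1))"
proof (intro equalityI subsetI)
  fix u assume "u \<in> {u \<in> carrier (term_at 0). \<epsilon> u = \<zero>\<^bsub>M\<^esub>}"
  then have u: "u \<in> carrier (term_at 0)" and eu: "\<epsilon> u i = 0" for i by (auto simp: M_simps)
  have "\<exists>v\<in>carrier (term_at (0 - 1)). D v = u"
  proof (rule preimage_exists[OF u])
    show "(0::int) \<le> 0" by simp
    fix t as assume t: "t \<in> T" "deg t = 0" "(vx t, as) \<in> nonzero_paths"
      and no: "\<not> (\<exists>h\<in>H. tgt h = t \<and> prefix (pth h) as)"
    have nz: "\<theta> t as \<noteq> 0" using killed[OF t] no by blast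
    have "act_path (vx t, as) (gen t) (\<zeta> t as) \<noteq> 0" using nz act_gen[OF t] by simp
    then have i: "\<zeta> t as \<in> N" using act_path_support(1) t(3) nonzero_paths_subset by blast
    have mem: "(t, as) \<in> fibre (\<zeta> t as)" using t nz by (simp add: fibre_def)
    show "co u t as = 0"
      using fibre_cases[OF i] unfolding fibre_def[symmetric]
    proof (elim disjE exE conjE bexE)
      fix t' as' assume "fibre (\<zeta> t as) = {(t', as')}"
      then have "fibre (\<zeta> t as) = {(t, as)}" using mem by auto
      then have "\<epsilon> u (\<zeta> t as) = co u t as * \<theta> t as" unfolding \<epsilon>_eq[OF u i] by simp
      then show ?thesis using eu nz by simp
    next
      fix h h' assume "h \<in> H" "h' \<in> H" "fibre (\<zeta> t as) = {(tgt h, pth h), (tgt h', pth h')}"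
      then show ?thesis using mem no by auto
    qed
  next
    fix h h' as assume h: "h \<in> H" "h' \<in> H" "src h = src h'" "deg (tgt h) = 0"
      "(vx (tgt h), pth h @ as) \<in> nonzero_paths" "(vx (tgt h'), pth h' @ as) \<in> nonzero_paths"
    show "co u (tgt h) (pth h @ as) / c h = co u (tgt h') (pth h' @ as) / c h'"
    proof (cases "h = h'")
      case False
      then have [simp]: "as = []" using src_arrow_unique[OF h(1-3) _ h(5,6)] by blast
      obtain i where i: "i \<in> N" and fib: "fibre i = {(tgt h, pth h), (tgt h', pth h')}"
        and sum0: "c h * \<theta> (tgt h) (pth h) + c h' * \<theta> (tgt h') (pth h') = 0"
        using fibre_pair[OF h(1,2) False h(3)] unfolding fibre_def[symmetric] by blast
      have "(tgt h, pth h) \<in> fibre i" "(tgt h', pth h') \<in> fibre i" using fib by auto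
      then have nz: "\<theta> (tgt h) (pth h) \<noteq> 0" "\<theta> (tgt h') (pth h') \<noteq> 0" by (auto simp: fibre_def)
      let ?u = "co u (tgt h) (pth h)" and ?u' = "co u (tgt h') (pth h')"
      let ?r = "\<theta> (tgt h) (pth h)" and ?r' = "\<theta> (tgt h') (pth h')"
      have "?u * ?r + ?u' * ?r' = 0" using \<epsilon>_pair[OF u i h(1,2) False fib] eu[of i] by simp
      then have "?u * ?r = - (?u' * ?r')" by (simp add: eq_neg_iff_add_eq_0)
      moreover have "c h * ?r = - (c h' * ?r')" using sum0 by (simp add: eq_neg_iff_add_eq_0)
      ultimately have "(?u * ?r) * (c h' * ?r') = (?u' * ?r') * (c h * ?r)" by simp
      then have "(?u * c h') * (?r * ?r') = (?u' * c h) * (?r * ?r')" by (simp add: algebra_simps)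
      then have "?u * c h' = ?u' * c h" using nz by simp
      then show ?thesis using scalar_nonzero h by (simp add: frac_eq_eq)
    qed simp
  qed
  then show "u \<in> D ` carrier (term_at (-1))" by auto
next
  fix u assume "u \<in> D ` carrier (term_at (-1))"
  then obtain v where v: "v \<in> carrier (term_at (-1))" and uv: "u = D v" by blast
  have u: "u \<in> carrier (term_at 0)" using D_closed[OF v] uv by simp
  have "\<epsilon> u i = 0" for i
  proof (cases "i \<in> N")
    case i: True
    show ?thesis
      using fibre_cases[OF i] unfolding fibre_def[symmetric]
    proof (elim disjE exE conjE bexE)
      fix t as assume no: "\<not> (\<exists>h\<in>H. tgt h = t \<and> prefix (pth h) as)" and fib: "fibre i = {(t, as)}"
      have "(t, as) \<in> fibre i" using fib by simp
      then have "co (D v) t as = 0"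
        by (intro co_D_zero[OF term_at_carrier[OF v] no]) (simp add: fibre_def)
      then show ?thesis unfolding \<epsilon>_eq[OF u i] fib by (simp add: uv)
    next
      fix h h' assume h: "h \<in> H" "h' \<in> H" "h \<noteq> h'" "src h = src h'"
        and fib: "fibre i = {(tgt h, pth h), (tgt h', pth h')}"
        and sum0: "c h * \<theta> (tgt h) (pth h) + c h' * \<theta> (tgt h') (pth h') = 0"
      have "co u (tgt h) (pth h @ []) = c h * co v (src h) []"
        "co u (tgt h') (pth h' @ []) = c h' * co v (src h') []"
        unfolding uv by (rule co_D[OF term_at_carrier[OF v]]; use h pth_nonzero in simp)+
      then have "\<epsilon> u i = co v (src h) [] * (c h * \<theta> (tgt h) (pth h) + c h' * \<theta> (tgt h') (pth h'))"
        using \<epsilon>_pair[OF u i h(1-3) fib] h(4) by (simp add: algebra_simps)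
      then show ?thesis by (simp add: sum0)
    qed
  next
    case False
    then show ?thesis using \<epsilon>_closed[of u] by (simp add: M_simps)
  qed
  then show "u \<in> {u \<in> carrier (term_at 0). \<epsilon> u = \<zero>\<^bsub>M\<^esub>}" using u by (auto simp: M_simps)
qed

theorem is_projective_resolution: "projective_resolution \<Lambda> term_at (\<lambda>d. D) M"
  unfolding projective_resolution_def
proof (intro conjI allI impI)
  show "carrier (term_at i) = {\<zero>\<^bsub>term_at i\<^esub>}" if "i > 0" for i
  proof
    show "carrier (term_at i) \<subseteq> {\<zero>\<^bsub>term_at i\<^esub>}"
    proof
      fix u assume "u \<in> carrier (term_at i)"
      then have "u t \<noteq> \<zero>\<^bsub>\<Lambda>\<^esub> \<Longrightarrow> t \<in> T \<and> deg t = i" for t unfolding mem_term_at by meson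
      then have "u t = \<zero>\<^bsub>\<Lambda>\<^esub>" for t using deg_nonpos[of t] that by fastforce
      then show "u \<in> {\<zero>\<^bsub>term_at i\<^esub>}" by (auto simp: term_at_simps)
    qed
    show "{\<zero>\<^bsub>term_at i\<^esub>} \<subseteq> carrier (term_at i)" by (auto simp: mem_term_at term_at_simps)
  qed
  show "\<exists>\<epsilon>\<in>lmod_hom \<Lambda> (term_at 0) M. \<epsilon> ` carrier (term_at 0) = carrier M \<and>
      {x \<in> carrier (term_at 0). \<epsilon> x = \<zero>\<^bsub>M\<^esub>} = D ` carrier (term_at (- 1))"
  proof (intro bexI[OF _ \<epsilon>_hom] conjI exact_at_zero equalityI subsetI)
    show "w \<in> carrier M" if "w \<in> \<epsilon> ` carrier (term_at 0)" for w using that \<epsilon>_closed by auto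
    show "w \<in> \<epsilon> ` carrier (term_at 0)" if "w \<in> carrier M" for w using \<epsilon>_surj[OF that] by auto
  qed
qed (use left_module_M projective_term_at D_hom exact_at_negative in auto)

end

section \<open>Walks seen from a position\<close>

context gentle_algebra
begin

text \<open>A nonzero path is determined by its first arrow and its length.\<close>

lemma nonzero_lists_comparable:
  assumes "nonzero_list as" "nonzero_list bs" "as \<noteq> []" "bs \<noteq> []" "hd as = hd bs"
  shows "prefix as bs \<or> prefix bs as"
  using assms
proof (induction as arbitrary: bs)
  case (Cons a as)
  obtain bs' where bs: "bs = a # bs'" using Cons.prems by (cases bs) auto
  show ?case
  proof (cases "as = [] \<or> bs' = []")
    case False
    let ?C = "{b \<in> arcs Q. head Q a = tail Q b \<and> \<not> path_in Q I [a, b]}"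
    have nz: "nonzero_list as" "nonzero_list bs'" "a \<in> arcs Q"
      using Cons.prems bs by (auto simp: nonzero_list_Cons)
    then have "hd as \<in> ?C" "hd bs' \<in> ?C"
      using Cons.prems bs False
      by (cases as; cases bs'; auto simp: nonzero_list_Cons rel_def)+
    moreover have "card ?C \<le> Suc 0" using nonzero_continuation[OF nz(3)] by simp
    moreover have "finite ?C" by simp
    ultimately have "hd as = hd bs'" using card_le_Suc0_iff_eq[of ?C] by blast
    then show ?thesis using Cons.IH[of bs'] nz False bs by auto
  qed (auto simp: bs)
qed simp

text \<open>
  Of two arrows ending at the same vertex, one has a zero relation with a given arrow starting
  there and the other one has not: neither both nor none of them, by the two conditions on \<open>c\<close>.
\<close>

lemma rel_unique_left:
  assumes "a \<in> arcs Q" "b \<in> arcs Q" "c \<in> arcs Q" "head Q a = tail Q c" "head Q b = tail Q c" "a \<noteq> b"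
  shows "rel a c \<longleftrightarrow> \<not> rel b c"
proof -
  let ?Z = "{b \<in> arcs Q. head Q b = tail Q c \<and> path_in Q I [b, c]}"
  let ?C = "{b \<in> arcs Q. head Q b = tail Q c \<and> \<not> path_in Q I [b, c]}"
  have "card ?Z \<le> Suc 0" "card ?C \<le> Suc 0" "finite ?Z" "finite ?C"
    using zero_continuation[OF assms(3)] nonzero_continuation[OF assms(3)] by simp_all
  then have "\<And>x y. x \<in> ?Z \<Longrightarrow> y \<in> ?Z \<Longrightarrow> x = y" "\<And>x y. x \<in> ?C \<Longrightarrow> y \<in> ?C \<Longrightarrow> x = y"
    using card_le_Suc0_iff_eq by blast+
  then show ?thesis using assms unfolding rel_def by blast
qed

lemma rel_unique_right:
  assumes "a \<in> arcs Q" "b \<in> arcs Q" "c \<in> arcs Q" "head Q a = tail Q b" "head Q a = tail Q c" "rel a b" "rel a c"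
  shows "b = c"
proof -
  let ?Z = "{b \<in> arcs Q. head Q a = tail Q b \<and> path_in Q I [a, b]}"
  have "card ?Z \<le> Suc 0" "finite ?Z" using zero_continuation[OF assms(1)] by simp_all
  moreover have "b \<in> ?Z" "c \<in> ?Z" using assms by (auto simp: rel_def)
  ultimately show ?thesis using card_le_Suc0_iff_eq[of ?Z] by blast
qed

lemma two_out_arrows:
  assumes "a \<in> arcs Q" "b \<in> arcs Q" "c \<in> arcs Q" "tail Q a = x" "tail Q b = x" "tail Q c = x" "a \<noteq> b"
  shows "c = a \<or> c = b"
proof (rule ccontr)
  assume "\<not> ?thesis"
  then have "card {a, b, c} = 3" using assms(7) by auto
  moreover have "{a, b, c} \<subseteq> {a \<in> arcs Q. tail Q a = x}" using assms by auto
  then have "card {a, b, c} \<le> card {a \<in> arcs Q. tail Q a = x}" by (intro card_mono) auto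
  moreover have "x \<in> verts Q" using assms by auto
  ultimately show False using two_arrows[of x] by auto
qed

end

definition sg :: "bool \<Rightarrow> int" where "sg u = (if u then 1 else -1)"

lemma sg_simps [simp]: "sg True = 1" "sg False = -1" "sg (\<not> u) = - sg u"
  by (simp_all add: sg_def)

definition pos :: "bool \<Rightarrow> int \<Rightarrow> nat \<Rightarrow> int" where "pos u t i = t + sg u * int i"

lemma pos_0 [simp]: "pos u t 0 = t"
  by (simp add: pos_def)

lemma pos_Suc: "pos u t (Suc i) = pos u t i + sg u"
  by (simp add: pos_def algebra_simps)

lemma pos_back: "pos u t (Suc i) - sg u = pos u t i"
  by (simp add: pos_Suc)

text \<open>
  A walk with letters \<open>L\<close> and vertices \<open>V\<close>, seen from a position \<open>k\<close> looking in one of two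
  directions \<open>u\<close>, \<open>True\<close> being upwards. The arrow between \<open>k\<close> and its neighbour in direction \<open>u\<close>
  is \<open>ar u k\<close>; it leads away from \<open>k\<close> (``outward'') if \<open>ot u k\<close>. The position \<open>pos u t i\<close> is \<open>i\<close>
  steps away from \<open>t\<close>. Treating the two directions alike halves the case distinctions.

  The positions of the homotopy string are \<open>E\<close>, those of the basis elements of the module are \<open>W\<close>.
  With respect to \<open>E\<close>, a letter pointing in direction \<open>u\<close> arrives at \<open>k\<close> if \<open>inc u k\<close> and leaves
  \<open>k\<close> if \<open>out u k\<close>; if both happen without a zero relation, \<open>thr u k\<close>, then \<open>k\<close> is an inner
  position of a homotopy letter. All other positions are the breaks, \<open>brk k\<close>. At a top nothing
  arrives. A run consists of \<open>m\<close> letters pointing in direction \<open>u\<close> away from \<open>t\<close> and forming a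
  nonzero path, and \<open>hl u t m\<close> means that it is a whole homotopy letter. The predicates \<open>winc\<close> and
  \<open>wrun\<close> are the analogues for \<open>W\<close>, where zero relations do not occur.
\<close>

locale sided_walk = gentle_algebra Q I
  for Q :: "('v, 'a) pre_digraph" and I :: "(('v, 'a) qpath \<Rightarrow> 'k::alg_closed_field) set" +
  fixes L :: "int \<Rightarrow> 'a letter" and V :: "int \<Rightarrow> 'v" and E W :: "int set"
begin

definition ar :: "bool \<Rightarrow> int \<Rightarrow> 'a" where
  "ar u k = arr (L (if u then k else k - 1))"

definition ot :: "bool \<Rightarrow> int \<Rightarrow> bool" where
  "ot u k \<longleftrightarrow> (if u then is_Dir (L k) else is_Inv (L (k - 1)))"

definition inc :: "bool \<Rightarrow> int \<Rightarrow> bool" where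
  "inc u k \<longleftrightarrow> k - sg u \<in> E \<and> k \<in> E \<and> ot u (k - sg u)"

definition out :: "bool \<Rightarrow> int \<Rightarrow> bool" where
  "out u k \<longleftrightarrow> k \<in> E \<and> k + sg u \<in> E \<and> ot u k"

definition thr :: "bool \<Rightarrow> int \<Rightarrow> bool" where
  "thr u k \<longleftrightarrow> inc u k \<and> out u k \<and> \<not> rel (ar u (k - sg u)) (ar u k)"

definition brk :: "int \<Rightarrow> bool" where
  "brk k \<longleftrightarrow> k \<in> E \<and> (\<forall>u. \<not> thr u k)"

definition top :: "int \<Rightarrow> bool" where
  "top k \<longleftrightarrow> k \<in> E \<and> (\<forall>u. \<not> inc u k)"

definition winc :: "bool \<Rightarrow> int \<Rightarrow> bool" where
  "winc u k \<longleftrightarrow> k - sg u \<in> W \<and> k \<in> W \<and> ot u (k - sg u)"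

definition run :: "bool \<Rightarrow> int \<Rightarrow> nat \<Rightarrow> bool" where
  "run u t m \<longleftrightarrow> m > 0 \<and> (\<forall>i<m. out u (pos u t i) \<and> (i = 0 \<or> thr u (pos u t i)))"

definition hl :: "bool \<Rightarrow> int \<Rightarrow> nat \<Rightarrow> bool" where
  "hl u t m \<longleftrightarrow> run u t m \<and> brk t \<and> brk (pos u t m)"

definition wrun :: "bool \<Rightarrow> int \<Rightarrow> nat \<Rightarrow> bool" where
  "wrun u t m \<longleftrightarrow> (\<forall>i\<le>m. pos u t i \<in> W) \<and> (\<forall>i<m. ot u (pos u t i))"

definition arrows :: "bool \<Rightarrow> int \<Rightarrow> nat \<Rightarrow> 'a list" where
  "arrows u t m = map (\<lambda>i. ar u (pos u t i)) [0..<m]"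

abbreviation P :: "int set" where "P \<equiv> W \<union> E"

lemma ar_flip: "ar (\<not> u) (k + sg u) = ar u k" "ar (\<not> u) k = ar u (k - sg u)"
  by (simp_all add: ar_def sg_def)

lemma ot_flip: "ot (\<not> u) (k + sg u) \<longleftrightarrow> \<not> ot u k" "ot (\<not> u) k \<longleftrightarrow> \<not> ot u (k - sg u)"
  by (cases "L k"; cases "L (k - 1)"; simp add: ot_def sg_def)+

lemma out_inc: "out u k \<longleftrightarrow> inc u (k + sg u)"
  by (auto simp: inc_def out_def)

lemma out_not_inc: "out u k \<Longrightarrow> \<not> inc (\<not> u) k"
  by (auto simp: inc_def out_def ot_flip)

lemma out_or_inc: "k \<in> E \<Longrightarrow> k + sg u \<in> E \<Longrightarrow> \<not> out u k \<Longrightarrow> inc (\<not> u) k"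
  by (auto simp: inc_def out_def ot_flip)

lemma arrows_simps [simp]: "arrows u t 0 = []" "length (arrows u t m) = m"
  "arrows u t m = [] \<longleftrightarrow> m = 0"
  by (simp_all add: arrows_def)

lemma arrows_Suc: "arrows u t (Suc m) = arrows u t m @ [ar u (pos u t m)]"
  by (simp add: arrows_def)

lemma arrows_nth: "i < m \<Longrightarrow> arrows u t m ! i = ar u (pos u t i)"
  by (simp add: arrows_def)

lemma hd_arrows: "m > 0 \<Longrightarrow> hd (arrows u t m) = ar u t"
  by (simp add: hd_conv_nth arrows_nth)

lemma last_arrows: "m > 0 \<Longrightarrow> last (arrows u t m) = ar u (pos u t (m - 1))"
  by (simp add: last_conv_nth arrows_nth)

lemma take_arrows: "i \<le> m \<Longrightarrow> take i (arrows u t m) = arrows u t i"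
  by (auto intro!: nth_equalityI simp: arrows_nth)

lemma prefix_arrows: "prefix as (arrows u t m) \<Longrightarrow> length as \<le> m \<and> as = arrows u t (length as)"
  by (metis arrows_simps(2) prefix_length_le take_arrows append_eq_conv_conj prefix_def)

lemma run_inc: "run u t m \<Longrightarrow> inc u (pos u t m)"
  unfolding run_def using out_inc[of u "pos u t (m - 1)"] pos_Suc[of u t "m - 1"] by simp

lemma run_out: "run u t m \<Longrightarrow> out u t"
  unfolding run_def using pos_0 by fastforce

lemma run_E: "run u t m \<Longrightarrow> i \<le> m \<Longrightarrow> pos u t i \<in> E"
  using run_inc[of u t m] by (cases "i = m") (auto simp: run_def inc_def out_def)

lemma run_extend_end: "run u t m \<Longrightarrow> thr u (pos u t m) \<Longrightarrow> run u t (Suc m)"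
  by (auto simp: run_def less_Suc_eq thr_def)

lemma pos_shift: "pos u (t - sg u) i = (if i = 0 then t - sg u else pos u t (i - 1))"
  by (cases i) (simp_all add: pos_def algebra_simps)

lemma run_extend_start:
  assumes "run u t m" "thr u t" shows "run u (t - sg u) (Suc m)"
proof -
  have "out u (t - sg u)" using assms(2) by (simp add: thr_def out_inc)
  moreover have "thr u (pos u t i)" "out u (pos u t i)" if "i < m" for i
    using assms that unfolding run_def by (cases "i = 0", auto)
  ultimately show ?thesis unfolding run_def pos_shift by auto
qed

lemma run_not_brk: "run u t m \<Longrightarrow> 0 < i \<Longrightarrow> i < m \<Longrightarrow> \<not> brk (pos u t i)"
  by (auto simp: run_def brk_def)

lemma run_end_brk: "run u t m \<Longrightarrow> \<not> thr u (pos u t m) \<Longrightarrow> brk (pos u t m)"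
  using run_inc[of u t m] out_not_inc[of "\<not> u" "pos u t m"]
  by (cases u) (auto simp: brk_def inc_def all_bool_eq thr_def)

lemma run_start_brk: "run u t m \<Longrightarrow> \<not> thr u t \<Longrightarrow> brk t"
  using run_out[of u t m] out_not_inc[of u t]
  by (cases u) (auto simp: brk_def out_def all_bool_eq thr_def)

lemmas hl_run = hl_def[THEN iffD1, THEN conjunct1]

lemma hl_pos: "hl u t m \<Longrightarrow> m > 0"
  by (simp add: hl_def run_def)

lemma hl_not_brk: "hl u t m \<Longrightarrow> 0 < i \<Longrightarrow> i < m \<Longrightarrow> \<not> brk (pos u t i)"
  using hl_run run_not_brk by blast

lemma hl_E: "hl u t m \<Longrightarrow> i \<le> m \<Longrightarrow> pos u t i \<in> E"
  using hl_run run_E by blast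

lemma hl_inc: "hl u t m \<Longrightarrow> inc u (pos u t m)"
  using hl_run run_inc by blast

lemma hl_out: "hl u t m \<Longrightarrow> out u t"
  using hl_run run_out by blast

text \<open>
  A homotopy letter has no breaks inside, so it is determined by its direction and one of its
  ends.
\<close>

lemma hl_unique_length:
  assumes "hl u t m" "hl u t m'" shows "m = m'"
proof (rule ccontr)
  assume "m \<noteq> m'"
  then consider "m < m'" | "m' < m" by linarith
  then show False
    using hl_not_brk[OF assms(2), of m] hl_not_brk[OF assms(1), of m'] assms by cases (auto simp: hl_def run_def)
qed

lemma hl_unique_start:
  assumes "hl u t m" "hl u t' m'" "pos u t m = pos u t' m'"
  shows "t = t' \<and> m = m'"
proof -
  have *: "\<not> m < m'" if "hl u t m" "hl u t' m'" "pos u t m = pos u t' m'" for t t' m m'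
  proof
    assume "m < m'"
    then have "t = pos u t' (m' - m)" using that(3) by (simp add: pos_def of_nat_diff algebra_simps)
    moreover have "brk t" using that by (simp add: hl_def)
    ultimately show False using hl_not_brk[OF that(2), of "m' - m"] \<open>m < m'\<close> that(1) by (auto simp: hl_def run_def)
  qed
  have "m = m'" using *[OF assms] *[OF assms(2,1) assms(3)[symmetric]] by linarith
  then show ?thesis using assms(3) by (simp add: pos_def)
qed

end

text \<open>
  The compatibility of letters and vertices, and the conditions on walks and strings, in terms of
  directions.
\<close>

locale proper_walk = sided_walk Q I L V E W
  for Q :: "('v, 'a) pre_digraph" and I :: "(('v, 'a) qpath \<Rightarrow> 'k::alg_closed_field) set"
    and L :: "int \<Rightarrow> 'a letter" and V :: "int \<Rightarrow> 'v" and E W :: "int set" +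
  assumes V_verts: "k \<in> P \<Longrightarrow> V k \<in> verts Q"
    and arrow: "\<lbrakk>k \<in> P; k + sg u \<in> P; ot u k\<rbrakk> \<Longrightarrow>
          ar u k \<in> arcs Q \<and> tail Q (ar u k) = V k \<and> head Q (ar u k) = V (k + sg u)"
    and no_backtrack: "\<lbrakk>k \<in> P; k + 1 \<in> P; k - 1 \<in> P; ot True k = ot False k\<rbrakk> \<Longrightarrow> ar True k \<noteq> ar False k"
    and E_convex: "\<lbrakk>i \<in> E; j \<in> E; i \<le> k; k \<le> j\<rbrakk> \<Longrightarrow> k \<in> E"
    and W_string: "\<lbrakk>winc u k; k + sg u \<in> W; ot u k\<rbrakk> \<Longrightarrow> \<not> rel (ar u (k - sg u)) (ar u k)"
begin

lemma no_backtrack': "\<lbrakk>k \<in> P; k + sg u \<in> P; k - sg u \<in> P; ot u k = ot (\<not> u) k\<rbrakk> \<Longrightarrow> ar u k \<noteq> ar (\<not> u) k"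
  using no_backtrack[of k] by (cases u) auto

lemma run_nonzero:
  assumes "t \<in> P" "\<And>i. i \<le> m \<Longrightarrow> pos u t i \<in> P" "\<And>i. i < m \<Longrightarrow> ot u (pos u t i)"
    "\<And>i. 0 < i \<Longrightarrow> i < m \<Longrightarrow> \<not> rel (ar u (pos u t i - sg u)) (ar u (pos u t i))"
  shows "(V t, arrows u t m) \<in> nonzero_paths \<and> path_end (V t) (arrows u t m) = V (pos u t m)"
  using assms(2-4)
proof (induction m)
  case 0
  then show ?case using assms(1) V_verts by simp
next
  case (Suc m)
  let ?k = "pos u t m"
  have k: "?k \<in> P" "?k + sg u \<in> P" "ot u ?k"
    using Suc.prems(1)[of m] Suc.prems(1)[of "Suc m"] Suc.prems(2)[of m] by (auto simp: pos_Suc)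
  have a: "ar u ?k \<in> arcs Q" "tail Q (ar u ?k) = V ?k" "head Q (ar u ?k) = V (?k + sg u)"
    using arrow[OF k] by auto
  have IH: "(V t, arrows u t m) \<in> nonzero_paths" "path_end (V t) (arrows u t m) = V ?k"
    using Suc by auto
  have "\<not> rel (last (arrows u t m)) (ar u ?k)" if "m > 0"
    using Suc.prems(3)[of m] that pos_back[of u t "m - 1"] by (simp add: last_arrows)
  then have "(V t, arrows u t (Suc m)) \<in> nonzero_paths"
    unfolding arrows_Suc nonzero_paths_append using IH a k V_verts
    by (auto simp: nonzero_paths_def nonzero_list_def)
  then show ?case using a by (simp add: arrows_Suc pos_Suc)
qed

lemma run_nonzero_path:
  assumes "run u t m"
  shows "(V t, arrows u t m) \<in> nonzero_paths" "path_end (V t) (arrows u t m) = V (pos u t m)"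
proof -
  have "(V t, arrows u t m) \<in> nonzero_paths \<and> path_end (V t) (arrows u t m) = V (pos u t m)"
  proof (rule run_nonzero)
    show "pos u t i \<in> P" if "i \<le> m" for i using run_E[OF assms that] by simp
    from this[of 0] show "t \<in> P" by simp
    show "ot u (pos u t i)" if "i < m" for i using assms that by (simp add: run_def out_def)
    show "\<not> rel (ar u (pos u t i - sg u)) (ar u (pos u t i))" if "0 < i" "i < m" for i
      using assms that by (auto simp: run_def thr_def)
  qed
  then show "(V t, arrows u t m) \<in> nonzero_paths" "path_end (V t) (arrows u t m) = V (pos u t m)" by auto
qed

lemmas hl_nonzero = run_nonzero_path[OF hl_run]

lemma wrun_winc: "wrun u t m \<Longrightarrow> 0 < i \<Longrightarrow> i \<le> m \<Longrightarrow> winc u (pos u t i)"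
  using pos_back[of u t "i - 1"] by (simp add: wrun_def winc_def)

lemma wrun_nonzero:
  assumes "wrun u t m"
  shows "(V t, arrows u t m) \<in> nonzero_paths" "path_end (V t) (arrows u t m) = V (pos u t m)"
proof -
  have "(V t, arrows u t m) \<in> nonzero_paths \<and> path_end (V t) (arrows u t m) = V (pos u t m)"
  proof (rule run_nonzero)
    show "t \<in> P" using assms pos_0[of u t] by (force simp: wrun_def)
    fix i assume i: "0 < i" "i < m"
    show "\<not> rel (ar u (pos u t i - sg u)) (ar u (pos u t i))"
    proof (rule W_string)
      show "winc u (pos u t i)" using wrun_winc[OF assms] i by simp
      show "pos u t i + sg u \<in> W" using assms i unfolding pos_Suc[symmetric] wrun_def by simp
    qed (use assms i in \<open>simp add: wrun_def\<close>)
  qed (use assms in \<open>auto simp: wrun_def\<close>)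
  then show "(V t, arrows u t m) \<in> nonzero_paths" "path_end (V t) (arrows u t m) = V (pos u t m)" by auto
qed

lemma wrun_length: "wrun u t m \<Longrightarrow> m < length_bound"
  using nonzero_path_length[OF wrun_nonzero(1), of u t m] by simp

text \<open>
  Nonzero paths have bounded length, so a run of outward letters ends at a break after finitely
  many steps.
\<close>

lemma next_break:
  assumes "brk t" "out u t"
  shows "\<exists>m. hl u t m"
proof -
  have "run u t 1" using assms by (simp add: run_def)
  moreover have "m \<le> length_bound" if "run u t m" for m
    using nonzero_path_length[OF run_nonzero_path(1)[OF that]] by simp
  ultimately have max: "run u t (GREATEST m. run u t m)" "\<And>m. run u t m \<Longrightarrow> m \<le> (GREATEST m. run u t m)"
    using GreatestI_nat[of "run u t" 1 length_bound] Greatest_le_nat[of "run u t" _ length_bound] by blast+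
  then have "\<not> thr u (pos u t (GREATEST m. run u t m))"
    using run_extend_end Suc_n_not_le_n by blast
  then show ?thesis using max(1) run_end_brk assms(1) by (auto simp: hl_def)
qed

lemma prev_break:
  assumes "brk k" "inc u k"
  shows "\<exists>t m. hl u t m \<and> pos u t m = k"
proof -
  define R where "R m \<longleftrightarrow> run u (k - sg u * int m) m" for m
  have "R 1" using assms by (simp add: R_def run_def out_inc)
  moreover have "m \<le> length_bound" if "R m" for m
    using nonzero_path_length[OF run_nonzero_path(1)] that by (fastforce simp: R_def)
  ultimately have max: "R (GREATEST m. R m)" "\<And>m. R m \<Longrightarrow> m \<le> (GREATEST m. R m)"
    using GreatestI_nat[of R 1 length_bound] Greatest_le_nat[of R _ length_bound] by blast+
  define m where "m = (GREATEST m. R m)"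
  define t where "t = k - sg u * int m"
  have k: "pos u t m = k" by (simp add: pos_def t_def)
  have run: "run u t m" using max(1) by (simp add: R_def t_def m_def)
  have "t - sg u = k - sg u * int (Suc m)" by (simp add: t_def algebra_simps)
  then have "\<not> thr u t"
    using run_extend_start[OF run] max(2)[of "Suc m"] by (auto simp: R_def m_def)
  then have "hl u t m" using run run_start_brk[OF run] assms(1) k by (simp add: hl_def)
  then show ?thesis using k by blast
qed

text \<open>
  Going back along arriving letters inside \<open>W\<close> traces a nonzero path, hence it stops, namely at a
  position where nothing arrives.
\<close>

lemma winc_origin:
  assumes "winc u k"
  shows "\<exists>t m. 0 < m \<and> wrun u t m \<and> pos u t m = k \<and> (\<forall>u. \<not> winc u t)"
proof -
  define R where "R m \<longleftrightarrow> wrun u (k - sg u * int m) m" for m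
  have "R 1" using assms by (auto simp: R_def wrun_def winc_def pos_def less_Suc_eq le_Suc_eq)
  moreover have "m \<le> length_bound" if "R m" for m
    using wrun_length that by (force simp: R_def)
  ultimately have max: "R (GREATEST m. R m)" "\<And>m. R m \<Longrightarrow> m \<le> (GREATEST m. R m)"
    using GreatestI_nat[of R 1 length_bound] Greatest_le_nat[of R _ length_bound] by blast+
  define m where "m = (GREATEST m. R m)"
  note max = max[folded m_def]
  define t where "t = k - sg u * int m"
  have k: "pos u t m = k" by (simp add: pos_def t_def)
  have m: "m > 0" using max(2)[OF \<open>R 1\<close>] by simp
  have w: "wrun u t m" using max(1) by (simp add: R_def t_def)
  have "\<not> winc u t"
  proof
    assume winc: "winc u t"
    have t': "k - sg u * int (Suc m) = t - sg u" by (simp add: t_def algebra_simps)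
    have "R (Suc m)" unfolding R_def t' wrun_def pos_shift using w winc by (auto simp: wrun_def winc_def)
    then show False using max(2)[of "Suc m"] by simp
  qed
  moreover have "ot u t" using w m by (auto simp: wrun_def dest: spec[of _ 0])
  then have "\<not> winc (\<not> u) t" by (simp add: winc_def ot_flip)
  ultimately have "\<forall>u. \<not> winc u t" by (cases u) (auto simp: all_bool_eq)
  then show ?thesis using m w k by blast
qed

lemma wrun_unique_start:
  assumes "wrun u t m" "wrun u t' m'" "\<forall>u. \<not> winc u t" "\<forall>u. \<not> winc u t'" "pos u t m = pos u t' m'"
  shows "t = t' \<and> m = m'"
proof -
  have *: "\<not> m < m'" if "wrun u t' m'" "\<forall>u. \<not> winc u t" "pos u t m = pos u t' m'" for t t' m m'
  proof
    assume "m < m'"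
    then have "t = pos u t' (m' - m)" using that(3) by (simp add: pos_def of_nat_diff algebra_simps)
    then show False using wrun_winc[OF that(1), of "m' - m"] \<open>m < m'\<close> that(2) by auto
  qed
  have "m = m'" using *[OF assms(2,3,5)] *[OF assms(1,4) assms(5)[symmetric]] by linarith
  then show ?thesis using assms(5) by (simp add: pos_def)
qed

end

section \<open>Homotopy letters and gradings\<close>

lemma is_Inv_iff: "is_Inv l \<longleftrightarrow> \<not> is_Dir l"
  by (cases l) auto

text \<open>
  The homotopy letters, the endpoints and the degrees of a walk \<open>\<sigma>\<close> that looks like \<open>L\<close> and \<open>V\<close> on
  its positions.
\<close>

locale hwalk_view = proper_walk Q I L V E W
  for Q :: "('v, 'a) pre_digraph" and I :: "(('v, 'a) qpath \<Rightarrow> 'k::alg_closed_field) set"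
    and L :: "int \<Rightarrow> 'a letter" and V :: "int \<Rightarrow> 'v" and E W :: "int set" +
  fixes \<sigma> :: "('v, 'a) hwalk"
  assumes positions: "positions \<sigma> = E"
    and lett: "\<lbrakk>k \<in> E; k + 1 \<in> E\<rbrakk> \<Longrightarrow> lett \<sigma> k = L k"
    and vtx: "k \<in> E \<Longrightarrow> vtx \<sigma> k = V k"
begin

abbreviation start :: "bool \<Rightarrow> int \<Rightarrow> int \<Rightarrow> int" where
  "start u i j \<equiv> if u then i else j"

lemma pos_start: "i < j \<Longrightarrow> pos u (start u i j) (nat (j - i)) = start u j i"
  by (simp add: pos_def)

lemma seg_path_eq:
  assumes "i < j" "{i..j} \<subseteq> E" "is_Dir (L i) \<longleftrightarrow> u"
  shows "seg_path \<sigma> i j = (V (start u i j), arrows u (start u i j) (nat (j - i)))"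
proof -
  let ?m = "nat (j - i)"
  have E: "i \<in> E" "j \<in> E" "i + 1 \<in> E" using assms by auto
  have l: "length [i..j - 1] = ?m" by simp
  have nth: "x < ?m \<Longrightarrow> arr (lett \<sigma> ([i..j - 1] ! x)) = arr (L (i + int x))" for x
    using assms(1,2) lett[of "i + int x"] by (auto simp: subset_iff)
  show ?thesis
  proof (cases u)
    case True
    have "map (\<lambda>k. arr (lett \<sigma> k)) [i..j - 1] = arrows True i ?m"
      by (rule nth_equalityI) (use nth l in \<open>auto simp: arrows_nth ar_def pos_def\<close>)
    then show ?thesis using True E assms lett[of i] vtx by (simp add: seg_path_def)
  next
    case False
    have "rev (map (\<lambda>k. arr (lett \<sigma> k)) [i..j - 1]) = arrows False j ?m"
    proof (rule nth_equalityI)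
      fix x assume "x < length (rev (map (\<lambda>k. arr (lett \<sigma> k)) [i..j - 1]))"
      then have x: "x < ?m" by simp
      then have "rev (map (\<lambda>k. arr (lett \<sigma> k)) [i..j - 1]) ! x = arr (lett \<sigma> ([i..j - 1] ! (?m - Suc x)))"
        by (simp add: rev_nth)
      also have "\<dots> = arr (L (i + int (?m - Suc x)))" by (rule nth) (use x in simp)
      also have "i + int (?m - Suc x) = j - int x - 1" using x assms(1) by (simp add: of_nat_diff)
      finally show "rev (map (\<lambda>k. arr (lett \<sigma> k)) [i..j - 1]) ! x = arrows False j ?m ! x"
        using x by (simp add: arrows_nth ar_def pos_def)
    qed simp
    then show ?thesis using False E assms lett[of i] vtx by (simp add: seg_path_def)
  qed
qed

lemma outward_qpath:
  assumes "\<And>i. i < m \<Longrightarrow> out u (pos u t i)" "t \<in> E"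
  shows "(V t, arrows u t m) \<in> qpaths Q \<and> path_end (V t) (arrows u t m) = V (pos u t m)"
  using assms(1)
proof (induction m)
  case 0
  then show ?case using V_verts assms(2) by (simp add: qpaths_Nil)
next
  case (Suc m)
  let ?k = "pos u t m"
  have k: "?k \<in> E" "?k + sg u \<in> E" "ot u ?k" using Suc.prems[of m] by (auto simp: out_def)
  have a: "ar u ?k \<in> arcs Q" "tail Q (ar u ?k) = V ?k" "head Q (ar u ?k) = V (?k + sg u)"
    using arrow[of ?k u] k by auto
  then show ?case using Suc k V_verts[of "?k + sg u"]
    by (simp add: arrows_Suc qpaths_append qpaths_Cons qpaths_Nil pos_Suc)
qed

lemma run_iff:
  "run u t m \<longleftrightarrow> m > 0 \<and> t \<in> E \<and> (\<forall>i<m. out u (pos u t i)) \<and> (V t, arrows u t m) \<in> nonzero_paths"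
proof
  assume r: "run u t m"
  then show "m > 0 \<and> t \<in> E \<and> (\<forall>i<m. out u (pos u t i)) \<and> (V t, arrows u t m) \<in> nonzero_paths"
    using run_nonzero_path[OF r] run_E[OF r, of 0] by (auto simp: run_def)
next
  assume r: "m > 0 \<and> t \<in> E \<and> (\<forall>i<m. out u (pos u t i)) \<and> (V t, arrows u t m) \<in> nonzero_paths"
  have "thr u (pos u t i)" if i: "0 < i" "i < m" for i
  proof -
    have "arrows u t m = arrows u t i @ drop i (arrows u t m)"
      using take_arrows[of i m u t] i by (metis append_take_drop_id less_imp_le)
    then have "\<not> rel (last (arrows u t i)) (hd (drop i (arrows u t m)))"
      using r i nonzero_paths_append[of "V t" "arrows u t i" "drop i (arrows u t m)"] by auto
    moreover have "hd (drop i (arrows u t m)) = ar u (pos u t i)"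
      using i by (simp add: hd_drop_conv_nth arrows_nth)
    moreover have "last (arrows u t i) = ar u (pos u t i - sg u)"
      using i pos_back[of u t "i - 1"] by (simp add: last_arrows)
    moreover have "out u (pos u t (i - 1))" "out u (pos u t i)" using r i by auto
    then have "inc u (pos u t i)"
      using pos_Suc[of u t "i - 1"] i by (simp add: out_inc)
    ultimately show ?thesis using r i by (simp add: thr_def)
  qed
  then show "run u t m" using r by (auto simp: run_def)
qed

lemma nonzero_segment_iff:
  "nonzero_segment I \<sigma> i j \<longleftrightarrow> i < j \<and> (\<exists>u. run u (start u i j) (nat (j - i)))"
proof -
  have dir: "(\<forall>k\<in>{i..<j}. is_Dir (lett \<sigma> k) \<longleftrightarrow> u) \<longleftrightarrow> (\<forall>x<nat (j - i). out u (pos u (start u i j) x))"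
    if ij: "i < j" "{i..j} \<subseteq> E" for u
  proof -
    have "(\<forall>k\<in>{i..<j}. is_Dir (lett \<sigma> k) \<longleftrightarrow> u) \<longleftrightarrow> (\<forall>k\<in>{i..<j}. is_Dir (L k) \<longleftrightarrow> u)"
      using ij lett by (auto simp: subset_iff)
    also have "\<dots> \<longleftrightarrow> (\<forall>x<nat (j - i). out u (pos u (start u i j) x))"
    proof (rule iffI)
      assume *: "\<forall>k\<in>{i..<j}. is_Dir (L k) \<longleftrightarrow> u"
      show "\<forall>x<nat (j - i). out u (pos u (start u i j) x)"
        using ij * by (cases u) (auto simp: out_def ot_def pos_def subset_iff is_Inv_iff)
    next
      assume *: "\<forall>x<nat (j - i). out u (pos u (start u i j) x)"
      show "\<forall>k\<in>{i..<j}. is_Dir (L k) \<longleftrightarrow> u"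
      proof (rule ballI)
        fix k assume "k \<in> {i..<j}"
        then show "is_Dir (L k) \<longleftrightarrow> u"
          using *[rule_format, of "nat (if u then k - i else j - 1 - k)"]
          by (cases u) (auto simp: out_def ot_def pos_def is_Inv_iff)
      qed
    qed
    finally show ?thesis .
  qed
  have nz: "path_elem 1 (seg_path \<sigma> i j) \<notin> I \<longleftrightarrow> (V (start u i j), arrows u (start u i j) (nat (j - i))) \<in> nonzero_paths"
    if ij: "i < j" "{i..j} \<subseteq> E" and u: "\<forall>x<nat (j - i). out u (pos u (start u i j) x)" for u
  proof -
    have E: "i \<in> E" "i + 1 \<in> E" using ij by (auto simp: subset_iff)
    have "is_Dir (lett \<sigma> i) \<longleftrightarrow> u" using dir[OF ij, of u] u ij(1) by (meson atLeastLessThan_iff order_refl)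
    then have "is_Dir (L i) \<longleftrightarrow> u" using lett[OF E] by simp
    then have "seg_path \<sigma> i j = (V (start u i j), arrows u (start u i j) (nat (j - i)))"
      by (rule seg_path_eq[OF ij])
    moreover have "(V (start u i j), arrows u (start u i j) (nat (j - i))) \<in> qpaths Q"
      using outward_qpath[of "nat (j - i)" u "start u i j"] u ij by (cases u) (auto simp: subset_iff)
    ultimately show ?thesis using path_elem_in_I_iff by auto
  qed
  show ?thesis
  proof
    assume s: "nonzero_segment I \<sigma> i j"
    then have ij: "i < j" "{i..j} \<subseteq> E" by (auto simp: nonzero_segment_def positions)
    obtain u where "\<forall>k\<in>{i..<j}. is_Dir (lett \<sigma> k) \<longleftrightarrow> u"
      using s unfolding nonzero_segment_def is_Inv_iff by blast
    then have u: "\<forall>x<nat (j - i). out u (pos u (start u i j) x)" using dir[OF ij] by blast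
    then have "run u (start u i j) (nat (j - i))"
      using nz[OF ij u] s ij by (auto simp: run_iff nonzero_segment_def)
    then show "i < j \<and> (\<exists>u. run u (start u i j) (nat (j - i)))" using ij by blast
  next
    assume "i < j \<and> (\<exists>u. run u (start u i j) (nat (j - i)))"
    then obtain u where i: "i < j" and r: "run u (start u i j) (nat (j - i))" by blast
    have "k \<in> E" if "k \<in> {i..j}" for k
      using run_E[OF r, of "nat (if u then k - i else j - k)"] that by (cases u) (auto simp: pos_def)
    then have ij: "i < j" "{i..j} \<subseteq> E" using i by auto
    have u: "\<forall>x<nat (j - i). out u (pos u (start u i j) x)" using r by (simp add: run_def)
    then show "nonzero_segment I \<sigma> i j"
      using dir[OF ij, of u] nz[OF ij u] r ij
      unfolding nonzero_segment_def is_Inv_iff positions by (cases u) (auto simp: run_iff)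
  qed
qed

lemma run_direction: "run u (start u i j) (nat (j - i)) \<Longrightarrow> is_Dir (lett \<sigma> i) \<longleftrightarrow> u"
proof -
  assume r: "run u (start u i j) (nat (j - i))"
  then have ij: "i < j" by (auto simp: run_def)
  have "out u (pos u (start u i j) (if u then 0 else nat (j - i) - 1))" using r by (auto simp: run_def)
  then have o: "if u then out True i else out False (i + 1)"
    using ij by (cases u) (auto simp: pos_def of_nat_diff add.commute)
  then have "lett \<sigma> i = L i" by (intro lett) (auto simp: out_def split: if_splits)
  then show ?thesis using o by (cases u; cases "L i") (auto simp: out_def ot_def)
qed

text \<open>
  If a run can be prolonged by one letter at one of its ends, then this end is an inner position
  of a homotopy letter. Conversely, a longer nonzero segment would have a break as an inner
  position.
\<close>

lemma homotopy_letter_iff: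
  "homotopy_letter I \<sigma> i j \<longleftrightarrow> i < j \<and> (\<exists>u. hl u (start u i j) (nat (j - i)))"
proof
  assume h: "homotopy_letter I \<sigma> i j"
  then have seg: "nonzero_segment I \<sigma> i j"
    and max: "\<And>i' j'. i' \<le> i \<Longrightarrow> j \<le> j' \<Longrightarrow> nonzero_segment I \<sigma> i' j' \<Longrightarrow> i' = i \<and> j' = j"
    by (auto simp: homotopy_letter_def)
  then obtain u where ij: "i < j" and r: "run u (start u i j) (nat (j - i))"
    by (auto simp: nonzero_segment_iff)
  have "\<not> thr u (start u i j)"
  proof
    assume "thr u (start u i j)"
    then have "run u (start u i j - sg u) (Suc (nat (j - i)))" by (rule run_extend_start[OF r])
    then have "nonzero_segment I \<sigma> (if u then i - 1 else i) (if u then j else j + 1)"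
      using ij unfolding nonzero_segment_iff by (intro conjI exI[of _ u]) (cases u; simp add: nat_add_distrib Suc_nat_eq_nat_zadd1 algebra_simps)+
    then show False using max[of "if u then i - 1 else i" "if u then j else j + 1"] by (cases u) auto
  qed
  moreover have "\<not> thr u (pos u (start u i j) (nat (j - i)))"
  proof
    assume "thr u (pos u (start u i j) (nat (j - i)))"
    then have "run u (start u i j) (Suc (nat (j - i)))" by (rule run_extend_end[OF r])
    then have "nonzero_segment I \<sigma> (if u then i else i - 1) (if u then j + 1 else j)"
      using ij unfolding nonzero_segment_iff by (intro conjI exI[of _ u]) (cases u; simp add: nat_add_distrib Suc_nat_eq_nat_zadd1 algebra_simps)+
    then show False using max[of "if u then i else i - 1" "if u then j + 1 else j"] by (cases u) auto
  qed
  ultimately have "hl u (start u i j) (nat (j - i))"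
    using r run_start_brk run_end_brk by (auto simp: hl_def)
  then show "i < j \<and> (\<exists>u. hl u (start u i j) (nat (j - i)))" using ij by blast
next
  assume "i < j \<and> (\<exists>u. hl u (start u i j) (nat (j - i)))"
  then obtain u where ij: "i < j" and h: "hl u (start u i j) (nat (j - i))" by blast
  have b: "brk i" "brk j" using h pos_start[OF ij, of u] by (cases u; auto simp: hl_def)+
  have "i' = i \<and> j' = j" if s: "i' \<le> i" "j \<le> j'" "nonzero_segment I \<sigma> i' j'" for i' j'
  proof -
    obtain u' where r: "run u' (start u' i' j') (nat (j' - i'))"
      using s by (auto simp: nonzero_segment_iff)
    have "\<not> brk k" if "i' < k" "k < j'" for k
      using run_not_brk[OF r, of "nat (if u' then k - i' else j' - k)"] that by (cases u') (auto simp: pos_def)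
    then show ?thesis using b[THEN notE[rotated]] s ij b by (metis order_le_less order_less_le_trans order_le_less_trans)
  qed
  moreover have "nonzero_segment I \<sigma> i j"
    unfolding nonzero_segment_iff using ij hl_run[OF h] by blast
  ultimately show "homotopy_letter I \<sigma> i j"
    unfolding homotopy_letter_def by blast
qed

lemma homotopy_letter_brk:
  assumes "homotopy_letter I \<sigma> i j" shows "brk i" "brk j"
proof -
  obtain u where ij: "i < j" and h: "hl u (start u i j) (nat (j - i))"
    using assms by (auto simp: homotopy_letter_iff)
  then show "brk i" "brk j" using pos_start[OF ij, of u] by (cases u; simp add: hl_def)+
qed

lemma hl_letter:
  assumes "hl u t m"
  shows "homotopy_letter I \<sigma> (if u then t else t - int m) (if u then t + int m else t)"
  using assms hl_pos[OF assms] by (auto simp: homotopy_letter_iff intro!: exI[of _ u])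

lemma neighbour_break:
  assumes "brk a" "a + sg d \<in> E"
  shows "\<exists>b u t m. hl u t m \<and> sg d * a < sg d * b \<and> {t, pos u t m} = {a, b}"
proof (cases "out d a")
  case True
  then obtain m where "hl d a m" using next_break assms by blast
  then show ?thesis using hl_pos[of d a m]
    by (intro exI[of _ "pos d a m"] exI[of _ d] exI[of _ a] exI[of _ m]) (cases d; simp add: pos_def)
next
  case False
  then have "inc (\<not> d) a" using out_or_inc assms by (auto simp: brk_def)
  then obtain t m where h: "hl (\<not> d) t m" "pos (\<not> d) t m = a" using prev_break assms by blast
  then show ?thesis using hl_pos[OF h(1)]
    by (intro exI[of _ t] exI[of _ "\<not> d"] exI[of _ t] exI[of _ m]) (cases d; auto simp: pos_def)
qed

lemma endpoints_eq:
  "endpoints I \<sigma> = {k. brk k}"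
proof (cases "\<exists>k. E = {k}")
  case True
  then obtain k where k: "E = {k}" by blast
  then have "\<not> inc u k" for u unfolding inc_def unfolding k by (cases u) auto
  moreover have "k \<in> E" using k by simp
  ultimately have b: "brk k" by (simp add: brk_def thr_def)
  have sub: "x \<in> E" if "brk x" for x using that by (simp add: brk_def)
  have "endpoints I \<sigma> = E" using k by (auto simp: endpoints_def positions)
  also have "E = {x. brk x}" using k sub b by (metis (mono_tags, lifting) Collect_cong singletonD singleton_iff Collect_mem_eq)
  finally show ?thesis .
next
  case False
  have *: "(\<exists>j. homotopy_letter I \<sigma> k j \<or> homotopy_letter I \<sigma> j k)" if k: "brk k" for k
  proof -
    have kE: "k \<in> E" using k by (simp add: brk_def)
    then obtain k' where k': "k' \<in> E" "k' \<noteq> k" using False by blast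
    have "\<exists>d. k + sg d \<in> E"
    proof (cases "k < k'")
      case True
      then have "k + sg True \<in> E" using E_convex[of k k' "k + 1"] kE k' by simp
      then show ?thesis by blast
    next
      case False
      then have "k + sg False \<in> E" using E_convex[of k' k "k - 1"] kE k' by simp
      then show ?thesis by blast
    qed
    then obtain d b u t m where h: "hl u t m" "{t, pos u t m} = {k, b}"
      using neighbour_break[OF k] by blast
    then have "k = t \<or> k = pos u t m" by auto
    then show ?thesis using hl_letter[OF h(1)] by (cases u) (auto simp: pos_def)
  qed
  then show ?thesis
    using False homotopy_letter_brk unfolding endpoints_def positions by (simp only: if_False) blast
qed

lemma grading_iff:
  "is_grading I n \<sigma> \<delta> \<longleftrightarrow>
     (\<forall>u t m. hl u t m \<longrightarrow> \<delta> t = \<delta> (pos u t m) + 1) \<and>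
     (\<forall>k. brk k \<longrightarrow> \<delta> (k mod n) = \<delta> k \<and> \<delta> k \<le> 0) \<and> (\<exists>k. brk k \<and> \<delta> k = 0)"
proof -
  have "(\<forall>i j. homotopy_letter I \<sigma> i j \<longrightarrow> (if is_Dir (lett \<sigma> i) then \<delta> i = \<delta> j + 1 else \<delta> j = \<delta> i + 1)) \<longleftrightarrow>
    (\<forall>u t m. hl u t m \<longrightarrow> \<delta> t = \<delta> (pos u t m) + 1)" (is "?l \<longleftrightarrow> ?r")
  proof
    assume l: ?l
    show ?r
    proof (intro allI impI)
      fix u t m assume h: "hl u t m"
      have "is_Dir (lett \<sigma> (if u then t else t - int m)) \<longleftrightarrow> u"
        using run_direction[of u "if u then t else t - int m" "if u then t + int m else t"] hl_run[OF h] by (cases u) auto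
      then show "\<delta> t = \<delta> (pos u t m) + 1" using l hl_letter[OF h] by (cases u) (auto simp: pos_def)
    qed
  next
    assume r: ?r
    show ?l
    proof (intro allI impI)
      fix i j assume "homotopy_letter I \<sigma> i j"
      then obtain u where ij: "i < j" and h: "hl u (start u i j) (nat (j - i))" by (auto simp: homotopy_letter_iff)
      have "is_Dir (lett \<sigma> i) \<longleftrightarrow> u" by (rule run_direction[OF hl_run[OF h]])
      then show "if is_Dir (lett \<sigma> i) then \<delta> i = \<delta> j + 1 else \<delta> j = \<delta> i + 1"
        using r h pos_start[OF ij, of u] by (cases u) auto
    qed
  qed
  then show ?thesis unfolding is_grading_def endpoints_eq by (simp only: mem_Collect_eq) blast
qed

text \<open>Consecutive endpoints are joined by homotopy letters, so an invariant of these is constant.\<close>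

lemma constant_on_breaks:
  assumes f: "\<And>u t m. hl u t m \<Longrightarrow> f t = f (pos u t m)" and "brk a" "brk b"
  shows "f a = f b"
proof -
  have less: "f a = f b" if "brk a" "brk b" "a < b" for a b
    using that
  proof (induction "nat (b - a)" arbitrary: a rule: less_induct)
    case less
    have "a + sg True \<in> E" using E_convex[of a b "a + 1"] less.prems by (auto simp: brk_def)
    then obtain c u t m where h: "hl u t m" "sg True * a < sg True * c" and eq: "{t, pos u t m} = {a, c}"
      using neighbour_break[OF less.prems(1)] by blast
    have fac: "f a = f c" using f[OF h(1)] eq by (metis doubleton_eq_iff)
    have c: "brk c" using h(1) eq unfolding hl_def by (metis doubleton_eq_iff)
    have "c \<le> b"
    proof (rule ccontr)
      assume "\<not> c \<le> b"
      have "t = a \<and> c = pos u t m \<or> t = c \<and> a = pos u t m" using eq by (metis doubleton_eq_iff)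
      then have "\<not> brk b"
      proof
        assume *: "t = a \<and> c = pos u t m"
        then have u using h(2) hl_pos[OF h(1)] by (cases u) (auto simp: pos_def)
        then show ?thesis using hl_not_brk[OF h(1), of "nat (b - a)"] * \<open>\<not> c \<le> b\<close> less.prems(3) by (simp add: pos_def)
      next
        assume *: "t = c \<and> a = pos u t m"
        then have "\<not> u" using h(2) hl_pos[OF h(1)] by (cases u) (auto simp: pos_def)
        then show ?thesis using hl_not_brk[OF h(1), of "nat (c - b)"] * \<open>\<not> c \<le> b\<close> less.prems(3) by (simp add: pos_def)
      qed
      then show False using less.prems by simp
    qed
    then show ?case
      using less.hyps[of c] fac c less.prems h(2) by (cases "c = b") auto
  qed
  show ?thesis
  proof (cases a b rule: linorder_cases)
    case greater
    then show ?thesis using less[OF assms(3,2)] by simp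
  qed (use less[OF assms(2,3)] in auto)
qed

text \<open>
  Two gradings differ by a constant, and both have maximum \<open>0\<close>.
\<close>

lemma position_degree_eq:
  assumes "is_grading I n \<sigma> \<delta>" "brk k"
  shows "position_degree I n \<sigma> k = \<delta> k"
proof -
  let ?\<delta> = "position_degree I n \<sigma>"
  have g: "is_grading I n \<sigma> ?\<delta>" unfolding position_degree_def using someI[of "is_grading I n \<sigma>", OF assms(1)] .
  have const: "\<delta> a - ?\<delta> a = \<delta> b - ?\<delta> b" if "brk a" "brk b" for a b
    by (rule constant_on_breaks[OF _ that]) (use assms(1) g in \<open>simp add: grading_iff\<close>)
  note gradings = assms(1)[unfolded grading_iff] g[unfolded grading_iff]
  obtain a where a: "brk a" "\<delta> a = 0" using gradings by blast
  obtain b where b: "brk b" "?\<delta> b = 0" using gradings by blast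
  have "\<delta> b \<le> 0" "?\<delta> a \<le> 0" using gradings a b by blast+
  then have "\<delta> a - ?\<delta> a = 0" using const[OF a(1) b(1)] a b by linarith
  then show ?thesis using const[OF a(1) assms(2)] by simp
qed

end

section \<open>The complex of a walk as a resolution\<close>

text \<open>
  What strings and bands have in common. All data are \<open>n\<close>-periodic, with \<open>n = 0\<close> for strings. The
  module has one basis element \<open>idx k\<close> for each position \<open>k \<in> W\<close> modulo \<open>n\<close>; a direct letter at
  \<open>k\<close> carries the scalar \<open>\<kappa> k\<close>. The homotopy letter starting at \<open>k\<close> carries the scalar \<open>c k\<close> in
  the differential, and \<open>\<eta> k\<close> is the scalar of the generator at \<open>k\<close>, if \<open>k\<close> is a top. The
  recursion \<open>\<eta>_step\<close> relates consecutive tops through the deep position between them.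

  The positions of \<open>E\<close> outside \<open>W\<close> form the two tails, at distance \<open>tl k\<close> from \<open>W\<close>: there, the
  letters point away from \<open>W\<close> and any two consecutive ones form a zero relation (\<open>tail_step\<close>,
  \<open>tail_depth\<close>), and a tail does not stop as long as a further zero relation exists (\<open>tail_end\<close>).
  The positions of \<open>W\<close> outside \<open>E\<close> belong to the letters removed from the string, which point
  outwards (\<open>removed\<close>) and could be followed only by arrows that have a zero relation with the
  last of them (\<open>removed_end\<close>). Inside \<open>W\<close>, a break that is not a top is deep (\<open>inner_inc\<close>). If a
  top is an end of the walk, then no further arrow starts at it (\<open>top_end\<close>).
\<close>

locale walk_resolution = hwalk_view Q I L V E W \<sigma>
  for Q :: "('v, 'a) pre_digraph" and I :: "(('v, 'a) qpath \<Rightarrow> 'k::alg_closed_field) set"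
    and L :: "int \<Rightarrow> 'a letter" and V :: "int \<Rightarrow> 'v" and E W :: "int set" and \<sigma> :: "('v, 'a) hwalk" +
  fixes n :: int and N :: "'i set" and vt :: "'i \<Rightarrow> 'v" and m :: "'a \<Rightarrow> 'i \<Rightarrow> 'i \<Rightarrow> 'k"
    and idx :: "int \<Rightarrow> 'i" and c \<kappa> \<eta> :: "int \<Rightarrow> 'k" and tl :: "int \<Rightarrow> int"
  assumes n_nonneg: "0 \<le> n"
    and periodic: "L (k + n) = L k" "V (k + n) = V k" "k + n \<in> E \<longleftrightarrow> k \<in> E" "k + n \<in> W \<longleftrightarrow> k \<in> W"
      "c (k + n) = c k" "\<kappa> (k + n) = \<kappa> k" "\<eta> (k + n) = \<eta> k" "tl (k + n) = tl k"
    and W_nonempty: "W \<noteq> {}"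
    and N: "N = idx ` W" "finite N"
    and idx_eq: "\<lbrakk>k \<in> W; k' \<in> W\<rbrakk> \<Longrightarrow> idx k = idx k' \<longleftrightarrow> k mod n = k' mod n"
    and vt_idx: "k \<in> W \<Longrightarrow> vt (idx k) = V k"
    and support: "\<lbrakk>a \<in> arcs Q; i \<in> N; j \<in> N; m a i j \<noteq> 0\<rbrakk> \<Longrightarrow> vt j = tail Q a \<and> vt i = head Q a"
    and act_move: "\<lbrakk>k \<in> W; k + sg u \<in> W; ot u k\<rbrakk> \<Longrightarrow>
          arrow_action N m (ar u k) (\<lambda>i. if i = idx k then 1 else 0) =
            (\<lambda>i. if i = idx (k + sg u) then (if u then \<kappa> k else 1) else 0)"
    and act_stop: "\<lbrakk>k \<in> W; a \<in> arcs Q; \<And>u. \<not> (k + sg u \<in> W \<and> ot u k \<and> ar u k = a)\<rbrakk> \<Longrightarrow>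
          arrow_action N m a (\<lambda>i. if i = idx k then 1 else 0) = (\<lambda>i. 0)"
    and scalars: "c k \<noteq> 0" "\<kappa> k \<noteq> 0" "\<eta> k \<noteq> 0"
    and \<eta>_step: "\<lbrakk>k \<in> W; k + 1 \<in> W\<rbrakk> \<Longrightarrow>
          \<eta> (k + 1) = (if ot True k then \<kappa> k * (if brk k then c k else 1)
                       else if brk k then - 1 / c k else 1) * \<eta> k"
    and tail_step: "\<lbrakk>inc u k; out u k; rel (ar u (k - sg u)) (ar u k); k + sg u + sg u \<in> E\<rbrakk> \<Longrightarrow>
          out u (k + sg u) \<and> rel (ar u k) (ar u (k + sg u))"
    and tail_end: "\<lbrakk>inc u k; k + sg u \<notin> E; b \<in> arcs Q; tail Q b = V k\<rbrakk> \<Longrightarrow> \<not> rel (ar u (k - sg u)) b"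
    and tail_depth: "\<lbrakk>k \<in> E; k \<notin> W\<rbrakk> \<Longrightarrow>
          \<exists>u. inc u k \<and> \<not> thr u k \<and> \<not> inc (\<not> u) k \<and> tl k = tl (k - sg u) + 1"
    and tl_W: "k \<in> W \<Longrightarrow> tl k = 0" and tl_nonneg: "tl k \<ge> 0"
    and inner_inc: "\<lbrakk>k \<in> E; k \<in> W; inc u k\<rbrakk> \<Longrightarrow> inc (\<not> u) k \<or> thr u k"
    and removed: "\<lbrakk>k \<in> W; k \<notin> E\<rbrakk> \<Longrightarrow> \<exists>u. winc u k \<and> \<not> winc (\<not> u) k"
    and inc_winc: "\<lbrakk>k \<in> W; k \<in> E\<rbrakk> \<Longrightarrow> inc u k \<longleftrightarrow> winc u k"
    and removed_end: "\<lbrakk>k \<in> W; k + sg u \<notin> P; winc u k; b \<in> arcs Q; tail Q b = V k\<rbrakk> \<Longrightarrow> rel (ar u (k - sg u)) b"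
    and top_end: "\<lbrakk>k \<in> W; top k; k + sg u \<notin> P; b \<in> arcs Q; tail Q b = V k\<rbrakk> \<Longrightarrow> k - sg u \<in> P \<and> b = ar (\<not> u) k"
begin

subsection \<open>Periodicity\<close>

text \<open>
  An \<open>n\<close>-periodic function only depends on the residue modulo \<open>n\<close>, also for \<open>n = 0\<close>.
\<close>

lemma shift:
  assumes "\<And>k. f (k + n) = f k" "k mod n = k' mod n"
  shows "f k = f k'"
proof -
  have *: "f (k + n * int z) = f k" for k z
  proof (induction z)
    case (Suc z)
    have "k + n * int (Suc z) = (k + n * int z) + n" by (simp add: algebra_simps)
    then show ?case using assms(1)[of "k + n * int z"] Suc by (simp only:)
  qed simp
  have **: "f (k mod n) = f k" for k
  proof (cases "k div n \<ge> 0")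
    case True
    then show ?thesis using *[of "k mod n" "nat (k div n)"] by (simp add: mult.commute)
  next
    case False
    then have "k + n * int (nat (- (k div n))) = k mod n" by (simp add: minus_div_mult_eq_mod[symmetric] algebra_simps)
    then show ?thesis using *[of k "nat (- (k div n))"] by simp
  qed
  show ?thesis using **[of k] **[of k'] assms(2) by simp
qed

lemma pos_n: "pos u (t + n) i = pos u t i + n"
  by (simp add: pos_def)

lemma pos_mod: "t mod n = t' mod n \<Longrightarrow> pos u t i mod n = pos u t' i mod n"
  unfolding pos_def by (metis mod_add_left_eq)

lemma periodic_local:
  "ar u (k + n) = ar u k" "ot u (k + n) = ot u k" "inc u (k + n) = inc u k" "out u (k + n) = out u k"
proof -
  have *: "k + n - 1 = (k - 1) + n" "k + n - sg u = (k - sg u) + n" "k + n + sg u = (k + sg u) + n" for k by simp_all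
  show o: "ar u (k + n) = ar u k" "ot u (k + n) = ot u k" for k
    unfolding ar_def ot_def using periodic(1)[of k] periodic(1)[of "k - 1"] by (simp_all add: *(1))
  show "inc u (k + n) = inc u k" "out u (k + n) = out u k"
    unfolding inc_def out_def * using periodic(3) o by auto
qed

lemma periodic_thr: "thr u (k + n) = thr u k"
proof -
  have "k + n - sg u = (k - sg u) + n" by simp
  then have "ar u (k + n - sg u) = ar u (k - sg u)" by (simp only: periodic_local)
  then show ?thesis unfolding thr_def by (simp add: periodic_local)
qed

lemma periodic_pred:
  "brk (k + n) = brk k" "top (k + n) = top k" "arrows u (k + n) len = arrows u k len"
  "hl u (k + n) len = hl u k len" "wrun u (k + n) len = wrun u k len"
proof -
  show b: "brk (k + n) = brk k" for k by (simp add: brk_def periodic periodic_thr)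
  show "top (k + n) = top k" by (simp add: top_def periodic periodic_local)
  show "arrows u (k + n) len = arrows u k len" by (simp add: arrows_def pos_n periodic_local)
  show "hl u (k + n) len = hl u k len" by (simp add: hl_def run_def pos_n periodic_local periodic_thr b)
  show "wrun u (k + n) len = wrun u k len" by (simp add: wrun_def pos_n periodic_local periodic)
qed

subsection \<open>The module\<close>

abbreviation kap :: "bool \<Rightarrow> int \<Rightarrow> 'k" where
  "kap u k \<equiv> if u then \<kappa> k else 1"

lemma act_unit:
  "arrow_action N m a (\<lambda>i. if i = idx k then x else 0) = (\<lambda>i. x * arrow_action N m a (\<lambda>i. if i = idx k then 1 else 0) i)"
  unfolding arrow_action_def by (auto simp: fun_eq_iff sum_distrib_left intro!: sum.cong)

sublocale bound_representation Q I N vt m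
proof unfold_locales
  show "finite N" by (rule N)
  show "vt i \<in> verts Q" if "i \<in> N" for i using that N vt_idx V_verts by auto
  show "vt j = tail Q a \<and> vt i = head Q a" if "a \<in> arcs Q" "i \<in> N" "j \<in> N" "m a i j \<noteq> 0" for a i j
    using support that by blast
  fix a b v assume ab: "a \<in> arcs Q" "b \<in> arcs Q" "rel a b"
  have unit: "arrow_action N m b (arrow_action N m a (\<lambda>i. if i = idx k then 1 else 0)) = (\<lambda>i. 0)" if k: "k \<in> W" for k
  proof (cases "\<exists>u. k + sg u \<in> W \<and> ot u k \<and> ar u k = a")
    case True
    then obtain u where u: "k + sg u \<in> W" "ot u k" "ar u k = a" by blast
    let ?k = "k + sg u"
    have stop: "arrow_action N m b (\<lambda>i. if i = idx ?k then 1 else 0) = (\<lambda>i. 0)"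
    proof (rule act_stop[OF u(1) ab(2)])
      fix u'
      show "\<not> (?k + sg u' \<in> W \<and> ot u' ?k \<and> ar u' ?k = b)"
      proof
        assume *: "?k + sg u' \<in> W \<and> ot u' ?k \<and> ar u' ?k = b"
        then have "u' = u" using u(2) ot_flip(1)[of u k] by (cases u; cases u') auto
        then have "\<not> rel a b" using W_string[of u ?k] * u k by (auto simp: winc_def)
        then show False using ab by simp
      qed
    qed
    have "arrow_action N m a (\<lambda>i. if i = idx k then 1 else 0) = (\<lambda>i. if i = idx ?k then kap u k else 0)"
      using act_move[OF k u(1,2)] u(3) by simp
    then show ?thesis using act_unit[of b ?k "kap u k"] stop by simp
  next
    case False
    then show ?thesis using act_stop[OF k ab(1)] by (auto simp: arrow_action_def)
  qed
  show "arrow_action N m b (arrow_action N m a v) = (\<lambda>i. 0)"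
  proof
    fix i
    have coef: "(\<Sum>j\<in>N. m b i j * m a j l) = 0" if il: "i \<in> N" "l \<in> N" for l
    proof -
      obtain k where "k \<in> W" "l = idx k" using il N by auto
      then have "arrow_action N m b (arrow_action N m a (\<lambda>i. if i = l then 1 else 0)) i = 0"
        using unit[of k] by simp
      then have "(\<Sum>j\<in>N. m b i j * (\<Sum>j'\<in>N. m a j j' * (if j' = l then 1 else 0))) = 0"
        using il by (simp add: arrow_action_def cong: sum.cong)
      then show ?thesis using il N(2) by (simp add: if_distrib[of "(*) _"] cong: if_cong)
    qed
    show "arrow_action N m b (arrow_action N m a v) i = 0"
    proof (cases "i \<in> N")
      case True
      have "arrow_action N m b (arrow_action N m a v) i = (\<Sum>j\<in>N. m b i j * (\<Sum>l\<in>N. m a j l * v l))"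
        using True by (simp add: arrow_action_def cong: sum.cong)
      also have "\<dots> = (\<Sum>j\<in>N. \<Sum>l\<in>N. m b i j * m a j l * v l)" by (simp add: sum_distrib_left mult.assoc)
      also have "\<dots> = (\<Sum>l\<in>N. (\<Sum>j\<in>N. m b i j * m a j l) * v l)" by (subst sum.swap) (simp add: sum_distrib_right)
      also have "\<dots> = 0" using coef True by simp
      finally show ?thesis .
    qed (simp add: arrow_action_def)
  qed
qed

text \<open>
  The paths from a position \<open>t \<in> W\<close> that do not kill the basis element at \<open>t\<close> are those running
  along the walk inside \<open>W\<close>, in one of the directions \<open>u\<close>; this is \<open>R u t as\<close>. They multiply it by
  \<open>wt u t\<close>. The two directions only compete for the empty path, where they give the same result.
\<close>

definition wt :: "bool \<Rightarrow> int \<Rightarrow> nat \<Rightarrow> 'k" where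
  "wt u t len = (\<Prod>i<len. kap u (pos u t i))"

definition R :: "bool \<Rightarrow> int \<Rightarrow> 'a list \<Rightarrow> bool" where
  "R u t as \<longleftrightarrow> as = arrows u t (length as) \<and> wrun u t (length as)"

definition \<theta> :: "int \<Rightarrow> 'a list \<Rightarrow> 'k" where
  "\<theta> t as = (if R True t as then \<eta> t * wt True t (length as)
             else if R False t as then \<eta> t * wt False t (length as) else 0)"

definition \<zeta> :: "int \<Rightarrow> 'a list \<Rightarrow> 'i" where
  "\<zeta> t as = idx (if R True t as then pos True t (length as) else pos False t (length as))"

definition gen :: "int \<Rightarrow> 'i \<Rightarrow> 'k" where
  "gen t = (\<lambda>i. if i = idx t then \<eta> t else 0)"

lemma wt_nonzero: "wt u t len \<noteq> 0"
  by (simp add: wt_def scalars)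

lemma wt_Suc: "wt u t (Suc len) = kap u (pos u t len) * wt u t len"
  by (simp add: wt_def)

lemma R_both: "R True t as \<Longrightarrow> R False t as \<Longrightarrow> as = []"
proof (rule ccontr)
  assume r: "R True t as" "R False t as" "as \<noteq> []"
  then have l: "length as > 0" by simp
  have "hd as = ar True t" "hd as = ar False t"
    using r hd_arrows[OF l] unfolding R_def by metis+
  moreover have "ot u t \<and> t + sg u \<in> W \<and> t \<in> W" if "R u t as" for u
    using that l pos_Suc[of u t 0] unfolding R_def wrun_def by (metis Suc_leI le0 pos_0)
  ultimately show False using no_backtrack'[of t True] r by force
qed

lemma R_eq:
  assumes "R u t as"
  shows "\<theta> t as = \<eta> t * wt u t (length as)" "\<zeta> t as = idx (pos u t (length as))"
  using assms R_both[of t as] by (cases u; cases "R True t as"; force simp: \<theta>_def \<zeta>_def wt_def)+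

lemma \<theta>_nonzero_iff: "\<theta> t as \<noteq> 0 \<longleftrightarrow> (\<exists>u. R u t as)"
proof
  assume "\<theta> t as \<noteq> 0"
  then show "\<exists>u. R u t as" by (auto simp: \<theta>_def split: if_splits)
next
  assume "\<exists>u. R u t as"
  then obtain u where "R u t as" by blast
  then show "\<theta> t as \<noteq> 0" using R_eq(1) wt_nonzero scalars by simp
qed

text \<open>
  By induction on the path: the next arrow either continues along the walk, or it is not the next
  arrow of the walk and annihilates the basis element reached so far.
\<close>

lemma act_gen:
  assumes t: "t \<in> W"
  shows "set as \<subseteq> arcs Q \<Longrightarrow> act_path (V t, as) (gen t) = (\<lambda>i. if i = \<zeta> t as then \<theta> t as else 0)"
proof (induction as rule: rev_induct)
  case Nil
  have "R u t []" for u using t by (simp add: R_def wrun_def)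
  moreover have "act_path (V t, []) (gen t) = (\<lambda>i. if i = idx t then \<eta> t else 0)"
    using N t vt_idx by (auto simp: path_action_def gen_def fun_eq_iff)
  ultimately show ?case using R_eq[of True t "[]"] by (simp add: wt_def cong: if_cong)
next
  case (snoc a as)
  have IH: "act_path (V t, as @ [a]) (gen t) = arrow_action N m a (\<lambda>i. if i = \<zeta> t as then \<theta> t as else 0)"
    using snoc by (simp add: path_action_def)
  have R_snoc: "R u t (as @ [a]) \<longleftrightarrow> R u t as \<and> pos u t (length as) + sg u \<in> W \<and>
      ot u (pos u t (length as)) \<and> ar u (pos u t (length as)) = a" for u
    by (auto simp: R_def wrun_def arrows_Suc pos_Suc[symmetric] le_Suc_eq less_Suc_eq)
  show ?case
  proof (cases "\<exists>u. R u t as")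
    case False
    then have "\<theta> t as = 0" "\<theta> t (as @ [a]) = 0" using \<theta>_nonzero_iff R_snoc by blast+
    then show ?thesis using IH arrow_action_zero by (simp cong: if_cong)
  next
    case True
    then obtain u where u: "R u t as" by blast
    define k where "k = pos u t (length as)"
    have kW: "k \<in> W" using u by (simp add: R_def wrun_def k_def)
    have act: "act_path (V t, as @ [a]) (gen t) =
      (\<lambda>i. \<theta> t as * arrow_action N m a (\<lambda>i. if i = idx k then 1 else 0) i)"
      unfolding IH R_eq(2)[OF u] k_def[symmetric] by (rule act_unit)
    show ?thesis
    proof (cases "\<exists>u'. k + sg u' \<in> W \<and> ot u' k \<and> ar u' k = a")
      case True
      then obtain u' where u': "k + sg u' \<in> W" "ot u' k" "ar u' k = a" by blast
      have R': "R u' t as \<and> k = pos u' t (length as)"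
      proof (cases "as = []")
        case True
        then show ?thesis using t k_def by (simp add: R_def wrun_def)
      next
        case False
        then have "ot u (pos u t (length as - 1))" using u by (simp add: R_def wrun_def)
        moreover have "k = pos u t (length as - 1) + sg u"
          using pos_Suc[of u t "length as - 1"] False by (simp add: k_def)
        ultimately have "\<not> ot (\<not> u) k" using ot_flip(1) by simp
        then have "u' = u" using u' by (cases u; cases u') auto
        then show ?thesis using u k_def by simp
      qed
      then have Ra: "R u' t (as @ [a])" using R_snoc u' by simp
      have "arrow_action N m a (\<lambda>i. if i = idx k then 1 else 0) = (\<lambda>i. if i = idx (k + sg u') then kap u' k else 0)"
        using act_move[OF kW u'(1,2)] u'(3) by simp
      moreover have "\<zeta> t (as @ [a]) = idx (k + sg u')" using R_eq(2)[OF Ra] R' by (simp add: pos_Suc)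
      moreover have "\<theta> t (as @ [a]) = kap u' k * \<theta> t as"
        using R_eq(1)[OF Ra] R_eq(1)[of u' t as] R' by (simp add: wt_Suc)
      ultimately show ?thesis unfolding act by auto
    next
      case False
      have "\<not> R u' t (as @ [a])" for u'
      proof
        assume r: "R u' t (as @ [a])"
        then have "R u' t as" using R_snoc by blast
        then have "pos u' t (length as) = k"
          using R_both[of t as] u k_def by (cases u; cases u') auto
        then show False using False r R_snoc[of u'] by auto
      qed
      then have "\<theta> t (as @ [a]) = 0" using \<theta>_nonzero_iff by blast
      moreover have "arrow_action N m a (\<lambda>i. if i = idx k then 1 else 0) = (\<lambda>i. 0)"
        by (rule act_stop[OF kW]) (use False snoc.prems in auto)
      ultimately show ?thesis unfolding act by (simp cong: if_cong)
    qed
  qed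
qed

subsection \<open>Tops and degrees\<close>

lemma top_W: "top t \<Longrightarrow> t \<in> W"
  using tail_depth[of t] by (auto simp: top_def)

lemma top_winc: "top t \<longleftrightarrow> t \<in> W \<and> (\<forall>u. \<not> winc u t)"
  using top_W[of t] removed[of t] inc_winc[of t] unfolding top_def by blast

lemma top_brk: "top t \<Longrightarrow> brk t"
  by (auto simp: top_def brk_def thr_def)

lemma outside_brk: "k \<in> E \<Longrightarrow> k \<notin> W \<Longrightarrow> brk k"
proof -
  assume k: "k \<in> E" "k \<notin> W"
  then obtain u where "inc u k" "\<not> thr u k" "\<not> inc (\<not> u) k" using tail_depth by blast
  then show ?thesis using k by (cases u) (auto simp: brk_def thr_def all_bool_eq)
qed

lemma hl_top_wrun:
  assumes "hl u t len" "top t" "i \<le> len" "i = len \<longrightarrow> pos u t len \<in> W"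
  shows "wrun u t i"
proof -
  have W: "pos u t j \<in> W" if "j \<le> i" for j
  proof (cases "j = 0 \<or> j = len")
    case True
    then show ?thesis using top_W[OF assms(2)] assms(3,4) that by auto
  next
    case False
    then show ?thesis using hl_not_brk[OF assms(1), of j] outside_brk hl_E[OF assms(1), of j] assms(3) that by force
  qed
  have "ot u (pos u t j)" if "j < i" for j
    using that assms(1,3) by (simp add: hl_def run_def out_def)
  with W show ?thesis by (simp add: wrun_def)
qed

text \<open>
  A break at which one letter arrives and another one leaves in the same direction carries a zero
  relation. It can only lie in a tail, where relations follow each other, so the leaving letter
  has length \<open>1\<close> and ends at a position where nothing arrives from the other side.
\<close>

lemma tail_letter:
  assumes "brk t" "inc u t" "out u t"
  shows "hl u t 1" "\<not> inc (\<not> u) (t + sg u)" "rel (ar u (t - sg u)) (ar u t)"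
proof -
  show r: "rel (ar u (t - sg u)) (ar u t)" using assms by (auto simp: brk_def thr_def)
  have next_step: "out u (t + sg u) \<and> rel (ar u t) (ar u (t + sg u))" if "t + sg u + sg u \<in> E"
    using tail_step[OF assms(2,3) r that] .
  have run: "run u t 1" using assms by (simp add: run_def)
  have "\<not> thr u (pos u t 1)" using next_step by (auto simp: pos_def thr_def out_def)
  then have "brk (pos u t 1)" by (rule run_end_brk[OF run])
  then show "hl u t 1" using run assms by (simp add: hl_def)
  show "\<not> inc (\<not> u) (t + sg u)"
    using next_step out_not_inc[of u "t + sg u"] by (auto simp: inc_def)
qed

lemma hl_from_nontop:
  assumes "hl u t len" "\<not> top t"
  shows "inc u t \<and> len = 1"
proof -
  have o: "out u t" and b: "brk t" using assms(1) hl_out by (auto simp: hl_def)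
  then obtain u' where "inc u' t" using assms(2) by (auto simp: top_def out_def)
  then have i: "inc u t" using out_not_inc[OF o] by (cases u; cases u') auto
  then show ?thesis using tail_letter(1)[OF b i o] hl_unique_length assms(1) by blast
qed

text \<open>
  Otherwise the letter would belong to a tail, where nothing arrives from the other side.
\<close>

lemma deep_top:
  assumes "hl u t len" "inc (\<not> u) (pos u t len)"
  shows "top t"
proof (rule ccontr)
  assume "\<not> top t"
  then have "inc u t" "len = 1" using hl_from_nontop[OF assms(1)] by auto
  moreover have "brk t" "out u t" using assms(1) hl_out by (auto simp: hl_def)
  ultimately show False using tail_letter(2)[of t u] assms(2) by (simp add: pos_def)
qed

lemma deep_W:
  assumes "inc u k" "inc (\<not> u) k" shows "k \<in> W"
proof (rule ccontr)
  assume "k \<notin> W"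
  moreover have "k \<in> E" using assms by (simp add: inc_def)
  ultimately obtain u' where "inc u' k" "\<not> inc (\<not> u') k" using tail_depth by blast
  then show False using assms by (cases u; cases u') auto
qed

text \<open>
  The degrees: the endpoints in \<open>W\<close> are tops or deep, and each step into a tail lowers the degree
  by \<open>1\<close>.
\<close>

definition depth :: "int \<Rightarrow> int" where
  "depth k = (if top k then 0 else if k \<in> W then -1 else - tl k)"

lemma depth_periodic: "depth (k + n) = depth k"
  by (simp add: depth_def periodic_pred periodic)

lemma depth_grading: "is_grading I n \<sigma> depth"
  unfolding grading_iff
proof (intro conjI allI impI)
  fix u t len assume h: "hl u t len"
  let ?s = "pos u t len"
  have inc: "inc u ?s" by (rule hl_inc[OF h])
  then have nt: "\<not> top ?s" by (auto simp: top_def)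
  have len: "len > 0" by (rule hl_pos[OF h])
  have sE: "?s \<in> E" and brk: "brk t" "brk ?s" using h inc by (auto simp: inc_def hl_def)
  have prev: "?s - sg u = pos u t (len - 1)" using pos_back[of u t "len - 1"] len by simp
  have tl_s: "tl ?s = tl (?s - sg u) + 1" if "?s \<notin> W"
  proof -
    obtain u' where u': "inc u' ?s" "\<not> inc (\<not> u') ?s" "tl ?s = tl (?s - sg u') + 1"
      using tail_depth[OF sE \<open>?s \<notin> W\<close>] by blast
    then have "u' = u" using inc by (cases u; cases u') auto
    then show ?thesis using u' by simp
  qed
  show "depth t = depth ?s + 1"
  proof (cases "top t")
    case True
    have "wrun u t (len - 1)" by (rule hl_top_wrun[OF h True]) (use len in auto)
    then have "?s - sg u \<in> W" unfolding prev by (simp add: wrun_def)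
    then show ?thesis using True nt tl_s tl_W by (auto simp: depth_def)
  next
    case False
    then have i: "inc u t" and l: "len = 1" using hl_from_nontop[OF h] by auto
    have o: "out u t" by (rule hl_out[OF h])
    have "t \<notin> W" using inner_inc[of t u] i out_not_inc[OF o] brk by (auto simp: brk_def inc_def)
    moreover have "?s \<notin> W"
      using inner_inc[OF sE _ inc] tail_letter(2)[OF brk(1) i o] brk(2) l by (auto simp: brk_def pos_def)
    ultimately show ?thesis using False nt tl_s prev l by (simp add: depth_def)
  qed
next
  fix k
  show "depth (k mod n) = depth k" by (rule shift[of depth]) (simp_all add: depth_periodic)
  show "depth k \<le> 0" using tl_nonneg[of k] by (simp add: depth_def)
next
  obtain k where k: "k \<in> W" using W_nonempty by blast
  have "\<exists>t. top t"
  proof (cases "\<exists>u. winc u k")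
    case True
    then obtain u t len where "wrun u t len" "\<forall>u. \<not> winc u t" using winc_origin by blast
    then have "top t" unfolding top_winc wrun_def by (metis le0 pos_0)
    then show ?thesis by blast
  next
    case False
    then show ?thesis using k top_winc by blast
  qed
  then obtain t where "top t" by blast
  then show "\<exists>k. brk k \<and> depth k = 0" using top_brk by (auto simp: depth_def)
qed

lemma degree_eq: "brk k \<Longrightarrow> position_degree I n \<sigma> k = depth k"
  by (rule position_degree_eq[OF depth_grading])

lemma depth_zero_iff: "brk k \<Longrightarrow> depth k = 0 \<longleftrightarrow> top k"
proof -
  assume "brk k"
  then have k: "k \<in> E" by (simp add: brk_def)
  have "tl k > 0" if w: "k \<notin> W"
  proof -
    obtain u where "tl k = tl (k - sg u) + 1" using tail_depth[OF k w] by blast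
    then show ?thesis using tl_nonneg[of "k - sg u"] by simp
  qed
  then show ?thesis by (auto simp: depth_def)
qed

subsection \<open>Generators and homotopy letters modulo the period\<close>

text \<open>
  The data of the criterion. As in the definition of the band complex, of the translates of a
  letter the one starting at a residue modulo \<open>n\<close> is taken; for the homotopy letter \<open>hl u t len\<close>
  this is \<open>nh u t len\<close>.
\<close>

definition T :: "int set" where "T = {k. brk k \<and> k mod n = k}"
definition H :: "(int \<times> int) set" where "H = {(i, j). homotopy_letter I \<sigma> i j \<and> i mod n = i}"
definition src :: "int \<times> int \<Rightarrow> int" where "src h = comp_source \<sigma> h mod n"
definition tgt :: "int \<times> int \<Rightarrow> int" where "tgt h = comp_target \<sigma> h mod n"
definition pth :: "int \<times> int \<Rightarrow> 'a list" where "pth h = snd (seg_path \<sigma> (fst h) (snd h))"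

definition nh :: "bool \<Rightarrow> int \<Rightarrow> nat \<Rightarrow> int \<times> int" where
  "nh u t len = (let i = (if u then t else t - int len) mod n in (i, i + int len))"

lemma T_mod: "brk k \<Longrightarrow> k mod n \<in> T"
  using shift[of brk "k mod n" k] periodic_pred by (simp add: T_def)

lemma V_mod: "V (k mod n) = V k"
  by (rule shift) (simp_all add: periodic)

lemma hl_mod: "t mod n = t' mod n \<Longrightarrow> hl u t len = hl u t' len"
  by (rule shift[of "\<lambda>t. hl u t len"]) (simp_all add: periodic_pred)

lemma arrows_mod: "t mod n = t' mod n \<Longrightarrow> arrows u t len = arrows u t' len"
  by (rule shift[of "\<lambda>t. arrows u t len"]) (simp_all add: periodic_pred)

lemma wrun_mod: "t mod n = t' mod n \<Longrightarrow> wrun u t len = wrun u t' len"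
  by (rule shift[of "\<lambda>t. wrun u t len"]) (simp_all add: periodic_pred)

lemma top_mod: "t mod n = t' mod n \<Longrightarrow> top t = top t'"
  by (rule shift[of top]) (simp_all add: periodic_pred)

lemma nh_mod:
  assumes "t mod n = t' mod n" shows "nh u t len = nh u t' len"
  using mod_diff_cong[OF assms refl, of "int len"] assms by (simp only: nh_def Let_def split: if_split) simp

lemma nh_letter:
  assumes "hl u t len"
  shows "nh u t len \<in> H" "tgt (nh u t len) = t mod n" "src (nh u t len) = pos u t len mod n"
    "pth (nh u t len) = arrows u t len"
proof -
  define i where "i = (if u then t else t - int len) mod n"
  define t' where "t' = (if u then i else i + int len)"
  have t': "t' mod n = t mod n"
  proof (cases u)
    case True
    then have "t' = t mod n" by (simp only: t'_def i_def if_True)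
    then show ?thesis by simp
  next
    case False
    then have "t' mod n = ((t - int len) mod n + int len) mod n" by (simp only: t'_def i_def if_False)
    also have "\<dots> = (t - int len + int len) mod n" by (rule mod_add_left_eq)
    finally show ?thesis by simp
  qed
  have h: "hl u t' len" using hl_mod[OF t'] assms by simp
  have len: "len > 0" by (rule hl_pos[OF h])
  have nh: "nh u t len = (i, i + int len)" by (simp add: nh_def i_def Let_def)
  have st: "start u i (i + int len) = t'" by (simp add: t'_def)
  have let1: "homotopy_letter I \<sigma> i (i + int len)"
    unfolding homotopy_letter_iff using h len st by (auto intro!: exI[of _ u])
  then show "nh u t len \<in> H" by (simp add: H_def nh i_def)
  have run: "run u (start u i (i + int len)) (nat (i + int len - i))" using hl_run[OF h] st by simp
  have dir: "is_Dir (lett \<sigma> i) = u" by (rule run_direction[OF run])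
  show "tgt (nh u t len) = t mod n"
    unfolding tgt_def nh comp_target_def using dir t' by (cases u) (simp_all add: t'_def)
  have "pos u t' len mod n = pos u t len mod n" by (rule pos_mod[OF t'])
  then show "src (nh u t len) = pos u t len mod n"
    unfolding src_def nh comp_source_def using dir by (cases u) (simp_all add: t'_def pos_def)
  have E: "{i..i + int len} \<subseteq> E"
  proof
    fix x assume x: "x \<in> {i..i + int len}"
    show "x \<in> E" using run_E[OF hl_run[OF h], of "nat (if u then x - i else i + int len - x)"] x
      by (cases u) (auto simp: pos_def t'_def)
  qed
  have "lett \<sigma> i = L i" by (rule lett) (use E len in \<open>auto simp: subset_iff\<close>)
  then have "seg_path \<sigma> i (i + int len) = (V t', arrows u t' len)"
    using seg_path_eq[of i "i + int len" u] E len dir st by simp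
  then show "pth (nh u t len) = arrows u t len"
    unfolding pth_def nh using arrows_mod[OF t'] by simp
qed

lemma H_cases:
  assumes "h \<in> H"
  obtains u t len where "hl u t len" "h = nh u t len"
proof -
  obtain i j u where h: "h = (i, j)" "i mod n = i" "i < j" "hl u (start u i j) (nat (j - i))"
    using assms unfolding H_def homotopy_letter_iff by auto
  have "h = nh u (start u i j) (nat (j - i))"
    using h by (cases u) (simp_all add: nh_def)
  then show thesis using that h(4) by blast
qed

text \<open>A letter whose target or source is known modulo the period can be moved there.\<close>

lemma H_at_target:
  assumes "h \<in> H" "tgt h = t mod n"
  obtains u len where "hl u t len" "h = nh u t len"
proof -
  obtain u t' len where h: "hl u t' len" "h = nh u t' len" using H_cases[OF assms(1)] by blast
  then have "t' mod n = t mod n" using assms(2) nh_letter(2)[OF h(1)] by simp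
  then show thesis using that h hl_mod nh_mod by metis
qed

lemma H_at_source:
  assumes "h \<in> H" "src h = s mod n"
  obtains u t len where "hl u t len" "h = nh u t len" "pos u t len = s"
proof -
  obtain u t' len where h: "hl u t' len" "h = nh u t' len" using H_cases[OF assms(1)] by blast
  then have "pos u t' len mod n = s mod n" using assms(2) nh_letter(3)[OF h(1)] by simp
  define t where "t = t' + (s - pos u t' len)"
  have "(s - pos u t' len) mod n = 0" using \<open>_ mod n = s mod n\<close> by (metis mod_eq_dvd_iff dvd_imp_mod_0)
  then have "t mod n = t' mod n" unfolding t_def by (metis add.right_neutral mod_add_right_eq)
  then have "hl u t len" "h = nh u t len" using h hl_mod nh_mod by metis+
  moreover have "pos u t len = s" by (simp add: t_def pos_def)
  ultimately show thesis using that by blast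
qed

text \<open>
  Letters with a common target lie on different sides of it, and a walk does not turn back on the
  arrow by which it came.
\<close>

lemma target_direction:
  assumes "hl u t len" "hl u' t len'" "hd (arrows u t len) = hd (arrows u' t len')"
  shows "u = u' \<and> len = len'"
proof -
  have o: "out u t" "out u' t" using assms hl_out by auto
  have "ar u t = ar u' t" using assms hl_pos hd_arrows by metis
  have "u = u'"
  proof (rule ccontr)
    assume "u \<noteq> u'"
    then have "u' = (\<not> u)" by auto
    then show False using no_backtrack'[of t u] o \<open>ar u t = ar u' t\<close> by (auto simp: out_def)
  qed
  then show ?thesis using hl_unique_length assms by blast
qed

lemma last_letter: "hl u t len \<Longrightarrow> last (arrows u t len) = ar u (pos u t len - sg u)"
  using last_arrows[of len u t] hl_pos[of u t len] pos_back[of u t "len - 1"] by simp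

lemma inc_both_arrows:
  assumes "inc u s" "inc (\<not> u) s"
  shows "ar u (s - sg u) \<noteq> ar (\<not> u) (s + sg u)"
proof -
  have "ot u s = ot (\<not> u) s" "s \<in> E" "s + sg u \<in> E" "s - sg u \<in> E"
    using assms ot_flip by (auto simp: inc_def)
  then have "ar u s \<noteq> ar (\<not> u) s" using no_backtrack'[of s u] by auto
  then show ?thesis using ar_flip[of u s] by simp
qed

lemma source_direction:
  assumes "hl u t len" "hl u' t' len'" "pos u t len = pos u' t' len'"
    "last (arrows u t len) = last (arrows u' t' len')"
  shows "u = u' \<and> t = t' \<and> len = len'"
proof -
  have "u = u'"
  proof (rule ccontr)
    assume "u \<noteq> u'"
    then have [simp]: "u' = (\<not> u)" by auto
    show False
      using inc_both_arrows[of u "pos u t len"] hl_inc[OF assms(1)] hl_inc[OF assms(2)] assms(3,4)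
        last_letter[OF assms(1)] last_letter[OF assms(2)] by simp
  qed
  then show ?thesis using hl_unique_start assms by blast
qed

subsection \<open>Exactness in negative degrees\<close>

lemma continue_iff:
  assumes "hl u t len"
  shows "(V t, arrows u t len @ as) \<in> nonzero_paths \<longleftrightarrow>
     (V (pos u t len), as) \<in> nonzero_paths \<and> (as = [] \<or> \<not> rel (ar u (pos u t len - sg u)) (hd as))"
  using nonzero_paths_append[of "V t" "arrows u t len" as] hl_nonzero[OF assms] last_letter[OF assms] hl_pos[OF assms]
  by auto

text \<open>
  Let the break \<open>s\<close> not be a top. If letters arrive from both sides, then no letter leaves, and
  one of the two arriving arrows can be followed by the first arrow of \<open>as\<close>. If just one letter
  arrives, with last arrow \<open>\<alpha>\<close> say, then it can be prolonged by \<open>as\<close> unless \<open>\<alpha>\<close> and the first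
  arrow of \<open>as\<close> form a zero relation. There is at most one arrow forming such a relation with \<open>\<alpha>\<close>,
  and if there is one, then the tail continues with it.
\<close>

lemma exact_at_source:
  assumes s: "brk s" "\<not> top s" and as: "(V s, as) \<in> nonzero_paths"
  shows "(\<exists>u len. hl u s len \<and> prefix (arrows u s len) as) \<longleftrightarrow>
     \<not> (\<exists>u. inc u s \<and> (as = [] \<or> \<not> rel (ar u (s - sg u)) (hd as)))"
proof -
  have sE: "s \<in> E" using s by (simp add: brk_def)
  then obtain u where u: "inc u s" using s by (auto simp: top_def)
  have inc_arrow: "ar u (s - sg u) \<in> arcs Q \<and> head Q (ar u (s - sg u)) = V s" if "inc u s" for u
    using arrow[of "s - sg u" u] that by (auto simp: inc_def)
  have nil: "\<not> prefix (arrows u s len) []" if "hl u s len" for u len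
    using hl_pos[OF that] by auto
  have as_hd: "hd as \<in> arcs Q" "tail Q (hd as) = V s" if "as \<noteq> []"
    using as that by (cases as; auto simp: nonzero_paths_def nonzero_list_def)+
  show ?thesis
  proof (cases "inc (\<not> u) s")
    case True
    have "\<not> out u' s" for u' using out_not_inc[of u' s] u True by (cases u; cases u') auto
    then have "\<not> (\<exists>u len. hl u s len \<and> prefix (arrows u s len) as)" using hl_out by blast
    moreover have "as = [] \<or> \<not> rel (ar u (s - sg u)) (hd as) \<or> \<not> rel (ar (\<not> u) (s - sg (\<not> u))) (hd as)"
    proof (cases "as = []")
      case False
      have "rel (ar u (s - sg u)) (hd as) \<longleftrightarrow> \<not> rel (ar (\<not> u) (s - sg (\<not> u))) (hd as)"
      proof (rule rel_unique_left)
        show "ar u (s - sg u) \<noteq> ar (\<not> u) (s - sg (\<not> u))" using inc_both_arrows[OF u True] by simp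
      qed (simp_all only: inc_arrow[OF u] inc_arrow[OF True] as_hd[OF False])
      then show ?thesis by blast
    qed simp
    ultimately show ?thesis using u True by blast
  next
    case only: False
    have u': "u' = u" if "inc u' s" for u' using that only by (cases u; cases u') auto
    have hl_u: "u' = u" if "hl u' s len" for u' len
      using hl_out[OF that] out_not_inc[of u' s] u by (cases u; cases u') auto
    show ?thesis
    proof (cases "as = []")
      case True
      then show ?thesis using u nil by blast
    next
      case False
      let ?\<alpha> = "ar u (s - sg u)"
      have r: "(\<exists>u. inc u s \<and> (as = [] \<or> \<not> rel (ar u (s - sg u)) (hd as))) \<longleftrightarrow> \<not> rel ?\<alpha> (hd as)"
        using u u' False by blast
      show ?thesis
      proof (cases "s + sg u \<in> E")
        case True
        then have o: "out u s" using out_or_inc[OF sE True] only by blast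
        have h: "hl u s 1" and rel: "rel ?\<alpha> (ar u s)" using tail_letter[OF s(1) u o] by auto
        have a: "ar u s \<in> arcs Q" "tail Q (ar u s) = V s" using arrow[of s u] o by (auto simp: out_def)
        have "(\<exists>u len. hl u s len \<and> prefix (arrows u s len) as) \<longleftrightarrow> prefix (arrows u s 1) as"
          using h hl_u hl_unique_length by blast
        also have "\<dots> \<longleftrightarrow> hd as = ar u s"
          using False by (cases as) (auto simp: arrows_def)
        also have "\<dots> \<longleftrightarrow> rel ?\<alpha> (hd as)"
          using rel rel_unique_right[of ?\<alpha> "hd as" "ar u s"] inc_arrow[OF u] a as_hd[OF False] by auto
        finally show ?thesis using r by simp
      next
        case edge: False
        then have "\<not> out u s" by (simp add: out_def)
        then have "\<not> (\<exists>u len. hl u s len \<and> prefix (arrows u s len) as)" using hl_u hl_out by blast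
        moreover have "\<not> rel ?\<alpha> (hd as)" using tail_end[OF u edge] as_hd[OF False] by blast
        ultimately show ?thesis using r by simp
      qed
    qed
  qed
qed

lemma dom_iff: "(\<exists>h\<in>H. tgt h = t mod n \<and> prefix (pth h) as) \<longleftrightarrow> (\<exists>u len. hl u t len \<and> prefix (arrows u t len) as)"
proof
  assume "\<exists>h\<in>H. tgt h = t mod n \<and> prefix (pth h) as"
  then obtain h where h: "h \<in> H" "tgt h = t mod n" "prefix (pth h) as" by blast
  then obtain u len where "hl u t len" "h = nh u t len" using H_at_target by blast
  then show "\<exists>u len. hl u t len \<and> prefix (arrows u t len) as" using h nh_letter(4) by metis
next
  assume "\<exists>u len. hl u t len \<and> prefix (arrows u t len) as"
  then show "\<exists>h\<in>H. tgt h = t mod n \<and> prefix (pth h) as" using nh_letter by metis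
qed

lemma ran_iff:
  assumes "(V s, as) \<in> nonzero_paths" "brk s"
  shows "(\<exists>h\<in>H. src h = s mod n \<and> (V (tgt h), pth h @ as) \<in> nonzero_paths) \<longleftrightarrow>
     (\<exists>u. inc u s \<and> (as = [] \<or> \<not> rel (ar u (s - sg u)) (hd as)))"
proof
  assume "\<exists>h\<in>H. src h = s mod n \<and> (V (tgt h), pth h @ as) \<in> nonzero_paths"
  then obtain h where h: "h \<in> H" "src h = s mod n" "(V (tgt h), pth h @ as) \<in> nonzero_paths" by blast
  then obtain u t len where u: "hl u t len" "h = nh u t len" "pos u t len = s" using H_at_source by blast
  then have "(V t, arrows u t len @ as) \<in> nonzero_paths"
    using h(3) nh_letter[OF u(1)] by (simp add: V_mod)
  then show "\<exists>u. inc u s \<and> (as = [] \<or> \<not> rel (ar u (s - sg u)) (hd as))"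
    using continue_iff[OF u(1)] hl_inc[OF u(1)] u(3) by blast
next
  assume "\<exists>u. inc u s \<and> (as = [] \<or> \<not> rel (ar u (s - sg u)) (hd as))"
  then obtain u where u: "inc u s" "as = [] \<or> \<not> rel (ar u (s - sg u)) (hd as)" by blast
  then obtain t len where h: "hl u t len" "pos u t len = s" using prev_break assms(2) by blast
  then have "(V t, arrows u t len @ as) \<in> nonzero_paths" using continue_iff[OF h(1)] u assms by simp
  then show "\<exists>h\<in>H. src h = s mod n \<and> (V (tgt h), pth h @ as) \<in> nonzero_paths"
    using nh_letter[OF h(1)] h(2) by (intro bexI[of _ "nh u t len"]) (simp_all add: V_mod)
qed

subsection \<open>The fibres of the augmentation\<close>

text \<open>
  The pairs of a top and a path along the walk that lead to the position \<open>k\<close>. Modulo the period,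
  this is the fibre of the augmentation over the basis element at \<open>k\<close>.
\<close>

definition fib :: "int \<Rightarrow> (int \<times> 'a list) set" where
  "fib k = {(t mod n, arrows u t len) | u t len. top t \<and> wrun u t len \<and> pos u t len = k}"

lemma fib_eq:
  assumes k: "k \<in> W"
  shows "{(t, as). t \<in> T \<and> depth t = 0 \<and> (V t, as) \<in> nonzero_paths \<and> \<zeta> t as = idx k \<and> \<theta> t as \<noteq> 0} = fib k"
    (is "?l = _")
proof (intro equalityI subsetI)
  fix p assume "p \<in> ?l"
  then obtain t as where p: "p = (t, as)" "t \<in> T" "depth t = 0" "\<zeta> t as = idx k" "\<theta> t as \<noteq> 0" by blast
  then obtain u where u: "R u t as" using \<theta>_nonzero_iff by blast
  let ?len = "length as"
  have as: "as = arrows u t ?len" and w: "wrun u t ?len" using u by (auto simp: R_def)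
  have "idx (pos u t ?len) = idx k" using R_eq(2)[OF u] p by simp
  moreover have "pos u t ?len \<in> W" using w by (simp add: wrun_def)
  ultimately have m: "pos u t ?len mod n = k mod n" using idx_eq k by blast
  define t' where "t' = t + (k - pos u t ?len)"
  have "(k - pos u t ?len) mod n = 0" using m by (metis mod_eq_dvd_iff dvd_imp_mod_0)
  then have t': "t' mod n = t mod n" unfolding t'_def by (metis add.right_neutral mod_add_right_eq)
  have "top t" using p depth_zero_iff by (simp add: T_def)
  then have "top t'" using top_mod[OF t'] by simp
  moreover have "wrun u t' ?len" using w wrun_mod[OF t'] by simp
  moreover have "pos u t' ?len = k" by (simp add: t'_def pos_def)
  moreover have "p = (t' mod n, arrows u t' ?len)"
    using p(1,2) as t' arrows_mod[OF t'] by (simp add: T_def)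
  ultimately show "p \<in> fib k" unfolding fib_def by blast
next
  fix p assume "p \<in> fib k"
  then obtain u t len where p: "p = (t mod n, arrows u t len)" and t: "top t" "wrun u t len" "pos u t len = k"
    by (auto simp: fib_def)
  let ?t = "t mod n"
  have m: "?t mod n = t mod n" by simp
  have R: "R u ?t (arrows u t len)" unfolding R_def using t(2) arrows_mod[OF m] wrun_mod[OF m] by simp
  have topm: "top ?t" using top_mod[OF m] t by simp
  have z: "idx (pos u ?t len) = idx k"
    using idx_eq[of "pos u ?t len" k] pos_mod[OF m, of u len] k t wrun_mod[OF m, of u len] by (auto simp: wrun_def)
  have "\<theta> ?t (arrows u t len) \<noteq> 0" using R \<theta>_nonzero_iff by blast
  moreover have "(V ?t, arrows u t len) \<in> nonzero_paths" using wrun_nonzero(1)[OF t(2)] by (simp add: V_mod)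
  moreover have "?t \<in> T" by (rule T_mod[OF top_brk[OF t(1)]])
  moreover have "depth ?t = 0" using topm by (simp add: depth_def)
  moreover have "\<zeta> ?t (arrows u t len) = idx k" using R_eq(2)[OF R] z by simp
  ultimately show "p \<in> ?l" by (simp add: p)
qed

lemma fib_top:
  assumes "k \<in> W" "\<forall>u. \<not> winc u k"
  shows "fib k = {(k mod n, [])}"
proof -
  have "len = 0 \<and> t = k" if "top t" "wrun u t len" "pos u t len = k" for u t len
    using wrun_winc[OF that(2), of len] assms(2) that(3) by (cases "len = 0") auto
  then have "(t mod n, arrows u t len) = (k mod n, [])" if "top t" "wrun u t len" "pos u t len = k" for u t len
    using that by (metis arrows_simps(1))
  then have "fib k \<subseteq> {(k mod n, [])}" unfolding fib_def by blast
  moreover have "top k" "wrun True k 0" using assms by (auto simp: top_winc wrun_def)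
  then have "(k mod n, arrows True k 0) \<in> fib k" unfolding fib_def using pos_0 by blast
  ultimately show ?thesis by auto
qed

lemma fib_single:
  assumes "winc u k" "\<not> winc (\<not> u) k" "top t" "wrun u t len" "pos u t len = k"
  shows "fib k = {(t mod n, arrows u t len)}"
proof -
  have "u' = u \<and> t' = t \<and> len' = len" if "top t'" "wrun u' t' len'" "pos u' t' len' = k" for u' t' len'
  proof -
    have "len' \<noteq> 0"
    proof
      assume "len' = 0"
      then have "t' = k" using that(3) by simp
      then show False using that(1) assms(1) by (auto simp: top_winc)
    qed
    then have "winc u' k" using wrun_winc[OF that(2), of len'] that(3) by simp
    then have "u' = u" using assms(2) by (cases u; cases u') auto
    then show ?thesis using wrun_unique_start[of u t' len' t len] that assms by (auto simp: top_winc)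
  qed
  then show ?thesis unfolding fib_def using assms by fast
qed

lemma fib_double:
  assumes "top t" "wrun True t len" "pos True t len = k" "top t'" "wrun False t' len'" "pos False t' len' = k"
    "winc True k"
  shows "fib k = {(t mod n, arrows True t len), (t' mod n, arrows False t' len')}"
proof -
  have "(t'' mod n, arrows u t'' len'') \<in> {(t mod n, arrows True t len), (t' mod n, arrows False t' len')}"
    if "top t''" "wrun u t'' len''" "pos u t'' len'' = k" for u t'' len''
  proof -
    have "len'' \<noteq> 0"
    proof
      assume "len'' = 0"
      then have "t'' = k" using that(3) by simp
      then show False using that(1) assms(7) by (auto simp: top_winc)
    qed
    show ?thesis
    proof (cases u)
      case True
      then show ?thesis using wrun_unique_start[of True t'' len'' t len] that assms by (auto simp: top_winc)
    next
      case False
      then show ?thesis using wrun_unique_start[of False t'' len'' t' len'] that assms by (auto simp: top_winc)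
    qed
  qed
  then show ?thesis unfolding fib_def using assms by fast
qed

text \<open>
  The solution of the recursion for \<open>\<eta>\<close>, first along a direct homotopy letter and then along an
  inverse one. The scalar \<open>c\<close> of a homotopy letter is attached to its lower end, which is the
  target of a direct letter and the source of an inverse one.
\<close>

lemma \<eta>_up:
  assumes "hl True t len" "wrun True t len" "0 < i" "i \<le> len"
  shows "\<eta> (pos True t i) = c t * wt True t i * \<eta> t"
  using assms(3,4)
proof (induction i)
  case (Suc i)
  let ?k = "pos True t i"
  have k: "?k \<in> W" "?k + 1 \<in> W" "ot True ?k"
    using assms(2) Suc.prems pos_Suc[of True t i] by (auto simp: wrun_def)
  have b: "brk ?k \<longleftrightarrow> i = 0" using hl_not_brk[OF assms(1), of i] Suc.prems assms(1) by (auto simp: hl_def)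
  have step: "\<eta> (pos True t (Suc i)) = \<kappa> ?k * (if i = 0 then c ?k else 1) * \<eta> ?k"
    using \<eta>_step[OF k(1,2)] k(3) b by (simp add: pos_Suc)
  show ?case
  proof (cases "i = 0")
    case True
    then show ?thesis using step by (simp add: wt_def mult_ac)
  next
    case False
    then show ?thesis using step Suc by (simp add: wt_Suc mult_ac)
  qed
qed simp

lemma \<eta>_down:
  assumes "hl False t len" "wrun False t len"
  shows "\<eta> t = - 1 / c (pos False t len) * \<eta> (pos False t len)"
proof -
  have *: "\<eta> (pos False t i) = (if brk (pos False t (Suc i)) then - 1 / c (pos False t (Suc i)) else 1) * \<eta> (pos False t (Suc i))"
    if "i < len" for i
  proof -
    let ?k = "pos False t (Suc i)"
    have k1: "?k + 1 = pos False t i" by (simp add: pos_Suc)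
    have "?k \<in> W" "?k + 1 \<in> W" "ot False (?k + 1)" using assms(2) that unfolding k1 by (auto simp: wrun_def)
    moreover then have "\<not> ot True ?k" using ot_flip(1)[of True ?k] by simp
    ultimately show ?thesis using \<eta>_step[of ?k] k1 by simp
  qed
  have "\<eta> (pos False t i) = \<eta> t" if "i < len" for i
    using that
  proof (induction i)
    case (Suc i)
    then show ?case using *[of i] hl_not_brk[OF assms(1), of "Suc i"] by simp
  qed simp
  then have "\<eta> t = \<eta> (pos False t (len - 1))" using hl_pos[OF assms(1)] by simp
  also have "\<dots> = - 1 / c (pos False t len) * \<eta> (pos False t len)"
    using *[of "len - 1"] hl_pos[OF assms(1)] assms(1) by (simp add: hl_def)
  finally show ?thesis .
qed

lemma \<theta>_wrun: "wrun u t len \<Longrightarrow> \<theta> (t mod n) (arrows u t len) = \<eta> t * wt u t len"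
proof -
  assume w: "wrun u t len"
  have m: "t mod n mod n = t mod n" by simp
  have "R u (t mod n) (arrows u t len)" unfolding R_def using w arrows_mod[OF m] wrun_mod[OF m] by simp
  then have "\<theta> (t mod n) (arrows u t len) = \<eta> (t mod n) * wt u (t mod n) len" using R_eq(1) by fastforce
  moreover have "\<eta> (t mod n) = \<eta> t" by (rule shift) (simp_all add: periodic)
  moreover have "wt u (t mod n) len = wt u t len"
    by (rule shift[of "\<lambda>t. wt u t len"]) (simp_all add: wt_def pos_n periodic cong: if_cong)
  ultimately show ?thesis by simp
qed

text \<open>
  A deep position receives two homotopy letters, and the corresponding paths map the generators at
  their targets to multiples of the same basis element. The scalars \<open>\<eta>\<close> are chosen such that the
  two contributions cancel.
\<close>

lemma deep_fibre:
  assumes "inc True k" "inc False k"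
  obtains t len t' len' where "hl True t len" "pos True t len = k" "hl False t' len'" "pos False t' len' = k"
    "k \<in> W" "nh True t len \<noteq> nh False t' len'"
    "fib k = {(t mod n, arrows True t len), (t' mod n, arrows False t' len')}"
    "c (fst (nh True t len)) * \<theta> (t mod n) (arrows True t len) +
     c (fst (nh False t' len')) * \<theta> (t' mod n) (arrows False t' len') = 0"
proof -
  have kE: "k \<in> E" using assms by (simp add: inc_def)
  have "\<not> out u k" for u using out_not_inc[of u k] assms by (cases u) auto
  then have b: "brk k" using kE by (simp add: brk_def thr_def)
  have kW: "k \<in> W" using deep_W[of True k] assms by simp
  obtain t len where h: "hl True t len" "pos True t len = k" using prev_break[OF b assms(1)] by blast
  obtain t' len' where h': "hl False t' len'" "pos False t' len' = k" using prev_break[OF b assms(2)] by blast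
  have top: "top t" "top t'" using deep_top[OF h(1)] deep_top[OF h'(1)] h h' assms by auto
  have w: "wrun True t len" "wrun False t' len'"
    using hl_top_wrun[OF h(1) top(1), of len] hl_top_wrun[OF h'(1) top(2), of len'] h h' kW by auto
  have "winc True k" using inc_winc[OF kW kE] assms by simp
  then have fib: "fib k = {(t mod n, arrows True t len), (t' mod n, arrows False t' len')}"
    using fib_double[OF top(1) w(1) h(2) top(2) w(2) h'(2)] by simp
  have ne: "nh True t len \<noteq> nh False t' len'"
  proof
    assume "nh True t len = nh False t' len'"
    then have "last (arrows True t len) = last (arrows False t' len')"
      using nh_letter(4)[OF h(1)] nh_letter(4)[OF h'(1)] by simp
    then show False using source_direction[OF h(1) h'(1)] h h' by auto
  qed
  have cm: "c (x mod n) = c x" for x by (rule shift) (simp_all add: periodic)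
  have "fst (nh True t len) = t mod n" "fst (nh False t' len') = k mod n"
    using h'(2) by (simp_all add: nh_def Let_def pos_def)
  moreover have "c t * (\<eta> t * wt True t len) = \<eta> k"
    using \<eta>_up[OF h(1) w(1), of len] hl_pos[OF h(1)] h(2) by (simp add: mult_ac)
  moreover have "c k * (\<eta> t' * wt False t' len') = - \<eta> k"
    using \<eta>_down[OF h'(1) w(2)] h'(2) scalars(1)[of k] by (simp add: wt_def)
  ultimately have "c (fst (nh True t len)) * \<theta> (t mod n) (arrows True t len) +
     c (fst (nh False t' len')) * \<theta> (t' mod n) (arrows False t' len') = 0"
    using \<theta>_wrun[OF w(1)] \<theta>_wrun[OF w(2)] by (simp add: cm)
  with that h h' kW ne fib show thesis by blast
qed

text \<open>
  Inside \<open>W\<close>, the homotopy letters from a top end at deep positions. A path that stays in \<open>W\<close> does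
  not go beyond such a position, and it does not end there if its end is approached from one side
  only.
\<close>

lemma not_dominated:
  assumes "top t" "wrun u t len" "pos u t len = k" "\<not> winc (\<not> u) k" "len > 0"
  shows "\<not> (\<exists>u' len'. hl u' t len' \<and> prefix (arrows u' t len') (arrows u t len))"
proof
  assume "\<exists>u' len'. hl u' t len' \<and> prefix (arrows u' t len') (arrows u t len)"
  then obtain u' l where h: "hl u' t l" and p: "prefix (arrows u' t l) (arrows u t len)" by blast
  have l: "l > 0" by (rule hl_pos[OF h])
  have le: "l \<le> len" using prefix_arrows[OF p] by simp
  have "ar u' t = ar u t"
  proof -
    obtain bs where "arrows u t len = arrows u' t l @ bs" using p by (auto simp: prefix_def)
    then show ?thesis using l hd_arrows[of l u' t] hd_arrows[of len u t] assms(5)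
      by (metis hd_append2 arrows_simps(3) neq0_conv)
  qed
  moreover have w: "\<forall>i\<le>len. pos u t i \<in> W" "\<forall>i<len. ot u (pos u t i)"
    using assms(2) by (auto simp: wrun_def)
  have "ot u t" "t \<in> W" "t + sg u \<in> W"
    using w(1)[rule_format, of 0] w(1)[rule_format, of 1] w(2)[rule_format, of 0] assms(5) by (auto simp: pos_def)
  moreover have o': "out u' t" by (rule hl_out[OF h])
  ultimately have "u' = u"
    using no_backtrack'[of t u] by (cases u; cases u') (auto simp: out_def)
  let ?s = "pos u t l"
  have sW: "?s \<in> W" using assms(2) le by (simp add: wrun_def)
  have inc: "inc u ?s" and b: "brk ?s" using hl_inc[OF h] h \<open>u' = u\<close> by (auto simp: hl_def)
  have sE: "?s \<in> E" using b by (simp add: brk_def)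
  have "inc (\<not> u) ?s" using inner_inc[OF sE sW inc] b by (auto simp: brk_def)
  then have w: "winc (\<not> u) ?s" using inc_winc[OF sW sE] by simp
  show False
  proof (cases "l = len")
    case True
    then show False using w assms(3,4) by simp
  next
    case False
    then have "ot u ?s" using le assms(2) by (simp add: wrun_def)
    then show False using w ot_flip(1)[of u ?s] by (simp add: winc_def)
  qed
qed

text \<open>
  A nonzero path that kills the generator at a top \<open>t\<close> leaves the string. Its first arrow is one
  of the at most two arrows of the walk at \<open>t\<close>, and a nonzero path is determined by its first
  arrow and its length. So the path follows the walk, either beyond the homotopy letter starting
  there, or beyond the removed letters. The latter is impossible, since every further arrow would
  give a zero relation.
\<close>

lemma killed_prefix:
  assumes t: "top t" and as: "(V t, as) \<in> nonzero_paths" and no: "\<And>u. \<not> R u t as"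
  shows "\<exists>u len. hl u t len \<and> prefix (arrows u t len) as"
proof -
  have tW: "t \<in> W" and tE: "t \<in> E" and tb: "brk t" using top_W top_brk t by (auto simp: top_def)
  have ne: "as \<noteq> []" using no[of True] tW by (auto simp: R_def wrun_def)
  have nzl: "nonzero_list as" and a: "hd as \<in> arcs Q" "tail Q (hd as) = V t"
    using as ne by (cases as; auto simp: nonzero_paths_def nonzero_list_def)+
  have ot: "ot u t" if "t + sg u \<in> P" for u
  proof (rule ccontr)
    assume "\<not> ot u t"
    then have "ot (\<not> u) (t + sg u)" by (simp add: ot_flip)
    then have "inc (\<not> u) t \<or> winc (\<not> u) t" using that tW tE by (auto simp: inc_def winc_def)
    then show False using t tW by (auto simp: top_def top_winc[OF] inc_winc[OF tW tE])
  qed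
  have "\<exists>u. t + sg u \<in> P \<and> hd as = ar u t"
  proof (cases "\<exists>u. t + sg u \<notin> P")
    case True
    then obtain u where "t + sg u \<notin> P" by blast
    then have "t - sg u \<in> P \<and> hd as = ar (\<not> u) t" using top_end[OF tW t] a by blast
    then show ?thesis by (intro exI[of _ "\<not> u"]) simp
  next
    case False
    then have p: "t + sg u \<in> P" for u by blast
    have ar: "ar u t \<in> arcs Q \<and> tail Q (ar u t) = V t" for u
      using arrow[of t u] p ot tW by simp
    have "ar True t \<noteq> ar False t"
      using no_backtrack'[of t True] p[of True] p[of False] ot tW by simp
    then have "hd as = ar True t \<or> hd as = ar False t"
      using two_out_arrows[of "ar True t" "ar False t" "hd as"] ar a by blast
    then show ?thesis using p by blast
  qed
  then obtain u where u: "t + sg u \<in> P" "hd as = ar u t" by blast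
  note otu = ot[OF u(1)]
  show ?thesis
  proof (cases "t + sg u \<in> E")
    case True
    then have "out u t" using otu tE by (simp add: out_def)
    then obtain len where h: "hl u t len" using next_break[OF tb] by blast
    have "prefix (arrows u t len) as \<or> prefix as (arrows u t len)"
      using nonzero_lists_comparable[of "arrows u t len" as] hl_nonzero(1)[OF h] nzl ne u hl_pos[OF h] hd_arrows[of len u t]
      by (auto simp: nonzero_paths_def)
    moreover have "prefix (arrows u t len) as" if p: "prefix as (arrows u t len)"
    proof (rule ccontr)
      assume "\<not> ?thesis"
      have l: "length as \<le> len" "as = arrows u t (length as)" using prefix_arrows[OF p] by auto
      have "length as \<noteq> len" using \<open>\<not> prefix (arrows u t len) as\<close> l by auto
      then have "wrun u t (length as)" using hl_top_wrun[OF h t l(1)] by simp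
      then show False using no[of u] l by (simp add: R_def)
    qed
    ultimately show ?thesis using h by blast
  next
    case False
    have beyond: "pos u t (Suc i) \<notin> E" for i
    proof
      assume "pos u t (Suc i) \<in> E"
      then show False using E_convex[of t "pos u t (Suc i)" "t + sg u"] E_convex[of "pos u t (Suc i)" t "t + sg u"]
          tE False by (cases u) (auto simp: pos_def)
    qed
    \<comment> \<open>the letters on this side are removed ones; follow them as far as possible\<close>
    have "wrun u t 1" using tW u(1) False otu by (auto simp: wrun_def le_Suc_eq pos_def)
    then have max: "wrun u t (GREATEST l. wrun u t l)" "\<And>l. wrun u t l \<Longrightarrow> l \<le> (GREATEST l. wrun u t l)"
      using GreatestI_nat[of "wrun u t" 1 length_bound] Greatest_le_nat[of "wrun u t" _ length_bound] wrun_length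
      by (meson less_imp_le)+
    define l where "l = (GREATEST l. wrun u t l)"
    have w: "wrun u t l" and lmax: "\<And>l'. wrun u t l' \<Longrightarrow> l' \<le> l" using max by (auto simp: l_def)
    have l: "l > 0" using lmax[OF \<open>wrun u t 1\<close>] by simp
    let ?k = "pos u t l"
    have k: "?k \<in> W" "?k \<notin> E" "winc u ?k"
      using w beyond[of "l - 1"] l wrun_winc[OF w, of l] by (auto simp: wrun_def)
    have "prefix (arrows u t l) as \<or> prefix as (arrows u t l)"
      using nonzero_lists_comparable[of "arrows u t l" as] wrun_nonzero(1)[OF w] nzl ne u l hd_arrows[of l u t]
      by (auto simp: nonzero_paths_def)
    moreover have "\<not> prefix as (arrows u t l)"
    proof
      assume "prefix as (arrows u t l)"
      then have p: "length as \<le> l" "as = arrows u t (length as)" using prefix_arrows by auto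
      then have "wrun u t (length as)" using w by (auto simp: wrun_def)
      then show False using no[of u] p by (simp add: R_def)
    qed
    ultimately obtain bs where bs: "as = arrows u t l @ bs" "bs \<noteq> []" by (auto simp: prefix_def)
    have b: "hd bs \<in> arcs Q" "tail Q (hd bs) = V ?k" "\<not> rel (ar u (?k - sg u)) (hd bs)"
    proof -
      have "(V ?k, bs) \<in> nonzero_paths" "\<not> rel (last (arrows u t l)) (hd bs)"
        using as bs l wrun_nonzero(2)[OF w] nonzero_paths_append[of "V t" "arrows u t l" bs] by auto
      then show "hd bs \<in> arcs Q" "tail Q (hd bs) = V ?k" "\<not> rel (ar u (?k - sg u)) (hd bs)"
        using bs(2) last_arrows[OF l] pos_back[of u t "l - 1"] l
        by (cases bs; auto simp: nonzero_paths_def nonzero_list_def)+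
    qed
    have "?k + sg u \<notin> W"
    proof
      assume W: "?k + sg u \<in> W"
      obtain u' where "winc u' ?k" "\<not> winc (\<not> u') ?k" using removed[OF k(1,2)] by blast
      then have "\<not> winc (\<not> u) ?k" using k(3) by (cases u; cases u') auto
      then have "ot u ?k" using W k(1) by (auto simp: winc_def ot_flip)
      then have "wrun u t (Suc l)" using w W pos_Suc[of u t l] by (auto simp: wrun_def le_Suc_eq less_Suc_eq)
      then show False using lmax by fastforce
    qed
    moreover have "?k + sg u \<notin> E" using beyond[of l] by (simp add: pos_Suc)
    ultimately have "rel (ar u (?k - sg u)) (hd bs)"
      using removed_end[OF k(1) _ k(3) b(1,2)] by blast
    then show ?thesis using b by blast
  qed
qed

end

text \<open>
  Differentials of a complex are compared on the carriers of its terms, since their values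
  elsewhere are arbitrary.
\<close>

lemma projective_resolution_cong:
  assumes res: "projective_resolution R C d M"
    and eq: "\<And>i x. x \<in> carrier (C i) \<Longrightarrow> d i x = d' i x"
  shows "projective_resolution R C d' M"
proof -
  have im: "d i ` carrier (C i) = d' i ` carrier (C i)" for i
    by (rule image_cong) (use eq in auto)
  have ker: "{x \<in> carrier (C i). d i x = z} = {x \<in> carrier (C i). d' i x = z}" for i z
    using eq by auto
  have hom: "d' i \<in> lmod_hom R (C i) (C (i + 1))" for i
  proof -
    interpret left_module R "C i"
      using res by (simp add: projective_resolution_def projective_lmod_def)
    have "d i \<in> lmod_hom R (C i) (C (i + 1))" using res by (simp add: projective_resolution_def)
    then show ?thesis
      unfolding lmod_hom_def using eq smult_closed by (auto simp: Pi_iff)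
  qed
  show ?thesis
    using res hom unfolding projective_resolution_def im ker by simp
qed

context walk_resolution
begin

lemma T_brk: "t \<in> T \<Longrightarrow> brk t \<and> t mod n = t"
  by (simp add: T_def)

lemma fibre_at:
  assumes "k \<in> W"
  shows "{(t, as). t \<in> T \<and> position_degree I n \<sigma> t = 0 \<and> (V t, as) \<in> nonzero_paths \<and> \<zeta> t as = idx k \<and> \<theta> t as \<noteq> 0} = fib k"
proof -
  have "position_degree I n \<sigma> t = depth t" if "t \<in> T" for t using that degree_eq T_brk by blast
  then show ?thesis using fib_eq[OF assms] by (simp cong: conj_cong)
qed

lemma degree_zero_top: "t \<in> T \<Longrightarrow> position_degree I n \<sigma> t = 0 \<longleftrightarrow> top t"
  using degree_eq depth_zero_iff T_brk by metis

lemma fibre_cases_walk: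
  assumes "k \<in> W"
  shows "(\<exists>t as. t \<in> T \<and> position_degree I n \<sigma> t = 0 \<and> \<not> (\<exists>h\<in>H. tgt h = t \<and> prefix (pth h) as) \<and> fib k = {(t, as)}) \<or>
    (\<exists>h\<in>H. \<exists>h'\<in>H. h \<noteq> h' \<and> src h = src h' \<and> fib k = {(tgt h, pth h), (tgt h', pth h')} \<and>
       c (fst h) * \<theta> (tgt h) (pth h) + c (fst h') * \<theta> (tgt h') (pth h') = 0)"
proof (cases "winc True k \<and> winc False k")
  case True
  then have "k \<in> E" using removed[OF assms] by (metis (full_types))
  then have "inc True k" "inc False k" using inc_winc[OF assms] True by auto
  then obtain t len t' len' where h: "hl True t len" "pos True t len = k" and h': "hl False t' len'" "pos False t' len' = k"
    and ne: "nh True t len \<noteq> nh False t' len'"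
    and fib: "fib k = {(t mod n, arrows True t len), (t' mod n, arrows False t' len')}"
    and sum0: "c (fst (nh True t len)) * \<theta> (t mod n) (arrows True t len) +
     c (fst (nh False t' len')) * \<theta> (t' mod n) (arrows False t' len') = 0"
    by (rule deep_fibre)
  note l = nh_letter[OF h(1)] and l' = nh_letter[OF h'(1)]
  show ?thesis
    by (rule disjI2, rule bexI[OF _ l(1)], rule bexI[OF _ l'(1)])
      (simp only: l l' ne fib sum0 h(2) h'(2) simp_thms)
next
  case False
  show ?thesis
  proof (cases "\<exists>u. winc u k")
    case True
    then obtain u where u: "winc u k" by blast
    then have nu: "\<not> winc (\<not> u) k" using False by (cases u) auto
    obtain t len where t: "0 < len" "wrun u t len" "pos u t len = k" "\<forall>u. \<not> winc u t"
      using winc_origin[OF u] by blast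
    have top: "top t" unfolding top_winc using t by (auto simp: wrun_def dest!: spec[of _ 0])
    have "fib k = {(t mod n, arrows u t len)}" by (rule fib_single[OF u nu top t(2,3)])
    moreover have "\<not> (\<exists>h\<in>H. tgt h = t mod n \<and> prefix (pth h) (arrows u t len))"
      unfolding dom_iff by (rule not_dominated[OF top t(2,3) nu t(1)])
    moreover have T: "t mod n \<in> T" by (rule T_mod[OF top_brk[OF top]])
    moreover have "position_degree I n \<sigma> (t mod n) = 0"
      unfolding degree_zero_top[OF T] using top top_mod[of "t mod n" t] by simp
    ultimately show ?thesis by blast
  next
    case False
    then have top: "top k" using top_winc assms by blast
    have T: "k mod n \<in> T" by (rule T_mod[OF top_brk[OF top]])
    moreover have "position_degree I n \<sigma> (k mod n) = 0"
      unfolding degree_zero_top[OF T] using top top_mod[of "k mod n" k] by simp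
    moreover have "\<not> (\<exists>h\<in>H. tgt h = k mod n \<and> prefix (pth h) [])"
      unfolding dom_iff using hl_pos by fastforce
    moreover have "fib k = {(k mod n, [])}" using fib_top[OF assms] False by blast
    ultimately show ?thesis by blast
  qed
qed

lemma fibre_pair_walk:
  assumes "h \<in> H" "h' \<in> H" "h \<noteq> h'" "src h = src h'"
  shows "\<exists>k\<in>W. inc True k \<and> inc False k \<and> src h = k mod n \<and> fib k = {(tgt h, pth h), (tgt h', pth h')} \<and>
       c (fst h) * \<theta> (tgt h) (pth h) + c (fst h') * \<theta> (tgt h') (pth h') = 0"
proof -
  obtain u t len where h: "hl u t len" "h = nh u t len" using H_cases[OF assms(1)] by blast
  define k where "k = pos u t len"
  have src: "src h = k mod n" using nh_letter(3)[OF h(1)] h(2) by (simp add: k_def)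
  then have "src h' = k mod n" using assms by simp
  then obtain u' t' len' where h': "hl u' t' len'" "h' = nh u' t' len'" "pos u' t' len' = k"
    using H_at_source[OF assms(2)] by blast
  have k: "pos u t len = k" by (simp add: k_def)
  have "u' \<noteq> u"
  proof
    assume "u' = u"
    then have "t = t' \<and> len = len'" using hl_unique_start[OF h(1)] h'(1,3) k by simp
    then show False using assms(3) h h' \<open>u' = u\<close> by simp
  qed
  then have u': "u' = (\<not> u)" by auto
  have inc: "inc True k" "inc False k"
    using hl_inc[OF h(1)] hl_inc[OF h'(1)] u' k h'(3) by (cases u; auto)+
  obtain s l s' l' where d: "hl True s l" "pos True s l = k" "hl False s' l'" "pos False s' l' = k" "k \<in> W"
    "fib k = {(s mod n, arrows True s l), (s' mod n, arrows False s' l')}"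
    "c (fst (nh True s l)) * \<theta> (s mod n) (arrows True s l) +
     c (fst (nh False s' l')) * \<theta> (s' mod n) (arrows False s' l') = 0"
    using inc by (rule deep_fibre)
  note l = nh_letter[OF d(1)] and l' = nh_letter[OF d(3)]
  have "{h, h'} = {nh True s l, nh False s' l'} \<and> (h = nh True s l \<longleftrightarrow> h' = nh False s' l')"
  proof (cases u)
    case True
    then have "h = nh True s l" "h' = nh False s' l'"
      using hl_unique_start[of True t len s l] hl_unique_start[of False t' len' s' l'] h h' d k u' by auto
    then show ?thesis by simp
  next
    case False
    then have "h = nh False s' l'" "h' = nh True s l"
      using hl_unique_start[of False t len s' l'] hl_unique_start[of True t' len' s l] h h' d k u' by auto
    then show ?thesis using assms(3) by auto
  qed
  then consider "h = nh True s l" "h' = nh False s' l'" | "h = nh False s' l'" "h' = nh True s l"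
    by (metis doubleton_eq_iff)
  then show ?thesis
  proof cases
    case 1
    then show ?thesis using d inc src l l' by (intro bexI[OF _ d(5)]) simp
  next
    case 2
    then show ?thesis using d inc src l l' by (intro bexI[OF _ d(5)]) (simp add: insert_commute add.commute)
  qed
qed

text \<open>
  The letters with a common target are distinguished by their first arrows, those with a common
  source by their last arrows, and there are only finitely many arrows.
\<close>

lemma finite_by_arrow:
  assumes "S \<subseteq> H" "\<And>h h'. h \<in> S \<Longrightarrow> h' \<in> S \<Longrightarrow> f (pth h) = f (pth h') \<Longrightarrow> h = h'"
    "\<And>as. as \<noteq> [] \<Longrightarrow> f as \<in> set as"
  shows "finite S"
proof (rule finite_imageD)
  have "f (pth h) \<in> arcs Q" if hS: "h \<in> S" for h
  proof -
    have "h \<in> H" using assms(1) hS by blast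
    then obtain u t len where h: "hl u t len" "h = nh u t len" using H_cases by blast
    have "set (pth h) \<subseteq> arcs Q" "pth h \<noteq> []"
      using hl_nonzero(1)[OF h(1)] nh_letter(4)[OF h(1)] h(2) hl_pos[OF h(1)]
      by (auto simp: nonzero_paths_def nonzero_list_def)
    then show ?thesis using assms(3) by blast
  qed
  then show "finite ((f \<circ> pth) ` S)" by (intro finite_subset[OF _ finite_arcs]) auto
  show "inj_on (f \<circ> pth) S" by (rule inj_onI) (use assms(2) in auto)
qed

lemma H_hd:
  assumes "h \<in> H" "h' \<in> H" "tgt h = tgt h'" "hd (pth h) = hd (pth h')"
  shows "h = h'"
proof -
  obtain u t len where h: "hl u t len" "h = nh u t len" using H_cases[OF assms(1)] by blast
  have "tgt h' = t mod n" using nh_letter(2)[OF h(1)] h(2) assms(3) by simp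
  then obtain u' len' where h': "hl u' t len'" "h' = nh u' t len'" using H_at_target[OF assms(2)] by blast
  then show ?thesis using target_direction[OF h(1) h'(1)] nh_letter(4)[OF h(1)] nh_letter(4)[OF h'(1)] h assms(4) by simp
qed

lemma H_last:
  assumes "h \<in> H" "h' \<in> H" "src h = src h'" "last (pth h) = last (pth h')"
  shows "h = h'"
proof -
  obtain u t len where h: "hl u t len" "h = nh u t len" using H_cases[OF assms(1)] by blast
  have "src h' = pos u t len mod n" using nh_letter(3)[OF h(1)] h(2) assms(3) by simp
  then obtain u' t' len' where h': "hl u' t' len'" "h' = nh u' t' len'" "pos u' t' len' = pos u t len"
    using H_at_source[OF assms(2)] by blast
  then show ?thesis
    using source_direction[OF h(1) h'(1)] nh_letter(4)[OF h(1)] nh_letter(4)[OF h'(1)] h assms(4) by simp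
qed

lemma path_resolution_walk:
  "path_resolution Q I N vt m T V (position_degree I n \<sigma>) H src tgt pth (\<lambda>h. c (fst h)) gen \<zeta> \<theta>"
proof unfold_locales
  show "V t \<in> verts Q" if "t \<in> T" for t using that V_verts by (auto simp: T_def brk_def)
  show "position_degree I n \<sigma> t \<le> 0" if "t \<in> T" for t
    using depth_grading[unfolded grading_iff] degree_eq T_brk that by metis
next
  fix h assume h: "h \<in> H"
  then obtain u t len where l: "hl u t len" "h = nh u t len" using H_cases by blast
  note h' = nh_letter[OF l(1)]
  have b: "brk t" "brk (pos u t len)" using l by (auto simp: hl_def)
  show "src h \<in> T" "tgt h \<in> T" using T_mod b h' l by auto
  have "depth t = depth (pos u t len) + 1" using depth_grading[unfolded grading_iff] l by blast
  moreover have "depth (x mod n) = depth x" for x by (rule shift) (simp_all add: depth_periodic)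
  ultimately show "position_degree I n \<sigma> (tgt h) = position_degree I n \<sigma> (src h) + 1"
    using T_mod[OF b(1)] T_mod[OF b(2)] degree_eq T_brk h' l by metis
  show "(V (tgt h), pth h) \<in> nonzero_paths" using hl_nonzero(1)[OF l(1)] h' l by (simp add: V_mod)
  show "pth h \<noteq> []" using h' l hl_pos[OF l(1)] by simp
  show "path_end (V (tgt h)) (pth h) = V (src h)" using hl_nonzero(2)[OF l(1)] h' l by (simp add: V_mod)
  show "c (fst h) \<noteq> 0" by (rule scalars)
next
  show "finite {h \<in> H. tgt h = t}" for t by (rule finite_by_arrow[where f = hd]) (use H_hd in auto)
  show "finite {h \<in> H. src h = s}" for s by (rule finite_by_arrow[where f = last]) (use H_last in auto)
  show "h = h'" if "h \<in> H" "h' \<in> H" "tgt h = tgt h'" "hd (pth h) = hd (pth h')" for h h'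
    using H_hd that by blast
  show "h = h'" if "h \<in> H" "h' \<in> H" "src h = src h'" "last (pth h) = last (pth h')" for h h'
    using H_last that by blast
next
  fix t assume t: "t \<in> T" "position_degree I n \<sigma> t = 0"
  then have tW: "t \<in> W" using degree_zero_top top_W by blast
  show "act_path (V t, as) (gen t) = (\<lambda>i. if i = \<zeta> t as then \<theta> t as else 0)" if "(V t, as) \<in> nonzero_paths" for as
    using act_gen[OF tW] that by (auto simp: nonzero_paths_def nonzero_list_def)
  show "\<exists>h\<in>H. tgt h = t \<and> prefix (pth h) as" if as: "(V t, as) \<in> nonzero_paths" "\<theta> t as = 0" for as
  proof -
    have "\<exists>u len. hl u t len \<and> prefix (arrows u t len) as"
      using killed_prefix[of t as] degree_zero_top t as \<theta>_nonzero_iff by blast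
    then show ?thesis using dom_iff[of t as] T_brk[OF t(1)] by simp
  qed
next
  fix s as assume s: "s \<in> T" "position_degree I n \<sigma> s < 0" "(V s, as) \<in> nonzero_paths"
  then have b: "brk s" "s mod n = s" "\<not> top s" using T_brk degree_zero_top by force+
  show "(\<exists>h\<in>H. tgt h = s \<and> prefix (pth h) as) \<longleftrightarrow>
      \<not> (\<exists>h\<in>H. src h = s \<and> (V (tgt h), pth h @ as) \<in> nonzero_paths)"
    using exact_at_source[OF b(1,3) s(3)] dom_iff[of s as] ran_iff[OF s(3) b(1)] b(2) by simp
next
  fix h h' assume h: "h \<in> H" "h' \<in> H" "src h = src h'" "position_degree I n \<sigma> (src h) < - 1"
  show "h = h'"
  proof (rule ccontr)
    assume "h \<noteq> h'"
    then obtain k where k: "k \<in> W" "inc True k" "src h = k mod n" using fibre_pair_walk h by blast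
    have "src h \<in> T"
    proof -
      obtain u t len where l: "hl u t len" "h = nh u t len" using H_cases h by blast
      then show ?thesis using T_mod nh_letter(3)[OF l(1)] by (simp add: hl_def)
    qed
    then have "position_degree I n \<sigma> (src h) = depth (src h)" using degree_eq T_brk by blast
    also have "depth (src h) = depth k" unfolding k(3) by (rule shift) (simp_all add: depth_periodic)
    also have "\<dots> = -1" using k by (auto simp: depth_def top_def)
    finally show False using h by simp
  qed
next
  fix i assume "i \<in> N"
  then obtain k where k: "k \<in> W" "i = idx k" using N by auto
  show "(\<exists>t as. t \<in> T \<and> position_degree I n \<sigma> t = 0 \<and> \<not> (\<exists>h\<in>H. tgt h = t \<and> prefix (pth h) as) \<and>
             {(t, as). t \<in> T \<and> position_degree I n \<sigma> t = 0 \<and> (V t, as) \<in> nonzero_paths \<and> \<zeta> t as = i \<and> \<theta> t as \<noteq> 0} = {(t, as)}) \<or>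
          (\<exists>h\<in>H. \<exists>h'\<in>H. h \<noteq> h' \<and> src h = src h' \<and>
             {(t, as). t \<in> T \<and> position_degree I n \<sigma> t = 0 \<and> (V t, as) \<in> nonzero_paths \<and> \<zeta> t as = i \<and> \<theta> t as \<noteq> 0} =
               {(tgt h, pth h), (tgt h', pth h')} \<and>
             c (fst h) * \<theta> (tgt h) (pth h) + c (fst h') * \<theta> (tgt h') (pth h') = 0)"
    unfolding k(2) fibre_at[OF k(1)] by (rule fibre_cases_walk[OF k(1)])
next
  fix h h' assume h: "h \<in> H" "h' \<in> H" "h \<noteq> h'" "src h = src h'"
  then obtain k where k: "k \<in> W" "fib k = {(tgt h, pth h), (tgt h', pth h')}"
    "c (fst h) * \<theta> (tgt h) (pth h) + c (fst h') * \<theta> (tgt h') (pth h') = 0"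
    using fibre_pair_walk by blast
  show "\<exists>i\<in>N. {(t, as). t \<in> T \<and> position_degree I n \<sigma> t = 0 \<and> (V t, as) \<in> nonzero_paths \<and> \<zeta> t as = i \<and> \<theta> t as \<noteq> 0} =
               {(tgt h, pth h), (tgt h', pth h')} \<and>
             c (fst h) * \<theta> (tgt h) (pth h) + c (fst h') * \<theta> (tgt h') (pth h') = 0"
    by (rule bexI[of _ "idx k"], unfold fibre_at[OF k(1)]) (use k N in auto)
qed

text \<open>
  Only the letters starting at residues modulo \<open>n\<close> occur in the differential, so the scalars need
  not be periodic.
\<close>

theorem walk_projective_resolution:
  assumes "\<And>i. i mod n = i \<Longrightarrow> c\<^sub>0 i = c i"
  shows "projective_resolution \<Lambda> (complex_term Q I n \<sigma>) (complex_diff Q I n c\<^sub>0 \<sigma>) (rep_module N vt m)"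
proof -
  interpret res: path_resolution Q I N vt m T V "position_degree I n \<sigma>" H src tgt pth "\<lambda>h. c (fst h)" gen \<zeta> \<theta>
    by (rule path_resolution_walk)
  have "complex_term Q I n \<sigma> = res.term_at"
  proof
    fix d
    have "(if k \<in> endpoints I \<sigma> \<and> k mod n = k \<and> position_degree I n \<sigma> k = d then proj_at Q I (vtx \<sigma> k) else {\<zero>\<^bsub>\<Lambda>\<^esub>}) =
      (if k \<in> T \<and> position_degree I n \<sigma> k = d then proj_at Q I (V k) else {\<zero>\<^bsub>\<Lambda>\<^esub>})" for k
      using vtx[of k] by (auto simp: endpoints_eq T_def brk_def)
    then show "complex_term Q I n \<sigma> d = res.term_at d"
      by (simp add: complex_term_def res.term_at_def)
  qed
  moreover have "res.D u = complex_diff Q I n c\<^sub>0 \<sigma> d u" if u: "u \<in> carrier (res.term_at d)" for d u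
  proof
    fix t
    have set: "{(i, j). homotopy_letter I \<sigma> i j \<and> i mod n = i \<and> comp_target \<sigma> (i, j) mod n = t} = {h \<in> H. tgt h = t}"
      by (auto simp: H_def tgt_def)
    have path: "path_class Q I (c\<^sub>0 (fst h)) (seg_path \<sigma> (fst h) (snd h)) = path_class Q I (c (fst h)) (V (tgt h), pth h)"
      if h: "h \<in> H" for h
    proof -
      obtain i j where ij: "h = (i, j)" "homotopy_letter I \<sigma> i j" "i mod n = i" using h by (auto simp: H_def)
      then obtain v where v: "i < j" "hl v (start v i j) (nat (j - i))" by (auto simp: homotopy_letter_iff)
      have "is_Dir (lett \<sigma> i) = v" by (rule run_direction[OF hl_run[OF v(2)]])
      moreover have "start v i j \<in> E" using v(2) by (simp add: hl_def brk_def)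
      ultimately have "fst (seg_path \<sigma> i j) = V (start v i j)"
        by (cases v) (simp_all add: seg_path_def vtx Let_def)
      moreover have "tgt h = start v i j mod n"
        using \<open>is_Dir (lett \<sigma> i) = v\<close> ij by (cases v) (simp_all add: tgt_def comp_target_def)
      ultimately have "seg_path \<sigma> i j = (V (tgt h), pth h)"
        by (simp add: V_mod pth_def ij(1) prod_eq_iff)
      then show ?thesis using ij assms by simp
    qed
    show "res.D u t = complex_diff Q I n c\<^sub>0 \<sigma> d u t"
      unfolding complex_diff_def res.D_def set src_def[symmetric]
    proof (rule res.\<Lambda>.finsum_cong'[OF refl])
      show "(\<lambda>h. u (src h) \<otimes>\<^bsub>\<Lambda>\<^esub> path_class Q I (c\<^sub>0 (fst h)) (seg_path \<sigma> (fst h) (snd h)))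
          \<in> {h \<in> H. tgt h = t} \<rightarrow> carrier \<Lambda>"
        using res.D_term_closed res.term_at_carrier[OF u] path by auto
    qed (use path in auto)
  qed
  ultimately show ?thesis
    using projective_resolution_cong[OF res.is_projective_resolution, of "complex_diff Q I n c\<^sub>0 \<sigma>"] by simp
qed

end

section \<open>Strings and bands as sided walks\<close>

context gentle_algebra
begin

text \<open>
  As \<open>I\<close> is generated by paths of length two, a walk is a string if and only if no two consecutive
  letters form a zero relation.
\<close>

fun pair_ok :: "'a letter \<Rightarrow> 'a letter \<Rightarrow> bool" where
  "pair_ok (Dir a) (Dir b) \<longleftrightarrow> \<not> rel a b"
| "pair_ok (Inv a) (Inv b) \<longleftrightarrow> \<not> rel b a"
| "pair_ok _ _ \<longleftrightarrow> True"

lemma rel_composable: "rel a b \<Longrightarrow> a \<in> arcs Q \<and> b \<in> arcs Q \<and> head Q a = tail Q b"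
proof -
  assume "rel a b"
  then have "path_elem (1 :: 'k) (tail Q a, [a, b]) \<in> carrier kQ"
    by (simp add: rel_def path_in_def I_iff)
  then have "(tail Q a, [a, b]) \<in> qpaths Q" by (auto simp: kQ_carrier path_elem_def)
  then show ?thesis by (simp add: qpaths_Cons)
qed

lemma string_pair:
  assumes "is_string Q I (x, ws)" "Suc i < length ws"
  shows "pair_ok (ws ! i) (ws ! Suc i)"
proof -
  have ws: "ws = take i ws @ [ws ! i, ws ! Suc i] @ drop (Suc (Suc i)) ws"
    using assms(2) by (metis Cons_nth_drop_Suc Suc_lessD append_Cons append_Nil append_take_drop_id)
  have s: "\<not> path_in Q I as" if "as \<noteq> []" "ws = us @ map Dir as @ vs \<or> ws = us @ map Inv (rev as) @ vs" for us as vs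
    using assms(1) that unfolding is_string.simps by blast
  show ?thesis
  proof (cases "ws ! i"; cases "ws ! Suc i")
    fix a b assume *: "ws ! i = Dir a" "ws ! Suc i = Dir b"
    then have "\<not> path_in Q I [a, b]" by (intro s[of _ "take i ws" "drop (Suc (Suc i)) ws"]) (use ws in auto)
    then show ?thesis using * by (simp add: rel_def)
  next
    fix a b assume *: "ws ! i = Inv a" "ws ! Suc i = Inv b"
    then have "\<not> path_in Q I [b, a]" by (intro s[of _ "take i ws" "drop (Suc (Suc i)) ws"]) (use ws in auto)
    then show ?thesis using * by (simp add: rel_def)
  qed auto
qed

lemma stringI:
  assumes walk: "is_walk Q (x, ws)" and ok: "\<And>i. Suc i < length ws \<Longrightarrow> pair_ok (ws ! i) (ws ! Suc i)"
  shows "is_string Q I (x, ws)"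
proof -
  have arcs: "arr (ws ! i) \<in> arcs Q" if "i < length ws" for i using walk that by auto
  have next_vtx: "src Q (ws ! Suc i) = tgt Q (ws ! i)" if "Suc i < length ws" for i using walk that by auto
  have nz: "\<not> path_in Q I as" if ne: "as \<noteq> []" and l: "nonzero_list as" for as
  proof -
    have "(tail Q (hd as), as) \<in> nonzero_paths" using ne l by (cases as) (auto simp: nonzero_paths_def nonzero_list_def)
    then show ?thesis using path_in_iff[OF ne] l nonzero_paths_subset by auto
  qed
  have "nonzero_list as" if eq: "ws = us @ map Dir as @ vs" for us as vs
    unfolding nonzero_list_def
  proof
    show "set as \<subseteq> arcs Q" using walk eq by (auto simp: image_Un image_image)
    show "successively (\<lambda>a b. head Q a = tail Q b \<and> \<not> rel a b) as"
      unfolding successively_conv_nth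
    proof (intro allI impI)
      fix i assume i: "Suc i < length as"
      have "ws ! (length us + i) = Dir (as ! i)" "ws ! Suc (length us + i) = Dir (as ! Suc i)"
        using i eq by (simp_all add: nth_append)
      then show "head Q (as ! i) = tail Q (as ! Suc i) \<and> \<not> rel (as ! i) (as ! Suc i)"
        using ok[of "length us + i"] next_vtx[of "length us + i"] i eq by simp
    qed
  qed
  moreover have "nonzero_list as" if eq: "ws = us @ map Inv (rev as) @ vs" for us as vs
    unfolding nonzero_list_def
  proof
    show "set as \<subseteq> arcs Q" using walk eq by (auto simp: image_Un image_image)
    show "successively (\<lambda>a b. head Q a = tail Q b \<and> \<not> rel a b) as"
      unfolding successively_conv_nth
    proof (intro allI impI)
      fix i assume i: "Suc i < length as"
      define j where "j = length as - Suc (Suc i)"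
      let ?j = "length us + j"
      have j: "Suc j < length as" "length as - Suc j = Suc i" "length as - Suc (Suc j) = i"
        using i by (auto simp: j_def)
      have nth: "ws ! (length us + k) = Inv (as ! (length as - Suc k))" if "k < length as" for k
        using that by (simp add: eq nth_append rev_nth)
      have "ws ! ?j = Inv (as ! Suc i)" "ws ! Suc ?j = Inv (as ! i)"
        using nth[of j] nth[of "Suc j"] j by simp_all
      moreover have "Suc ?j < length ws" using j eq by simp
      ultimately show "head Q (as ! i) = tail Q (as ! Suc i) \<and> \<not> rel (as ! i) (as ! Suc i)"
        using ok[of ?j] next_vtx[of ?j] by simp
    qed
  qed
  ultimately show ?thesis using walk nz by auto
qed

lemma proper_walkI:
  assumes V: "\<And>k. k \<in> W \<union> E \<Longrightarrow> V k \<in> verts Q"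
    and letter: "\<And>k. \<lbrakk>k \<in> W \<union> E; k + 1 \<in> W \<union> E\<rbrakk> \<Longrightarrow>
          arr (L k) \<in> arcs Q \<and> src Q (L k) = V k \<and> tgt Q (L k) = V (k + 1)"
    and nobt: "\<And>k. \<lbrakk>k - 1 \<in> W \<union> E; k \<in> W \<union> E; k + 1 \<in> W \<union> E\<rbrakk> \<Longrightarrow> L k \<noteq> bar (L (k - 1))"
    and convex: "\<And>i j k. \<lbrakk>i \<in> E; j \<in> E; i \<le> k; k \<le> j\<rbrakk> \<Longrightarrow> k \<in> E"
    and ok: "\<And>k. \<lbrakk>k - 1 \<in> W; k \<in> W; k + 1 \<in> W\<rbrakk> \<Longrightarrow> pair_ok (L (k - 1)) (L k)"
  shows "proper_walk Q I L V E W"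
proof -
  interpret sided_walk Q I L V E W by unfold_locales
  show ?thesis
  proof unfold_locales
    show "V k \<in> verts Q" if "k \<in> P" for k using V that by blast
    show "k \<in> E" if "i \<in> E" "j \<in> E" "i \<le> k" "k \<le> j" for i j k using convex that by blast
    show "ar u k \<in> arcs Q \<and> tail Q (ar u k) = V k \<and> head Q (ar u k) = V (k + sg u)"
      if "k \<in> P" "k + sg u \<in> P" "ot u k" for k u
      using letter[of k] letter[of "k - 1"] that
      by (cases u; cases "L k"; cases "L (k - 1)") (auto simp: ar_def ot_def)
    show "ar True k \<noteq> ar False k" if "k \<in> P" "k + 1 \<in> P" "k - 1 \<in> P" "ot True k = ot False k" for k
      using nobt[of k] that by (cases "L k"; cases "L (k - 1)") (auto simp: ar_def ot_def)
    show "\<not> rel (ar u (k - sg u)) (ar u k)" if "winc u k" "k + sg u \<in> W" "ot u k" for u k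
      using ok[of k] that by (cases u; cases "L k"; cases "L (k - 1)") (auto simp: ar_def ot_def winc_def)
  qed
qed

end

text \<open>
  String and band modules have the same matrices locally: the letter of the walk at \<open>k\<close> connects
  the basis elements at \<open>k\<close> and \<open>k + 1\<close>. As the walk does not turn back, an arrow moves a basis
  element along at most one letter.
\<close>

context proper_walk
begin

lemma matrix_walk:
  assumes N: "N = idx ` W" "finite N" and vt: "\<And>k. k \<in> W \<Longrightarrow> vt (idx k) = V k"
    and m: "\<And>a i k. \<lbrakk>k \<in> W; i \<in> N\<rbrakk> \<Longrightarrow> m a i (idx k) =
      (if k + 1 \<in> W \<and> L k = Dir a \<and> i = idx (k + 1) then \<kappa> k else 0) +
      (if k - 1 \<in> W \<and> L (k - 1) = Inv a \<and> i = idx (k - 1) then 1 else (0 :: 'k))"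
  shows "\<lbrakk>a \<in> arcs Q; i \<in> N; j \<in> N; m a i j \<noteq> 0\<rbrakk> \<Longrightarrow> vt j = tail Q a \<and> vt i = head Q a"
    and "\<lbrakk>k \<in> W; k + sg u \<in> W; ot u k\<rbrakk> \<Longrightarrow>
          arrow_action N m (ar u k) (\<lambda>i. if i = idx k then 1 else 0) =
            (\<lambda>i. if i = idx (k + sg u) then (if u then \<kappa> k else 1) else 0)"
    and "\<lbrakk>k \<in> W; a \<in> arcs Q; \<And>u. \<not> (k + sg u \<in> W \<and> ot u k \<and> ar u k = a)\<rbrakk> \<Longrightarrow>
          arrow_action N m a (\<lambda>i. if i = idx k then 1 else 0) = (\<lambda>i. 0)"
proof -
  have up: "L k = Dir a \<longleftrightarrow> ot True k \<and> ar True k = a" for k a by (cases "L k") (auto simp: ot_def ar_def)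
  have down: "L (k - 1) = Inv a \<longleftrightarrow> ot False k \<and> ar False k = a" for k a by (cases "L (k - 1)") (auto simp: ot_def ar_def)
  have m': "m a i (idx k) = (if k + 1 \<in> W \<and> ot True k \<and> ar True k = a \<and> i = idx (k + 1) then \<kappa> k else 0) +
      (if k - 1 \<in> W \<and> ot False k \<and> ar False k = a \<and> i = idx (k - 1) then 1 else 0)" if "k \<in> W" "i \<in> N" for a i k
    using m[OF that] up down by simp
  show "vt j = tail Q a \<and> vt i = head Q a" if a: "a \<in> arcs Q" "i \<in> N" "j \<in> N" "m a i j \<noteq> 0"
  proof -
    obtain k where k: "k \<in> W" "j = idx k" using a N by auto
    have "\<exists>u. k + sg u \<in> W \<and> ot u k \<and> ar u k = a \<and> i = idx (k + sg u)"
    proof (cases "k + 1 \<in> W \<and> ot True k \<and> ar True k = a \<and> i = idx (k + 1)")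
      case True
      then show ?thesis by (intro exI[of _ True]) simp
    next
      case False
      then have "k - 1 \<in> W \<and> ot False k \<and> ar False k = a \<and> i = idx (k - 1)"
        using a(4) m'[OF k(1) a(2), of a] k(2) by (simp split: if_splits)
      then show ?thesis by (intro exI[of _ False]) simp
    qed
    then obtain u where u: "k + sg u \<in> W" "ot u k" "ar u k = a" "i = idx (k + sg u)" by blast
    then show ?thesis using arrow[of k u] k vt by auto
  qed
  have act: "arrow_action N m a (\<lambda>i. if i = idx k then 1 else 0) = (\<lambda>i. if i \<in> N then m a i (idx k) else 0)"
    if "k \<in> W" for a k
  proof
    fix i
    have "idx k \<in> N" using that N by auto
    then show "arrow_action N m a (\<lambda>i. if i = idx k then 1 else 0) i = (if i \<in> N then m a i (idx k) else 0)"
      using N(2) by (simp add: arrow_action_def if_distrib[of "(*) _"] cong: if_cong)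
  qed
  show "arrow_action N m (ar u k) (\<lambda>i. if i = idx k then 1 else 0) =
      (\<lambda>i. if i = idx (k + sg u) then (if u then \<kappa> k else 1) else 0)"
    if k: "k \<in> W" "k + sg u \<in> W" "ot u k"
  proof
    fix i
    have N': "idx (k + sg u) \<in> N" using k N by auto
    have "\<not> (k - sg u \<in> W \<and> ot (\<not> u) k \<and> ar (\<not> u) k = ar u k)"
      using no_backtrack'[of k u] k by auto
    then have "m (ar u k) i (idx k) = (if i = idx (k + sg u) then (if u then \<kappa> k else 1) else 0)" if "i \<in> N"
      using m'[OF k(1) that, of "ar u k"] k by (cases u) auto
    then show "arrow_action N m (ar u k) (\<lambda>i. if i = idx k then 1 else 0) i =
      (if i = idx (k + sg u) then (if u then \<kappa> k else 1) else 0)"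
      using act[OF k(1)] N' by auto
  qed
  show "arrow_action N m a (\<lambda>i. if i = idx k then 1 else 0) = (\<lambda>i. 0)"
    if k: "k \<in> W" "a \<in> arcs Q" and no: "\<And>u. \<not> (k + sg u \<in> W \<and> ot u k \<and> ar u k = a)"
  proof -
    have "m a i (idx k) = 0" if "i \<in> N" for i
      using m'[OF k(1) that, of a] no[of True] no[of False] by auto
    then show ?thesis using act[OF k(1)] by auto
  qed
qed

end

section \<open>Bands\<close>

text \<open>
  A band of length \<open>n\<close>, unrolled to an \<open>n\<close>-periodic walk. It has no ends: all integers are
  positions of the homotopy string as well as of basis elements.
\<close>

locale band = gentle_algebra Q I
  for Q :: "('v, 'a) pre_digraph" and I :: "(('v, 'a) qpath \<Rightarrow> 'k::alg_closed_field) set" +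
  fixes x :: 'v and ws :: "'a letter list"
  assumes band: "is_band Q I (x, ws)"
begin

abbreviation n :: int where "n \<equiv> int (length ws)"
definition ix :: "int \<Rightarrow> nat" where "ix k = nat (k mod n)"
definition L :: "int \<Rightarrow> 'a letter" where "L k = ws ! ix k"
definition V :: "int \<Rightarrow> 'v" where "V k = wvtx Q (x, ws) (ix k)"

lemma n_pos: "n > 0" "ws \<noteq> []"
  using band by auto

lemma ix_less: "ix k < length ws"
  using n_pos by (simp add: ix_def nat_less_iff)

lemma ix_int: "int (ix k) = k mod n"
  using n_pos by (simp add: ix_def)

lemma ix_eq_iff: "ix k = ix k' \<longleftrightarrow> k mod n = k' mod n"
  using ix_int[of k] ix_int[of k'] by (metis of_nat_eq_iff)

lemma ix_of_nat: "i < length ws \<Longrightarrow> ix (int i) = i"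
  by (simp add: ix_def)

lemma ix_Suc: "ix (k + 1) = Suc (ix k) mod length ws"
proof -
  have "int (Suc (ix k) mod length ws) = (int (ix k) + 1) mod n" by (simp add: zmod_int add.commute)
  also have "\<dots> = (k + 1) mod n" by (simp add: ix_int mod_simps)
  also have "\<dots> = int (ix (k + 1))" by (simp add: ix_int)
  finally show ?thesis by linarith
qed

lemma ix_succ_iff: "j < length ws \<Longrightarrow> Suc j mod length ws = ix k \<longleftrightarrow> j = ix (k - 1)"
proof -
  assume j: "j < length ws"
  have "Suc j mod length ws = ix (int j + 1)" using ix_Suc[of "int j"] ix_of_nat[OF j] by simp
  then have "Suc j mod length ws = ix k \<longleftrightarrow> (int j + 1) mod n = k mod n" by (simp add: ix_eq_iff)
  also have "\<dots> \<longleftrightarrow> int j mod n = (k - 1) mod n"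
    by (simp add: mod_eq_dvd_iff algebra_simps)
  also have "\<dots> \<longleftrightarrow> j = ix (k - 1)" using ix_of_nat[OF j] ix_eq_iff[of "int j" "k - 1"] by simp
  finally show ?thesis .
qed

lemma string: "is_string Q I (x, ws)"
  using band unfolding is_band.simps by (rule conjunct1)

lemma walk: "is_walk Q (x, ws)"
  using string unfolding is_string.simps by (rule conjunct1)

lemma letters: "arr (L k) \<in> arcs Q" "src Q (L k) = V k" "tgt Q (L k) = V (k + 1)"
proof -
  show "arr (L k) \<in> arcs Q" "src Q (L k) = V k" using walk ix_less[of k] by (auto simp: L_def V_def)
  show "tgt Q (L k) = V (k + 1)"
  proof (cases "Suc (ix k) = length ws")
    case True
    then have "wvtx Q (x, ws) (length ws) = x" using band by simp
    then have "tgt Q (ws ! ix k) = x" using True by (metis wvtx.simps(2))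
    then show ?thesis using True by (simp add: L_def V_def ix_Suc)
  next
    case False
    then have "ix (k + 1) = Suc (ix k)" using ix_Suc[of k] ix_less[of k] by simp
    then show ?thesis by (simp add: L_def V_def)
  qed
qed

lemma consecutive: "L (k + 1) \<noteq> bar (L k)" "pair_ok (L k) (L (k + 1))"
proof -
  have "L (k + 1) \<noteq> bar (L k) \<and> pair_ok (L k) (L (k + 1))"
  proof (cases "Suc (ix k) = length ws")
    case True
    then have l: "L k = last ws" "L (k + 1) = hd ws"
    proof -
      have "ix k = length ws - 1" using True by simp
      then show "L k = last ws" using n_pos by (simp add: L_def last_conv_nth)
      show "L (k + 1) = hd ws" using n_pos True by (simp add: L_def ix_Suc hd_conv_nth)
    qed
    have b: "hd ws \<noteq> bar (last ws)" "is_string Q I (src Q (last ws), [last ws, hd ws])"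
      using band unfolding is_band.simps by blast+
    have "pair_ok (last ws) (hd ws)" using string_pair[OF b(2), of 0] by simp
    then show ?thesis using l b(1) by simp
  next
    case False
    then have s: "ix (k + 1) = Suc (ix k)" "Suc (ix k) < length ws" using ix_Suc[of k] ix_less[of k] by simp_all
    then show ?thesis using walk string_pair[OF string s(2)] by (simp add: L_def)
  qed
  then show "L (k + 1) \<noteq> bar (L k)" "pair_ok (L k) (L (k + 1))" by auto
qed

sublocale hwalk_view Q I L V UNIV UNIV "unroll Q (x, ws)"
proof -
  have *: "proper_walk Q I L V UNIV UNIV"
  proof (rule proper_walkI)
    show "V k \<in> verts Q" for k
      using letters(1,2)[of k] tail_in_verts head_in_verts by (cases "L k") fastforce+
  qed (use letters consecutive[of "_ - 1"] in auto)
  show "hwalk_view Q I L V UNIV UNIV (unroll Q (x, ws))"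
    by (intro hwalk_view.intro * hwalk_view_axioms.intro) (auto simp: L_def V_def ix_def Let_def)
qed

text \<open>
  Going once around the band, the recursion for \<open>\<eta>\<close> multiplies by a sign \<open>s\<close>, by \<open>\<mu>\<close> for the
  marked direct letter of the module, and by \<open>\<nu>\<close> or \<open>1 / \<nu>\<close> for the marked component of the
  complex, according to its direction. A periodic solution exists if the product is \<open>1\<close>, which
  determines \<open>\<nu> = \<phi> \<mu>\<close>.
\<close>

lemma band_resolution:
  assumes r: "r < length ws" "is_Dir (ws ! r)" and q: "band_component Q I (x, ws) q"
  shows "\<exists>\<phi>. bij_betw \<phi> {\<mu>::'k. \<mu> \<noteq> 0} {\<nu>. \<nu> \<noteq> 0} \<and> (\<forall>\<mu>. \<mu> \<noteq> 0 \<longrightarrow>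
    projective_resolution \<Lambda> (band_complex Q I (x, ws)) (band_complex_diff Q I (x, ws) q (\<phi> \<mu>))
      (band_module Q (x, ws) r \<mu>))"
proof -
  have q_brk: "brk q" and q_range: "0 \<le> q" "q < n"
    using q homotopy_letter_brk by (auto simp: band_component_def)
  define s :: 'k where "s = (\<Prod>j<length ws. if ot True (int j) then 1 else if brk (int j) then -1 else 1)"
  have s: "s \<noteq> 0" by (simp add: s_def)
  define \<phi> where "\<phi> \<mu> = (if ot True q then 1 / (s * \<mu>) else s * \<mu>)" for \<mu> :: 'k
  have "bij_betw \<phi> {\<mu>. \<mu> \<noteq> 0} {\<nu>. \<nu> \<noteq> 0}"
    by (rule bij_betw_byWitness[where f' = "\<lambda>\<nu>. if ot True q then 1 / (s * \<nu>) else \<nu> / s"])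
      (use s in \<open>auto simp: \<phi>_def\<close>)
  moreover have "projective_resolution \<Lambda> (band_complex Q I (x, ws)) (band_complex_diff Q I (x, ws) q (\<phi> \<mu>))
      (band_module Q (x, ws) r \<mu>)" if \<mu>: "\<mu> \<noteq> 0" for \<mu>
  proof -
    define \<nu> where "\<nu> = \<phi> \<mu>"
    have \<nu>: "\<nu> \<noteq> 0" using s \<mu> by (simp add: \<nu>_def \<phi>_def)
    define c where "c k = (if k mod n = q then \<nu> else 1)" for k
    define \<kappa> where "\<kappa> k = (if k mod n = int r then \<mu> else 1)" for k
    \<comment> \<open>the factor of the recursion at each step\<close>
    define \<rho> where "\<rho> k = (if ot True k then \<kappa> k * (if brk k then c k else 1) else if brk k then - 1 / c k else 1)" for k
    define \<eta> where "\<eta> k = (\<Prod>j<ix k. \<rho> (int j))" for k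
    have per: "L (k + n) = L k" "V (k + n) = V k" "c (k + n) = c k" "\<kappa> (k + n) = \<kappa> k" "\<eta> (k + n) = \<eta> k" for k
      by (simp_all add: L_def V_def c_def \<kappa>_def \<eta>_def ix_def)
    have ar_per: "ar u (k + n) = ar u k" "ot u (k + n) = ot u k" for u k
      using per(1)[of k] per(1)[of "k - 1"] by (simp_all add: ar_def ot_def algebra_simps)
    have "thr u (k + n) = thr u k" for u k
      using ar_per[of u k] ar_per[of u "k - sg u"] by (simp add: thr_def inc_def out_def algebra_simps)
    then have brk_per: "brk (k + n) = brk k" for k by (simp add: brk_def)
    have total: "(\<Prod>j<length ws. \<rho> (int j)) = 1"
    proof -
      have "\<rho> (int j) = (if ot True (int j) then 1 else if brk (int j) then -1 else 1) *
          (if j = r then \<mu> else 1) * (if j = nat q then (if ot True q then \<nu> else 1 / \<nu>) else 1)"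
        if j: "j < length ws" for j
      proof -
        have "j = r \<Longrightarrow> ot True (int j)" using r by (simp add: ot_def L_def ix_of_nat)
        moreover have "c (int j) = (if j = nat q then \<nu> else 1)" "\<kappa> (int j) = (if j = r then \<mu> else 1)"
          using j q_range by (auto simp: c_def \<kappa>_def)
        ultimately show ?thesis using q_brk q_range by (auto simp: \<rho>_def)
      qed
      then have "(\<Prod>j<length ws. \<rho> (int j)) = s * (\<Prod>j<length ws. if j = r then \<mu> else 1) *
          (\<Prod>j<length ws. if j = nat q then (if ot True q then \<nu> else 1 / \<nu>) else 1)"
        unfolding s_def prod.distrib[symmetric] by (intro prod.cong) auto
      also have "\<dots> = s * \<mu> * (if ot True q then \<nu> else 1 / \<nu>)"
        using r q_range by (simp add: prod.delta nat_less_iff)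
      also have "\<dots> = 1" using s \<mu> by (simp add: \<nu>_def \<phi>_def)
      finally show ?thesis .
    qed
    have \<rho>_per: "\<rho> (int (ix k)) = \<rho> k" for k
    proof -
      have *: "\<rho> (k + n) = \<rho> k" for k by (simp add: \<rho>_def per ar_per brk_per)
      have "\<rho> (k + n * int z) = \<rho> k" for k z
      proof (induction z)
        case (Suc z)
        have "k + n * int (Suc z) = (k + n * int z) + n" by (simp add: algebra_simps)
        then show ?case using Suc * by (simp only:)
      qed simp
      note mult = this
      show ?thesis
      proof (cases "k div n \<ge> 0")
        case True
        then show ?thesis using mult[of "k mod n" "nat (k div n)"] by (simp add: ix_int mult.commute)
      next
        case False
        then have "k + n * int (nat (- (k div n))) = k mod n" by (simp add: minus_div_mult_eq_mod[symmetric] algebra_simps)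
        then show ?thesis using mult[of k "nat (- (k div n))"] by (simp add: ix_int)
      qed
    qed
    have \<eta>_step: "\<eta> (k + 1) = \<rho> k * \<eta> k" for k
    proof (cases "Suc (ix k) = length ws")
      case True
      then have "\<eta> (k + 1) = 1" by (simp add: \<eta>_def ix_Suc)
      also have "\<dots> = (\<Prod>j<Suc (ix k). \<rho> (int j))" using total True by simp
      also have "\<dots> = \<rho> k * \<eta> k" by (simp add: \<eta>_def \<rho>_per)
      finally show ?thesis .
    next
      case False
      then have "ix (k + 1) = Suc (ix k)" using ix_Suc[of k] ix_less[of k] by simp
      then show ?thesis by (simp add: \<eta>_def \<rho>_per)
    qed
    define m where "m = (\<lambda>a i j. \<Sum>k<length ws.
        (if ws ! k = Dir a \<and> j = k \<and> i = Suc k mod length ws then (if k = r then \<mu> else 1) else 0) +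
        (if ws ! k = Inv a \<and> j = Suc k mod length ws \<and> i = k then 1 else 0))"
    have m: "m a i (ix k) = (if k + 1 \<in> UNIV \<and> L k = Dir a \<and> i = ix (k + 1) then \<kappa> k else 0) +
      (if k - 1 \<in> UNIV \<and> L (k - 1) = Inv a \<and> i = ix (k - 1) then 1 else 0)"
      if "i \<in> {0..<length ws}" for a i k
    proof -
      have "m a i (ix k) = (\<Sum>j<length ws. if j = ix k then (if L k = Dir a \<and> i = ix (k + 1) then \<kappa> k else 0) else 0) +
        (\<Sum>j<length ws. if j = ix (k - 1) then (if L (k - 1) = Inv a \<and> i = ix (k - 1) then 1 else 0) else 0)"
        unfolding m_def sum.distrib[symmetric]
      proof (rule sum.cong)
        fix j assume "j \<in> {..<length ws}"
        then have j: "j < length ws" by simp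
        have "ix k = Suc j mod length ws \<longleftrightarrow> j = ix (k - 1)" using ix_succ_iff[OF j, of k] by auto
        moreover have "ix k = r \<longleftrightarrow> k mod n = int r" using ix_int[of k] by auto
        ultimately show "(if ws ! j = Dir a \<and> ix k = j \<and> i = Suc j mod length ws then (if j = r then \<mu> else 1) else 0) +
          (if ws ! j = Inv a \<and> ix k = Suc j mod length ws \<and> i = j then 1 else 0) =
          (if j = ix k then (if L k = Dir a \<and> i = ix (k + 1) then \<kappa> k else 0) else 0) +
          (if j = ix (k - 1) then (if L (k - 1) = Inv a \<and> i = ix (k - 1) then 1 else 0) else 0)"
          by (auto simp: L_def ix_Suc \<kappa>_def)
      qed simp
      then show ?thesis using ix_less by simp
    qed
    have N: "{0..<length ws} = ix ` UNIV"
      using ix_less ix_of_nat by (auto simp: image_iff) metis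
    have vt: "wvtx Q (x, ws) (ix k) = V k" for k by (simp add: V_def)
    have "walk_resolution Q I L V UNIV UNIV (unroll Q (x, ws)) n {0..<length ws} (wvtx Q (x, ws)) m ix c \<kappa> \<eta> (\<lambda>_. 0)"
    proof unfold_locales
      show "c k \<noteq> 0" "\<kappa> k \<noteq> 0" for k using \<mu> \<nu> by (auto simp: c_def \<kappa>_def)
      then show "\<eta> k \<noteq> 0" for k by (auto simp: \<eta>_def \<rho>_def)
      show "\<eta> (k + 1) = (if ot True k then \<kappa> k * (if brk k then c k else 1) else if brk k then - 1 / c k else 1) * \<eta> k" for k
        using \<eta>_step[of k] by (simp add: \<rho>_def)
      show "inc u k \<Longrightarrow> inc (\<not> u) k \<or> thr u k" for u k
        using W_string[of u k] ot_flip(1)[of u k] by (auto simp: inc_def winc_def thr_def out_def)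
      show "inc u k \<longleftrightarrow> winc u k" for u k by (simp add: inc_def winc_def)
      show "inc u k \<Longrightarrow> out u k \<Longrightarrow> rel (ar u (k - sg u)) (ar u k) \<Longrightarrow>
          out u (k + sg u) \<and> rel (ar u k) (ar u (k + sg u))" for u k
        using W_string[of u k] by (auto simp: inc_def winc_def out_def)
      note matrix = matrix_walk[where idx = ix and N = "{0..<length ws}" and vt = "wvtx Q (x, ws)" and m = m and \<kappa> = \<kappa>,
          OF N finite_atLeastLessThan vt m]
      show "a \<in> arcs Q \<Longrightarrow> i \<in> {0..<length ws} \<Longrightarrow> j \<in> {0..<length ws} \<Longrightarrow> m a i j \<noteq> 0 \<Longrightarrow>
          wvtx Q (x, ws) j = tail Q a \<and> wvtx Q (x, ws) i = head Q a" for a i j by (rule matrix(1))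
      show "ot u k \<Longrightarrow> arrow_action {0..<length ws} m (ar u k) (\<lambda>i. if i = ix k then 1 else 0) =
          (\<lambda>i. if i = ix (k + sg u) then if u then \<kappa> k else 1 else 0)" for u k by (rule matrix(2)) auto
      show "a \<in> arcs Q \<Longrightarrow> (\<And>u. \<not> (k + sg u \<in> UNIV \<and> ot u k \<and> ar u k = a)) \<Longrightarrow>
          arrow_action {0..<length ws} m a (\<lambda>i. if i = ix k then 1 else 0) = (\<lambda>i. 0)" for a k by (rule matrix(3)) auto
      show "{0..<length ws} = range ix" by (rule N)
    qed (simp_all add: per vt ix_eq_iff)
    then have "projective_resolution \<Lambda> (complex_term Q I n (unroll Q (x, ws)))
        (complex_diff Q I n (\<lambda>i. if i = q then \<nu> else 1) (unroll Q (x, ws)))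
        (rep_module {0..<length ws} (wvtx Q (x, ws)) m)"
      by (rule walk_resolution.walk_projective_resolution) (simp add: c_def)
    then show ?thesis
      unfolding m_def \<nu>_def band_module.simps snd_conv .
  qed
  ultimately show ?thesis by blast
qed

end

section \<open>Strings and their tails\<close>

text \<open>
  The data of a string \<open>w\<close> with the direct tail \<open>f\<close> and the inverse tail \<open>g\<close> (of lengths \<open>N\<close> and
  \<open>M\<close>), where the letters before \<open>i0\<close> and from \<open>j0\<close> on are removed. Positions are those of the
  homotopy string, so that the position \<open>k\<close> is the basis element \<open>k + i0\<close> of the string module.

  A tail of length \<open>0\<close> means that there is no arrow by which the string could be extended on that
  side. Then outer letters are removed (\<open>f_none\<close>, \<open>g_none\<close>), and each arrow \<open>b\<close> starting at the
  end of the string either would reverse its last letter or has a zero relation with it (\<open>f_end\<close>,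
  \<open>g_end\<close>). For a trivial string the only such arrow \<open>b\<close> is the one used for the tail on the other
  side.
\<close>

locale pi_string = gentle_algebra Q I
  for Q :: "('v, 'a) pre_digraph" and I :: "(('v, 'a) qpath \<Rightarrow> 'k::alg_closed_field) set" +
  fixes x :: 'v and ws :: "'a letter list" and i0 j0 :: nat and N M :: enat and f g :: "nat \<Rightarrow> 'a"
  assumes string: "is_string Q I (x, ws)"
    and i0_j0: "i0 \<le> j0" "j0 \<le> length ws"
    and f_arcs: "enat i < N \<Longrightarrow> f i \<in> arcs Q" and f_rel: "enat (Suc i) < N \<Longrightarrow> rel (f i) (f (Suc i))"
    and f_max: "N = enat (Suc i) \<Longrightarrow> \<not> rel (f i) b"
    and g_arcs: "enat i < M \<Longrightarrow> g i \<in> arcs Q" and g_rel: "enat (Suc i) < M \<Longrightarrow> rel (g i) (g (Suc i))"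
    and g_max: "M = enat (Suc i) \<Longrightarrow> \<not> rel (g i) b"
    and f_start: "N \<noteq> 0 \<Longrightarrow> j0 = length ws \<and> tail Q (f 0) = wvtx Q (x, ws) (length ws)"
    and f_ok: "\<lbrakk>N \<noteq> 0; ws \<noteq> []\<rbrakk> \<Longrightarrow> last ws \<noteq> Inv (f 0) \<and> pair_ok (last ws) (Dir (f 0))"
    and f_none: "N = 0 \<Longrightarrow> (\<forall>i. j0 \<le> i \<and> i < length ws \<longrightarrow> is_Dir (ws ! i)) \<and> (0 < j0 \<longrightarrow> is_Inv (ws ! (j0 - 1)))"
    and f_end: "\<lbrakk>N = 0; b \<in> arcs Q; tail Q b = wvtx Q (x, ws) (length ws)\<rbrakk> \<Longrightarrow>
          if ws = [] then M \<noteq> 0 \<and> b = g 0 else last ws = Inv b \<or> (\<exists>a. last ws = Dir a \<and> rel a b)"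
    and g_start: "M \<noteq> 0 \<Longrightarrow> i0 = 0 \<and> tail Q (g 0) = x"
    and g_ok: "\<lbrakk>M \<noteq> 0; ws \<noteq> []\<rbrakk> \<Longrightarrow> hd ws \<noteq> Dir (g 0) \<and> pair_ok (Inv (g 0)) (hd ws)"
    and g_none: "M = 0 \<Longrightarrow> (\<forall>i<i0. is_Inv (ws ! i)) \<and> (i0 < length ws \<longrightarrow> is_Dir (ws ! i0))"
    and g_end: "\<lbrakk>M = 0; b \<in> arcs Q; tail Q b = x\<rbrakk> \<Longrightarrow>
          if ws = [] then N \<noteq> 0 \<and> b = f 0 else hd ws = Dir b \<or> (\<exists>a. hd ws = Inv a \<and> rel a b)"
    and two_tails: "\<lbrakk>ws = []; N \<noteq> 0; M \<noteq> 0\<rbrakk> \<Longrightarrow> f 0 \<noteq> g 0"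
begin

definition lo :: int where "lo = - int i0"
definition hi :: int where "hi = int (length ws) - int i0"
definition e :: int where "e = int j0 - int i0"
definition L :: "int \<Rightarrow> 'a letter" where
  "L k = (if k < lo then Inv (g (nat (- k - 1))) else if k < hi then ws ! nat (k + int i0) else Dir (f (nat (k - hi))))"
definition V :: "int \<Rightarrow> 'v" where
  "V k = (if k < lo then head Q (g (nat (- k - 1))) else if k \<le> hi then wvtx Q (x, ws) (nat (k + int i0))
          else head Q (f (nat (k - hi - 1))))"
definition E :: "int set" where
  "E = {k. (k > e \<longrightarrow> enat (nat (k - e)) \<le> N) \<and> (k < 0 \<longrightarrow> enat (nat (- k)) \<le> M)}"
abbreviation W :: "int set" where "W \<equiv> {lo..hi}"
definition \<sigma> :: "('v, 'a) hwalk" where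
  "\<sigma> = glue Q (N, f) (wvtx Q (x, ws) i0, take (j0 - i0) (drop i0 ws)) (M, g)"

lemma walk: "is_walk Q (x, ws)"
  using string unfolding is_string.simps by (rule conjunct1)

lemma bounds: "lo \<le> 0" "0 \<le> e" "e \<le> hi" "N \<noteq> 0 \<Longrightarrow> e = hi" "M \<noteq> 0 \<Longrightarrow> lo = 0"
  unfolding lo_def e_def hi_def using i0_j0 f_start g_start by simp_all

lemma V_ends: "V hi = wvtx Q (x, ws) (length ws)" "V lo = x"
  using bounds by (simp_all add: V_def hi_def lo_def)

lemma ws_empty: "ws = [] \<Longrightarrow> hi = lo"
  unfolding hi_def lo_def by simp

lemma enat_mono: "enat (nat b) \<le> n \<Longrightarrow> a \<le> b \<Longrightarrow> enat (nat a) \<le> n"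
  by (erule order_trans[rotated]) (simp add: nat_mono)

lemma enat_positive: "n \<noteq> 0 \<Longrightarrow> enat (Suc 0) \<le> n"
  by (simp add: Suc_ile_eq zero_enat_def[symmetric])

lemma enat_eq_SucI: "enat i < n \<Longrightarrow> \<not> enat (Suc i) < n \<Longrightarrow> n = enat (Suc i)"
  by (cases n) auto

lemma L_mid: "lo \<le> k \<Longrightarrow> k < hi \<Longrightarrow> L k = ws ! nat (k + int i0)"
  by (simp add: L_def)

lemma L_up: "hi \<le> k \<Longrightarrow> L k = Dir (f (nat (k - hi)))"
  using bounds by (simp add: L_def)

lemma L_down: "k < lo \<Longrightarrow> L k = Inv (g (nat (- k - 1)))"
  by (simp add: L_def)

lemma Dir_from_e: "e \<le> k \<Longrightarrow> is_Dir (L k)"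
proof (cases "k < hi")
  case True
  assume "e \<le> k"
  then have "N = 0" using True bounds by auto
  moreover have "j0 \<le> nat (k + int i0)" "nat (k + int i0) < length ws" "lo \<le> k"
    using \<open>e \<le> k\<close> True bounds(1,2) unfolding e_def hi_def by linarith+
  ultimately show ?thesis using f_none True by (simp add: L_mid)
qed (simp add: L_up)

lemma Inv_below_0: "k < 0 \<Longrightarrow> is_Inv (L k)"
proof (cases "k < lo")
  case False
  assume "k < 0"
  then have "M = 0" using False bounds by auto
  then show ?thesis using g_none \<open>k < 0\<close> False bounds
    by (subst L_mid) (auto simp: lo_def nat_less_iff)
qed (simp add: L_down)

lemma Inv_before_e: "N = 0 \<Longrightarrow> is_Inv (L (e - 1))"
proof (cases "e - 1 < lo")
  case False
  assume "N = 0"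
  have "e - 1 < hi" "nat (e - 1 + int i0) = j0 - 1" "0 < j0"
    using bounds False by (auto simp: e_def lo_def)
  then show ?thesis using f_none[OF \<open>N = 0\<close>] False by (simp add: L_mid)
qed (simp add: L_down)

lemma Dir_at_0: "M = 0 \<Longrightarrow> is_Dir (L 0)"
proof (cases "hi = 0")
  case False
  assume "M = 0"
  have "0 < hi" using False bounds by simp
  then show ?thesis using g_none[OF \<open>M = 0\<close>] bounds by (subst L_mid) (auto simp: hi_def)
qed (simp add: L_up)

lemma E_above: "k \<in> E \<Longrightarrow> k + 1 \<notin> E \<Longrightarrow> e \<le> k"
  using enat_mono[of "- k" M "- (k + 1)"] by (rule_tac ccontr) (auto simp: E_def)

lemma E_below: "k \<in> E \<Longrightarrow> k - 1 \<notin> E \<Longrightarrow> k \<le> 0"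
  using enat_mono[of "k - e" N "k - 1 - e"] by (rule_tac ccontr) (auto simp: E_def)

lemma E_N0: assumes "N = 0" "k \<in> E" shows "k \<le> e"
proof (rule ccontr)
  assume k: "\<not> k \<le> e"
  then have "enat (nat (k - e)) \<le> N" using assms(2) by (simp add: E_def)
  then show False using assms(1) k by (simp add: zero_enat_def)
qed

lemma E_M0: assumes "M = 0" "k \<in> E" shows "0 \<le> k"
proof (rule ccontr)
  assume k: "\<not> 0 \<le> k"
  then have "enat (nat (- k)) \<le> M" using assms(2) by (simp add: E_def)
  then show False using assms(1) k by (simp add: zero_enat_def)
qed

lemma E_mid: "0 \<le> k \<Longrightarrow> k \<le> e \<Longrightarrow> k \<in> E"
  by (simp add: E_def)

lemma E_up: "k \<in> E \<Longrightarrow> hi < k \<Longrightarrow> N \<noteq> 0 \<and> enat (nat (k - hi - 1)) < N"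
proof -
  assume k: "k \<in> E" "hi < k"
  then have N: "N \<noteq> 0" using E_N0[of k] bounds(3) by linarith
  then have "enat (Suc (nat (k - hi - 1))) \<le> N"
    using k bounds(4) by (simp add: E_def Suc_nat_eq_nat_zadd1)
  then show ?thesis using N by (simp add: Suc_ile_eq)
qed

lemma E_down: "k \<in> E \<Longrightarrow> k < lo \<Longrightarrow> M \<noteq> 0 \<and> enat (nat (- k - 1)) < M"
proof -
  assume k: "k \<in> E" "k < lo"
  then have M: "M \<noteq> 0" using E_M0[of k] bounds(1) by linarith
  then have "enat (Suc (nat (- k - 1))) \<le> M"
    using k bounds(5) by (simp add: E_def Suc_nat_eq_nat_zadd1)
  then show ?thesis using M by (simp add: Suc_ile_eq)
qed

lemma E_step_up: "N \<noteq> 0 \<Longrightarrow> hi + 1 \<in> E"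
  using bounds enat_positive[of N] by (simp add: E_def)

lemma E_step_down: "M \<noteq> 0 \<Longrightarrow> -1 \<in> E"
  using bounds enat_positive[of M] by (simp add: E_def)

lemma E_convex: "i \<in> E \<Longrightarrow> j \<in> E \<Longrightarrow> i \<le> k \<Longrightarrow> k \<le> j \<Longrightarrow> k \<in> E"
  using enat_mono[of "j - e" N "k - e"] enat_mono[of "- i" M "- k"] by (auto simp: E_def)

lemma adjacent:
  assumes "k \<in> W \<union> E" "k + 1 \<in> W \<union> E"
  obtains (down) "k < lo" "lo = 0" "M \<noteq> 0" "enat (nat (- k - 1)) < M"
  | (mid) "lo \<le> k" "k < hi"
  | (up) "hi \<le> k" "e = hi" "N \<noteq> 0" "enat (nat (k - hi)) < N"
proof -
  consider "k < lo" | "lo \<le> k \<and> k < hi" | "hi \<le> k" by linarith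
  then show thesis
  proof cases
    case 1
    then have "k \<in> E" using assms by auto
    then show thesis using E_down 1 bounds(5) down by blast
  next
    case 3
    then have "k + 1 \<in> E" using assms by auto
    then show thesis using E_up[of "k + 1"] 3 bounds(4) up by simp
  qed (use mid in blast)
qed

lemma V_verts: "k \<in> W \<union> E \<Longrightarrow> V k \<in> verts Q"
proof -
  assume k: "k \<in> W \<union> E"
  consider "k < lo" | "lo \<le> k \<and> k \<le> hi" | "hi < k" by linarith
  then show ?thesis
  proof cases
    case 1
    then show ?thesis using E_down[of k] k g_arcs by (auto simp: V_def)
  next
    case 2
    have "wvtx Q (x, ws) i \<in> verts Q" if "i \<le> length ws" for i
    proof (cases i)
      case 0
      then show ?thesis using walk by simp
    next
      case (Suc i')
      then have "arr (ws ! i') \<in> arcs Q" using walk that by auto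
      then show ?thesis using Suc by (cases "ws ! i'") auto
    qed
    moreover have "nat (k + int i0) \<le> length ws" using 2 unfolding hi_def by linarith
    ultimately show ?thesis using 2 by (simp add: V_def)
  next
    case 3
    then show ?thesis using E_up[of k] k f_arcs bounds by (auto simp: V_def)
  qed
qed

lemma letters:
  assumes "k \<in> W \<union> E" "k + 1 \<in> W \<union> E"
  shows "arr (L k) \<in> arcs Q \<and> src Q (L k) = V k \<and> tgt Q (L k) = V (k + 1)"
  using assms
proof (cases rule: adjacent)
  case down
  have "tail Q (g (nat (- k - 1))) = V (k + 1)"
  proof (cases "k + 1 < lo")
    case True
    have s: "nat (- k - 1) = Suc (nat (- k - 2))" using True down by linarith
    then have "rel (g (nat (- k - 2))) (g (nat (- k - 1)))" using g_rel[of "nat (- k - 2)"] down by simp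
    moreover have "V (k + 1) = head Q (g (nat (- k - 2)))"
    proof -
      have "- (k + 1) - 1 = - k - 2" by simp
      then show ?thesis unfolding V_def using True by (simp only: if_True)
    qed
    ultimately show ?thesis using rel_composable by simp
  next
    case False
    then have k: "k = -1" using down by simp
    have "tail Q (g 0) = x" using g_start down by blast
    then show ?thesis using V_ends(2) down(2) k by simp
  qed
  then show ?thesis using down g_arcs by (simp add: L_down) (simp add: V_def)
next
  case mid
  let ?i = "nat (k + int i0)"
  have i: "?i < length ws" "nat (k + 1 + int i0) = Suc ?i" using mid by (auto simp: lo_def hi_def)
  have "arr (ws ! ?i) \<in> arcs Q" "src Q (ws ! ?i) = wvtx Q (x, ws) ?i" using walk i by auto
  then show ?thesis using mid i by (simp add: L_mid V_def)
next
  case up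
  have "tail Q (f (nat (k - hi))) = V k"
  proof (cases "hi < k")
    case True
    have s: "nat (k - hi) = Suc (nat (k - hi - 1))" using True by linarith
    then have "rel (f (nat (k - hi - 1))) (f (nat (k - hi)))" using f_rel[of "nat (k - hi - 1)"] up by simp
    then show ?thesis using rel_composable True bounds by (auto simp: V_def)
  next
    case False
    then have "k = hi" using up by simp
    then show ?thesis using f_start[OF up(3)] bounds by (simp add: V_def hi_def)
  qed
  then show ?thesis using up f_arcs bounds by (simp add: L_up) (simp add: V_def)
qed

lemma ws_last: "ws \<noteq> [] \<Longrightarrow> lo \<le> hi - 1 \<and> L (hi - 1) = last ws"
proof -
  assume "ws \<noteq> []"
  then have "0 < length ws" by simp
  then have "lo \<le> hi - 1" "nat (hi - 1 + int i0) = length ws - 1" by (auto simp: lo_def hi_def)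
  then show ?thesis using \<open>ws \<noteq> []\<close> by (simp add: L_mid last_conv_nth)
qed

lemma ws_hd: "ws \<noteq> [] \<Longrightarrow> L lo = hd ws"
  using bounds by (subst L_mid) (auto simp: lo_def hi_def hd_conv_nth)

lemma ws_Nil: "lo \<le> hi - 1 \<Longrightarrow> ws \<noteq> []"
  by (auto simp: lo_def hi_def)

lemma no_backtracking:
  assumes "k - 1 \<in> W \<union> E" "k \<in> W \<union> E" "k + 1 \<in> W \<union> E"
  shows "L k \<noteq> bar (L (k - 1))"
  using assms(2,3)
proof (cases rule: adjacent)
  case down
  then show ?thesis by (simp add: L_down)
next
  case mid
  show ?thesis
  proof (cases "k = lo")
    case True
    then have "k - 1 \<in> E" using assms by auto
    then have "M \<noteq> 0" "lo = 0" using E_down[of "k - 1"] True bounds by auto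
    moreover have "ws \<noteq> []" using mid by (auto simp: hi_def lo_def)
    ultimately show ?thesis using g_ok ws_hd True by (simp add: L_down)
  next
    case False
    then have i: "nat (k + int i0) = Suc (nat (k - 1 + int i0))" "Suc (nat (k - 1 + int i0)) < length ws"
      using mid by (auto simp: lo_def hi_def)
    then show ?thesis using walk mid False by (simp add: L_mid)
  qed
next
  case up
  show ?thesis
  proof (cases "k = hi")
    case True
    show ?thesis
    proof (cases "ws = []")
      case ws: True
      then have "hi = lo" by (rule ws_empty)
      then have "k - 1 \<in> E" using assms True by auto
      then have "M \<noteq> 0" "lo = 0" using E_down[of "k - 1"] True \<open>hi = lo\<close> bounds by auto
      then show ?thesis using two_tails[OF ws up(3)] True \<open>hi = lo\<close> by (simp add: L_up L_down)
    next
      case False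
      then show ?thesis using f_ok[OF up(3) False] ws_last True by (cases "last ws") (auto simp: L_up)
    qed
  next
    case False
    then show ?thesis using up by (simp add: L_up)
  qed
qed

lemma ok_W:
  assumes "k - 1 \<in> W \<union> E" "k \<in> W" "k + 1 \<in> W \<union> E"
  shows "pair_ok (L (k - 1)) (L k)"
proof -
  have "k \<in> W \<union> E" using assms by simp
  then show ?thesis using assms(3)
  proof (cases rule: adjacent)
    case down
    then show ?thesis using assms by simp
  next
    case mid
    show ?thesis
    proof (cases "k = lo")
      case True
      then have "k - 1 \<in> E" using assms by auto
      then have "M \<noteq> 0" "lo = 0" using E_down[of "k - 1"] True bounds by auto
      moreover have "ws \<noteq> []" using mid by (auto simp: hi_def lo_def)
      ultimately show ?thesis using g_ok ws_hd True by (simp add: L_down)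
    next
      case False
      then have i: "nat (k + int i0) = Suc (nat (k - 1 + int i0))" "Suc (nat (k - 1 + int i0)) < length ws"
        using mid by (auto simp: lo_def hi_def)
      then show ?thesis using string_pair[OF string i(2)] mid False by (simp add: L_mid)
    qed
  next
    case up
    then have k: "k = hi" using assms by simp
    show ?thesis
    proof (cases "ws = []")
      case True
      then have "k - 1 < lo" using ws_empty k by linarith
      then have "L (k - 1) = Inv (g (nat (- (k - 1) - 1)))" by (rule L_down)
      then show ?thesis using k by (simp add: L_up)
    next
      case False
      then show ?thesis using f_ok[OF up(3) False] ws_last k by (simp add: L_up)
    qed
  qed
qed

lemma wvtx_sub:
  assumes "k \<le> l" "i + l \<le> length ws"
  shows "wvtx Q (wvtx Q (x, ws) i, take l (drop i ws)) k = wvtx Q (x, ws) (i + k)"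
  using assms by (cases k) auto

sublocale hwalk_view Q I L V E W \<sigma>
proof -
  have *: "proper_walk Q I L V E W"
    by (rule proper_walkI) (use V_verts letters no_backtracking E_convex ok_W in blast)+
  show "hwalk_view Q I L V E W \<sigma>"
  proof (intro hwalk_view.intro * hwalk_view_axioms.intro)
    have len: "int (length (take (j0 - i0) (drop i0 ws))) = e" using i0_j0 by (simp add: e_def)
    have \<sigma>: "positions \<sigma> = E"
      "vtx \<sigma> k = (if k < 0 then head Q (g (nat (- k - 1)))
        else if k \<le> e then wvtx Q (wvtx Q (x, ws) i0, take (j0 - i0) (drop i0 ws)) (nat k) else head Q (f (nat (k - e - 1))))"
      "lett \<sigma> k = (if k < 0 then Inv (g (nat (- k - 1))) else if k < e then take (j0 - i0) (drop i0 ws) ! nat k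
        else Dir (f (nat (k - e))))" for k
      unfolding \<sigma>_def glue.simps Let_def len by (simp_all add: E_def)
    show "positions \<sigma> = E" by (rule \<sigma>)
    fix k assume k: "k \<in> E"
    have neg: "lo = 0" if "k < 0" using that k E_M0[of k] bounds by force
    have "e = hi" if "k > e" using that k E_N0[of k] bounds by force
    moreover have "wvtx Q (wvtx Q (x, ws) i0, take (j0 - i0) (drop i0 ws)) (nat k) = wvtx Q (x, ws) (nat (k + int i0))"
      if "0 \<le> k" "k \<le> e"
    proof -
      have "nat (k + int i0) = i0 + nat k" using that by simp
      then show ?thesis using that i0_j0 wvtx_sub[of "nat k" "j0 - i0" i0] by (simp add: e_def nat_le_iff)
    qed
    ultimately show "vtx \<sigma> k = V k"
      using neg bounds unfolding \<sigma>(2) V_def by auto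
    assume k1: "k + 1 \<in> E"
    have "e = hi" if "k \<ge> e" using that k1 E_N0[of "k + 1"] bounds by force
    moreover have "take (j0 - i0) (drop i0 ws) ! nat k = ws ! nat (k + int i0)" if "0 \<le> k" "k < e"
    proof -
      have "nat (k + int i0) = i0 + nat k" using that by simp
      then show ?thesis using that i0_j0 by (simp add: e_def nat_less_iff)
    qed
    ultimately show "lett \<sigma> k = L k"
      using neg bounds unfolding \<sigma>(3) L_def by auto
  qed
qed

lemma dirs:
  "ot True k \<longleftrightarrow> is_Dir (L k)" "ar True k = arr (L k)" "ot False k \<longleftrightarrow> is_Inv (L (k - 1))" "ar False k = arr (L (k - 1))"
  by (simp_all add: ot_def ar_def)

lemma pair_rel:
  "pair_ok l l' \<Longrightarrow> is_Dir l \<Longrightarrow> is_Dir l' \<Longrightarrow> \<not> rel (arr l) (arr l')"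
  "pair_ok l l' \<Longrightarrow> is_Inv l \<Longrightarrow> is_Inv l' \<Longrightarrow> \<not> rel (arr l') (arr l)"
  by (cases l; cases l'; simp)+

lemma ok_rel:
  assumes "k \<in> W" "inc u k" "out u k"
  shows "\<not> rel (ar u (k - sg u)) (ar u k)"
proof -
  have "k - 1 \<in> W \<union> E" "k + 1 \<in> W \<union> E" using assms by (cases u; auto simp: inc_def out_def)+
  then have "pair_ok (L (k - 1)) (L k)" using ok_W assms(1) by blast
  then show ?thesis using pair_rel[of "L (k - 1)" "L k"] assms
    by (cases u) (auto simp: inc_def out_def dirs)
qed

lemma tail_up:
  assumes "k \<in> E" "k + 1 \<in> E" "hi < k"
  shows "rel (arr (L (k - 1))) (arr (L k))"
proof -
  have i: "nat (k - hi) = Suc (nat (k - 1 - hi))" using assms by linarith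
  have "enat (nat (k - hi)) < N" using E_up[of "k + 1"] assms by simp
  then have "rel (f (nat (k - 1 - hi))) (f (nat (k - hi)))" using f_rel[of "nat (k - 1 - hi)"] i by simp
  then show ?thesis using assms by (simp add: L_up)
qed

lemma tail_down:
  assumes "k \<in> E" "k - 1 \<in> E" "k < lo"
  shows "rel (arr (L k)) (arr (L (k - 1)))"
proof -
  have i: "nat (- k) = Suc (nat (- k - 1))" using assms bounds by linarith
  have "enat (nat (- k)) < M" using E_down[of "k - 1"] assms by simp
  then have "rel (g (nat (- k - 1))) (g (nat (- k)))" using g_rel[of "nat (- k - 1)"] i by simp
  then show ?thesis using assms by (simp add: L_down)
qed

lemma tail_step:
  assumes "inc u k" "out u k" "rel (ar u (k - sg u)) (ar u k)" "k + sg u + sg u \<in> E"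
  shows "out u (k + sg u) \<and> rel (ar u k) (ar u (k + sg u))"
proof -
  have "k \<notin> W" using ok_rel assms by blast
  then have kW: "k < lo \<or> hi < k" by auto
  show ?thesis
  proof (cases u)
    case True
    then have "is_Dir (L k)" using assms by (simp add: out_def dirs)
    then have "hi < k" using kW L_down by fastforce
    then show ?thesis using tail_up[of "k + 1"] L_up[of "k + 1"] assms True by (auto simp: out_def dirs)
  next
    case False
    then have "is_Inv (L (k - 1))" using assms by (simp add: out_def dirs)
    then have "k < lo" using kW L_up[of "k - 1"] by auto
    then show ?thesis using tail_down[of "k - 1"] L_down[of "k - 2"] assms False by (auto simp: out_def dirs)
  qed
qed

text \<open>
  By the maximality of the antipaths.
\<close>

lemma tail_end:
  assumes "inc u k" "k + sg u \<notin> E"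
  shows "\<not> rel (ar u (k - sg u)) b"
proof (cases u)
  case True
  have k: "k \<in> E" "k + 1 \<notin> E" "is_Dir (L (k - 1))" using assms True by (auto simp: inc_def dirs)
  have ke: "e \<le> k" by (rule E_above[OF k(1,2)])
  have N: "N \<noteq> 0" using E_N0[of k] k ke Inv_before_e by (auto simp: is_Inv_iff)
  then have "k \<noteq> hi" using E_step_up k by auto
  then have hk: "hi < k" using ke bounds(4)[OF N] by simp
  have s: "nat (k - hi) = Suc (nat (k - hi - 1))" using hk by linarith
  have "enat (nat (k - hi)) \<le> N" using E_up[OF k(1) hk] s by (simp add: Suc_ile_eq)
  moreover have "\<not> enat (Suc (nat (k - hi))) \<le> N"
    using k(2) hk bounds(2,3) bounds(4)[OF N] by (simp add: E_def Suc_nat_eq_nat_zadd1 algebra_simps)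
  ultimately have "N = enat (Suc (nat (k - hi - 1)))" using s by (intro enat_eq_SucI) (simp_all add: Suc_ile_eq)
  then show ?thesis using f_max True hk by (simp add: dirs L_up algebra_simps)
next
  case False
  have k: "k \<in> E" "k - 1 \<notin> E" "is_Inv (L k)" using assms False by (auto simp: inc_def dirs)
  have k0: "k \<le> 0" by (rule E_below[OF k(1,2)])
  have M: "M \<noteq> 0" using E_M0[of k] k k0 Dir_at_0 by (auto simp: is_Inv_iff)
  then have "k \<noteq> 0" using E_step_down k by auto
  then have kl: "k < lo" using k0 bounds(5)[OF M] by simp
  have s: "nat (- k) = Suc (nat (- k - 1))" using kl bounds by linarith
  have "enat (nat (- k)) \<le> M" using E_down[OF k(1) kl] s by (simp add: Suc_ile_eq)
  moreover have "\<not> enat (Suc (nat (- k))) \<le> M"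
    using k(2) kl bounds(1,2) bounds(5)[OF M] by (simp add: E_def Suc_nat_eq_nat_zadd1 algebra_simps)
  ultimately have "M = enat (Suc (nat (- k - 1)))" using s by (intro enat_eq_SucI) (simp_all add: Suc_ile_eq)
  then show ?thesis using g_max False kl by (simp add: dirs L_down)
qed

definition tl :: "int \<Rightarrow> int" where
  "tl k = (if hi < k then k - hi else if k < lo then lo - k else 0)"

lemma tail_depth:
  assumes "k \<in> E" "k \<notin> W"
  shows "\<exists>u. inc u k \<and> \<not> thr u k \<and> \<not> inc (\<not> u) k \<and> tl k = tl (k - sg u) + 1"
proof (cases "hi < k")
  case True
  have "hi \<in> E" using E_mid bounds E_up[OF assms(1) True] by auto
  then have "k - 1 \<in> E" using E_convex[of hi k "k - 1"] assms True by simp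
  moreover have "\<not> thr True k" using tail_up[OF assms(1) _ True] by (auto simp: thr_def out_def dirs)
  moreover have "\<not> inc False k" using True by (simp add: inc_def dirs L_up)
  moreover have "tl k = tl (k - 1) + 1" using True bounds by (simp add: tl_def)
  ultimately show ?thesis using assms True by (intro exI[of _ True]) (simp add: inc_def dirs L_up)
next
  case False
  then have kl: "k < lo" using assms by auto
  have "0 \<in> E" using E_mid bounds by simp
  then have "k + 1 \<in> E" using E_convex[of k 0 "k + 1"] assms kl bounds by simp
  moreover have "\<not> thr False k" using tail_down[OF assms(1) _ kl] by (auto simp: thr_def out_def dirs)
  moreover have "\<not> inc True k" using kl by (simp add: inc_def dirs L_down)
  moreover have "tl k = tl (k + 1) + 1" using kl bounds False by (simp add: tl_def)
  ultimately show ?thesis using assms kl by (intro exI[of _ False]) (simp add: inc_def dirs L_down)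
qed

text \<open>
  If the end of the homotopy string lies in the string, then letters have been removed there or
  there was nothing to remove, and the last remaining letter points inwards. Thus no letter
  arrives at this end, and inside the string there are no zero relations.
\<close>

lemma inner_inc:
  assumes "k \<in> E" "k \<in> W" "inc u k"
  shows "inc (\<not> u) k \<or> thr u k"
proof -
  have "k + sg u \<in> E"
  proof (rule ccontr)
    assume n: "k + sg u \<notin> E"
    show False
    proof (cases u)
      case True
      then have ke: "e \<le> k" "k + 1 \<notin> E" using E_above n assms by auto
      show False
      proof (cases "N = 0")
        case N: True
        have "k = e" using E_N0[OF N assms(1)] ke(1) by simp
        moreover have "is_Dir (L (k - 1))" using assms(3) True by (simp add: inc_def dirs)
        ultimately show False using Inv_before_e[OF N] by (simp add: is_Inv_iff)
      next
        case False
        then show False using E_step_up ke bounds(4) assms(2) by (cases "k = hi") auto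
      qed
    next
      case False
      then have k0: "k \<le> 0" "k - 1 \<notin> E" using E_below n assms by auto
      show False
      proof (cases "M = 0")
        case M: True
        have "k = 0" using E_M0[OF M assms(1)] k0(1) by simp
        moreover have "is_Inv (L k)" using assms(3) False by (simp add: inc_def dirs)
        ultimately show False using Dir_at_0[OF M] by (simp add: is_Inv_iff)
      next
        case M: False
        then show False using E_step_down k0 bounds(5) assms(2) by (cases "k = 0") auto
      qed
    qed
  qed
  then have "inc (\<not> u) k \<or> out u k" using out_or_inc assms by blast
  then show ?thesis using ok_rel assms by (auto simp: thr_def)
qed

lemma removed:
  assumes "k \<in> W" "k \<notin> E"
  shows "\<exists>u. winc u k \<and> \<not> winc (\<not> u) k"
proof -
  have "k < 0 \<or> e < k" using assms(2) E_mid[of k] by (meson not_less)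
  then show ?thesis
  proof
    assume "e < k"
    then have "is_Dir (L (k - 1))" "is_Dir (L k)" using Dir_from_e by auto
    then show ?thesis using assms \<open>e < k\<close> bounds by (intro exI[of _ True]) (auto simp: winc_def dirs is_Inv_iff)
  next
    assume "k < 0"
    then have "is_Inv (L (k - 1))" "is_Inv (L k)" using Inv_below_0 by auto
    then show ?thesis using assms \<open>k < 0\<close> bounds by (intro exI[of _ False]) (auto simp: winc_def dirs is_Inv_iff)
  qed
qed

lemma inc_winc:
  assumes "k \<in> W" "k \<in> E"
  shows "inc u k \<longleftrightarrow> winc u k"
proof (cases u)
  case True
  have "k - 1 \<in> E \<longleftrightarrow> k - 1 \<in> W" if "is_Dir (L (k - 1))"
  proof
    assume "k - 1 \<in> E"
    show "k - 1 \<in> W" using that assms L_down[of "k - 1"] by (cases "k - 1 < lo") auto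
  next
    assume "k - 1 \<in> W"
    show "k - 1 \<in> E"
    proof (rule ccontr)
      assume "k - 1 \<notin> E"
      then have "k \<le> 0" using E_below assms by blast
      then show False using Inv_below_0[of "k - 1"] that by (simp add: is_Inv_iff)
    qed
  qed
  then show ?thesis using True assms by (auto simp: inc_def winc_def dirs)
next
  case False
  have "k + 1 \<in> E \<longleftrightarrow> k + 1 \<in> W" if "is_Inv (L k)"
  proof
    assume "k + 1 \<in> E"
    show "k + 1 \<in> W" using that assms L_up[of k] by (cases "hi \<le> k") auto
  next
    assume "k + 1 \<in> W"
    show "k + 1 \<in> E"
    proof (rule ccontr)
      assume "k + 1 \<notin> E"
      then have "e \<le> k" using E_above assms by blast
      then show False using Dir_from_e[of k] that by (simp add: is_Inv_iff)
    qed
  qed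
  then show ?thesis using False assms by (auto simp: inc_def winc_def dirs)
qed

lemma end_cases:
  assumes "k \<in> W" "k + sg u \<notin> P"
  shows "if u then k = hi \<and> N = 0 else k = lo \<and> M = 0"
proof (cases u)
  case True
  then have k: "k + 1 \<notin> W" "k + 1 \<notin> E" using assms by auto
  then have "k = hi" using assms(1) by auto
  then show ?thesis using True k E_step_up by auto
next
  case False
  then have k: "k - 1 \<notin> W" "k - 1 \<notin> E" using assms by auto
  then have kl: "k = lo" using assms(1) by auto
  have "M = 0"
  proof (rule ccontr)
    assume "M \<noteq> 0"
    then show False using E_step_down bounds(5) kl k(2) by simp
  qed
  then show ?thesis using False kl by simp
qed

lemma removed_end:
  assumes "k \<in> W" "k + sg u \<notin> P" "winc u k" "b \<in> arcs Q" "tail Q b = V k"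
  shows "rel (ar u (k - sg u)) b"
proof (cases u)
  case True
  then have k: "k = hi" "N = 0" using end_cases[OF assms(1,2)] by auto
  have w: "lo \<le> hi - 1" "is_Dir (L (hi - 1))" using assms(3) True k by (auto simp: winc_def dirs)
  then have "ws \<noteq> []" by (intro ws_Nil)
  then have "L (hi - 1) = Inv b \<or> (\<exists>a. L (hi - 1) = Dir a \<and> rel a b)"
    using f_end[OF k(2) assms(4)] assms(5) V_ends k ws_last by simp
  then show ?thesis using w True k by (auto simp: dirs)
next
  case False
  then have k: "k = lo" "M = 0" using end_cases[OF assms(1,2)] by auto
  have w: "lo + 1 \<le> hi" "is_Inv (L lo)" using assms(3) False k by (auto simp: winc_def dirs)
  then have ne: "ws \<noteq> []" by (intro ws_Nil) simp
  then have "L lo = Dir b \<or> (\<exists>a. L lo = Inv a \<and> rel a b)"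
    using g_end[OF k(2) assms(4)] assms(5) V_ends k ws_hd[OF ne] by simp
  then show ?thesis using w False k by (auto simp: dirs)
qed

lemma top_end:
  assumes "k \<in> W" "top k" "k + sg u \<notin> P" "b \<in> arcs Q" "tail Q b = V k"
  shows "k - sg u \<in> P \<and> b = ar (\<not> u) k"
proof (cases u)
  case True
  then have k: "k = hi" "N = 0" using end_cases[OF assms(1,3)] by auto
  have "k \<in> E" using assms(2) by (simp add: top_def)
  then have "hi \<in> E" using k(1) by simp
  then have "e = hi" using E_N0[OF k(2), of hi] bounds by simp
  then have inv: "is_Inv (L (hi - 1))" using Inv_before_e[OF k(2)] by simp
  show ?thesis
  proof (cases "ws = []")
    case ws: True
    then have "M \<noteq> 0" "b = g 0" using f_end[OF k(2) assms(4)] assms(5) V_ends k by auto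
    moreover have "lo = 0" by (rule bounds(5)) fact
    moreover have "hi = 0" using ws_empty[OF ws] \<open>lo = 0\<close> by (rule trans)
    ultimately show ?thesis using True k E_step_down by (simp add: dirs L_down)
  next
    case False
    then have "last ws = Inv b \<or> (\<exists>a. last ws = Dir a \<and> rel a b)"
      using f_end[OF k(2) assms(4)] assms(5) V_ends k by simp
    then have "L (hi - 1) = Inv b" using inv ws_last[OF False] by auto
    then show ?thesis using True k ws_last[OF False] by (simp add: dirs)
  qed
next
  case False
  then have k: "k = lo" "M = 0" using end_cases[OF assms(1,3)] by auto
  have "k \<in> E" using assms(2) by (simp add: top_def)
  then have "lo \<in> E" using k(1) by simp
  then have lo: "lo = 0" using E_M0[OF k(2), of lo] bounds by simp
  have dir: "is_Dir (L lo)" using Dir_at_0[OF k(2)] lo by simp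
  show ?thesis
  proof (cases "ws = []")
    case ws: True
    then have "N \<noteq> 0" "b = f 0" using g_end[OF k(2) assms(4)] assms(5) V_ends k by auto
    moreover have "hi = 0" using ws_empty[OF ws] lo by (rule trans)
    ultimately show ?thesis using False k lo E_step_up by (simp add: dirs L_up)
  next
    case ws: False
    then have "hd ws = Dir b \<or> (\<exists>a. hd ws = Inv a \<and> rel a b)"
      using g_end[OF k(2) assms(4)] assms(5) V_ends k by simp
    then have "L lo = Dir b" using dir ws_hd[OF ws] by auto
    then show ?thesis using False k ws_last[OF ws] by (simp add: dirs)
  qed
qed

definition idx :: "int \<Rightarrow> nat" where "idx k = nat (k + int i0)"
text \<open>
  The solution of the recursion for the scalars \<open>\<eta>\<close> of the generators: as all other scalars are
  \<open>1\<close>, these are signs.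
\<close>

definition sgn_at :: "int \<Rightarrow> 'k" where
  "sgn_at k = (\<Prod>j\<in>{lo..<k}. if ot True j then 1 else if brk j then -1 else 1)"
definition mat :: "'a \<Rightarrow> nat \<Rightarrow> nat \<Rightarrow> 'k" where
  "mat = (\<lambda>a i j. if \<exists>k<length ws. ws ! k = Dir a \<and> j = k \<and> i = Suc k \<or> ws ! k = Inv a \<and> j = Suc k \<and> i = k then 1 else 0)"

lemma idx_simps: "k \<in> W \<Longrightarrow> int (idx k) = k + int i0"
  by (simp add: idx_def lo_def)

lemma idx_inj: "k \<in> W \<Longrightarrow> k' \<in> W \<Longrightarrow> idx k = idx k' \<longleftrightarrow> k = k'"
  using idx_simps by (metis add_right_cancel)

lemma idx_image: "{0..length ws} = idx ` W"
proof (intro equalityI subsetI)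
  fix i assume "i \<in> {0..length ws}"
  then show "i \<in> idx ` W" by (intro image_eqI[of _ _ "int i - int i0"]) (auto simp: idx_def lo_def hi_def)
qed (auto simp: idx_def lo_def hi_def)

lemma mat_walk:
  assumes "k \<in> W" "i \<in> {0..length ws}"
  shows "mat a i (idx k) = (if k + 1 \<in> W \<and> L k = Dir a \<and> i = idx (k + 1) then 1 else 0) +
      (if k - 1 \<in> W \<and> L (k - 1) = Inv a \<and> i = idx (k - 1) then 1 else 0)"
proof -
  have up: "(\<exists>k'<length ws. ws ! k' = Dir a \<and> idx k = k' \<and> i = Suc k') \<longleftrightarrow> k + 1 \<in> W \<and> L k = Dir a \<and> i = idx (k + 1)"
    (is "_ \<longleftrightarrow> ?u")
  proof (cases "k < hi")
    case True
    have "idx k < length ws" "idx (k + 1) = Suc (idx k)" "L k = ws ! idx k"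
      using True assms(1) by (auto simp: idx_def lo_def hi_def L_def)
    then show ?thesis using True assms(1) by auto
  next
    case False
    have "\<not> idx k < length ws" using False assms(1) by (auto simp: idx_def lo_def hi_def)
    then show ?thesis using False by auto
  qed
  have down: "(\<exists>k'<length ws. ws ! k' = Inv a \<and> idx k = Suc k' \<and> i = k') \<longleftrightarrow> k - 1 \<in> W \<and> L (k - 1) = Inv a \<and> i = idx (k - 1)"
    (is "_ \<longleftrightarrow> ?d")
  proof (cases "lo < k")
    case True
    have "idx (k - 1) < length ws" "idx k = Suc (idx (k - 1))" "L (k - 1) = ws ! idx (k - 1)"
      using True assms(1) by (auto simp: idx_def lo_def hi_def L_def)
    then show ?thesis using True assms(1) by auto
  next
    case False
    have "idx k = 0" using False assms(1) by (auto simp: idx_def lo_def)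
    then show ?thesis using False by auto
  qed
  have "\<not> (?u \<and> ?d)"
    using idx_inj[of "k + 1" "k - 1"] by auto
  moreover have "mat a i (idx k) = (if ?u \<or> ?d then 1 else 0)"
    unfolding mat_def up[symmetric] down[symmetric] by (rule if_cong) auto
  ultimately show ?thesis by auto
qed

lemma vt_idx: "k \<in> W \<Longrightarrow> wvtx Q (x, ws) (idx k) = V k"
  by (simp add: V_def idx_def)

lemma walk_resolution_string:
  "walk_resolution Q I L V E W \<sigma> 0 {0..length ws} (wvtx Q (x, ws)) mat idx (\<lambda>_. 1) (\<lambda>_. 1) sgn_at tl"
proof unfold_locales
  note matrix = matrix_walk[where idx = idx and N = "{0..length ws}" and vt = "wvtx Q (x, ws)" and m = mat and \<kappa> = "\<lambda>_. 1",
      OF idx_image finite_atLeastAtMost vt_idx mat_walk]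
  show "a \<in> arcs Q \<Longrightarrow> i \<in> {0..length ws} \<Longrightarrow> j \<in> {0..length ws} \<Longrightarrow> mat a i j \<noteq> 0 \<Longrightarrow>
      wvtx Q (x, ws) j = tail Q a \<and> wvtx Q (x, ws) i = head Q a" for a i j by (rule matrix(1))
  show "k \<in> W \<Longrightarrow> k + sg u \<in> W \<Longrightarrow> ot u k \<Longrightarrow> arrow_action {0..length ws} mat (ar u k) (\<lambda>i. if i = idx k then 1 else 0) =
      (\<lambda>i. if i = idx (k + sg u) then if u then 1 else 1 else 0)" for u k by (rule matrix(2))
  show "k \<in> W \<Longrightarrow> a \<in> arcs Q \<Longrightarrow> (\<And>u. \<not> (k + sg u \<in> W \<and> ot u k \<and> ar u k = a)) \<Longrightarrow>
      arrow_action {0..length ws} mat a (\<lambda>i. if i = idx k then 1 else 0) = (\<lambda>i. 0)" for a k by (rule matrix(3))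
  show "sgn_at (k + 1) = (if ot True k then 1 * (if brk k then 1 else 1) else if brk k then - 1 / 1 else 1) * sgn_at k"
    if "k \<in> W" "k + 1 \<in> W" for k
  proof -
    have "{lo..<k + 1} = insert k {lo..<k}" using that by auto
    then show ?thesis by (simp add: sgn_at_def)
  qed
  show "sgn_at k \<noteq> 0" for k by (simp add: sgn_at_def)
  show "W \<noteq> {}" using bounds by auto
  show "k \<in> W \<Longrightarrow> tl k = 0" "0 \<le> tl k" for k by (auto simp: tl_def)
  show "k \<in> W \<Longrightarrow> k' \<in> W \<Longrightarrow> idx k = idx k' \<longleftrightarrow> k mod 0 = k' mod 0" for k k' using idx_inj by simp
  show "{0..length ws} = idx ` W" by (rule idx_image)
qed (use vt_idx tail_step tail_end tail_depth inner_inc removed inc_winc removed_end top_end in \<open>simp_all\<close>)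

lemma string_resolution:
  "projective_resolution \<Lambda> (string_complex Q I \<sigma>) (string_complex_diff Q I \<sigma>) (string_module Q (x, ws))"
proof -
  have "projective_resolution \<Lambda> (complex_term Q I 0 \<sigma>) (complex_diff Q I 0 (\<lambda>_. 1) \<sigma>)
      (rep_module {0..length ws} (wvtx Q (x, ws)) mat)"
    by (rule walk_resolution.walk_projective_resolution[OF walk_resolution_string]) simp
  then show ?thesis unfolding mat_def string_module.simps .
qed

lemma homotopy_string_\<sigma>: "homotopy_string Q I \<sigma>"
proof -
  have zero: "0 \<in> E" and "e \<in> E" using E_mid bounds by auto
  note outside_brk = walk_resolution.outside_brk[OF walk_resolution_string]
  have "is_hwalk Q \<sigma>"
    unfolding is_hwalk_def positions
  proof (intro conjI ballI allI impI)
    show "E \<noteq> {}" using zero by blast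
    show "{i..j} \<subseteq> E" if "i \<in> E" "j \<in> E" for i j
    proof
      fix k assume "k \<in> {i..j}"
      then show "k \<in> E" using E_convex[OF that, of k] by simp
    qed
    show "vtx \<sigma> i \<in> verts Q" if "i \<in> E" for i using vtx V_verts that by simp
    fix i assume "{i, i + 1} \<subseteq> E"
    then have i: "i \<in> E" "i + 1 \<in> E" by blast+
    then have "i \<in> W \<union> E" "i + 1 \<in> W \<union> E" by blast+
    then show "arr (lett \<sigma> i) \<in> arcs Q" "src Q (lett \<sigma> i) = vtx \<sigma> i" "tgt Q (lett \<sigma> i) = vtx \<sigma> (i + 1)"
      using letters[of i] lett[OF i] vtx[OF i(1)] vtx[OF i(2)] by simp_all
  next
    fix i assume "{i, i + 1, i + 2} \<subseteq> E"
    moreover have i2: "i + 2 = i + 1 + 1" by simp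
    ultimately have i: "i \<in> E" "i + 1 \<in> E" "i + 1 + 1 \<in> E" by (simp_all only: insert_subset)
    have "i + 1 - 1 \<in> W \<union> E" using i(1) by simp
    moreover have "i + 1 \<in> W \<union> E" "i + 1 + 1 \<in> W \<union> E" using i by blast+
    ultimately have "L (i + 1) \<noteq> bar (L (i + 1 - 1))" by (rule no_backtracking)
    moreover have "lett \<sigma> i = L i" "lett \<sigma> (i + 1) = L (i + 1)" using lett[OF i(1,2)] lett[OF i(2,3)] by simp_all
    ultimately show "lett \<sigma> (i + 1) \<noteq> bar (lett \<sigma> i)" by simp
  qed
  moreover have "\<exists>m. \<forall>k\<ge>m. is_Dir (lett \<sigma> k) \<and> homotopy_letter I \<sigma> k (k + 1)" if unb: "\<not> bdd_above E"
  proof (intro exI[of _ "hi + 1"] allI impI)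
    fix k assume k: "hi + 1 \<le> k"
    have E: "k' \<in> E" if "hi \<le> k'" for k'
    proof -
      obtain j where "j \<in> E" "k' < j" using unb unfolding bdd_above_def by (meson not_le)
      then show ?thesis using E_convex[OF \<open>e \<in> E\<close>, of j k'] that bounds(3) by simp
    qed
    have o: "out True k" using E[of k] E[of "k + 1"] k by (simp add: out_def dirs L_up)
    have "brk k" "brk (k + 1)" using outside_brk[of k] outside_brk[of "k + 1"] E k by auto
    then have "hl True k 1" using o by (simp add: hl_def run_def pos_def)
    then have "homotopy_letter I \<sigma> k (k + 1)" using hl_letter by fastforce
    moreover have "lett \<sigma> k = L k" using lett[of k] E[of k] E[of "k + 1"] k by simp
    ultimately show "is_Dir (lett \<sigma> k) \<and> homotopy_letter I \<sigma> k (k + 1)" using k by (simp add: L_up)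
  qed
  moreover have "\<exists>m. \<forall>k\<le>m. is_Inv (lett \<sigma> k) \<and> homotopy_letter I \<sigma> k (k + 1)" if unb: "\<not> bdd_below E"
  proof (intro exI[of _ "lo - 2"] allI impI)
    fix k assume k: "k \<le> lo - 2"
    have E: "k' \<in> E" if "k' < lo" for k'
    proof -
      obtain j where "j \<in> E" "j < k'" using unb unfolding bdd_below_def by (meson not_le)
      then show ?thesis using E_convex[OF _ zero, of j k'] that bounds(1) by simp
    qed
    have o: "out False (k + 1)" using E[of k] E[of "k + 1"] k by (simp add: out_def dirs L_down)
    have "brk k" "brk (k + 1)" using outside_brk[of k] outside_brk[of "k + 1"] E k by auto
    then have "hl False (k + 1) 1" using o by (simp add: hl_def run_def pos_def)
    then have "homotopy_letter I \<sigma> k (k + 1)" using hl_letter by fastforce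
    moreover have "lett \<sigma> k = L k" using lett[of k] E[of k] E[of "k + 1"] k by simp
    ultimately show "is_Inv (lett \<sigma> k) \<and> homotopy_letter I \<sigma> k (k + 1)" using k by (simp add: L_down)
  qed
  ultimately show ?thesis unfolding homotopy_string_def positions by blast
qed

end

section \<open>The homotopy string of a string\<close>

subsection \<open>Maximal antipaths\<close>

context gentle_algebra
begin

lemma direct_walk_view:
  assumes "N \<noteq> 0" and arcs: "\<And>i. enat i < N \<Longrightarrow> f i \<in> arcs Q"
    and comp: "\<And>i. enat (Suc i) < N \<Longrightarrow> head Q (f i) = tail Q (f (Suc i))"
  shows "hwalk_view Q I (\<lambda>k. Dir (f (nat k))) (\<lambda>k. if k \<le> 0 then tail Q (f 0) else head Q (f (nat (k - 1))))
    {k. 0 \<le> k \<and> enat (nat k) \<le> N} {} (direct_walk Q (N, f))"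
proof -
  let ?L = "\<lambda>k :: int. Dir (f (nat k))" and ?V = "\<lambda>k. if k \<le> 0 then tail Q (f 0) else head Q (f (nat (k - 1)))"
  let ?E = "{k. 0 \<le> k \<and> enat (nat k) \<le> N}"
  have E: "k = 0 \<or> 0 < k \<and> enat (nat (k - 1)) < N" if "k \<in> ?E" for k
  proof (cases "k = 0")
    case False
    then have "enat (Suc (nat (k - 1))) \<le> N" using that by (simp add: Suc_nat_eq_nat_zadd1)
    then show ?thesis using that False by (simp add: Suc_ile_eq)
  qed simp
  have f0: "f 0 \<in> arcs Q" using arcs[of 0] assms(1) by (simp add: zero_enat_def[symmetric])
  have "proper_walk Q I ?L ?V ?E {}"
  proof (rule proper_walkI)
    show "?V k \<in> verts Q" if "k \<in> {} \<union> ?E" for k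
      using E[of k] that f0 arcs[of "nat (k - 1)"] by auto
    show "arr (?L k) \<in> arcs Q \<and> src Q (?L k) = ?V k \<and> tgt Q (?L k) = ?V (k + 1)"
      if "k \<in> {} \<union> ?E" "k + 1 \<in> {} \<union> ?E" for k
    proof -
      have k: "0 \<le> k" "enat (nat k) < N" using that E[of "k + 1"] by auto
      have "tail Q (f (nat k)) = ?V k"
      proof (cases "k = 0")
        case False
        then have "nat k = Suc (nat (k - 1))" using k by simp
        then show ?thesis using comp[of "nat (k - 1)"] k False by simp
      qed simp
      then show ?thesis using arcs k by simp
    qed
    show "k \<in> ?E" if "i \<in> ?E" "j \<in> ?E" "i \<le> k" "k \<le> j" for i j k
    proof -
      have "enat (nat k) \<le> enat (nat j)" using that by (simp add: nat_mono)
      also have "\<dots> \<le> N" using that by simp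
      finally show ?thesis using that by simp
    qed
  qed auto
  then show ?thesis
    by (intro hwalk_view.intro hwalk_view_axioms.intro) auto
qed

text \<open>
  A direct walk has only homotopy letters of length \<open>1\<close> if and only if all its positions are
  breaks.
\<close>

lemma direct_antipath_iff:
  assumes "N \<noteq> 0"
  shows "direct_antipath Q I (N, f) \<longleftrightarrow>
    (\<forall>i. enat i < N \<longrightarrow> f i \<in> arcs Q) \<and> (\<forall>i. enat (Suc i) < N \<longrightarrow> rel (f i) (f (Suc i)))"
    (is "_ \<longleftrightarrow> ?arcs \<and> ?rel")
proof
  assume anti: "direct_antipath Q I (N, f)"
  then have hw: "is_hwalk Q (direct_walk Q (N, f))" by (simp add: direct_antipath_def)
  have arcs: "f i \<in> arcs Q \<and> tail Q (f i) = vtx (direct_walk Q (N, f)) (int i) \<and> head Q (f i) = vtx (direct_walk Q (N, f)) (int i + 1)"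
    if "enat i < N" for i
  proof -
    have "enat (Suc i) \<le> N" using that by (simp add: Suc_ile_eq)
    moreover have "nat (int i + 1) = Suc i" by simp
    ultimately have "{int i, int i + 1} \<subseteq> positions (direct_walk Q (N, f))" using that by simp
    then have "arr (lett (direct_walk Q (N, f)) (int i)) \<in> arcs Q \<and>
        src Q (lett (direct_walk Q (N, f)) (int i)) = vtx (direct_walk Q (N, f)) (int i) \<and>
        tgt Q (lett (direct_walk Q (N, f)) (int i)) = vtx (direct_walk Q (N, f)) (int i + 1)"
      using hw unfolding is_hwalk_def by blast
    then show ?thesis by simp
  qed
  have comp: "head Q (f i) = tail Q (f (Suc i))" if "enat (Suc i) < N" for i
  proof -
    have "enat i < N" using that by (metis enat_ord_simps(2) lessI order_less_trans)
    then show ?thesis using arcs[of i] arcs[OF that] by (simp add: add.commute)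
  qed
  interpret hwalk_view Q I "\<lambda>k. Dir (f (nat k))" "\<lambda>k. if k \<le> 0 then tail Q (f 0) else head Q (f (nat (k - 1)))"
    "{k. 0 \<le> k \<and> enat (nat k) \<le> N}" "{}" "direct_walk Q (N, f)"
    by (rule direct_walk_view[OF assms]) (use arcs comp in auto)
  let ?E = "{k :: int. 0 \<le> k \<and> enat (nat k) \<le> N}"
  have no_False: "\<not> thr False k" for k by (simp add: thr_def inc_def ot_def)
  have out: "out True (int i) \<longleftrightarrow> enat i < N" for i
  proof -
    have "nat (int i + 1) = Suc i" by simp
    moreover have "enat i \<le> N" if "enat (Suc i) \<le> N" using that by (simp add: Suc_ile_eq)
    ultimately show ?thesis by (auto simp: out_def ot_def Suc_ile_eq)
  qed
  have brk: "brk (int i)" if "enat i \<le> N" for i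
    using that
  proof (induction i)
    case 0
    have "\<not> thr True 0" by (simp add: thr_def inc_def)
    then show ?case using no_False 0 by (auto simp: brk_def all_bool_eq)
  next
    case (Suc i)
    then have i: "enat i < N" by (simp add: Suc_ile_eq)
    then obtain m where h: "hl True (int i) m" using next_break Suc.IH out by (meson less_imp_le)
    then have "homotopy_letter I (direct_walk Q (N, f)) (int i) (int i + int m)" using hl_letter[OF h] by simp
    then have "m = 1" using anti unfolding direct_antipath_def by (metis add_left_cancel of_nat_1 of_nat_eq_iff)
    then show ?case using h by (simp add: hl_def pos_def add.commute)
  qed
  have "rel (f i) (f (Suc i))" if i: "enat (Suc i) < N" for i
  proof -
    have "enat i < N" using i by (metis enat_ord_simps(2) lessI order_less_trans)
    then have "out True (int i)" "out True (int (Suc i))" using out i by blast+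
    then have "inc True (int (Suc i))" using out_inc[of True "int i"] by (simp add: add.commute)
    moreover have "\<not> thr True (int (Suc i))" using brk[of "Suc i"] i by (simp add: brk_def)
    ultimately have "rel (ar True (int (Suc i) - sg True)) (ar True (int (Suc i)))"
      using \<open>out True (int (Suc i))\<close> by (simp only: thr_def simp_thms)
    moreover have "nat (1 + int i) = Suc i" by simp
    ultimately show ?thesis by (simp add: ar_def)
  qed
  then show "?arcs \<and> ?rel" using arcs by blast
next
  assume a: "?arcs \<and> ?rel"
  interpret hwalk_view Q I "\<lambda>k. Dir (f (nat k))" "\<lambda>k. if k \<le> 0 then tail Q (f 0) else head Q (f (nat (k - 1)))"
    "{k. 0 \<le> k \<and> enat (nat k) \<le> N}" "{}" "direct_walk Q (N, f)"
    by (rule direct_walk_view[OF assms]) (use a rel_composable in auto)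
  let ?E = "{k :: int. 0 \<le> k \<and> enat (nat k) \<le> N}"
  let ?w = "direct_walk Q (N, f)"
  have "is_hwalk Q ?w"
    unfolding is_hwalk_def positions
  proof (intro conjI ballI allI impI)
    show "?E \<noteq> {}" by (auto simp: zero_enat_def[symmetric] intro!: exI[of _ 0])
    show "{i..j} \<subseteq> ?E" if "i \<in> ?E" "j \<in> ?E" for i j using E_convex[OF that] by auto
    show "vtx ?w i \<in> verts Q" if "i \<in> ?E" for i using V_verts[of i] vtx[OF that] that by simp
    fix i assume i: "{i, i + 1} \<subseteq> ?E"
    have o: "ot True i" by (simp add: ot_def)
    have "ar True i \<in> arcs Q \<and> tail Q (ar True i) = vtx ?w i \<and> head Q (ar True i) = vtx ?w (i + 1)"
      using arrow[of i True] o i vtx[of i] vtx[of "i + 1"] by simp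
    moreover have "lett ?w i = Dir (ar True i)" using i by (simp add: ar_def)
    ultimately show "arr (lett ?w i) \<in> arcs Q" "src Q (lett ?w i) = vtx ?w i" "tgt Q (lett ?w i) = vtx ?w (i + 1)"
      by (simp_all del: direct_walk.simps)
  qed simp
  moreover have "j = i + 1" if hij: "homotopy_letter I ?w i j" for i j
  proof -
    obtain u where ij: "i < j" and h: "hl u (start u i j) (nat (j - i))" using hij unfolding homotopy_letter_iff by blast
    have all_brk: "brk k" if "k \<in> ?E" for k
    proof -
      have "\<not> thr True k"
      proof
        assume "thr True k"
        then have t: "k - 1 \<in> ?E" "k + 1 \<in> ?E" "\<not> rel (f (nat (k - 1))) (f (nat k))"
          by (auto simp: thr_def inc_def out_def ar_def)
        have "nat k = Suc (nat (k - 1))" "nat (k + 1) = Suc (nat k)" using t by auto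
        then have "enat (Suc (nat (k - 1))) < N" using t(2) by (simp add: Suc_ile_eq)
        then show False using a t(3) \<open>nat k = Suc (nat (k - 1))\<close> by simp
      qed
      moreover have "\<not> thr False k" by (simp add: thr_def inc_def ot_def)
      ultimately show ?thesis using that by (auto simp: brk_def all_bool_eq)
    qed
    have "\<not> 1 < nat (j - i)"
      using hl_not_brk[OF h, of 1] hl_E[OF h, of 1] all_brk by auto
    then show ?thesis using ij by simp
  qed
  ultimately show "direct_antipath Q I (N, f)" unfolding direct_antipath_def by blast
qed

lemma max_antipathD:
  assumes "max_antipath Q I b (N, f)"
  shows "N \<noteq> 0" "f 0 = b" "enat i < N \<Longrightarrow> f i \<in> arcs Q" "enat (Suc i) < N \<Longrightarrow> rel (f i) (f (Suc i))"
    "N = enat (Suc i) \<Longrightarrow> \<not> rel (f i) c"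
proof -
  show N: "N \<noteq> 0" and "f 0 = b" using assms by auto
  have anti: "direct_antipath Q I (N, f)" using assms by simp
  then show a: "enat i < N \<Longrightarrow> f i \<in> arcs Q" "enat (Suc i) < N \<Longrightarrow> rel (f i) (f (Suc i))" for i
    using direct_antipath_iff[OF N] by auto
  show "\<not> rel (f i) c" if "N = enat (Suc i)"
  proof
    assume r: "rel (f i) c"
    let ?f = "f(Suc i := c)" and ?N = "enat (Suc (Suc i))"
    have "direct_antipath Q I (?N, ?f)"
      by (subst direct_antipath_iff) (use a that r rel_composable[OF r] in \<open>auto simp: zero_enat_def less_Suc_eq\<close>)
    moreover have "?N > N" "\<forall>j. enat j < N \<longrightarrow> ?f j = f j" using that by auto
    ultimately show False using assms unfolding max_antipath.simps by blast
  qed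
qed

text \<open>
  Follow zero relations as long as there are any, starting with \<open>b\<close>.
\<close>

lemma max_antipath_exists:
  assumes "b \<in> arcs Q"
  shows "\<exists>\<tau>. max_antipath Q I b \<tau>"
proof -
  define f where "f i = ((\<lambda>a. SOME c. rel a c) ^^ i) b" for i
  define last where "last i \<longleftrightarrow> \<not> (\<exists>c. rel (f i) c)" for i
  define N where "N = (if \<exists>i. last i then enat (Suc (LEAST i. last i)) else \<infinity>)"
  have r: "rel (f i) (f (Suc i))" if "enat (Suc i) < N" for i
  proof -
    have "\<not> last i"
      using that not_less_Least[of i last] by (auto simp: N_def split: if_splits)
    then show ?thesis by (auto simp: last_def f_def intro: someI)
  qed
  have N: "N \<noteq> 0" by (simp add: N_def zero_enat_def)
  have "f i \<in> arcs Q" if "enat i < N" for i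
    using that r rel_composable assms by (cases i) (auto simp: f_def)
  then have anti: "direct_antipath Q I (N, f)" using r direct_antipath_iff[OF N] by blast
  have "\<not> (N' > N \<and> (\<forall>i. enat i < N \<longrightarrow> f' i = f i) \<and> direct_antipath Q I (N', f'))" for N' f'
  proof
    assume *: "N' > N \<and> (\<forall>i. enat i < N \<longrightarrow> f' i = f i) \<and> direct_antipath Q I (N', f')"
    then have ex: "\<exists>i. last i" by (auto simp: N_def split: if_splits)
    define k where "k = (LEAST i. last i)"
    have k: "last k" "N = enat (Suc k)" using ex LeastI_ex[OF ex] by (auto simp: N_def k_def)
    have "N' \<noteq> 0" using * by auto
    then have "rel (f' k) (f' (Suc k))" using * direct_antipath_iff k(2) by auto
    moreover have "f' k = f k" using * k(2) by simp
    ultimately show False using k(1) by (auto simp: last_def)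
  qed
  moreover have "1 \<le> N" using N by (simp add: ileI1 one_eSuc)
  ultimately have "max_antipath Q I b (N, f)" using anti by (auto simp: f_def)
  then show ?thesis by blast
qed

declare max_antipath.simps [simp del]

subsection \<open>Extending strings\<close>

lemma string_iff:
  "is_string Q I (x, ws) \<longleftrightarrow> is_walk Q (x, ws) \<and> (\<forall>i. Suc i < length ws \<longrightarrow> pair_ok (ws ! i) (ws ! Suc i))"
proof
  assume s: "is_string Q I (x, ws)"
  then have "is_walk Q (x, ws)" unfolding is_string.simps by (rule conjunct1)
  then show "is_walk Q (x, ws) \<and> (\<forall>i. Suc i < length ws \<longrightarrow> pair_ok (ws ! i) (ws ! Suc i))"
    using string_pair[OF s] by blast
qed (use stringI in blast)

declare is_string.simps [simp del]

lemma wvtx_snoc: "i \<le> length ws \<Longrightarrow> wvtx Q (x, ws @ [l]) i = wvtx Q (x, ws) i"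
  by (cases i) (auto simp: nth_append)

lemma wvtx_Cons: "wvtx Q (x, l # ws) (Suc i) = wvtx Q (tgt Q l, ws) i"
  by (cases i) auto

lemma string_snoc:
  "is_string Q I (x, ws @ [l]) \<longleftrightarrow> is_string Q I (x, ws) \<and> arr l \<in> arcs Q \<and> src Q l = wvtx Q (x, ws) (length ws) \<and>
     (ws \<noteq> [] \<longrightarrow> l \<noteq> bar (last ws) \<and> pair_ok (last ws) l)"
proof -
  have all: "(\<forall>i<length (ws @ [l]). R i) \<longleftrightarrow> (\<forall>i<length ws. R i) \<and> R (length ws)" for R
    by (auto simp: less_Suc_eq)
  have pairs: "(\<forall>i. Suc i < length (ws @ [l]) \<longrightarrow> R ((ws @ [l]) ! i) ((ws @ [l]) ! Suc i)) \<longleftrightarrow>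
      (\<forall>i. Suc i < length ws \<longrightarrow> R (ws ! i) (ws ! Suc i)) \<and> (ws \<noteq> [] \<longrightarrow> R (last ws) l)" for R
  proof (cases ws rule: rev_cases)
    case (snoc us l')
    have old: "(ws @ [l]) ! i = ws ! i" if "i < length ws" for i using that by (simp add: nth_append)
    have "(\<forall>i. Suc i < length (ws @ [l]) \<longrightarrow> R ((ws @ [l]) ! i) ((ws @ [l]) ! Suc i)) \<longleftrightarrow>
      (\<forall>i<Suc (length us). R ((ws @ [l]) ! i) ((ws @ [l]) ! Suc i))"
      by (simp add: snoc)
    also have "\<dots> \<longleftrightarrow> (\<forall>i<length us. R ((ws @ [l]) ! i) ((ws @ [l]) ! Suc i)) \<and> R l' l"
      unfolding All_less_Suc by (simp add: snoc nth_append conj_commute)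
    also have "(\<forall>i<length us. R ((ws @ [l]) ! i) ((ws @ [l]) ! Suc i)) \<longleftrightarrow>
        (\<forall>i. Suc i < length ws \<longrightarrow> R (ws ! i) (ws ! Suc i))"
    proof -
      have "length ws = Suc (length us)" by (simp add: snoc)
      then show ?thesis using old by (metis Suc_less_eq less_SucI)
    qed
    finally show ?thesis by (simp add: snoc)
  qed simp
  have src: "(\<forall>i<length (ws @ [l]). src Q ((ws @ [l]) ! i) = wvtx Q (x, ws @ [l]) i) \<longleftrightarrow>
      (\<forall>i<length ws. src Q (ws ! i) = wvtx Q (x, ws) i) \<and> src Q l = wvtx Q (x, ws) (length ws)"
    unfolding all by (simp add: nth_append wvtx_snoc)
  show ?thesis
    unfolding string_iff is_walk.simps src pairs[of pair_ok] pairs[of "\<lambda>l l'. l' \<noteq> bar l"]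
    by (simp only: set_append list.set image_Un image_insert image_empty Un_subset_iff insert_subset empty_subsetI simp_thms) blast
qed

lemma string_Cons:
  "is_string Q I (y, l # ws) \<longleftrightarrow> arr l \<in> arcs Q \<and> src Q l = y \<and> is_string Q I (tgt Q l, ws) \<and>
     (ws \<noteq> [] \<longrightarrow> hd ws \<noteq> bar l \<and> pair_ok l (hd ws))"
proof -
  have all: "(\<forall>i<length (l # ws). R i) \<longleftrightarrow> R 0 \<and> (\<forall>i<length ws. R (Suc i))" for R
    by (auto simp: less_Suc_eq_0_disj)
  have pairs: "(\<forall>i. Suc i < length (l # ws) \<longrightarrow> R ((l # ws) ! i) ((l # ws) ! Suc i)) \<longleftrightarrow>
      (ws \<noteq> [] \<longrightarrow> R l (hd ws)) \<and> (\<forall>i. Suc i < length ws \<longrightarrow> R (ws ! i) (ws ! Suc i))" for R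
  proof (cases ws)
    case (Cons l' us)
    have "(\<forall>i. Suc i < length (l # ws) \<longrightarrow> R ((l # ws) ! i) ((l # ws) ! Suc i)) \<longleftrightarrow>
      (\<forall>i<length ws. R ((l # ws) ! i) (ws ! i))" by auto
    also have "\<dots> \<longleftrightarrow> R l l' \<and> (\<forall>i. Suc i < length ws \<longrightarrow> R (ws ! i) (ws ! Suc i))"
      unfolding Cons by (auto simp: less_Suc_eq_0_disj)
    finally show ?thesis using Cons by simp
  qed simp
  have src: "(\<forall>i<length (l # ws). src Q ((l # ws) ! i) = wvtx Q (y, l # ws) i) \<longleftrightarrow>
      src Q l = y \<and> (\<forall>i<length ws. src Q (ws ! i) = wvtx Q (tgt Q l, ws) i)"
    unfolding all wvtx_Cons by simp
  have "src Q l \<in> verts Q \<and> tgt Q l \<in> verts Q" if "arr l \<in> arcs Q" using that by (cases l) auto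
  then show ?thesis
    unfolding string_iff is_walk.simps src pairs[of pair_ok] pairs[of "\<lambda>l l'. l' \<noteq> bar l"]
    by (simp only: set_append list.set image_Un image_insert image_empty Un_subset_iff insert_subset empty_subsetI simp_thms) blast
qed

lemma left_ext_iff:
  assumes "is_string Q I (x, ws)"
  shows "left_ext Q I b (x, ws) \<longleftrightarrow> b \<in> arcs Q \<and> tail Q b = wvtx Q (x, ws) (length ws) \<and>
    (ws \<noteq> [] \<longrightarrow> last ws \<noteq> Inv b \<and> pair_ok (last ws) (Dir b))"
proof -
  have "Dir b \<noteq> bar l \<longleftrightarrow> l \<noteq> Inv b" for l by (cases l) auto
  then show ?thesis using assms by (simp add: string_snoc)
qed

lemma right_ext_iff:
  assumes "is_string Q I (x, ws)"
  shows "right_ext Q I (x, ws) c \<longleftrightarrow> c \<in> arcs Q \<and> tail Q c = x \<and>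
    (ws \<noteq> [] \<longrightarrow> hd ws \<noteq> Dir c \<and> pair_ok (Inv c) (hd ws))"
  using assms by (auto simp: string_Cons)

text \<open>
  The extensions on the two sides are independent, except that the two new letters become
  neighbours if the string is trivial.
\<close>

lemma both_ext_iff:
  assumes "is_string Q I (x, ws)"
  shows "both_ext Q I b (x, ws) c \<longleftrightarrow> left_ext Q I b (x, ws) \<and> right_ext Q I (x, ws) c \<and> (ws = [] \<longrightarrow> b \<noteq> c)"
proof (cases "ws = []")
  case True
  then show ?thesis
    using assms by (auto simp: string_Cons string_snoc[of _ "[]", simplified])
next
  case False
  then show ?thesis
    unfolding both_ext.simps left_ext.simps right_ext.simps
    using assms by (auto simp: string_Cons[of _ "Inv c"])
qed

lemma not_pair_ok_Dir: "\<not> pair_ok l (Dir b) \<longleftrightarrow> (\<exists>a. l = Dir a \<and> rel a b)"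
  by (cases l) auto

lemma not_pair_ok_Inv: "\<not> pair_ok (Inv c) l \<longleftrightarrow> (\<exists>a. l = Inv a \<and> rel a c)"
  by (cases l) auto

lemma no_left_ext:
  assumes "is_string Q I (x, ws)" "\<nexists>b. left_ext Q I b (x, ws)" "b \<in> arcs Q" "tail Q b = wvtx Q (x, ws) (length ws)"
  shows "ws \<noteq> [] \<and> (last ws = Inv b \<or> (\<exists>a. last ws = Dir a \<and> rel a b))"
  using assms left_ext_iff[OF assms(1), of b] not_pair_ok_Dir by blast

lemma no_right_ext:
  assumes "is_string Q I (x, ws)" "\<nexists>c. right_ext Q I (x, ws) c" "c \<in> arcs Q" "tail Q c = x"
  shows "ws \<noteq> [] \<and> (hd ws = Dir c \<or> (\<exists>a. hd ws = Inv a \<and> rel a c))"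
  using assms right_ext_iff[OF assms(1), of c] not_pair_ok_Inv by blast

declare glue.simps [simp del]

subsection \<open>The cases of the definition\<close>

lemma remove_left_direct_eq:
  obtains j where "j \<le> length ws" "remove_left_direct (x, ws) = (x, take j ws)"
    "\<forall>i. j \<le> i \<and> i < length ws \<longrightarrow> is_Dir (ws ! i)" "0 < j \<longrightarrow> is_Inv (ws ! (j - 1))"
proof -
  define us where "us = rev (dropWhile is_Dir (rev ws))"
  define vs where "vs = rev (takeWhile is_Dir (rev ws))"
  have ws: "ws = us @ vs" unfolding us_def vs_def by (metis rev_append rev_rev_ident takeWhile_dropWhile_id)
  have dir: "\<forall>l\<in>set vs. is_Dir l" by (auto simp: vs_def dest: set_takeWhileD)
  have inv: "us \<noteq> [] \<Longrightarrow> is_Inv (last us)"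
    unfolding us_def by (simp add: last_rev is_Inv_iff hd_dropWhile)
  show thesis
  proof (rule that[of "length us"])
    have "take (length us) ws = us" unfolding ws by simp
    then show "remove_left_direct (x, ws) = (x, take (length us) ws)" by (simp add: us_def)
    show "\<forall>i. length us \<le> i \<and> i < length ws \<longrightarrow> is_Dir (ws ! i)" using dir ws by (auto simp: nth_append)
    show "0 < length us \<longrightarrow> is_Inv (ws ! (length us - 1))" using inv ws by (auto simp: nth_append last_conv_nth)
  qed (simp add: ws)
qed

text \<open>
  For a nontrivial string, an arrow starting at an end that does not extend the string there must
  fail to do so for one of two reasons, namely those in \<open>f_end\<close> and \<open>g_end\<close>. For a trivial string
  at \<open>x\<close> that cannot be extended on both sides at once, there is at most one arrow starting at
  \<open>x\<close>.
\<close>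

lemma pi_stringI:
  assumes s: "is_string Q I (x, ws)" and pi: "is_pi Q I (x, ws) \<sigma>"
  obtains i0 j0 N M f g where "pi_string Q I x ws i0 j0 N M f g"
    "\<sigma> = glue Q (N, f) (wvtx Q (x, ws) i0, take (j0 - i0) (drop i0 ws)) (M, g)"
  using pi
proof (cases rule: is_pi.cases)
  case (both b c \<tau> \<rho>)
  obtain N f M g where [simp]: "\<tau> = (N, f)" "\<rho> = (M, g)" by (cases \<tau>, cases \<rho>)
  note f = max_antipathD[OF both(3)[unfolded \<open>\<tau> = (N, f)\<close>]] and g = max_antipathD[OF both(4)[unfolded \<open>\<rho> = (M, g)\<close>]]
  have ext: "left_ext Q I b (x, ws)" "right_ext Q I (x, ws) c" "ws = [] \<longrightarrow> b \<noteq> c"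
    using both(2) both_ext_iff[OF s] by auto
  note ext' = ext(1)[unfolded left_ext_iff[OF s]] ext(2)[unfolded right_ext_iff[OF s]]
  have "pi_string Q I x ws 0 (length ws) N M f g"
    by unfold_locales (use s f g ext' ext(3) in auto)
  then show thesis by (rule that) (simp add: both(1))
next
  case (right c \<rho>)
  obtain M g where [simp]: "\<rho> = (M, g)" by (cases \<rho>)
  note g = max_antipathD[OF right(4)[unfolded \<open>\<rho> = (M, g)\<close>]]
  note ext = right(2)[unfolded right_ext_iff[OF s]]
  obtain j where j: "j \<le> length ws" "remove_left_direct (x, ws) = (x, take j ws)"
    "\<forall>i. j \<le> i \<and> i < length ws \<longrightarrow> is_Dir (ws ! i)" "0 < j \<longrightarrow> is_Inv (ws ! (j - 1))"
    using remove_left_direct_eq[of ws x] by blast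
  have "pi_string Q I x ws 0 j 0 M undefined g"
    by unfold_locales (use s g ext j no_left_ext[OF s right(3)] in \<open>auto simp: zero_enat_def\<close>)
  then show thesis by (rule that) (simp add: right(1) j(2) no_letters_def del: remove_left_direct.simps)
next
  case (left b \<tau>)
  obtain N f where [simp]: "\<tau> = (N, f)" by (cases \<tau>)
  note f = max_antipathD[OF left(4)[unfolded \<open>\<tau> = (N, f)\<close>]]
  note ext = left(2)[unfolded left_ext_iff[OF s]]
  define i where "i = length (takeWhile is_Inv ws)"
  have i: "i \<le> length ws" "\<forall>k<i. is_Inv (ws ! k)" "i < length ws \<longrightarrow> is_Dir (ws ! i)"
    unfolding i_def using nth_length_takeWhile[of is_Inv ws]
    by (auto simp: length_takeWhile_le is_Inv_iff takeWhile_nth dest: nth_mem set_takeWhileD)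
       (metis is_Inv_iff nth_mem set_takeWhileD takeWhile_nth)
  have "pi_string Q I x ws i (length ws) N 0 f undefined"
    by unfold_locales (use s f ext i no_right_ext[OF s left(3)] in \<open>auto simp: zero_enat_def\<close>)
  then show thesis by (rule that) (simp add: left(1) no_letters_def i_def dropWhile_eq_drop)
next
  case neither
  obtain j where j: "j \<le> length ws" "remove_left_direct (x, ws) = (x, take j ws)"
    "\<forall>i. j \<le> i \<and> i < length ws \<longrightarrow> is_Dir (ws ! i)" "0 < j \<longrightarrow> is_Inv (ws ! (j - 1))"
    using remove_left_direct_eq[of ws x] by blast
  define i where "i = length (takeWhile is_Inv (take j ws))"
  have ij: "i \<le> j" unfolding i_def using length_takeWhile_le[of is_Inv "take j ws"] by simp
  have i: "\<forall>k<i. is_Inv (ws ! k)"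
  proof (intro allI impI)
    fix k assume k: "k < i"
    then have "takeWhile is_Inv (take j ws) ! k = ws ! k" using ij by (simp add: i_def takeWhile_nth)
    then show "is_Inv (ws ! k)" using k by (metis i_def nth_mem set_takeWhileD)
  qed
  have d: "is_Dir (ws ! i)" if "i < length ws"
  proof (cases "i < j")
    case True
    then have "\<not> is_Inv (take j ws ! i)"
      unfolding i_def by (intro nth_length_takeWhile) (use j(1) in simp)
    then show ?thesis using True by (simp add: is_Inv_iff)
  qed (use j(3) that in simp)
  have p: "pi_string Q I x ws i j 0 0 undefined undefined"
    by unfold_locales (use s j i d ij no_left_ext[OF s neither(3)] no_right_ext[OF s neither(2)] in \<open>auto simp: zero_enat_def\<close>)
  moreover have "take (j - i) (drop i ws) = dropWhile is_Inv (take j ws)"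
    by (simp add: i_def dropWhile_eq_drop drop_take)
  moreover have "wvtx Q (x, take j ws) i = wvtx Q (x, ws) i" using ij by (cases i) auto
  ultimately have "\<sigma> = glue Q (0, undefined) (wvtx Q (x, ws) i, take (j - i) (drop i ws)) (0, undefined)"
    by (simp add: neither(1) j(2) no_letters_def i_def del: remove_left_direct.simps)
  with p show thesis by (rule that)
next
  case (trivial_right c \<rho>)
  obtain M g where [simp]: "\<rho> = (M, g)" by (cases \<rho>)
  have [simp]: "ws = []" by (rule trivial_right(1))
  note g = max_antipathD[OF trivial_right(5)[unfolded \<open>\<rho> = (M, g)\<close>]]
  have sN: "is_string Q I (x, [])" using s by simp
  have c: "c \<in> arcs Q" "tail Q c = x" using trivial_right(3) right_ext_iff[OF sN, of c] by auto
  have only: "b = c" if "b \<in> arcs Q" "tail Q b = x" for b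
    using trivial_right(4) both_ext_iff[OF sN, of b c] left_ext_iff[OF sN, of b] right_ext_iff[OF sN, of c] that c by auto
  have "pi_string Q I x ws 0 0 0 M undefined g"
  proof unfold_locales
    show "if ws = [] then M \<noteq> 0 \<and> b = g 0 else last ws = Inv b \<or> (\<exists>a. last ws = Dir a \<and> rel a b)"
      if "b \<in> arcs Q" "tail Q b = wvtx Q (x, ws) (length ws)" for b
      using only[OF that(1)] that(2) g(1,2) by simp
  qed (use s g c in \<open>auto simp: zero_enat_def\<close>)
  then show thesis by (rule that) (simp add: trivial_right(2) no_letters_def)
next
  case (trivial_left b \<tau>)
  obtain N f where [simp]: "\<tau> = (N, f)" by (cases \<tau>)
  have [simp]: "ws = []" by (rule trivial_left(1))
  note f = max_antipathD[OF trivial_left(5)[unfolded \<open>\<tau> = (N, f)\<close>]]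
  have sN: "is_string Q I (x, [])" using s by simp
  have b: "b \<in> arcs Q" "tail Q b = x" using trivial_left(3) left_ext_iff[OF sN, of b] by auto
  have only: "c = b" if "c \<in> arcs Q" "tail Q c = x" for c
    using trivial_left(4) both_ext_iff[OF sN, of b c] left_ext_iff[OF sN, of b] right_ext_iff[OF sN, of c] that b by auto
  have "pi_string Q I x ws 0 0 N 0 f undefined"
  proof unfold_locales
    show "if ws = [] then N \<noteq> 0 \<and> c = f 0 else hd ws = Dir c \<or> (\<exists>a. hd ws = Inv a \<and> rel a c)"
      if "c \<in> arcs Q" "tail Q c = x" for c
      using only[OF that] f(1,2) by simp
  qed (use s f b in \<open>auto simp: zero_enat_def\<close>)
  then show thesis by (rule that) (simp add: trivial_left(2) no_letters_def)
qed

text \<open>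
  If a string can be extended on each side but not on both sides at once, then it is trivial and
  the rules for trivial strings apply.
\<close>

lemma is_pi_exists:
  assumes s: "is_string Q I (x, ws)"
  shows "\<exists>\<sigma>. is_pi Q I (x, ws) \<sigma>"
proof (cases "(\<exists>c. right_ext Q I (x, ws) c) \<and> (\<exists>b. left_ext Q I b (x, ws))")
  case True
  then obtain b c where bc: "right_ext Q I (x, ws) c" "left_ext Q I b (x, ws)" by blast
  have c: "c \<in> arcs Q" using bc right_ext_iff[OF s] by blast
  show ?thesis
  proof (cases "\<exists>b. both_ext Q I b (x, ws) c")
    case True
    then obtain b where b: "both_ext Q I b (x, ws) c" by blast
    then have "b \<in> arcs Q" using both_ext_iff[OF s] left_ext_iff[OF s] by blast
    then show ?thesis using is_pi.both[OF b] max_antipath_exists c by blast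
  next
    case False
    then have "ws = []" using bc both_ext_iff[OF s] by blast
    then show ?thesis using is_pi.trivial_right[of Q I x c] False bc max_antipath_exists[OF c] by blast
  qed
next
  case False
  then consider "(\<nexists>c. right_ext Q I (x, ws) c) \<and> (\<nexists>b. left_ext Q I b (x, ws))"
    | c where "right_ext Q I (x, ws) c" "\<nexists>b. left_ext Q I b (x, ws)"
    | b where "left_ext Q I b (x, ws)" "\<nexists>c. right_ext Q I (x, ws) c" by blast
  then show ?thesis
  proof cases
    case 1
    then show ?thesis using is_pi.neither by blast
  next
    case 2
    then have "c \<in> arcs Q" using right_ext_iff[OF s] by blast
    then show ?thesis using is_pi.right[OF 2] max_antipath_exists by blast
  next
    case 3
    then have "b \<in> arcs Q" using left_ext_iff[OF s] by blast
    then show ?thesis using is_pi.left[OF 3] max_antipath_exists by blast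
  qed
qed

end

section \<open>Projective resolutions of string and band modules\<close>

theorem corollary2p12:
  fixes Q :: "('v, 'a) pre_digraph"
    and I :: "(('v, 'a) qpath \<Rightarrow> 'k::alg_closed_field) set"
    and w :: "('v, 'a) fwalk"
  assumes "gentle_algebra Q I"
  shows "(is_string Q I w \<longrightarrow>
            (\<exists>\<sigma>. is_pi Q I w \<sigma>) \<and>
            (\<forall>\<sigma>. is_pi Q I w \<sigma> \<longrightarrow> homotopy_string Q I \<sigma> \<and>
               projective_resolution (bound_quiver_algebra Q I)
                 (string_complex Q I \<sigma>) (string_complex_diff Q I \<sigma>) (string_module Q w))) \<and>
         (is_band Q I w \<longrightarrow>
            (\<forall>r q. r < length (snd w) \<and> is_Dir (snd w ! r) \<and> band_component Q I w q \<longrightarrow>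
               (\<exists>\<phi>. bij_betw \<phi> {\<mu>::'k. \<mu> \<noteq> 0} {\<nu>. \<nu> \<noteq> 0} \<and>
                  (\<forall>\<mu>. \<mu> \<noteq> 0 \<longrightarrow>
                     projective_resolution (bound_quiver_algebra Q I)
                       (band_complex Q I w) (band_complex_diff Q I w q (\<phi> \<mu>))
                       (band_module Q w r \<mu>)))))"
proof -
  interpret gentle_algebra Q I by (rule assms)
  obtain x ws where w: "w = (x, ws)" by (cases w)
  show ?thesis
    unfolding w
  proof (intro conjI impI allI)
    assume s: "is_string Q I (x, ws)"
    show "\<exists>\<sigma>. is_pi Q I (x, ws) \<sigma>" by (rule is_pi_exists[OF s])
    fix \<sigma> assume "is_pi Q I (x, ws) \<sigma>"
    then obtain i0 j0 N M f g where p: "pi_string Q I x ws i0 j0 N M f g"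
      and \<sigma>: "\<sigma> = glue Q (N, f) (wvtx Q (x, ws) i0, take (j0 - i0) (drop i0 ws)) (M, g)"
      by (rule pi_stringI[OF s])
    have \<sigma>': "pi_string.\<sigma> Q x ws i0 j0 N M f g = \<sigma>" unfolding \<sigma> by (rule pi_string.\<sigma>_def[OF p])
    show "homotopy_string Q I \<sigma>" using pi_string.homotopy_string_\<sigma>[OF p] \<sigma>' by simp
    show "projective_resolution \<Lambda> (string_complex Q I \<sigma>) (string_complex_diff Q I \<sigma>) (string_module Q (x, ws))"
      using pi_string.string_resolution[OF p] unfolding \<sigma>' .
  next
    fix r q assume b: "is_band Q I (x, ws)"
      and rq: "r < length (snd (x, ws)) \<and> is_Dir (snd (x, ws) ! r) \<and> band_component Q I (x, ws) q"
    interpret band Q I x ws by unfold_locales (rule b)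
    show "\<exists>\<phi>. bij_betw \<phi> {\<mu>::'k. \<mu> \<noteq> 0} {\<nu>. \<nu> \<noteq> 0} \<and> (\<forall>\<mu>. \<mu> \<noteq> 0 \<longrightarrow>
      projective_resolution \<Lambda> (band_complex Q I (x, ws)) (band_complex_diff Q I (x, ws) q (\<phi> \<mu>))
        (band_module Q (x, ws) r \<mu>))"
      by (rule band_resolution) (use rq in auto)
  qed
qed

end
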